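(* Let $\rho:\Gamma\to GL_5(\mathbb{C})$ be an irreducible representation with $\rho(T)=\mathrm{diag}(e^{2\pi i r_1},\dots,e^{2\pi i r_5})$, $0\le r_j<1$ real, let $\upsilon$ be a multiplier system for $\Gamma$, let $\{\lambda_1,\dots,\lambda_5\}$ be the minimal admissible set of $(\rho,\upsilon)$, set $\lambda=\sum_j\lambda_j$, and write $\mathcal{H}(\rho,\upsilon)=\bigoplus_{k\ge0}\mathcal{H}(k_0+2k,\rho,\upsilon)$ with $k_0$ the minimal weight. Then there are five possibilities for the associated Hilbert-Poincaré series, namely $$\Psi(\rho,\upsilon)(t)=\frac{t^{k_0}P_N(t)}{(1-t^4)(1-t^6)},\qquad N\in\{0,1,2,3,4\},$$ where $k_0\geq\frac{12\lambda}{5}-4$ and \begin{align*} P_0(t)&=1+t^2+t^4+t^6+t^8,\\ P_1(t)&=2+2t^2+t^4,\\ P_2(t)&=1+t^2+2t^4+t^6,\\ P_3(t)&=1+2t^2+t^4+t^6,\\ P_4(t)&=1+2t^2+2t^4. \end{align*}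
   Context: $\Gamma=SL_2(\mathbb{Z})$, $T=\begin{pmatrix}1&1\\0&1\end{pmatrix}$, $\mathbb{H}$ is the upper half-plane. For $k\in\mathbb{R}$, a multiplier system in weight $k$ is a function $\upsilon:\Gamma\to\{z\in\mathbb{C}:|z|=1\}$ such that $f|_k^\upsilon\gamma(z)=\upsilon(\gamma)^{-1}(cz+d)^{-k}f\left(\frac{az+b}{cz+d}\right)$, $\gamma=\begin{pmatrix}a&b\\c&d\end{pmatrix}\in\Gamma$, defines a right action of $\Gamma$ on the holomorphic functions on $\mathbb{H}$ (real powers are taken with a fixed branch of the argument, e.g. $-\pi<\arg\le\pi$); it is then a multiplier system exactly in the weights congruent to $k$ mod $\mathbb{Z}$. The cusp parameter of $\upsilon$ is the unique $0\le m<12$ with $\upsilon(T)=e^{2\pi im/12}$. Vector-valued modular forms: for $\rho:\Gamma\to GL_d(\mathbb{C})$, $\mathcal{H}(k,\rho,\upsilon)$ is the space of $F=(f_1,\dots,f_d)^t:\mathbb{H}\to\mathbb{C}^d$ with each $f_j$ holomorphic and of moderate growth at infinity (there is an integer $N\ge0$ with $|f_j(x+iy)|<y^N$ for any fixed $x$ and $y\gg0$) and $F|_k^\upsilon\gamma=\rho(\gamma)F$ for all $\gamma\in\Gamma$. $\mathcal{H}(\rho,\upsilon)$ is the direct sum of the $\mathcal{H}(k,\rho,\upsilon)$ over all weights $k$ of $\upsilon$. When $\rho(-I)$ is scalar (in particular for irreducible $\rho$), $\mathcal{H}(\rho,\upsilon)=\bigoplus_{k\ge0}\mathcal{H}(k_0+2k,\rho,\upsilon)$,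 where $k_0$, the minimal weight, is the least weight with nonzero graded piece. It is a graded module over $\mathcal{M}=\mathbb{C}[E_4,E_6]$, the ring of holomorphic modular forms for $\Gamma$. The Hilbert-Poincaré series is $\Psi(\rho,\upsilon)(t)=\sum_{k\ge0}\dim\mathcal{H}(k_0+2k,\rho,\upsilon)\,t^{k_0+2k}$. Minimal admissible set: if $\rho(T)=\mathrm{diag}(e^{2\pi i r_1},\dots,e^{2\pi i r_d})$, $0\le r_j<1$, the minimal admissible set of $(\rho,\upsilon)$ is $\{\lambda_1,\dots,\lambda_d\}$, where $0\le\lambda_j<1$ and $\lambda_j\equiv r_j+\frac{m}{12}\pmod{\mathbb{Z}}$.
   Formalization: Moderate growth is taken with the bound |f_j(x+iy)| < y^N holding for all y beyond a threshold uniform in x; with a threshold depending on the fixed x, the spaces H(k,ρ,υ) would be infinite-dimensional (multiply forms by suitable entire functions of j). *)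

theory Defs
  imports
    "HOL-Analysis.Analysis"
    "HOL-Library.Function_Algebras"
    "HOL-Computational_Algebra.Formal_Power_Series"
begin

section \<open>The modular group and its representations\<close>

definition SL2Z :: "(int^2^2) set" where
  "SL2Z = {\<gamma>. det \<gamma> = 1}"

definition T_mat :: "int^2^2" where
  "T_mat = vector [vector [1, 1], vector [0, 1]]"

text \<open>
  Functions on \<^const>\<open>SL2Z\<close> are total functions on integer matrices whose values outside
  \<^const>\<open>SL2Z\<close> play no role; likewise functions on the upper half-plane are total functions on
  the complex numbers.
\<close>

definition representation :: "(int^2^2 \<Rightarrow> complex^'n^'n) \<Rightarrow> bool" where
  "representation \<rho> \<longleftrightarrow>
     (\<forall>\<gamma>\<in>SL2Z. invertible (\<rho> \<gamma>)) \<and>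
     (\<forall>\<gamma>\<in>SL2Z. \<forall>\<delta>\<in>SL2Z. \<rho> (\<gamma> ** \<delta>) = \<rho> \<gamma> ** \<rho> \<delta>)"

definition irreducible_representation :: "(int^2^2 \<Rightarrow> complex^'n^'n) \<Rightarrow> bool" where
  "irreducible_representation \<rho> \<longleftrightarrow>
     representation \<rho> \<and>
     (\<forall>W. vec.subspace W \<and> (\<forall>\<gamma>\<in>SL2Z. \<forall>w\<in>W. \<rho> \<gamma> *v w \<in> W) \<longrightarrow> W = {0} \<or> W = UNIV)"


section \<open>Slash operator and multiplier systems\<close>

definition upper_half_plane :: "complex set" where
  "upper_half_plane = {z. Im z > 0}"

definition moebius :: "int^2^2 \<Rightarrow> complex \<Rightarrow> complex" where
  "moebius \<gamma> z = (of_int (\<gamma>$1$1) * z + of_int (\<gamma>$1$2)) / (of_int (\<gamma>$2$1) * z + of_int (\<gamma>$2$2))"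

text \<open>
  The complex power is \<^term>\<open>w powr s = exp (s * Ln w)\<close> for \<^term>\<open>w \<noteq> 0\<close>, where \<^const>\<open>Ln\<close> has
  imaginary part in the half-open interval from \<open>-pi\<close> (excluded) to \<open>pi\<close> (included).
\<close>

definition slash ::
  "real \<Rightarrow> (int^2^2 \<Rightarrow> complex) \<Rightarrow> int^2^2 \<Rightarrow> (complex \<Rightarrow> complex) \<Rightarrow> complex \<Rightarrow> complex" where
  "slash k \<upsilon> \<gamma> f z =
     inverse (\<upsilon> \<gamma>) * (of_int (\<gamma>$2$1) * z + of_int (\<gamma>$2$2)) powr (- of_real k) * f (moebius \<gamma> z)"

definition multiplier_system :: "real \<Rightarrow> (int^2^2 \<Rightarrow> complex) \<Rightarrow> bool" where
  "multiplier_system k \<upsilon> \<longleftrightarrow>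
     (\<forall>\<gamma>\<in>SL2Z. norm (\<upsilon> \<gamma>) = 1) \<and>
     (\<forall>f. f holomorphic_on upper_half_plane \<longrightarrow>
        (\<forall>\<gamma>\<in>SL2Z. slash k \<upsilon> \<gamma> f holomorphic_on upper_half_plane) \<and>
        (\<forall>z\<in>upper_half_plane. slash k \<upsilon> (mat 1) f z = f z) \<and>
        (\<forall>\<gamma>\<in>SL2Z. \<forall>\<delta>\<in>SL2Z. \<forall>z\<in>upper_half_plane.
           slash k \<upsilon> \<delta> (slash k \<upsilon> \<gamma> f) z = slash k \<upsilon> (\<gamma> ** \<delta>) f z))"

definition cusp_parameter :: "(int^2^2 \<Rightarrow> complex) \<Rightarrow> real" where
  "cusp_parameter \<upsilon> = (THE m. 0 \<le> m \<and> m < 12 \<and> \<upsilon> T_mat = cis (2 * pi * m / 12))"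

text \<open>
  The minimal admissible set is kept as a family indexed like the exponents \<open>r\<close>, so that sums over
  it count multiplicities.
\<close>

definition minimal_admissible ::
  "('n \<Rightarrow> real) \<Rightarrow> (int^2^2 \<Rightarrow> complex) \<Rightarrow> ('n \<Rightarrow> real) \<Rightarrow> bool" where
  "minimal_admissible r \<upsilon> \<Lambda> \<longleftrightarrow>
     (\<forall>j. 0 \<le> \<Lambda> j \<and> \<Lambda> j < 1 \<and> \<Lambda> j - (r j + cusp_parameter \<upsilon> / 12) \<in> \<int>)"


section \<open>Vector-valued modular forms\<close>

text \<open>
  The threshold beyond which the bound holds is uniform in the real part. A threshold
  depending on the real part would admit essential singularities at the cusp: there are
  nonconstant entire functions \<open>h\<close> that are bounded outside a thin neighbourhood of an arc of a
  parabola, and then \<open>h \<circ> j\<close>, with \<open>j\<close> the modular invariant, is bounded along every vertical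
  half-line.
\<close>

definition moderate_growth :: "(complex \<Rightarrow> complex) \<Rightarrow> bool" where
  "moderate_growth f \<longleftrightarrow> (\<exists>N::nat. \<forall>\<^sub>F y in at_top. \<forall>x. norm (f (Complex x y)) < y ^ N)"

text \<open>
  The condition that a form vanish outside the upper half-plane only selects one total function
  for each function on the upper half-plane.
\<close>

definition vvmf ::
  "real \<Rightarrow> (int^2^2 \<Rightarrow> complex^'n^'n) \<Rightarrow> (int^2^2 \<Rightarrow> complex) \<Rightarrow> (complex \<Rightarrow> complex^'n) set" where
  "vvmf k \<rho> \<upsilon> = {F.
     (\<forall>z. z \<notin> upper_half_plane \<longrightarrow> F z = 0) \<and>
     (\<forall>j. (\<lambda>z. F z $ j) holomorphic_on upper_half_plane) \<and>
     (\<forall>j. moderate_growth (\<lambda>z. F z $ j)) \<and>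
     (\<forall>\<gamma>\<in>SL2Z. \<forall>z\<in>upper_half_plane.
        (\<chi> j. slash k \<upsilon> \<gamma> (\<lambda>w. F w $ j) z) = \<rho> \<gamma> *v F z)}"

definition fun_scale :: "complex \<Rightarrow> (complex \<Rightarrow> complex^'n) \<Rightarrow> complex \<Rightarrow> complex^'n" where
  "fun_scale c F = (\<lambda>z. c *s F z)"

lemma vector_space_fun_scale: "vector_space fun_scale"
  by unfold_locales
     (auto simp: fun_scale_def fun_eq_iff vec_eq_iff algebra_simps)

lemma moderate_growth_0: "moderate_growth (\<lambda>_. 0)"
  unfolding moderate_growth_def
  by (rule exI[of _ 0]) simp

lemma moderate_growth_add:
  assumes "moderate_growth f" "moderate_growth g"
  shows "moderate_growth (\<lambda>z. f z + g z)"
proof -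
  obtain M N where
    M: "\<forall>\<^sub>F y in at_top. \<forall>x. norm (f (Complex x y)) < y ^ M" and
    N: "\<forall>\<^sub>F y in at_top. \<forall>x. norm (g (Complex x y)) < y ^ N"
    using assms unfolding moderate_growth_def by blast
  have "\<forall>\<^sub>F y in at_top. \<forall>x. norm (f (Complex x y) + g (Complex x y)) < y ^ Suc (M + N)"
    using M N eventually_ge_at_top[of 2]
  proof eventually_elim
    case (elim y)
    have "y ^ M \<le> y ^ (M + N)" "y ^ N \<le> y ^ (M + N)"
      using elim(3) by (auto intro!: power_increasing)
    moreover have "2 * y ^ (M + N) \<le> y ^ Suc (M + N)"
      using elim(3) by (simp add: mult_right_mono)
    ultimately have "y ^ M + y ^ N \<le> y ^ Suc (M + N)"
      by linarith
    with elim(1,2) show ?case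
      by (meson add_strict_mono less_le_trans norm_triangle_ineq order_le_less_trans)
  qed
  then show ?thesis
    unfolding moderate_growth_def by blast
qed

lemma moderate_growth_scale:
  assumes "moderate_growth f"
  shows "moderate_growth (\<lambda>z. c * f z)"
proof -
  obtain M where M: "\<forall>\<^sub>F y in at_top. \<forall>x. norm (f (Complex x y)) < y ^ M"
    using assms unfolding moderate_growth_def by blast
  have "\<forall>\<^sub>F y in at_top. \<forall>x. norm (c * f (Complex x y)) < y ^ Suc M"
    using M eventually_gt_at_top[of "norm c"]
  proof eventually_elim
    case (elim y)
    show ?case
    proof
      fix x
      have "norm c * norm (f (Complex x y)) \<le> norm c * y ^ M"
        using elim(1) by (simp add: less_imp_le mult_left_mono)
      also have "\<dots> < y * y ^ M"
        using elim(2) norm_ge_zero[of c]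
        by (intro mult_strict_right_mono zero_less_power) linarith+
      finally show "norm (c * f (Complex x y)) < y ^ Suc M"
        by (simp add: norm_mult)
    qed
  qed
  then show ?thesis
    unfolding moderate_growth_def by blast
qed

lemma subspace_vvmf: "module.subspace fun_scale (vvmf k \<rho> \<upsilon>)"
proof -
  interpret vector_space "fun_scale :: complex \<Rightarrow> (complex \<Rightarrow> complex^'n) \<Rightarrow> _"
    by (rule vector_space_fun_scale)
  show ?thesis
  proof (rule subspaceI)
    show "0 \<in> vvmf k \<rho> \<upsilon>"
      by (simp add: vvmf_def moderate_growth_0 slash_def vec_eq_iff)
  next
    fix F G assume "F \<in> vvmf k \<rho> \<upsilon>" "G \<in> vvmf k \<rho> \<upsilon>"
    then show "F + G \<in> vvmf k \<rho> \<upsilon>"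
      by (auto simp: vvmf_def moderate_growth_add slash_def vec_eq_iff
          matrix_vector_right_distrib distrib_left intro!: holomorphic_intros)
  next
    fix c and F assume "F \<in> vvmf k \<rho> \<upsilon>"
    then show "fun_scale c F \<in> vvmf k \<rho> \<upsilon>"
      by (auto simp: vvmf_def fun_scale_def moderate_growth_scale slash_def vec_eq_iff
          vector_scalar_commute mult.left_commute intro!: holomorphic_intros)
  qed
qed

definition dim_vvmf ::
  "real \<Rightarrow> (int^2^2 \<Rightarrow> complex^'n^'n) \<Rightarrow> (int^2^2 \<Rightarrow> complex) \<Rightarrow> nat" where
  "dim_vvmf k \<rho> \<upsilon> = vector_space.dim fun_scale (vvmf k \<rho> \<upsilon>)"

definition minimal_weight :: "(int^2^2 \<Rightarrow> complex^'n^'n) \<Rightarrow> (int^2^2 \<Rightarrow> complex) \<Rightarrow> real" where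
  "minimal_weight \<rho> \<upsilon> = (LEAST k. multiplier_system k \<upsilon> \<and> vvmf k \<rho> \<upsilon> \<noteq> {0})"


section \<open>Hilbert-Poincare series\<close>

text \<open>
  The series has real exponents, so it is represented as a formal series by its coefficient
  function \<open>real \<Rightarrow> real\<close> from exponents to coefficients. As in the decomposition of the graded
  module when the image of \<open>-I\<close> is scalar, only the weights \<open>k0 + 2k\<close> contribute.
\<close>

definition hilbert_poincare ::
  "(int^2^2 \<Rightarrow> complex^'n^'n) \<Rightarrow> (int^2^2 \<Rightarrow> complex) \<Rightarrow> real \<Rightarrow> real" where
  "hilbert_poincare \<rho> \<upsilon> x =
     (if \<exists>k::nat. x = minimal_weight \<rho> \<upsilon> + 2 * real k then real (dim_vvmf x \<rho> \<upsilon>) else 0)"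

text \<open>The formal series \<open>t\<^sup>s A(t)\<close> for real \<open>s\<close>, in the same representation.\<close>

definition shift_fps :: "real \<Rightarrow> real fps \<Rightarrow> real \<Rightarrow> real" where
  "shift_fps s A x = (if x - s \<in> \<nat> then fps_nth A (nat \<lfloor>x - s\<rfloor>) else 0)"

definition P_poly :: "nat \<Rightarrow> real fps" where
  "P_poly N =
     (let t = fps_X in
     [1 + t^2 + t^4 + t^6 + t^8,
      2 + 2 * t^2 + t^4,
      1 + t^2 + 2 * t^4 + t^6,
      1 + 2 * t^2 + t^4 + t^6,
      1 + 2 * t^2 + 2 * t^4] ! N)"

end

theory Submission
  imports Defs "HOL-Complex_Analysis.Complex_Analysis" "HOL-Real_Asymp.Real_Asymp"
begin

text \<open>
  Let \<open>V\<^sub>n\<close> be the space of forms of weight \<open>k\<^sub>0 + 2 n\<close>. Since \<open>E\<^sub>6\<close> vanishes to first order exactly on the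
  orbit of \<open>\<i>\<close>, and \<open>E\<^sub>4\<close> on that of a primitive cube root of unity \<open>\<omega>\<close>, the forms in \<open>V\<^sub>n\<close> vanishing at
  \<open>\<i>\<close> are \<open>E\<^sub>6 V\<^bsub>n-3\<^esub>\<close> and those vanishing at \<open>\<omega>\<close> are \<open>E\<^sub>4 V\<^bsub>n-2\<^esub>\<close>. So the dimensions of the spaces of values
  of \<open>V\<^sub>n\<close> at these two points determine \<open>dim V\<^sub>n\<close>, and both jump by the number \<open>m\<^sub>n\<close> of new generators
  in degree \<open>n\<close> when compared with \<open>V\<^bsub>n-2\<^esub>\<close> and \<open>V\<^bsub>n-3\<^esub>\<close> respectively. The numerator of the Hilbert-Poincare
  series is \<open>\<Sum> m\<^sub>n t\<^bsup>2n\<^esup>\<close>. The values at the elliptic points are eigenvectors of \<open>\<rho>(S)\<close> and \<open>\<rho>(R)\<close>, where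
  \<open>R\<close> of order three in the modular group fixes \<open>\<omega>\<close>, for eigenvalues depending on \<open>n\<close> modulo 2 and
  modulo 3. An eigenspace of \<open>\<rho>(S)\<close> meets one of \<open>\<rho>(R)\<close> trivially by irreducibility, so their
  dimensions add up to at most 5.

  By irreducibility the components of a form \<open>F \<noteq> 0\<close> in \<open>V\<^sub>0\<close> are linearly independent, so \<open>F\<close> and its
  first four modular derivatives \<open>D\<^sup>j F\<close> have a nonzero Wronskian. It is a modular form of weight
  \<open>5 k\<^sub>0 + 20\<close> vanishing to order at least \<open>\<lambda>\<close> at the cusp, whence the bound on \<open>k\<^sub>0\<close>. Moreover
  \<open>m\<^sub>0 + \<dots> + m\<^sub>4 \<ge> 5\<close>, and if \<open>m\<^sub>n = 0\<close> for some \<open>n > 0\<close>, the module generated in degrees below \<open>n\<close> is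
  stable under \<open>D\<close>, so that already \<open>m\<^sub>0 + \<dots> + m\<^bsub>n-1\<^esub> \<ge> 5\<close>. Only five sequences \<open>m\<close> are left.

  That a nonzero form exists at all follows from Poincare series of large weight.
\<close>

text \<open>Nothing is assumed about the image of \<open>\<rho>\<close>, which may be infinite and
  not unitary, so a reduction to scalar forms on a subgroup of finite index is not possible. This
  has several consequences. The norm of \<open>\<rho> A\<close> must be bounded by a power of the
  bottom row of \<open>A\<close> before a Poincare series converges. The Wronskian carries a real
  power of \<open>q\<close> and a multiplier, so only its absolute value transforms simply, and its
  vanishing in too small a weight comes from the maximum principle. The zeros of \<open>E4\<close>,
  \<open>E6\<close> and the discriminant are found without contour integration: every orbit meets
  the region \<open>norm q < 1 / 200\<close>, where the relevant Lambert series are so close to the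
  identity map that they are injective. The five generators are squeezed from both sides: the
  Wronskian needs at least five in degrees up to 4, while the values at \<open>\<i>\<close> in even
  and in odd degree fill at most two different eigenspaces of \<open>\<rho>(S)\<close>, of total
  dimension at most 5. This equality leaves a finite list of cases and excludes generators from
  degree 5 on.\<close>

no_notation fps_nth (infixl "$" 75)

section \<open>The modular group\<close>

definition mat22 :: "int \<Rightarrow> int \<Rightarrow> int \<Rightarrow> int \<Rightarrow> int^2^2" where
  "mat22 a b c d = vector [vector [a, b], vector [c, d]]"

lemma mat22_nth [simp]:
  "mat22 a b c d $ 1 $ 1 = a" "mat22 a b c d $ 1 $ 2 = b"
  "mat22 a b c d $ 2 $ 1 = c" "mat22 a b c d $ 2 $ 2 = d"
  by (simp_all add: mat22_def vector_2)

lemma mat22_eq_iff: "A = B \<longleftrightarrow> A$1$1 = B$1$1 \<and> A$1$2 = B$1$2 \<and> A$2$1 = B$2$1 \<and> A$2$2 = B$2$2"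
  for A B :: "int^2^2"
  by (auto simp: vec_eq_iff forall_2)

lemma mat22_mult_nth:
  fixes A B :: "int^2^2"
  shows "(A ** B)$1$1 = A$1$1 * B$1$1 + A$1$2 * B$2$1" "(A ** B)$1$2 = A$1$1 * B$1$2 + A$1$2 * B$2$2"
    "(A ** B)$2$1 = A$2$1 * B$1$1 + A$2$2 * B$2$1" "(A ** B)$2$2 = A$2$1 * B$1$2 + A$2$2 * B$2$2"
  by (simp_all add: matrix_matrix_mult_def sum_2)

lemma mat_1_nth: "(mat 1 :: int^2^2)$1$1 = 1" "(mat 1 :: int^2^2)$1$2 = 0"
  "(mat 1 :: int^2^2)$2$1 = 0" "(mat 1 :: int^2^2)$2$2 = 1"
  by (simp_all add: mat_def)

lemmas mat22_simps = mat22_eq_iff mat22_mult_nth mat_1_nth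

lemma SL2Z_iff: "A \<in> SL2Z \<longleftrightarrow> A$1$1 * A$2$2 - A$1$2 * A$2$1 = 1"
  by (simp add: SL2Z_def det_2)

lemma T_mat_eq: "T_mat = mat22 1 1 0 1"
  by (simp add: T_mat_def mat22_def)

definition S_mat :: "int^2^2" where "S_mat = mat22 0 (-1) 1 0"

text \<open>The adjugate: on determinant 1 an inverse with explicit integer entries.\<close>

definition adj22 :: "int^2^2 \<Rightarrow> int^2^2" where
  "adj22 A = mat22 (A$2$2) (- A$1$2) (- A$2$1) (A$1$1)"

lemma SL2Z_mult: "A \<in> SL2Z \<Longrightarrow> B \<in> SL2Z \<Longrightarrow> A ** B \<in> SL2Z"
  unfolding SL2Z_def by (simp add: det_mul)

lemma SL2Z_1 [simp]: "mat 1 \<in> SL2Z"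
  by (simp add: SL2Z_def)

lemma SL2Z_S [simp]: "S_mat \<in> SL2Z"
  by (simp add: SL2Z_iff S_mat_def)

lemma SL2Z_T [simp]: "T_mat \<in> SL2Z"
  by (simp add: SL2Z_iff T_mat_eq)

lemma SL2Z_Tn [simp]: "mat22 1 n 0 1 \<in> SL2Z"
  by (simp add: SL2Z_iff)

lemma SL2Z_neg1 [simp]: "mat22 (-1) 0 0 (-1) \<in> SL2Z"
  by (simp add: SL2Z_iff)

lemma SL2Z_adj [simp]: "A \<in> SL2Z \<Longrightarrow> adj22 A \<in> SL2Z"
  by (simp add: SL2Z_iff adj22_def algebra_simps)

lemma adj22_left: "A \<in> SL2Z \<Longrightarrow> adj22 A ** A = mat 1"
  and adj22_right: "A \<in> SL2Z \<Longrightarrow> A ** adj22 A = mat 1"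
  by (auto simp: mat22_simps adj22_def SL2Z_iff algebra_simps)

lemma SL2Z_coprime: "A \<in> SL2Z \<Longrightarrow> coprime (A$2$1) (A$2$2)"
proof -
  assume "A \<in> SL2Z"
  then have "A$1$1 * A$2$2 - A$1$2 * A$2$1 = 1"
    by (simp add: SL2Z_iff)
  then show ?thesis
    by (metis coprime_iff_gcd_eq_1 dvd_diff dvd_mult gcd_dvd1 gcd_dvd2 is_unit_gcd)
qed

lemma SL2Z_bottom_row_exists:
  assumes "coprime c d"
  shows "\<exists>A\<in>SL2Z. A$2$1 = c \<and> A$2$2 = d"
proof -
  obtain u v where "u * c + v * d = 1"
    using bezout_int[of c d] assms by auto
  then show ?thesis
    by (intro bexI[of _ "mat22 v (-u) c d"]) (auto simp: SL2Z_iff)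
qed

text \<open>\<open>B A^-1\<close> has bottom row \<open>(0, 1)\<close>. Cosets of the translations
  are therefore indexed by coprime pairs, the index set of the Poincare series.\<close>

lemma SL2Z_bottom_row_eq:
  assumes "A \<in> SL2Z" "B \<in> SL2Z" "A$2$1 = B$2$1" "A$2$2 = B$2$2"
  shows "\<exists>n. B = mat22 1 n 0 1 ** A"
proof -
  have "(B ** adj22 A)$2$1 = 0" "(B ** adj22 A)$2$2 = 1" and "B ** adj22 A \<in> SL2Z"
    using assms by (auto simp: mat22_mult_nth adj22_def SL2Z_iff algebra_simps intro: SL2Z_mult)
  then have "B ** adj22 A = mat22 1 ((B ** adj22 A)$1$2) 0 1"
    by (auto simp: mat22_eq_iff SL2Z_iff)
  moreover have "(B ** adj22 A) ** A = B"
    by (metis adj22_left assms(1) matrix_mul_assoc matrix_mul_rid)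
  ultimately show ?thesis by metis
qed

lemma T_power_eq: "mat22 1 m 0 1 ** mat22 1 n 0 1 = mat22 1 (m + n) 0 1"
  by (simp add: mat22_simps)

lemma S_squared: "S_mat ** S_mat = mat22 (-1) 0 0 (-1)"
  by (simp add: mat22_simps S_mat_def)

text \<open>The Euclidean algorithm on the bottom row, with remainders of least absolute value.\<close>

lemma SL2Z_euclid [consumes 1, case_names triangular step]:
  fixes P :: "int^2^2 \<Rightarrow> bool"
  assumes "A \<in> SL2Z"
    and tri: "\<And>A. A \<in> SL2Z \<Longrightarrow> A$2$1 = 0 \<Longrightarrow> P A"
    and step: "\<And>A n. A \<in> SL2Z \<Longrightarrow> P A \<Longrightarrow> 2 * \<bar>A$2$1\<bar> \<le> \<bar>A$2$2\<bar> \<Longrightarrow> A$2$2 \<noteq> 0 \<Longrightarrow>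
           P ((A ** (S_mat ** mat22 (-1) 0 0 (-1))) ** mat22 1 n 0 1)"
  shows "P A"
  using assms(1)
proof (induction "nat \<bar>A$2$1\<bar>" arbitrary: A rule: less_induct)
  case less
  show ?case
  proof (cases "A$2$1 = 0")
    case True
    then show ?thesis using tri less.prems by blast
  next
    case False
    define c d where "c = A$2$1" and "d = A$2$2"
    \<comment> \<open>\<open>n\<close> is an integer nearest to \<open>d / c\<close>, expressed by
      integer division, and \<open>r\<close> is the remainder of least absolute value. The resulting
      factor 2 in \<open>2 * \<bar>r\<bar> \<le> \<bar>c\<bar>\<close> later makes the number of
      steps logarithmic.\<close>
    define n where "n = (2 * d + \<bar>c\<bar>) div (2 * \<bar>c\<bar>) * sgn c"
    define r where "r = d - c * n"
    have c0: "c \<noteq> 0" using False by (simp add: c_def)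
    have cn: "c * n = \<bar>c\<bar> * ((2 * d + \<bar>c\<bar>) div (2 * \<bar>c\<bar>))"
      unfolding n_def by (simp add: abs_sgn mult.commute mult.left_commute)
    have "2 * r = (2 * d + \<bar>c\<bar>) mod (2 * \<bar>c\<bar>) - \<bar>c\<bar>"
      unfolding r_def using cn
      by (simp add: minus_div_mult_eq_mod[symmetric] algebra_simps)
    moreover have "0 \<le> (2 * d + \<bar>c\<bar>) mod (2 * \<bar>c\<bar>)" "(2 * d + \<bar>c\<bar>) mod (2 * \<bar>c\<bar>) < 2 * \<bar>c\<bar>"
      using c0 by auto
    ultimately have r: "2 * \<bar>r\<bar> \<le> \<bar>c\<bar>" by linarith
    define B where "B = (A ** mat22 1 (-n) 0 1) ** S_mat"
    have B: "B \<in> SL2Z" unfolding B_def using less.prems by (intro SL2Z_mult) auto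
    have B2: "B$2$1 = r" "B$2$2 = -c"
      by (simp_all add: B_def mat22_mult_nth S_mat_def r_def c_def d_def)
    have "nat \<bar>B$2$1\<bar> < nat \<bar>A$2$1\<bar>" using r c0 by (simp add: B2 c_def[symmetric])
    then have "P B" using less.hyps B by blast
    then have "P ((B ** (S_mat ** mat22 (-1) 0 0 (-1))) ** mat22 1 n 0 1)"
      by (rule step[OF B]) (use B2 r c0 in auto)
    also have "(B ** (S_mat ** mat22 (-1) 0 0 (-1))) ** mat22 1 n 0 1 = A"
      by (simp add: B_def mat22_simps S_mat_def algebra_simps)
    finally show ?thesis .
  qed
qed

lemma SL2Z_triangular:
  assumes "A \<in> SL2Z" "A$2$1 = 0"
  obtains n where "A = mat22 1 n 0 1" | n where "A = mat22 (-1) 0 0 (-1) ** mat22 1 n 0 1"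
proof -
  have "A$1$1 * A$2$2 = 1" using assms by (simp add: SL2Z_iff)
  then have "A$1$1 = 1 \<and> A$2$2 = 1 \<or> A$1$1 = -1 \<and> A$2$2 = -1"
    using zmult_eq_1_iff by blast
  then have "A = mat22 1 (A$1$2) 0 1 \<or> A = mat22 (-1) 0 0 (-1) ** mat22 1 (-(A$1$2)) 0 1"
    using assms(2) by (auto simp: mat22_simps)
  then show ?thesis using that by blast
qed

text \<open>Closure under inverses gives all powers of \<open>T\<close>, and
  \<open>-I = S\<^sup>2\<close>, so the triangular matrices and the Euclidean step are words in the
  two generators.\<close>

lemma SL2Z_generated [consumes 1, case_names S T inv mult]:
  assumes "A \<in> SL2Z" and S: "P S_mat" and T: "P T_mat"
    and inv: "\<And>A. A \<in> SL2Z \<Longrightarrow> P A \<Longrightarrow> P (adj22 A)"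
    and mult: "\<And>A B. A \<in> SL2Z \<Longrightarrow> B \<in> SL2Z \<Longrightarrow> P A \<Longrightarrow> P B \<Longrightarrow> P (A ** B)"
  shows "P A"
proof -
  have one: "P (mat 1)"
    using mult[OF SL2Z_T SL2Z_adj[OF SL2Z_T] T inv[OF SL2Z_T T]] by (simp add: adj22_right)
  have Tn: "P (mat22 1 (int n) 0 1)" for n
  proof (induction n)
    case 0
    have "mat22 1 0 0 1 = mat 1" by (simp add: mat22_simps)
    then show ?case using one by simp
  next
    case (Suc n)
    then show ?case using mult[OF SL2Z_Tn SL2Z_T Suc T] by (simp add: T_mat_eq T_power_eq add.commute)
  qed
  have Tn: "P (mat22 1 n 0 1)" for n
  proof (cases "n \<ge> 0")
    case True
    then show ?thesis using Tn[of "nat n"] by simp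
  next
    case False
    then show ?thesis using inv[OF _ Tn[of "nat (-n)"]] by (simp add: adj22_def)
  qed
  have neg: "P (mat22 (-1) 0 0 (-1))"
    using mult[OF SL2Z_S SL2Z_S S S] by (simp add: S_squared)
  from assms(1) show ?thesis
  proof (induction rule: SL2Z_euclid)
    case (triangular A)
    then show ?case by (rule SL2Z_triangular) (auto simp: Tn neg mult)
  next
    case (step A n)
    have "P (S_mat ** mat22 (-1) 0 0 (-1))" by (rule mult[OF SL2Z_S SL2Z_neg1 S neg])
    then have "P (A ** (S_mat ** mat22 (-1) 0 0 (-1)))"
      by (rule mult[OF step.hyps(1) SL2Z_mult[OF SL2Z_S SL2Z_neg1] step.IH])
    then show ?case
      by (rule mult[OF SL2Z_mult[OF step.hyps(1) SL2Z_mult[OF SL2Z_S SL2Z_neg1]] SL2Z_Tn _ Tn])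
  qed
qed

section \<open>The action on the upper half-plane\<close>

definition den :: "int^2^2 \<Rightarrow> complex \<Rightarrow> complex" where
  "den A z = of_int (A$2$1) * z + of_int (A$2$2)"

lemma upper_half_plane_iff [simp]: "z \<in> upper_half_plane \<longleftrightarrow> Im z > 0"
  by (simp add: upper_half_plane_def)

lemma open_upper_half_plane [simp]: "open upper_half_plane"
  unfolding upper_half_plane_def by (rule open_halfspace_Im_gt)

lemma convex_upper_half_plane [simp]: "convex upper_half_plane"
  unfolding upper_half_plane_def by (rule convex_halfspace_Im_gt)

lemma connected_upper_half_plane [simp]: "connected upper_half_plane"
  by (simp add: convex_connected)

lemma den_nonzero:
  assumes "A \<in> SL2Z" "Im z > 0"
  shows "den A z \<noteq> 0"
proof
  assume "den A z = 0"
  then have "of_int (A$2$1) * Im z = 0" "of_int (A$2$1) * Re z + of_int (A$2$2) = 0"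
    unfolding den_def by (auto simp: complex_eq_iff)
  then have "A$2$1 = 0" "A$2$2 = 0" using assms(2) by auto
  then show False using assms(1) by (simp add: SL2Z_iff)
qed

lemma moebius_def': "moebius A z = (of_int (A$1$1) * z + of_int (A$1$2)) / den A z"
  by (simp add: moebius_def den_def)

lemma Im_moebius:
  assumes "A \<in> SL2Z"
  shows "Im (moebius A z) = Im z / (norm (den A z))\<^sup>2"
proof -
  define a b c d where "a = real_of_int (A$1$1)" "b = real_of_int (A$1$2)"
    "c = real_of_int (A$2$1)" "d = real_of_int (A$2$2)"
  have "real_of_int (A$1$1 * A$2$2 - A$1$2 * A$2$1) = 1"
    using assms by (simp add: SL2Z_iff)
  then have det: "a * d - b * c = 1" by (simp add: a_b_c_d_def)
  have "Im (moebius A z) = (a * Im z * (c * Re z + d) - (a * Re z + b) * (c * Im z)) / (norm (den A z))\<^sup>2"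
    by (simp add: moebius_def' den_def a_b_c_d_def Im_divide cmod_power2)
  also have "a * Im z * (c * Re z + d) - (a * Re z + b) * (c * Im z) = Im z * (a * d - b * c)"
    by (simp add: algebra_simps)
  finally show ?thesis using det by simp
qed

lemma Im_moebius_pos:
  assumes "A \<in> SL2Z" "Im z > 0"
  shows "Im (moebius A z) > 0"
  using den_nonzero[OF assms] assms by (simp add: Im_moebius)

lemma den_mult:
  assumes "B \<in> SL2Z" "Im z > 0"
  shows "den (A ** B) z = den A (moebius B z) * den B z"
  using den_nonzero[OF assms]
  by (simp add: den_def[of "A ** B"] den_def[of A] moebius_def' mat22_mult_nth field_simps)
     (simp add: den_def field_simps)

lemma moebius_mult:
  assumes "A \<in> SL2Z" "B \<in> SL2Z" "Im z > 0"
  shows "moebius (A ** B) z = moebius A (moebius B z)"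
proof -
  have "den A (moebius B z) \<noteq> 0" "den B z \<noteq> 0"
    using assms by (auto simp: den_nonzero Im_moebius_pos)
  moreover have "(of_int ((A ** B)$1$1) * z + of_int ((A ** B)$1$2)) =
     (of_int (A$1$1) * moebius B z + of_int (A$1$2)) * den B z"
    using \<open>den B z \<noteq> 0\<close>
    by (simp add: moebius_def' mat22_mult_nth field_simps) (simp add: den_def field_simps)
  ultimately show ?thesis
    using assms by (simp add: moebius_def'[of "A ** B"] moebius_def'[of A "moebius B z"] den_mult)
qed

lemma moebius_1 [simp]: "moebius (mat 1) z = z" and den_1 [simp]: "den (mat 1) z = 1"
  by (simp_all add: moebius_def den_def mat_1_nth)

lemma moebius_Tn [simp]: "moebius (mat22 1 n 0 1) z = z + of_int n" and den_Tn [simp]: "den (mat22 1 n 0 1) z = 1"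
  by (simp_all add: moebius_def den_def)

lemma moebius_T [simp]: "moebius T_mat z = z + 1" and den_T [simp]: "den T_mat z = 1"
  by (simp_all add: T_mat_eq)

lemma moebius_neg1 [simp]: "moebius (mat22 (-1) 0 0 (-1)) z = z"
  and den_neg1 [simp]: "den (mat22 (-1) 0 0 (-1)) z = -1"
  by (simp_all add: moebius_def den_def)

lemma moebius_S [simp]: "moebius S_mat z = -1 / z" and den_S [simp]: "den S_mat z = z"
  by (simp_all add: moebius_def den_def S_mat_def)

lemma holomorphic_den [holomorphic_intros]: "den A holomorphic_on X"
  unfolding den_def by (intro holomorphic_intros)

lemma has_field_derivative_den: "(den A has_field_derivative of_int (A$2$1)) (at z)"
  unfolding den_def by (auto intro!: derivative_eq_intros)

lemma has_field_derivative_moebius: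
  assumes "A \<in> SL2Z" "Im z > 0"
  shows "(moebius A has_field_derivative 1 / (den A z)\<^sup>2) (at z)"
proof -
  have "complex_of_int (A$1$1 * A$2$2 - A$1$2 * A$2$1) = 1"
    using assms by (simp add: SL2Z_iff)
  then have det: "complex_of_int (A$1$1) * of_int (A$2$2) - of_int (A$1$2) * of_int (A$2$1) = 1" by simp
  have "((\<lambda>z. (of_int (A$1$1) * z + of_int (A$1$2)) / den A z) has_field_derivative
     (of_int (A$1$1) * den A z - (of_int (A$1$1) * z + of_int (A$1$2)) * of_int (A$2$1)) / (den A z * den A z)) (at z)"
    using den_nonzero[OF assms]
    by (auto intro!: derivative_eq_intros has_field_derivative_den)
  moreover have "of_int (A$1$1) * den A z - (of_int (A$1$1) * z + of_int (A$1$2)) * of_int (A$2$1) = 1"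
    using det by (simp add: den_def algebra_simps)
  ultimately show ?thesis
    by (simp add: moebius_def'[abs_def] power2_eq_square)
qed

lemma holomorphic_moebius: "A \<in> SL2Z \<Longrightarrow> moebius A holomorphic_on upper_half_plane"
  by (meson has_field_derivative_moebius field_differentiable_at_within field_differentiable_def
      holomorphic_onI upper_half_plane_iff)

lemma norm_den_ge_Im: "norm (den A z) \<ge> \<bar>real_of_int (A$2$1)\<bar> * \<bar>Im z\<bar>"
  using abs_Im_le_cmod[of "den A z"] by (simp add: den_def abs_mult)

text \<open>The height \<open>Im z / (norm (den A z))\<^sup>2\<close> of an image is largest where
  the denominator is smallest. Only finitely many pairs \<open>(c, d)\<close> make the denominator
  at most 1 in absolute value, so a minimum exists.\<close>

lemma SL2Z_reduction:
  assumes "Im z > 0"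
  shows "\<exists>A\<in>SL2Z. Im (moebius A z) \<ge> sqrt 3 / 2 \<and> \<bar>Re (moebius A z)\<bar> \<le> 1 / 2"
proof -
  define X where "X = {(c, d). coprime c d \<and> norm (of_int c * z + of_int d) \<le> 1}"
  have "X \<subseteq> {-\<lceil>1 / Im z\<rceil>..\<lceil>1 / Im z\<rceil>} \<times> {-\<lceil>1 + norm z / Im z\<rceil>..\<lceil>1 + norm z / Im z\<rceil>}"
  proof clarify
    fix c d assume "(c, d) \<in> X"
    then have n1: "norm (of_int c * z + of_int d) \<le> 1" by (simp add: X_def)
    have "\<bar>of_int c\<bar> * Im z \<le> 1"
      using abs_Im_le_cmod[of "of_int c * z + of_int d"] n1 assms by (simp add: abs_mult)
    then have c: "\<bar>real_of_int c\<bar> \<le> 1 / Im z" using assms by (simp add: field_simps)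
    have "\<bar>real_of_int d\<bar> = norm ((of_int c * z + of_int d) - of_int c * z :: complex)" by simp
    also have "\<dots> \<le> norm (of_int c * z + of_int d) + norm (of_int c * z)" by (rule norm_triangle_ineq4)
    also have "\<dots> \<le> 1 + \<bar>real_of_int c\<bar> * norm z" using n1 by (simp add: norm_mult)
    also have "\<dots> \<le> 1 + norm z / Im z" using mult_right_mono[OF c, of "norm z"] by simp
    finally show "c \<in> {-\<lceil>1 / Im z\<rceil>..\<lceil>1 / Im z\<rceil>} \<and> d \<in> {-\<lceil>1 + norm z / Im z\<rceil>..\<lceil>1 + norm z / Im z\<rceil>}"
      using c by (auto simp: ceiling_le_iff le_ceiling_iff abs_le_iff) linarith+
  qed
  then have fin: "finite X" by (rule finite_subset) auto
  have "(0, 1) \<in> X" by (simp add: X_def)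
  then obtain c d where cd: "(c, d) \<in> X"
    "\<And>c' d'. (c', d') \<in> X \<Longrightarrow> norm (of_int c * z + of_int d) \<le> norm (of_int c' * z + of_int d')"
    using ex_min_if_finite[of "(\<lambda>(c, d). norm (of_int c * z + of_int d)) ` X"] fin
    by (force simp: not_less)
  have min: "norm (of_int c * z + of_int d) \<le> norm (den B z)" if "B \<in> SL2Z" for B
  proof (cases "norm (den B z) \<le> 1")
    case True
    then show ?thesis using cd(2)[of "B$2$1" "B$2$2"] SL2Z_coprime[OF that] by (simp add: X_def den_def)
  next
    case False
    then show ?thesis using cd(1) by (auto simp: X_def)
  qed
  obtain A where A: "A \<in> SL2Z" "A$2$1 = c" "A$2$2 = d"
    using SL2Z_bottom_row_exists[of c d] cd(1) by (auto simp: X_def)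
  have minA: "norm (den A z) \<le> norm (den B z)" if "B \<in> SL2Z" for B
    using min[OF that] A by (simp add: den_def)
  define n where "n = - round (Re (moebius A z))"
  define B where "B = mat22 1 n 0 1 ** A"
  have B: "B \<in> SL2Z" using A by (simp add: B_def SL2Z_mult)
  have mB: "moebius B z = moebius A z + of_int n"
    using A assms by (simp add: B_def moebius_mult)
  have dB: "den B z = den A z" using A assms by (simp add: B_def den_mult)
  define w where "w = moebius B z"
  have Re: "\<bar>Re w\<bar> \<le> 1/2"
    using of_int_round_abs_le[of "Re (moebius A z)"] by (simp add: w_def mB n_def abs_minus_commute)
  have w: "Im w > 0" unfolding w_def using B assms by (rule Im_moebius_pos)
  \<comment> \<open>Minimality against \<open>S_mat ** B\<close> gives
    \<open>norm w \<ge> 1\<close>; with \<open>\<bar>Re w\<bar> \<le> 1 / 2\<close> this is a height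
    of at least \<open>sqrt 3 / 2\<close>.\<close>
  have "norm (den A z) \<le> norm (den (S_mat ** B) z)"
    using B by (intro minA SL2Z_mult) auto
  also have "\<dots> = norm w * norm (den A z)" using B assms by (simp add: den_mult norm_mult w_def dB)
  finally have "norm w \<ge> 1" using den_nonzero[OF A(1) assms] by simp
  then have "(Re w)\<^sup>2 + (Im w)\<^sup>2 \<ge> 1" by (simp add: cmod_power2[symmetric] one_le_power)
  moreover have "(Re w)\<^sup>2 \<le> (1/2)\<^sup>2" using Re by (metis abs_ge_zero power2_abs power_mono)
  ultimately have "(Im w)\<^sup>2 \<ge> 3 / 4" by (simp add: power2_eq_square)
  then have "Im w \<ge> sqrt (3 / 4)" using w by (simp add: real_le_rsqrt real_sqrt_le_iff real_le_lsqrt)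
  then have "Im w \<ge> sqrt 3 / 2" by (simp add: real_sqrt_divide)
  then show ?thesis using Re B by (auto simp: w_def)
qed

section \<open>Expansions at the cusp\<close>

text \<open>The power \<open>q^\<mu>\<close> for real \<open>\<mu>\<close>, as a function of
  \<open>z\<close>; in \<open>q\<close> itself it would be multivalued.\<close>

definition qp :: "real \<Rightarrow> complex \<Rightarrow> complex" where
  "qp \<mu> z = exp (2 * of_real pi * \<i> * of_real \<mu> * z)"

lemma norm_qp: "norm (qp \<mu> z) = exp (- (2 * pi * \<mu> * Im z))"
  by (simp add: qp_def)

lemma qp_nonzero [simp]: "qp \<mu> z \<noteq> 0"
  by (simp add: qp_def)

lemma qp_0 [simp]: "qp 0 z = 1"
  by (simp add: qp_def)

lemma qp_add: "qp (\<mu> + \<nu>) z = qp \<mu> z * qp \<nu> z"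
  by (simp add: qp_def exp_add[symmetric] algebra_simps)

lemma qp_shift: "qp \<mu> (z + of_real x) = cis (2 * pi * \<mu> * x) * qp \<mu> z"
  by (simp add: qp_def cis_conv_exp exp_add[symmetric] algebra_simps)

lemma has_field_derivative_qp [derivative_intros]:
  assumes "(f has_field_derivative f') (at z within A)"
  shows "((\<lambda>z. qp \<mu> (f z)) has_field_derivative 2 * of_real pi * \<i> * of_real \<mu> * qp \<mu> (f z) * f') (at z within A)"
  unfolding qp_def by (auto intro!: derivative_eq_intros assms)

lemma holomorphic_qp [holomorphic_intros]:
  "f holomorphic_on A \<Longrightarrow> (\<lambda>z. qp \<mu> (f z)) holomorphic_on A"
  unfolding qp_def by (intro holomorphic_intros)

lemma norm_qp1_less_1: "Im z > 0 \<Longrightarrow> norm (qp 1 z) < 1"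
  by (simp add: norm_qp)

lemma qp_1_eq_iff: "qp 1 z = qp 1 w \<longleftrightarrow> (\<exists>n::int. z = w + of_int n)"
proof -
  have "qp 1 z = qp 1 w \<longleftrightarrow> (\<exists>n::int. 2 * of_real pi * \<i> * z = 2 * of_real pi * \<i> * w + (of_int (2 * n) * pi) * \<i>)"
    by (simp add: qp_def exp_eq)
  also have "\<dots> \<longleftrightarrow> (\<exists>n::int. (2 * of_real pi * \<i>) * z = (2 * of_real pi * \<i>) * (w + of_int n))"
    by (intro arg_cong[of _ _ Ex] ext) (simp add: algebra_simps)
  also have "\<dots> \<longleftrightarrow> (\<exists>n::int. z = w + of_int n)"
    by (simp del: distrib_left)
  finally show ?thesis .
qed

lemma qp_1_surj:
  assumes "q \<noteq> 0" "norm q < 1"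
  obtains z where "Im z > 0" "qp 1 z = q"
proof -
  define z where "z = Ln q / (2 * of_real pi * \<i>)"
  have q: "qp 1 z = q" using assms by (simp add: qp_def z_def)
  have "exp (- (2 * pi * Im z)) < 1" using assms(2) q norm_qp[of 1 z] by simp
  then have "Im z > 0" by (simp add: zero_less_mult_iff)
  then show ?thesis using q that by blast
qed

text \<open>Order at least \<open>\<mu>\<close> at the cusp together with the eigenvalue
  \<open>cis (2 * pi * \<mu>)\<close> under translation by 1. Exponents add under products, which is
  how the order of the Wronskian is found, and derivatives keep the exponent.\<close>

definition q_class :: "real \<Rightarrow> (complex \<Rightarrow> complex) \<Rightarrow> bool" where
  "q_class \<mu> f \<longleftrightarrow> (\<exists>h. h holomorphic_on ball 0 1 \<and> (\<forall>z. Im z > 0 \<longrightarrow> f z = qp \<mu> z * h (qp 1 z)))"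

lemma q_classI:
  assumes "h holomorphic_on ball 0 1" "\<And>z. Im z > 0 \<Longrightarrow> f z = qp \<mu> z * h (qp 1 z)"
  shows "q_class \<mu> f"
  using assms by (auto simp: q_class_def)

lemma holomorphic_comp_qp:
  assumes "h holomorphic_on ball 0 1"
  shows "(\<lambda>z. h (qp 1 z)) holomorphic_on upper_half_plane"
  using holomorphic_on_compose_gen[of "qp 1" upper_half_plane h "ball 0 1"] assms
  by (force simp: o_def norm_qp1_less_1 intro!: holomorphic_intros)

lemma q_class_holomorphic:
  assumes "q_class \<mu> f"
  shows "f holomorphic_on upper_half_plane"
proof -
  obtain h where h: "h holomorphic_on ball 0 1" "\<And>z. Im z > 0 \<Longrightarrow> f z = qp \<mu> z * h (qp 1 z)"
    using assms by (auto simp: q_class_def)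
  have "(\<lambda>z. qp \<mu> z * h (qp 1 z)) holomorphic_on upper_half_plane"
    by (intro holomorphic_intros holomorphic_comp_qp h)
  then show ?thesis
    by (rule holomorphic_transform) (simp add: h)
qed

lemma q_class_cong: "(\<And>z. Im z > 0 \<Longrightarrow> f z = g z) \<Longrightarrow> q_class \<mu> f \<longleftrightarrow> q_class \<mu> g"
  by (simp add: q_class_def)

lemma q_class_const: "q_class 0 (\<lambda>_. c)"
  by (rule q_classI[of "\<lambda>_. c"]) auto

lemma q_class_add:
  assumes "q_class \<mu> f" "q_class \<mu> g"
  shows "q_class \<mu> (\<lambda>z. f z + g z)"
proof -
  obtain h k where "h holomorphic_on ball 0 1" "\<And>z. Im z > 0 \<Longrightarrow> f z = qp \<mu> z * h (qp 1 z)"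
    "k holomorphic_on ball 0 1" "\<And>z. Im z > 0 \<Longrightarrow> g z = qp \<mu> z * k (qp 1 z)"
    using assms by (auto simp: q_class_def)
  then show ?thesis
    by (intro q_classI[of "\<lambda>q. h q + k q"]) (auto intro!: holomorphic_intros simp: algebra_simps)
qed

lemma q_class_mult:
  assumes "q_class \<mu> f" "q_class \<nu> g"
  shows "q_class (\<mu> + \<nu>) (\<lambda>z. f z * g z)"
proof -
  obtain h k where "h holomorphic_on ball 0 1" "\<And>z. Im z > 0 \<Longrightarrow> f z = qp \<mu> z * h (qp 1 z)"
    "k holomorphic_on ball 0 1" "\<And>z. Im z > 0 \<Longrightarrow> g z = qp \<nu> z * k (qp 1 z)"
    using assms by (auto simp: q_class_def)
  then show ?thesis
    by (intro q_classI[of "\<lambda>q. h q * k q"]) (auto intro!: holomorphic_intros simp: qp_add)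
qed

lemma q_class_mult0: "q_class 0 f \<Longrightarrow> q_class \<mu> g \<Longrightarrow> q_class \<mu> (\<lambda>z. f z * g z)"
  using q_class_mult[of 0 f \<mu> g] by simp

lemma q_class_cmult: "q_class \<mu> f \<Longrightarrow> q_class \<mu> (\<lambda>z. c * f z)"
  by (rule q_class_mult0[OF q_class_const])

lemma q_class_diff: "q_class \<mu> f \<Longrightarrow> q_class \<mu> g \<Longrightarrow> q_class \<mu> (\<lambda>z. f z - g z)"
  using q_class_add[of \<mu> f "\<lambda>z. (-1) * g z"] q_class_cmult[of \<mu> g "-1"] by simp

lemma q_class_sum:
  assumes "finite I" "I \<noteq> {}" "\<And>i. i \<in> I \<Longrightarrow> q_class \<mu> (f i)"
  shows "q_class \<mu> (\<lambda>z. \<Sum>i\<in>I. f i z)"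
  using assms by (induction I rule: finite_ne_induct) (auto intro: q_class_add)

lemma q_class_prod:
  assumes "finite I" "\<And>i. i \<in> I \<Longrightarrow> q_class (\<mu> i) (f i)"
  shows "q_class (\<Sum>i\<in>I. \<mu> i) (\<lambda>z. \<Prod>i\<in>I. f i z)"
  using assms by (induction I rule: finite_induct) (auto intro: q_class_mult q_class_const)

lemma q_class_deriv:
  assumes "q_class \<mu> f"
  shows "q_class \<mu> (deriv f)"
proof -
  obtain h where h: "h holomorphic_on ball 0 1" "\<And>z. Im z > 0 \<Longrightarrow> f z = qp \<mu> z * h (qp 1 z)"
    using assms by (auto simp: q_class_def)
  define c where "c = 2 * of_real pi * \<i>"
  show ?thesis
  proof (rule q_classI[of "\<lambda>q. c * (of_real \<mu> * h q + q * deriv h q)"])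
    show "(\<lambda>q. c * (of_real \<mu> * h q + q * deriv h q)) holomorphic_on ball 0 1"
      by (intro holomorphic_intros h) auto
  next
    fix z assume z: "Im z > 0"
    have dh: "(h has_field_derivative deriv h (qp 1 z)) (at (qp 1 z))"
      using h(1) z by (intro holomorphic_derivI[of _ "ball 0 1"]) (auto simp: norm_qp1_less_1)
    have d: "((\<lambda>z. qp \<mu> z * h (qp 1 z)) has_field_derivative qp \<mu> z * (c * (of_real \<mu> * h (qp 1 z) + qp 1 z * deriv h (qp 1 z)))) (at z)"
      by (rule derivative_eq_intros DERIV_chain2[where f = h and g = "qp 1", OF dh] refl)+ (simp add: c_def algebra_simps)
    have "eventually (\<lambda>z. z \<in> upper_half_plane) (nhds z)"
      using z by (intro eventually_nhds_in_open) auto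
    then have e: "eventually (\<lambda>z. f z = qp \<mu> z * h (qp 1 z)) (nhds z)"
      by eventually_elim (use h in auto)
    have "(f has_field_derivative qp \<mu> z * (c * (of_real \<mu> * h (qp 1 z) + qp 1 z * deriv h (qp 1 z)))) (at z)"
      using d DERIV_cong_ev[OF refl e refl] by simp
    then show "deriv f z = qp \<mu> z * (c * (of_real \<mu> * h (qp 1 z) + qp 1 z * deriv h (qp 1 z)))"
      by (rule DERIV_imp_deriv)
  qed
qed

lemma holomorphic_disc_bounded:
  fixes h :: "complex \<Rightarrow> complex"
  assumes "h holomorphic_on ball 0 1" "r < 1"
  shows "\<exists>C>0. \<forall>q. norm q \<le> r \<longrightarrow> norm (h q) \<le> C"
proof -
  have "compact (h ` cball 0 r)"
    using assms by (intro compact_continuous_image holomorphic_on_imp_continuous_on holomorphic_on_subset[OF assms(1)]) auto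
  then obtain C where "C > 0" "\<forall>x\<in>h ` cball 0 r. norm x \<le> C"
    using bounded_pos compact_imp_bounded by metis
  then show ?thesis by auto
qed

lemma q_class_bound:
  assumes "q_class \<mu> f" "b > 0"
  shows "\<exists>C>0. \<forall>z. Im z \<ge> b \<longrightarrow> norm (f z) \<le> C * exp (- (2 * pi * \<mu> * Im z))"
proof -
  obtain h where h: "h holomorphic_on ball 0 1" "\<And>z. Im z > 0 \<Longrightarrow> f z = qp \<mu> z * h (qp 1 z)"
    using assms by (auto simp: q_class_def)
  obtain C where C: "C > 0" "\<And>q. norm q \<le> exp (- (2 * pi * b)) \<Longrightarrow> norm (h q) \<le> C"
    using holomorphic_disc_bounded[OF h(1), of "exp (- (2 * pi * b))"] \<open>b > 0\<close> by auto
  have "norm (f z) \<le> C * exp (- (2 * pi * \<mu> * Im z))" if "Im z \<ge> b" for z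
  proof -
    have "norm (h (qp 1 z)) \<le> C" using that by (intro C) (simp add: norm_qp)
    then show ?thesis using h(2)[of z] that \<open>b > 0\<close>
      by (simp add: norm_mult norm_qp mult.commute mult_left_mono)
  qed
  then show ?thesis using C(1) by blast
qed

lemma q_class_moderate_growth:
  assumes "q_class \<mu> f" "\<mu> \<ge> 0"
  shows "moderate_growth f"
proof -
  obtain C where C: "C > 0" "\<And>z. Im z \<ge> 1 \<Longrightarrow> norm (f z) \<le> C * exp (- (2 * pi * \<mu> * Im z))"
    using q_class_bound[OF assms(1), of 1] by auto
  have "\<forall>\<^sub>F y in at_top. \<forall>x. norm (f (Complex x y)) < y ^ 1"
    using eventually_gt_at_top[of C] eventually_ge_at_top[of 1]
  proof eventually_elim
    case (elim y)
    show ?case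
    proof
      fix x
      have "norm (f (Complex x y)) \<le> C * exp (- (2 * pi * \<mu> * y))" using C(2)[of "Complex x y"] elim by simp
      also have "\<dots> \<le> C * 1" using C assms elim by (intro mult_left_mono) auto
      finally show "norm (f (Complex x y)) < y ^ 1" using elim by simp
    qed
  qed
  then show ?thesis unfolding moderate_growth_def by blast
qed

text \<open>The logarithm has no branch on the punctured disc. By periodicity \<open>f\<close> does
  not see the choice of branch, so \<open>h\<close> agrees near every point with the composite of
  \<open>f\<close> and some holomorphic branch.\<close>

lemma periodic_factor:
  assumes hol: "f holomorphic_on upper_half_plane"
    and per: "\<And>z. Im z > 0 \<Longrightarrow> f (z + 1) = f z"
  obtains h where "h holomorphic_on ball 0 1 - {0}" "\<And>z. Im z > 0 \<Longrightarrow> f z = h (qp 1 z)"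
proof -
  have perN: "f (z + of_nat n) = f z" if "Im z > 0" for z n
    by (induction n) (use per[of "z + of_nat _"] that in \<open>auto simp: add_ac\<close>)
  have perZ: "f (z + of_int n) = f z" if "Im z > 0" for z n
  proof (cases "n \<ge> 0")
    case True
    then show ?thesis using perN[OF that, of "nat n"] by simp
  next
    case False
    then show ?thesis using perN[of "z + of_int n" "nat (-n)"] that by simp
  qed
  define l where "l q = Ln q / (2 * of_real pi * \<i>)" for q
  define h where "h q = f (l q)" for q
  have l: "qp 1 (l q) = q" if "q \<noteq> 0" for q using that by (simp add: l_def qp_def)
  have lpos: "Im (l q) > 0" if "q \<noteq> 0" "norm q < 1" for q
  proof -
    have "exp (- (2 * pi * Im (l q))) < 1" using norm_qp[of 1 "l q"] l that by simp
    then show ?thesis by (simp add: zero_less_mult_iff)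
  qed
  have heq: "h q = f z" if "Im z > 0" "q = qp 1 z" for q z
  proof -
    have "qp 1 (l q) = qp 1 z" using that l by simp
    then obtain n where "l q = z + of_int n" using qp_1_eq_iff by blast
    then show ?thesis using perZ[OF that(1)] by (simp add: h_def)
  qed
  \<comment> \<open>Multiplying by \<open>c\<close> before taking \<open>Ln\<close> rotates the cut;
    the slit discs for \<open>c = 1\<close> and \<open>c = -1\<close> cover the punctured
    disc.\<close>
  have slit: "h holomorphic_on {q \<in> ball 0 1. c * q \<notin> \<real>\<^sub>\<le>\<^sub>0}" if "c \<noteq> 0" for c
  proof -
    let ?X = "{q \<in> ball 0 1. c * q \<notin> \<real>\<^sub>\<le>\<^sub>0}"
    define m where "m q = (Ln (c * q) - Ln c) / (2 * of_real pi * \<i>)" for q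
    have m: "qp 1 (m q) = q" if "q \<noteq> 0" for q
      using that \<open>c \<noteq> 0\<close> by (simp add: m_def qp_def exp_diff)
    have mpos: "Im (m q) > 0" if "q \<noteq> 0" "norm q < 1" for q
    proof -
      have "exp (- (2 * pi * Im (m q))) < 1" using norm_qp[of 1 "m q"] m that by simp
      then show ?thesis by (simp add: zero_less_mult_iff)
    qed
    have "m holomorphic_on ?X" unfolding m_def by (intro holomorphic_intros) auto
    moreover have "m ` ?X \<subseteq> upper_half_plane" using mpos by (auto intro!: mpos)
    ultimately have "(f \<circ> m) holomorphic_on ?X"
      using holomorphic_on_compose_gen[OF _ hol] by blast
    then show ?thesis
      by (rule holomorphic_transform) (auto simp: o_def intro!: heq[symmetric] mpos m[symmetric])
  qed
  have op: "open {q \<in> ball 0 1. c * q \<notin> \<real>\<^sub>\<le>\<^sub>0}" for c :: complex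
  proof -
    have "open (ball 0 1 \<inter> (\<lambda>q. c * q) -` (- \<real>\<^sub>\<le>\<^sub>0))"
      by (intro open_Int open_vimage continuous_intros) (auto simp: open_Compl)
    then show ?thesis by (simp add: Int_def Collect_conj_eq[symmetric] vimage_def)
  qed
  have "(ball 0 1 :: complex set) - {0} = {q \<in> ball 0 1. 1 * q \<notin> \<real>\<^sub>\<le>\<^sub>0} \<union> {q \<in> ball 0 1. -1 * q \<notin> \<real>\<^sub>\<le>\<^sub>0}"
  proof -
    have "q = 0" if "q \<in> \<real>\<^sub>\<le>\<^sub>0" "- 1 * q \<in> \<real>\<^sub>\<le>\<^sub>0" for q :: complex
      using that by (auto simp: complex_nonpos_Reals_iff complex_nonneg_Reals_iff complex_eq_iff)
    then have "z \<in> ball 0 1 - {0} \<longleftrightarrow> z \<in> {q \<in> ball 0 1. 1 * q \<notin> \<real>\<^sub>\<le>\<^sub>0} \<union> {q \<in> ball 0 1. -1 * q \<notin> \<real>\<^sub>\<le>\<^sub>0}" for z :: complex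
      by (cases "z = 0") auto
    then show ?thesis by (rule set_eqI)
  qed
  moreover have "h holomorphic_on ({q \<in> ball 0 1. 1 * q \<notin> \<real>\<^sub>\<le>\<^sub>0} \<union> {q \<in> ball 0 1. -1 * q \<notin> \<real>\<^sub>\<le>\<^sub>0})"
    by (rule holomorphic_on_Un[OF slit slit op op]) simp_all
  ultimately have "h holomorphic_on ball 0 1 - {0}" by simp
  then show ?thesis using that heq by metis
qed

text \<open>Riemann's theorem on removable singularities: in terms of \<open>q\<close>, growth like
  \<open>y ^ N\<close> is growth like a power of \<open>ln (norm q)\<close>, and the factor
  \<open>q^(1 - \<mu>)\<close> overcomes it. This is where \<open>\<mu> < 1\<close> enters.\<close>

lemma q_class_of_moderate_growth:
  assumes hol: "f holomorphic_on upper_half_plane"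
    and per: "\<And>z. Im z > 0 \<Longrightarrow> f (z + 1) = cis (2 * pi * \<mu>) * f z"
    and \<mu>: "\<mu> < 1" and gr: "moderate_growth f"
  shows "q_class \<mu> f"
proof -
  define g where "g z = qp (-\<mu>) z * f z" for z
  have "g holomorphic_on upper_half_plane" unfolding g_def by (intro holomorphic_intros hol)
  moreover have "g (z + 1) = g z" if "Im z > 0" for z
    using qp_shift[of "-\<mu>" z 1] per[OF that] by (simp add: g_def cis_mult cis_inverse[symmetric] field_simps)
  ultimately obtain h where h: "h holomorphic_on ball 0 1 - {0}" "\<And>z. Im z > 0 \<Longrightarrow> g z = h (qp 1 z)"
    using periodic_factor by metis
  obtain N where N: "\<forall>\<^sub>F y in at_top. \<forall>x. norm (f (Complex x y)) < y ^ N"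
    using gr by (auto simp: moderate_growth_def)
  have "((\<lambda>q. (q - 0) * h q) \<longlongrightarrow> 0) (at 0)"
  proof (rule Lim_null_comparison)
    define Y where "Y q = - ln (norm q) / (2 * pi)" for q :: complex
    have Ytop: "filterlim Y at_top (at 0)"
    proof -
      have "filterlim (\<lambda>r. - ln r / (2 * pi)) at_top (at_right 0)" by real_asymp
      moreover have "filterlim norm (at_right 0) (at (0::complex))"
        unfolding filterlim_at by (auto simp: eventually_at intro!: tendsto_eq_intros exI[of _ 1])
      ultimately show ?thesis unfolding Y_def by (rule filterlim_compose)
    qed
    have "((\<lambda>y. y ^ N * exp (- (2 * pi * (1 - \<mu>) * y))) \<longlongrightarrow> 0) at_top"
      using \<mu> by real_asymp
    then show "((\<lambda>q. Y q ^ N * exp (- (2 * pi * (1 - \<mu>) * Y q))) \<longlongrightarrow> 0) (at 0)"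
      by (rule filterlim_compose[OF _ Ytop])
    have "eventually (\<lambda>q::complex. q \<in> ball 0 1 - {0}) (at 0)"
      by (rule eventually_at_in_open) auto
    moreover have "eventually (\<lambda>q. \<forall>x. norm (f (Complex x (Y q))) < Y q ^ N) (at 0)"
      using N Ytop by (rule eventually_compose_filterlim)
    ultimately show "\<forall>\<^sub>F q in at 0. norm ((q - 0) * h q) \<le> Y q ^ N * exp (- (2 * pi * (1 - \<mu>) * Y q))"
    proof eventually_elim
      case (elim q)
      then obtain z where z: "Im z > 0" "qp 1 z = q" using qp_1_surj[of q] by auto
      have "norm q = exp (- (2 * pi * Im z))" using z norm_qp[of 1 z] by simp
      then have Y: "Im z = Y q" by (simp add: Y_def)
      have "z = Complex (Re z) (Y q)" using Y by (simp add: complex_eq_iff)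
      then have "norm (f z) < Y q ^ N" using elim(2) by metis
      then have "norm (qp (1 - \<mu>) z) * norm (f z) \<le> norm (qp (1 - \<mu>) z) * Y q ^ N"
        by (intro mult_left_mono) auto
      moreover have "(q - 0) * h q = qp (1 - \<mu>) z * f z"
        using h(2)[OF z(1)] z(2) qp_add[of 1 "-\<mu>" z] by (simp add: g_def)
      ultimately show ?case by (simp add: norm_mult norm_qp Y mult.commute)
    qed
  qed
  then obtain k where k: "k holomorphic_on ball 0 1" "\<And>z. z \<in> ball 0 1 - {0} \<Longrightarrow> k z = h z"
    using holomorphic_on_extend_lim[OF h(1)] by auto
  show ?thesis
  proof (rule q_classI[OF k(1)])
    fix z assume z: "Im z > 0"
    have "k (qp 1 z) = g z" using z h(2) k(2)[of "qp 1 z"] norm_qp1_less_1 by simp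
    then show "f z = qp \<mu> z * k (qp 1 z)"
      using qp_add[of \<mu> "-\<mu>" z] by (simp add: g_def)
  qed
qed

section \<open>Two lemmas on holomorphic functions\<close>

text \<open>At a zero \<open>a\<close> of \<open>g\<close> both functions are replaced by their
  difference quotients at \<open>a\<close>, which are holomorphic; that of \<open>g\<close> takes
  the value \<open>deriv g a \<noteq> 0\<close>. So \<open>h\<close> is locally a quotient with
  nonvanishing denominator.\<close>

lemma holomorphic_division:
  assumes f: "f holomorphic_on S" and g: "g holomorphic_on S" and S: "open S"
    and zero: "\<And>z. z \<in> S \<Longrightarrow> g z = 0 \<Longrightarrow> f z = 0 \<and> deriv g z \<noteq> 0"
  obtains h where "h holomorphic_on S" "\<And>z. z \<in> S \<Longrightarrow> f z = g z * h z"
proof -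
  define h where "h z = (if g z = 0 then deriv f z / deriv g z else f z / g z)" for z
  have "h field_differentiable (at a within S)" if a: "a \<in> S" for a
  proof -
    define F where "F = (\<lambda>z. if z = a then deriv f a else (f z - f a) / (z - a))"
    define G where "G = (\<lambda>z. if z = a then deriv g a else (g z - g a) / (z - a))"
    have hol: "F holomorphic_on S" "G holomorphic_on S"
      unfolding F_def G_def using a S by (auto intro!: pole_lemma f g simp: interior_open)
    have *: "\<exists>u v U. open U \<and> a \<in> U \<and> U \<subseteq> S \<and> u holomorphic_on U \<and> v holomorphic_on U \<and>
       (\<forall>z\<in>U. v z \<noteq> 0 \<and> h z = u z / v z)"
    proof (cases "g a = 0")
      case True
      have "G a \<noteq> 0" using zero[OF a True] by (simp add: G_def)
      moreover have "isCont G a" using hol(2) a S by (meson continuous_on_eq_continuous_at holomorphic_on_imp_continuous_on)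
      ultimately have "eventually (\<lambda>z. G z \<noteq> 0) (nhds a)"
        using tendsto_imp_eventually_ne[of G "G a" "nhds a" 0] by (simp add: continuous_at_imp_continuous_at_within isCont_def tendsto_nhds_iff)
      then obtain U where U: "open U" "a \<in> U" "\<forall>z\<in>U. G z \<noteq> 0" unfolding eventually_nhds by blast
      have "G z \<noteq> 0 \<and> h z = F z / G z" if "z \<in> U \<inter> S" for z
        using that U True zero[OF a True] by (auto simp: h_def F_def G_def divide_simps split: if_splits)
      then show ?thesis using U a S hol
        by (intro exI[of _ F] exI[of _ G] exI[of _ "U \<inter> S"]) (auto intro: holomorphic_on_subset)
    next
      case False
      have "isCont g a" using g a S by (meson continuous_on_eq_continuous_at holomorphic_on_imp_continuous_on)
      then have "eventually (\<lambda>z. g z \<noteq> 0) (nhds a)"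
        using tendsto_imp_eventually_ne[of g "g a" "nhds a" 0] False by (simp add: isCont_def tendsto_nhds_iff)
      then obtain U where U: "open U" "a \<in> U" "\<forall>z\<in>U. g z \<noteq> 0" unfolding eventually_nhds by blast
      then show ?thesis using a S f g
        by (intro exI[of _ f] exI[of _ g] exI[of _ "U \<inter> S"]) (auto simp: h_def intro: holomorphic_on_subset)
    qed
    then obtain u v U where U: "open U" "a \<in> U" "U \<subseteq> S" "u holomorphic_on U" "v holomorphic_on U"
       "\<forall>z\<in>U. v z \<noteq> 0 \<and> h z = u z / v z" by blast
    have "(\<lambda>z. u z / v z) holomorphic_on U" using U by (intro holomorphic_intros) auto
    then have "h holomorphic_on U" by (rule holomorphic_transform) (use U in auto)
    then show ?thesis
      using U by (meson field_differentiable_at_within holomorphic_on_imp_differentiable_at)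
  qed
  then have "h holomorphic_on S" by (simp add: holomorphic_on_def)
  moreover have "f z = g z * h z" if "z \<in> S" for z
    using zero[OF that] by (auto simp: h_def)
  ultimately show ?thesis using that by blast
qed

lemma det_holomorphic:
  assumes "\<And>i j. (\<lambda>z. A z $ i $ j) holomorphic_on X"
  shows "(\<lambda>z. det (A z)) holomorphic_on X"
  unfolding det_def by (intro holomorphic_intros assms)

lemma higher_deriv_zero_mult:
  assumes "f holomorphic_on S" "g holomorphic_on S" "open S" "z \<in> S"
    "\<And>m. m \<le> n \<Longrightarrow> (deriv ^^ m) g z = 0"
  shows "(deriv ^^ n) (\<lambda>w. f w * g w) z = 0"
  using assms by (subst higher_deriv_mult[of f S g]) auto

lemma higher_deriv_zero_sum:
  fixes f :: "'i \<Rightarrow> complex \<Rightarrow> complex"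
  assumes "finite I" "\<And>i. i \<in> I \<Longrightarrow> f i holomorphic_on S" "open S" "z \<in> S"
    "\<And>i. i \<in> I \<Longrightarrow> (deriv ^^ n) (f i) z = 0"
  shows "(deriv ^^ n) (\<lambda>w. \<Sum>i\<in>I. f i w) z = 0"
  using assms
proof (induction I rule: finite_induct)
  case empty
  then show ?case by (simp add: higher_deriv_const)
next
  case (insert i I)
  then show ?case
    by (simp, subst higher_deriv_add[of _ S]) (auto intro!: holomorphic_intros)
qed

text \<open>
  If \<open>r\<close> is the largest number of iterates that are independent at some point, then on a
  neighbourhood \<open>G\<^sub>r\<close> is a holomorphic combination of the previous iterates, and a functional
  annihilating those at one point annihilates all Taylor coefficients of \<open>G\<^sub>0\<close> there.
\<close>

lemma generic_independence:
  fixes G :: "nat \<Rightarrow> complex \<Rightarrow> complex^'n"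
  assumes U: "open U" "connected U"
    and hol: "\<And>n j. (\<lambda>z. G n z $ j) holomorphic_on U"
    and a: "\<And>n. a n holomorphic_on U"
    and rec: "\<And>n j z. z \<in> U \<Longrightarrow> deriv (\<lambda>z. G n z $ j) z = G (Suc n) z $ j + a n z * G n z $ j"
    and nondeg: "\<And>v. (\<And>z. z \<in> U \<Longrightarrow> (\<Sum>j\<in>UNIV. v $ j * G 0 z $ j) = 0) \<Longrightarrow> v = 0"
  shows "\<exists>z\<in>U. \<exists>idx. bij_betw idx (UNIV :: 'n set) {..<CARD('n)} \<and>
    det (\<chi> i b. G (idx b) z $ i) \<noteq> 0"
proof -
  \<comment> \<open>The columns are the iterates below \<open>r\<close>, filled up by constant
    vectors \<open>u\<close>. Invertibility for some \<open>u\<close> says that these iterates are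
    independent at \<open>z\<close>, by a determinant whose size does not vary with
    \<open>r\<close>.\<close>
  define M where "M r idx u z = (\<chi> i b. if (idx :: 'n \<Rightarrow> nat) b < r then G (idx b) z $ i else (u :: 'n \<Rightarrow> complex^'n) b $ i)"
    for r idx u z
  define good where "good r \<longleftrightarrow> (\<exists>z\<in>U. \<exists>idx u. bij_betw idx UNIV {..<CARD('n)} \<and> det (M r idx u z) \<noteq> 0)" for r
  have "U \<noteq> {}"
  proof
    assume "U = {}"
    then have "(axis undefined 1 :: complex^'n) = 0" by (intro nondeg) auto
    then show False by (simp add: axis_eq_0_iff)
  qed
  then obtain z0 where z0: "z0 \<in> U" by blast
  obtain idx0 where idx0: "bij_betw idx0 (UNIV :: 'n set) {..<CARD('n)}"
    using ex_bij_betw_finite_nat[of "UNIV :: 'n set"] by (auto simp: atLeast0LessThan)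
  have "M 0 idx0 (\<lambda>b. axis b 1) z0 = mat 1"
    by (auto simp: M_def vec_eq_iff mat_def axis_def)
  then have good0: "good 0" unfolding good_def using z0 idx0
    by (intro bexI[of _ z0] exI[of _ idx0] exI[of _ "\<lambda>b. axis b 1"]) auto
  have "good CARD('n)"
  proof (rule ccontr)
    assume "\<not> good CARD('n)"
    moreover have "good n" if "\<And>r. r < CARD('n) \<Longrightarrow> good r \<Longrightarrow> good (Suc r)" "n \<le> CARD('n)" for n
      using that(2) by (induction n) (auto simp: good0 that(1))
    ultimately obtain r where r: "r < CARD('n)" "good r" "\<not> good (Suc r)" by blast
    obtain z1 idx u where z1: "z1 \<in> U" and idx: "bij_betw idx UNIV {..<CARD('n)}"
      and det1: "det (M r idx u z1) \<noteq> 0"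
      using r(2) unfolding good_def by blast
    have idx_inj: "idx x = idx y \<longleftrightarrow> x = y" for x y
      using idx by (auto simp: bij_betw_def inj_on_def)
    have idx_surj: "\<exists>b. idx b = i" if "i < CARD('n)" for i
    proof -
      have "i \<in> range idx" unfolding bij_betw_imp_surj_on[OF idx] using that by simp
      then show ?thesis by auto
    qed
    obtain b' where b': "idx b' = r" using idx_surj[OF r(1)] by blast
    have Mhol: "(\<lambda>z. M r idx u z $ i $ j) holomorphic_on U" for i j
      unfolding M_def by (cases "idx j < r") (auto intro: hol)
    have dethol: "(\<lambda>z. det (M r idx u z)) holomorphic_on U"
      by (intro det_holomorphic Mhol)
    have "isCont (\<lambda>z. det (M r idx u z)) z1"
      using dethol z1 U by (meson continuous_on_eq_continuous_at holomorphic_on_imp_continuous_on)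
    then have "eventually (\<lambda>z. det (M r idx u z) \<noteq> 0) (nhds z1)"
      using tendsto_imp_eventually_ne[of "\<lambda>z. det (M r idx u z)" "det (M r idx u z1)" "nhds z1" 0] det1
      by (simp add: isCont_def tendsto_nhds_iff)
    then obtain B0 where B0: "open B0" "z1 \<in> B0" "\<forall>z\<in>B0. det (M r idx u z) \<noteq> 0" unfolding eventually_nhds by blast
    define B where "B = B0 \<inter> U"
    have B: "open B" "z1 \<in> B" "B \<subseteq> U" "\<And>z. z \<in> B \<Longrightarrow> det (M r idx u z) \<noteq> 0"
      using B0 z1 U by (auto simp: B_def)
    \<comment> \<open>Cramer's rule: the coefficients of \<open>G r\<close> with respect to the
      columns of \<open>M r idx u\<close>, holomorphic wherever the determinant is nonzero.\<close>
    define c where "c b z = det (\<chi> i k. if k = b then G r z $ i else M r idx u z $ i $ k) / det (M r idx u z)" for b z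
    have rhol: "(\<lambda>z. (\<chi> i k. if k = b then G r z $ i else M r idx u z $ i $ k) $ i $ j) holomorphic_on B" for b i j
      by (cases "j = b") (auto intro: holomorphic_on_subset[OF hol B(3)] holomorphic_on_subset[OF Mhol B(3)])
    have chol: "c b holomorphic_on B" for b
      unfolding c_def
      by (intro holomorphic_on_divide det_holomorphic rhol holomorphic_on_subset[OF dethol B(3)] B(4))
    have c0: "c b z = 0" if "z \<in> B" "idx b \<ge> r" for b z
    proof -
      \<comment> \<open>Exchanging \<open>b\<close> with the column numbered \<open>r\<close> turns
        the numerator of \<open>c b\<close> into a determinant of type \<open>M (Suc r)\<close>,
        which vanishes by maximality of \<open>r\<close>.\<close>
      define \<tau> where "\<tau> k = (if k = b then b' else if k = b' then b else k)" for k
      have "\<tau> \<circ> \<tau> = id" by (auto simp: \<tau>_def fun_eq_iff)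
      then have \<tau>: "bij \<tau>" by (rule o_bij) (simp add: \<open>\<tau> \<circ> \<tau> = id\<close>)
      define idx' where "idx' = idx \<circ> \<tau>"
      have "bij_betw idx' UNIV {..<CARD('n)}" unfolding idx'_def
        using bij_betw_trans[OF \<tau> idx] .
      then have "det (M (Suc r) idx' u z) = 0" for u
        using r(3) that(1) B(3) unfolding good_def by blast
      moreover have "M (Suc r) idx' u z = (\<chi> i k. if k = b then G r z $ i else M r idx u z $ i $ k)"
        using that(2) b' idx_inj
        by (auto simp: M_def vec_eq_iff idx'_def \<tau>_def less_Suc_eq)
      ultimately have "det (\<chi> i k. if k = b then G r z $ i else M r idx u z $ i $ k) = 0" by metis
      then show ?thesis by (simp only: c_def div_0)
    qed
    have Gr: "G r z $ i = (\<Sum>b\<in>{b. idx b < r}. c b z * G (idx b) z $ i)" if "z \<in> B" for z i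
    proof -
      have "M r idx u z *v (\<chi> b. c b z) = G r z"
        by (simp only: cramer[OF B(4)[OF that]] c_def)
      then have "G r z $ i = (M r idx u z *v (\<chi> b. c b z)) $ i" by simp
      also have "\<dots> = (\<Sum>b\<in>UNIV. M r idx u z $ i $ b * c b z)"
        by (simp add: matrix_vector_mult_def)
      also have "\<dots> = (\<Sum>b\<in>{b. idx b < r}. M r idx u z $ i $ b * c b z)"
        by (rule sum.mono_neutral_right) (auto simp: c0[OF that])
      also have "\<dots> = (\<Sum>b\<in>{b. idx b < r}. c b z * G (idx b) z $ i)"
        by (rule sum.cong) (auto simp: M_def)
      finally show ?thesis .
    qed
    \<comment> \<open>A row of the inverse is a functional that vanishes on all columns but one. The
      row \<open>b'\<close> kills \<open>G i z1\<close> for \<open>i < r\<close> and is not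
      zero.\<close>
    obtain N where N: "N ** M r idx u z1 = mat 1"
      using det1 by (metis invertible_det_nz invertible_def)
    define v where "v = N $ b'"
    have v: "(\<Sum>j\<in>UNIV. v $ j * M r idx u z1 $ j $ b) = (if b = b' then 1 else 0)" for b
    proof -
      have "(N ** M r idx u z1) $ b' $ b = (if b = b' then 1 else 0)" by (simp add: N mat_def)
      then show ?thesis by (simp add: matrix_matrix_mult_def v_def)
    qed
    define y where "y n z = (\<Sum>j\<in>UNIV. v $ j * G n z $ j)" for n z
    have yhol: "y n holomorphic_on U" for n unfolding y_def by (intro holomorphic_intros hol)
    have yderiv: "deriv (y n) z = y (Suc n) z + a n z * y n z" if "z \<in> U" for n z
    proof -
      have "(y n has_field_derivative (\<Sum>j\<in>UNIV. v $ j * deriv (\<lambda>z. G n z $ j) z)) (at z)"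
        unfolding y_def
        by (intro DERIV_sum DERIV_cmult holomorphic_derivI[OF hol U(1) that])
      then show ?thesis using that
        by (simp add: DERIV_imp_deriv rec y_def sum.distrib sum_distrib_left algebra_simps)
    qed
    have ysmall: "y i z1 = 0" if "i < r" for i
    proof -
      have "i < CARD('n)" using that r(1) by simp
      then obtain b where b: "idx b = i" using idx_surj by blast
      then have "b \<noteq> b'" using b' that by auto
      then show ?thesis using v[of b] b that by (simp add: y_def M_def)
    qed
    have yr: "y r z = (\<Sum>b\<in>{b. idx b < r}. c b z * y (idx b) z)" if "z \<in> B" for z
    proof -
      have "y r z = (\<Sum>j\<in>UNIV. \<Sum>b\<in>{b. idx b < r}. v $ j * (c b z * G (idx b) z $ j))"
        by (simp only: y_def Gr[OF that] sum_distrib_left)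
      also have "\<dots> = (\<Sum>b\<in>{b. idx b < r}. \<Sum>j\<in>UNIV. v $ j * (c b z * G (idx b) z $ j))"
        by (rule sum.swap)
      finally show ?thesis by (simp add: y_def sum_distrib_left mult_ac)
    qed
    \<comment> \<open>Differentiating \<open>y i\<close> for \<open>i < r\<close> leads to
      \<open>y (Suc i)\<close> and \<open>y i\<close> at lower order, whereas \<open>y r\<close> is
      a combination of the earlier functions at the same order. So each order is settled first below
      \<open>r\<close> and then at \<open>r\<close>.\<close>
    have flat: "\<forall>i\<le>r. (deriv ^^ n) (y i) z1 = 0" for n
    proof (induction n rule: less_induct)
      case (less n)
      have small: "(deriv ^^ n) (y i) z1 = 0" if "i < r" for i
      proof (cases n)
        case 0
        then show ?thesis using ysmall that by simp
      next
        case (Suc m)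
        have "(deriv ^^ n) (y i) z1 = (deriv ^^ m) (deriv (y i)) z1"
          by (simp add: Suc funpow_swap1)
        also have "\<dots> = (deriv ^^ m) (\<lambda>z. y (Suc i) z + a i z * y i z) z1"
          by (rule higher_deriv_transform_within_open[of _ U])
             (use U z1 yderiv in \<open>auto intro!: holomorphic_intros yhol a\<close>)
        also have "\<dots> = (deriv ^^ m) (y (Suc i)) z1 + (deriv ^^ m) (\<lambda>z. a i z * y i z) z1"
          by (rule higher_deriv_add[of _ U]) (use U z1 in \<open>auto intro!: holomorphic_intros yhol a\<close>)
        also have "(deriv ^^ m) (y (Suc i)) z1 = 0" using less.IH[of m] Suc that by auto
        also have "(deriv ^^ m) (\<lambda>z. a i z * y i z) z1 = 0"
          by (rule higher_deriv_zero_mult[of _ U]) (use less.IH Suc that U z1 a yhol in auto)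
        finally show ?thesis by simp
      qed
      have "(deriv ^^ n) (y r) z1 = (deriv ^^ n) (\<lambda>z. \<Sum>b\<in>{b. idx b < r}. c b z * y (idx b) z) z1"
        by (rule higher_deriv_transform_within_open[of _ B])
           (use B yr in \<open>auto intro!: holomorphic_intros chol holomorphic_on_subset[OF yhol B(3)]\<close>)
      also have "\<dots> = 0"
      proof (rule higher_deriv_zero_sum[of _ _ B])
        fix b assume "b \<in> {b. idx b < r}"
        then have b: "idx b < r" by simp
        show "(deriv ^^ n) (\<lambda>z. c b z * y (idx b) z) z1 = 0"
        proof (rule higher_deriv_zero_mult[of _ B])
          fix m assume "m \<le> n"
          then show "(deriv ^^ m) (y (idx b)) z1 = 0"
            using small[OF b] less.IH[of m] b by (cases "m = n") auto
        qed (use B in \<open>auto intro!: chol holomorphic_on_subset[OF yhol B(3)]\<close>)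
      qed (use B in \<open>auto intro!: holomorphic_intros chol holomorphic_on_subset[OF yhol B(3)]\<close>)
      finally have "(deriv ^^ n) (y r) z1 = 0" .
      then show ?case using small by (auto simp: le_less)
    qed
    have "y 0 z = 0" if "z \<in> U" for z
      by (rule holomorphic_fun_eq_0_on_connected[OF yhol U _ z1 that]) (use flat in auto)
    then have "v = 0" by (intro nondeg) (auto simp: y_def)
    then show False using v[of b'] by simp
  qed
  then obtain z idx u where "z \<in> U" and idx: "bij_betw idx UNIV {..<CARD('n)}"
     and "det (M CARD('n) idx u z) \<noteq> 0" unfolding good_def by blast
  moreover have "idx b < CARD('n)" for b using idx by (auto simp: bij_betw_def)
  then have "M CARD('n) idx u z = (\<chi> i b. G (idx b) z $ i)"
    by (simp add: M_def)
  ultimately show ?thesis by auto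
qed

section \<open>Lattice sums\<close>

lemma holomorphic_infsum:
  fixes f :: "'i \<Rightarrow> complex \<Rightarrow> complex"
  assumes S: "open S" and hol: "\<And>i. i \<in> I \<Longrightarrow> f i holomorphic_on S"
    and bound: "\<And>z. z \<in> S \<Longrightarrow> \<exists>r>0. \<exists>M. M summable_on I \<and> cball z r \<subseteq> S \<and> (\<forall>i\<in>I. \<forall>w\<in>cball z r. norm (f i w) \<le> M i)"
  shows "(\<lambda>z. \<Sum>\<^sub>\<infinity>i\<in>I. f i z) holomorphic_on S"
proof -
  have "(\<lambda>z. \<Sum>\<^sub>\<infinity>i\<in>I. f i z) field_differentiable (at z)" if "z \<in> S" for z
  proof -
    obtain r M where r: "r > 0" "M summable_on I" "cball z r \<subseteq> S"
      "\<And>i w. i \<in> I \<Longrightarrow> w \<in> cball z r \<Longrightarrow> norm (f i w) \<le> M i"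
      using bound[OF \<open>z \<in> S\<close>] by blast
    have ul: "uniform_limit (cball z r) (\<lambda>X w. \<Sum>i\<in>X. f i w) (\<lambda>w. \<Sum>\<^sub>\<infinity>i\<in>I. f i w) (finite_subsets_at_top I)"
      by (rule Weierstrass_m_test_general[OF r(4) r(2)])
    have ev: "\<forall>\<^sub>F X in finite_subsets_at_top I. continuous_on (cball z r) (\<lambda>w. \<Sum>i\<in>X. f i w) \<and> (\<lambda>w. \<Sum>i\<in>X. f i w) holomorphic_on ball z r"
    proof (rule eventually_finite_subsets_at_top_weakI)
      fix X assume "finite X" "X \<subseteq> I"
      then have "(\<lambda>w. \<Sum>i\<in>X. f i w) holomorphic_on S" by (intro holomorphic_intros hol) auto
      then show "continuous_on (cball z r) (\<lambda>w. \<Sum>i\<in>X. f i w) \<and> (\<lambda>w. \<Sum>i\<in>X. f i w) holomorphic_on ball z r"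
        using r(3) ball_subset_cball by (meson holomorphic_on_imp_continuous_on holomorphic_on_subset subset_trans)
    qed
    have "(\<lambda>w. \<Sum>\<^sub>\<infinity>i\<in>I. f i w) holomorphic_on ball z r"
      by (rule holomorphic_uniform_limit[OF ev ul]) auto
    then show ?thesis using r(1) by (auto intro!: holomorphic_on_imp_differentiable_at[of _ "ball z r"])
  qed
  then show ?thesis by (auto simp: holomorphic_on_def intro: field_differentiable_at_within)
qed

section \<open>Sums over products and over the integers\<close>

lemma summable_on_product_real:
  fixes f :: "'a \<Rightarrow> real" and g :: "'b \<Rightarrow> real"
  assumes "f summable_on A" "g summable_on B" "\<And>x. x \<in> A \<Longrightarrow> f x \<ge> 0" "\<And>x. x \<in> B \<Longrightarrow> g x \<ge> 0"
  shows "(\<lambda>(x, y). f x * g y) summable_on A \<times> B"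
proof (rule nonneg_bdd_above_summable_on)
  show "bdd_above (sum (\<lambda>(x, y). f x * g y) ` {F. F \<subseteq> A \<times> B \<and> finite F})"
  proof (rule bdd_aboveI2)
    fix F assume "F \<in> {F. F \<subseteq> A \<times> B \<and> finite F}"
    then have F: "F \<subseteq> A \<times> B" "finite F" by auto
    have "sum (\<lambda>(x, y). f x * g y) F \<le> sum (\<lambda>(x, y). f x * g y) (fst ` F \<times> snd ` F)"
      using F assms(3,4) by (intro sum_mono2) (force intro!: mult_nonneg_nonneg)+
    also have "\<dots> = sum f (fst ` F) * sum g (snd ` F)"
      by (simp add: sum.cartesian_product[symmetric] sum_product)
    also have "\<dots> \<le> infsum f A * infsum g B"
      using F assms
      by (intro mult_mono finite_sum_le_infsum infsum_nonneg sum_nonneg) (force)+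
    finally show "sum (\<lambda>(x, y). f x * g y) F \<le> infsum f A * infsum g B" .
  qed
qed (use assms in auto)

lemma has_sum_product_real:
  fixes f :: "'a \<Rightarrow> real" and g :: "'b \<Rightarrow> real"
  assumes "(f has_sum s) A" "(g has_sum t) B" "\<And>x. x \<in> A \<Longrightarrow> f x \<ge> 0" "\<And>x. x \<in> B \<Longrightarrow> g x \<ge> 0"
  shows "((\<lambda>(x, y). f x * g y) has_sum s * t) (A \<times> B)"
proof (rule has_sum_SigmaI[where g = "\<lambda>x. f x * t"])
  show "((\<lambda>y. case (x, y) of (x, y) \<Rightarrow> f x * g y) has_sum f x * t) B" if "x \<in> A" for x
    using assms(2) by (simp add: has_sum_cmult_right)
  show "((\<lambda>x. f x * t) has_sum s * t) A" using assms(1) by (rule has_sum_cmult_left)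
  show "(\<lambda>(x, y). f x * g y) summable_on A \<times> B"
    using assms by (intro summable_on_product_real) (auto simp: summable_on_def)
qed

lemma summable_on_int:
  fixes f :: "int \<Rightarrow> 'a::banach"
  assumes "(\<lambda>n. f (int n)) summable_on UNIV" "(\<lambda>n. f (- int n - 1)) summable_on UNIV"
  shows "f summable_on UNIV"
    and "infsum f UNIV = (\<Sum>\<^sub>\<infinity>n. f (int n)) + (\<Sum>\<^sub>\<infinity>n. f (- int n - 1))"
proof -
  have U: "(UNIV :: int set) = range int \<union> range (\<lambda>n. - int n - 1)"
  proof -
    have "x \<in> range int \<union> range (\<lambda>n. - int n - 1)" for x :: int
    proof (cases "x \<ge> 0")
      case True
      then show ?thesis by (metis UnI1 nat_0_le rangeI)
    next
      case False
      then have "x = - int (nat (- x - 1)) - 1" by simp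
      then show ?thesis by blast
    qed
    then show ?thesis by blast
  qed
  have disj: "range int \<inter> range (\<lambda>n. - int n - 1) = {}" by auto
  have i: "inj int" "inj (\<lambda>n. - int n - 1)" by (auto intro: injI)
  have s: "f summable_on range int" "f summable_on range (\<lambda>n. - int n - 1)"
    using assms i by (auto simp: summable_on_reindex o_def)
  show "f summable_on UNIV" unfolding U by (rule summable_on_Un_disjoint[OF s disj])
  show "infsum f UNIV = (\<Sum>\<^sub>\<infinity>n. f (int n)) + (\<Sum>\<^sub>\<infinity>n. f (- int n - 1))"
    unfolding U infsum_Un_disjoint[OF s disj] using i by (simp add: infsum_reindex o_def)
qed

text \<open>A majorant for lattice sums that factors into one-variable sums. Off the origin
  \<open>(1 + \<bar>c\<bar>) * (1 + \<bar>d\<bar>) \<le> (2 * (\<bar>c\<bar> +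
  \<bar>d\<bar>))\<^sup>2\<close>, so it dominates the exponent 4 up to a constant; this is the
  origin of the lower bound 4 on exponents.\<close>

definition lat :: "int \<times> int \<Rightarrow> real" where
  "lat = (\<lambda>(c, d). 1 / (1 + \<bar>of_int c\<bar>)\<^sup>2 * (1 / (1 + \<bar>of_int d\<bar>)\<^sup>2))"

lemma lat_summable: "lat summable_on X"
proof -
  have "summable (\<lambda>n. inverse (of_nat (Suc n) ^ 2 :: real))"
    using inverse_power_summable[of 2, where 'a = real] by (subst summable_Suc_iff) simp
  then have 1: "(\<lambda>n. 1 / (1 + \<bar>real_of_int (int n)\<bar>)\<^sup>2) summable_on UNIV"
    by (subst summable_on_UNIV_nonneg_real_iff) (auto simp: field_simps)
  have "(\<lambda>n. 1 / (1 + \<bar>real_of_int (- int n - 1)\<bar>)\<^sup>2) summable_on UNIV"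
    by (rule summable_on_comparison_test[OF 1]) (auto intro!: divide_left_mono power_mono)
  with 1 have "(\<lambda>n::int. 1 / (1 + \<bar>real_of_int n\<bar>)\<^sup>2) summable_on UNIV"
    by (rule summable_on_int)
  then have "lat summable_on UNIV \<times> UNIV"
    unfolding lat_def by (intro summable_on_product_real) auto
  then show ?thesis by (rule summable_on_subset_banach) auto
qed

text \<open>The imaginary part of \<open>c z + d\<close> bounds \<open>c\<close>, and then the real
  part bounds \<open>d\<close>, so
  \<open>\<bar>c\<bar> + \<bar>d\<bar> \<le> K * norm (c z + d)\<close> with \<open>K\<close>
  depending only on \<open>\<epsilon>\<close> and \<open>R\<close>. The exponent is real for the
  sake of Poincare series in real weight.\<close>

lemma lattice_bound:
  assumes z: "Im z \<ge> \<epsilon>" "\<epsilon> > 0" "\<bar>Re z\<bar> \<le> R" and cd: "(c, d) \<noteq> (0, 0)" and s: "s \<ge> 4"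
  shows "norm (of_int c * z + of_int d) powr (- s) \<le> 16 * (1 + (1 + R) / \<epsilon>) powr s * lat (c, d)"
proof -
  define n where "n = norm (of_int c * z + of_int d)"
  define K where "K = 1 + (1 + R) / \<epsilon>"
  define l where "l = \<bar>real_of_int c\<bar> + \<bar>real_of_int d\<bar>"
  have R: "R \<ge> 0" using z by linarith
  have K: "K \<ge> 1" using R z by (simp add: K_def)
  have "\<bar>of_int c * Im z\<bar> \<le> n"
    using abs_Im_le_cmod[of "of_int c * z + of_int d"] by (simp add: n_def)
  then have "\<bar>real_of_int c\<bar> * \<epsilon> \<le> n"
    using z mult_left_mono[of \<epsilon> "Im z" "\<bar>real_of_int c\<bar>"] by (simp add: abs_mult)
  then have c: "\<bar>real_of_int c\<bar> \<le> n / \<epsilon>" using z by (simp add: field_simps)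
  have "\<bar>of_int c * Re z + of_int d\<bar> \<le> n"
    using abs_Re_le_cmod[of "of_int c * z + of_int d"] by (simp add: n_def)
  then have "\<bar>real_of_int d\<bar> \<le> n + \<bar>real_of_int c\<bar> * \<bar>Re z\<bar>"
    by (simp add: abs_mult[symmetric])
  also have "\<dots> \<le> n + n / \<epsilon> * R" using c z R by (intro add_left_mono mult_mono) auto
  finally have "l \<le> n / \<epsilon> + (n + n / \<epsilon> * R)" using c by (simp add: l_def)
  then have l: "l \<le> K * n" by (simp add: K_def add_divide_distrib algebra_simps)
  have "\<bar>c\<bar> + \<bar>d\<bar> \<ge> 1" using cd by auto
  then have "real_of_int (\<bar>c\<bar> + \<bar>d\<bar>) \<ge> 1" by (simp only: of_int_1_le_iff)
  then have l1: "l \<ge> 1" by (simp add: l_def)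
  have "l / K \<le> n" using l K by (simp add: field_simps)
  then have "n powr (-s) \<le> (l / K) powr (-s)"
    using l1 K s by (intro powr_mono2') auto
  also have "\<dots> = K powr s * l powr (-s)"
    using l1 K by (simp add: powr_divide powr_minus field_simps)
  also have "\<dots> \<le> K powr s * l powr (-4)"
    using l1 s by (intro mult_left_mono powr_mono) auto
  also have "l powr (-4) = 1 / l ^ 4" using l1 by (simp add: powr_minus powr_numeral divide_inverse)
  also have "\<dots> \<le> 16 * lat (c, d)"
  proof -
    have "(1 + \<bar>real_of_int c\<bar>) * (1 + \<bar>real_of_int d\<bar>) \<le> (2 * l) * (2 * l)"
      using l1 by (intro mult_mono) (auto simp: l_def)
    then have "((1 + \<bar>real_of_int c\<bar>) * (1 + \<bar>real_of_int d\<bar>))\<^sup>2 \<le> ((2 * l) * (2 * l))\<^sup>2"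
      by (intro power_mono) auto
    also have "\<dots> = 16 * l ^ 4" by (simp add: power2_eq_square power4_eq_xxxx)
    finally have "1 / (16 * l ^ 4) \<le> 1 / ((1 + \<bar>real_of_int c\<bar>) * (1 + \<bar>real_of_int d\<bar>))\<^sup>2"
      using l1 by (intro divide_left_mono) (auto intro!: mult_pos_pos zero_less_power add_pos_nonneg)
    then show ?thesis by (simp add: lat_def power_mult_distrib)
  qed
  finally show ?thesis using K by (simp add: n_def K_def mult_left_mono mult_ac)
qed

lemma lattice_bound_power:
  assumes z: "Im z \<ge> \<epsilon>" "\<epsilon> > 0" "\<bar>Re z\<bar> \<le> R" and cd: "(c, d) \<noteq> (0, 0)" and k: "k \<ge> 4"
  shows "norm (1 / (of_int c * z + of_int d) ^ k) \<le> 16 * (1 + (1 + R) / \<epsilon>) powr k * lat (c, d)"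
proof -
  have "of_int c * z + of_int d \<noteq> 0"
  proof
    assume "of_int c * z + of_int d = 0"
    then have "of_int c * Im z = 0" "of_int c * Re z + of_int d = 0" by (auto simp: complex_eq_iff)
    then show False using cd z by auto
  qed
  then have "norm (1 / (of_int c * z + of_int d) ^ k) = norm (of_int c * z + of_int d) powr (- real k)"
    by (simp add: powr_minus powr_realpow norm_divide norm_power norm_inverse divide_inverse)
  then show ?thesis using lattice_bound[OF z cd, of "real k"] k by simp
qed

section \<open>Eisenstein series as lattice sums\<close>

definition eis :: "nat \<Rightarrow> complex \<Rightarrow> complex" where
  "eis k z = (\<Sum>\<^sub>\<infinity>(c, d)\<in>UNIV - {(0, 0)}. 1 / (of_int c * z + of_int d) ^ k)"

lemma eis_abs_summable:
  assumes "Im z > 0" "k \<ge> 4"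
  shows "(\<lambda>p. norm (case p of (c, d) \<Rightarrow> 1 / (of_int c * z + of_int d) ^ k)) summable_on UNIV - {(0, 0)}"
proof (rule summable_on_comparison_test)
  show "(\<lambda>p. 16 * (1 + (1 + \<bar>Re z\<bar>) / Im z) powr k * lat p) summable_on UNIV - {(0, 0)}"
    by (intro summable_on_cmult_right lat_summable)
  show "norm (case p of (c, d) \<Rightarrow> 1 / (of_int c * z + of_int d) ^ k) \<le> 16 * (1 + (1 + \<bar>Re z\<bar>) / Im z) powr k * lat p"
    if "p \<in> UNIV - {(0, 0)}" for p
    using that lattice_bound_power[of "Im z" z "\<bar>Re z\<bar>" "fst p" "snd p" k] assms by (auto simp: case_prod_beta)
qed auto

lemma eis_modular:
  assumes A: "A \<in> SL2Z" and z: "Im z > 0"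
  shows "eis k (moebius A z) = den A z ^ k * eis k z"
proof -
  \<comment> \<open>\<open>g\<close> multiplies a row \<open>(c, d)\<close> by \<open>A\<close> from
    the right and permutes the nonzero rows. The law holds for every \<open>k\<close>, since a sum
    that does not converge has the value 0.\<close>
  define g where "g p = (fst p * A$1$1 + snd p * A$2$1, fst p * A$1$2 + snd p * A$2$2)" for p
  define g' where "g' p = (fst p * A$2$2 - snd p * A$2$1, snd p * A$1$1 - fst p * A$1$2)" for p
  have det: "A$1$1 * A$2$2 - A$1$2 * A$2$1 = 1" using A by (simp add: SL2Z_iff)
  have gg': "g (g' p) = p" "g' (g p) = p" for p
  proof -
    have "g (g' p) = ((A$1$1 * A$2$2 - A$1$2 * A$2$1) * fst p, (A$1$1 * A$2$2 - A$1$2 * A$2$1) * snd p)"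
      by (simp add: g_def g'_def algebra_simps)
    then show "g (g' p) = p" using det by simp
    have "g' (g p) = ((A$1$1 * A$2$2 - A$1$2 * A$2$1) * fst p, (A$1$1 * A$2$2 - A$1$2 * A$2$1) * snd p)"
      by (simp add: g_def g'_def algebra_simps)
    then show "g' (g p) = p" using det by simp
  qed
  have g0: "g (0, 0) = (0, 0)" "g' (0, 0) = (0, 0)" by (simp_all add: g_def g'_def)
  have bij: "bij_betw g (UNIV - {(0, 0)}) (UNIV - {(0, 0)})"
  proof (rule bij_betw_byWitness[of _ g'])
    have "g p \<noteq> (0, 0)" if "p \<noteq> (0, 0)" for p using gg'(2)[of p] g0(2) that by metis
    then show "g ` (UNIV - {(0, 0)}) \<subseteq> UNIV - {(0, 0)}" by (intro image_subsetI) simp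
    have "g' p \<noteq> (0, 0)" if "p \<noteq> (0, 0)" for p using gg'(1)[of p] g0(1) that by metis
    then show "g' ` (UNIV - {(0, 0)}) \<subseteq> UNIV - {(0, 0)}" by (intro image_subsetI) simp
  qed (use gg' in auto)
  have nz: "den A z \<noteq> 0" using A z by (rule den_nonzero)
  have tm: "1 / (of_int c * moebius A z + of_int d) ^ k =
        den A z ^ k * (case g (c, d) of (c, d) \<Rightarrow> 1 / (of_int c * z + of_int d) ^ k)" for c d
  proof -
    have "of_int c * moebius A z + of_int d = (of_int (fst (g (c, d))) * z + of_int (snd (g (c, d)))) / den A z"
      using nz by (simp add: moebius_def' g_def field_simps) (simp add: den_def algebra_simps)
    then show ?thesis by (simp add: case_prod_beta power_divide)
  qed
  have "eis k (moebius A z) = (\<Sum>\<^sub>\<infinity>p\<in>UNIV - {(0, 0)}. den A z ^ k * (case g p of (c, d) \<Rightarrow> 1 / (of_int c * z + of_int d) ^ k))"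
    unfolding eis_def
  proof (rule infsum_cong)
    fix p :: "int \<times> int"
    show "(case p of (c, d) \<Rightarrow> 1 / (of_int c * moebius A z + of_int d) ^ k) =
      den A z ^ k * (case g p of (c, d) \<Rightarrow> 1 / (of_int c * z + of_int d) ^ k)"
      by (cases p) (simp only: tm prod.case)
  qed
  also have "\<dots> = den A z ^ k * (\<Sum>\<^sub>\<infinity>p\<in>UNIV - {(0, 0)}. (case g p of (c, d) \<Rightarrow> 1 / (of_int c * z + of_int d) ^ k))"
    by (rule infsum_cmult_right')
  also have "\<dots> = den A z ^ k * eis k z"
    unfolding eis_def by (subst infsum_reindex_bij_betw[OF bij]) simp
  finally show ?thesis .
qed

section \<open>The Lipschitz formula\<close>

text \<open>The polylogarithm of order \<open>- k\<close>, with constant term 1 for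
  \<open>k = 0\<close> because \<open>0 ^ 0 = 1\<close>. Multiplying its derivative by
  \<open>x\<close> raises \<open>k\<close> by one.\<close>

definition powser :: "nat \<Rightarrow> complex \<Rightarrow> complex" where
  "powser k x = (\<Sum>n. of_nat n ^ k * x ^ n)"

lemma summable_powser:
  fixes x :: "'a :: {real_normed_field, banach}"
  assumes "norm x < 1"
  shows "summable (\<lambda>n. of_nat n ^ k * x ^ n)"
  using assms
proof (induction k arbitrary: x)
  case 0
  then show ?case by (simp add: summable_geometric)
next
  case (Suc k)
  have "summable (\<lambda>n. diffs (\<lambda>n. of_nat n ^ k) n * x ^ n)"
    by (rule termdiff_converges[OF Suc.prems]) (use Suc.IH in auto)
  then have "summable (\<lambda>n. x * (diffs (\<lambda>n. of_nat n ^ k) n * x ^ n))" by (rule summable_mult)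
  moreover have "x * (diffs (\<lambda>n. of_nat n ^ k) n * x ^ n) = of_nat (Suc n) ^ Suc k * x ^ Suc n" for n
    by (simp add: diffs_def del: of_nat_Suc)
  ultimately show ?case by (subst summable_Suc_iff[symmetric]) simp
qed

lemma powser_Suc_deriv:
  assumes "norm x < 1"
  shows "\<exists>D. (powser k has_field_derivative D) (at x) \<and> x * D = powser (Suc k) x"
proof (intro exI conjI)
  show "(powser k has_field_derivative (\<Sum>n. diffs (\<lambda>n. of_nat n ^ k) n * x ^ n)) (at x)"
    unfolding powser_def[abs_def]
    by (rule termdiffs_strong'[where K = 1]) (use summable_powser assms in auto)
  have s: "summable (\<lambda>n. diffs (\<lambda>n. of_nat n ^ k) n * x ^ n)"
    by (rule termdiff_converges[OF assms]) (use summable_powser in auto)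
  have "x * (\<Sum>n. diffs (\<lambda>n. of_nat n ^ k) n * x ^ n) = (\<Sum>n. x * (diffs (\<lambda>n. of_nat n ^ k) n * x ^ n))"
    by (rule suminf_mult[OF s, symmetric])
  also have "\<dots> = (\<Sum>n. of_nat (Suc n) ^ Suc k * x ^ Suc n)"
    by (simp add: diffs_def mult_ac del: of_nat_Suc)
  also have "\<dots> = powser (Suc k) x"
    unfolding powser_def using suminf_split_head[OF summable_powser[OF assms, of "Suc k"]] by simp
  finally show "x * (\<Sum>n. diffs (\<lambda>n. of_nat n ^ k) n * x ^ n) = powser (Suc k) x" .
qed

lemma powser_0: "norm x < 1 \<Longrightarrow> powser 0 x = 1 / (1 - x)"
  by (simp add: powser_def suminf_geometric)

lemma powser_closed_step:
  assumes eq: "\<And>x. norm x < 1 \<Longrightarrow> powser k x = f x" and x: "norm x < 1"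
    and D: "(f has_field_derivative D) (at x)"
  shows "powser (Suc k) x = x * D"
proof -
  obtain D' where D': "(powser k has_field_derivative D') (at x)" "x * D' = powser (Suc k) x"
    using powser_Suc_deriv[OF x] by blast
  have "eventually (\<lambda>x. x \<in> ball 0 1) (nhds x)" using x by (intro eventually_nhds_in_open) auto
  then have e: "eventually (\<lambda>x. powser k x = f x) (nhds x)" by eventually_elim (use eq in auto)
  have "(f has_field_derivative D') (at x)" using D' DERIV_cong_ev[OF refl e refl] by simp
  with D have "D = D'" by (rule DERIV_unique)
  then show ?thesis using D'(2) by simp
qed

lemma has_field_derivative_over_power:
  fixes N :: "complex \<Rightarrow> complex"
  assumes "(N has_field_derivative N') (at x)" "norm x < 1" "N' * (1 - x) + of_nat n * N x = M"
  shows "((\<lambda>x. N x / (1 - x) ^ n) has_field_derivative M / (1 - x) ^ Suc n) (at x)"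
proof -
  have ne: "1 - x \<noteq> 0" using assms(2) by auto
  have "((\<lambda>x. (1 - x) ^ n) has_field_derivative - (of_nat n * (1 - x) ^ (n - 1))) (at x)"
    by (auto intro!: derivative_eq_intros)
  from DERIV_divide[OF assms(1) this] ne
  have "((\<lambda>x. N x / (1 - x) ^ n) has_field_derivative
     (N' * (1 - x) ^ n - N x * - (of_nat n * (1 - x) ^ (n - 1))) / ((1 - x) ^ n * (1 - x) ^ n)) (at x)" by simp
  also have "N' * (1 - x) ^ n - N x * - (of_nat n * (1 - x) ^ (n - 1)) = M * (1 - x) ^ n / (1 - x)"
    using ne by (cases n) (simp_all add: assms(3)[symmetric] field_simps)
  also have "M * (1 - x) ^ n / (1 - x) / ((1 - x) ^ n * (1 - x) ^ n) = M / (1 - x) ^ Suc n"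
    using ne by simp
  finally show ?thesis .
qed

text \<open>The numerators are \<open>x\<close> times Eulerian polynomials, produced by applying
  \<open>x d/dx\<close> to the geometric series. The cases 3 and 5 belong to the weights 4 and
  6.\<close>

lemma powser_closed:
  assumes "norm x < 1"
  shows powser_3: "powser 3 x = x * (1 + 4 * x + x ^ 2) / (1 - x) ^ 4"
    and powser_5: "powser 5 x = x * (1 + 26 * x + 66 * x ^ 2 + 26 * x ^ 3 + x ^ 4) / (1 - x) ^ 6"
proof -
  have ne: "1 - x \<noteq> 0" if "norm x < 1" for x :: complex using that by auto
  have 1: "powser 1 x = x / (1 - x) ^ 2" if "norm x < 1" for x
  proof -
    have "((\<lambda>x. 1 / (1 - x)) has_field_derivative 1 / (1 - x) ^ 2) (at x)"
      using ne[OF that] by (auto intro!: derivative_eq_intros simp: power2_eq_square)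
    from powser_closed_step[OF powser_0 that this] show ?thesis by simp
  qed
  have 2: "powser 2 x = x * (1 + x) / (1 - x) ^ 3" if "norm x < 1" for x
  proof -
    have "((\<lambda>x. x) has_field_derivative 1) (at x)"
      by (auto intro!: derivative_eq_intros simp: algebra_simps power2_eq_square power3_eq_cube)
    then have "((\<lambda>x. x / (1 - x) ^ 2) has_field_derivative (1 + x) / (1 - x) ^ Suc 2) (at x)"
      by (rule has_field_derivative_over_power[OF _ that]) (simp add: algebra_simps eval_nat_numeral)
    then have "((\<lambda>x. x / (1 - x) ^ 2) has_field_derivative (1 + x) / (1 - x) ^ 3) (at x)"
      by (simp add: eval_nat_numeral)
    from powser_closed_step[OF 1 that this] show ?thesis by (simp add: numeral_2_eq_2)
  qed
  have 3: "powser 3 x = x * (1 + 4 * x + x ^ 2) / (1 - x) ^ 4" if "norm x < 1" for x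
  proof -
    have "((\<lambda>x. x * (1 + x)) has_field_derivative 1 + 2 * x) (at x)"
      by (auto intro!: derivative_eq_intros simp: algebra_simps power2_eq_square power3_eq_cube)
    then have "((\<lambda>x. x * (1 + x) / (1 - x) ^ 3) has_field_derivative (1 + 4 * x + x ^ 2) / (1 - x) ^ Suc 3) (at x)"
      by (rule has_field_derivative_over_power[OF _ that]) (simp add: algebra_simps eval_nat_numeral)
    then have "((\<lambda>x. x * (1 + x) / (1 - x) ^ 3) has_field_derivative (1 + 4 * x + x ^ 2) / (1 - x) ^ 4) (at x)"
      by (simp add: eval_nat_numeral)
    from powser_closed_step[OF 2 that this] show ?thesis by (simp add: eval_nat_numeral)
  qed
  have 4: "powser 4 x = x * (1 + 11 * x + 11 * x ^ 2 + x ^ 3) / (1 - x) ^ 5" if "norm x < 1" for x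
  proof -
    have "((\<lambda>x. x * (1 + 4 * x + x ^ 2)) has_field_derivative 1 + 8 * x + 3 * x ^ 2) (at x)"
      by (auto intro!: derivative_eq_intros simp: algebra_simps power2_eq_square power3_eq_cube)
    then have "((\<lambda>x. x * (1 + 4 * x + x ^ 2) / (1 - x) ^ 4) has_field_derivative (1 + 11 * x + 11 * x ^ 2 + x ^ 3) / (1 - x) ^ Suc 4) (at x)"
      by (rule has_field_derivative_over_power[OF _ that]) (simp add: algebra_simps eval_nat_numeral)
    then have "((\<lambda>x. x * (1 + 4 * x + x ^ 2) / (1 - x) ^ 4) has_field_derivative (1 + 11 * x + 11 * x ^ 2 + x ^ 3) / (1 - x) ^ 5) (at x)"
      by (simp add: eval_nat_numeral)
    from powser_closed_step[OF 3 that this] show ?thesis by (simp add: eval_nat_numeral)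
  qed
  have 5: "powser 5 x = x * (1 + 26 * x + 66 * x ^ 2 + 26 * x ^ 3 + x ^ 4) / (1 - x) ^ 6" if "norm x < 1" for x
  proof -
    have "((\<lambda>x. x * (1 + 11 * x + 11 * x ^ 2 + x ^ 3)) has_field_derivative 1 + 22 * x + 33 * x ^ 2 + 4 * x ^ 3) (at x)"
      by (auto intro!: derivative_eq_intros simp: algebra_simps power2_eq_square power3_eq_cube)
    then have "((\<lambda>x. x * (1 + 11 * x + 11 * x ^ 2 + x ^ 3) / (1 - x) ^ 5) has_field_derivative (1 + 26 * x + 66 * x ^ 2 + 26 * x ^ 3 + x ^ 4) / (1 - x) ^ Suc 5) (at x)"
      by (rule has_field_derivative_over_power[OF _ that]) (simp add: algebra_simps eval_nat_numeral)
    then have "((\<lambda>x. x * (1 + 11 * x + 11 * x ^ 2 + x ^ 3) / (1 - x) ^ 5) has_field_derivative (1 + 26 * x + 66 * x ^ 2 + 26 * x ^ 3 + x ^ 4) / (1 - x) ^ 6) (at x)"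
      by (simp add: eval_nat_numeral)
    from powser_closed_step[OF 4 that this] show ?thesis by (simp add: eval_nat_numeral)
  qed
  show "powser 3 x = x * (1 + 4 * x + x ^ 2) / (1 - x) ^ 4"
    "powser 5 x = x * (1 + 26 * x + 66 * x ^ 2 + 26 * x ^ 3 + x ^ 4) / (1 - x) ^ 6"
    using 3 5 assms by blast+
qed

section \<open>The cotangent expansion and its derivatives\<close>

lemma not_nonpos_Int: "Im z \<noteq> 0 \<Longrightarrow> z \<notin> \<int>\<^sub>\<le>\<^sub>0"
  by (auto elim!: nonpos_Ints_cases)

text \<open>The logarithmic derivative of \<open>Gamma z * Gamma (1 - z) = pi / sin (pi * z)\<close>
  is \<open>- pi * cot (pi * z)\<close>, a geometric series in \<open>q\<close> up to the constant
  \<open>pi * \<i>\<close>. Differentiation gives the other \<open>n\<close> and removes the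
  constant.\<close>

lemma Polygamma_reflection:
  assumes "Im z > 0"
  shows "Polygamma n z + (-1) ^ Suc n * Polygamma n (1 - z) =
    (2 * of_real pi * \<i>) ^ Suc n * powser n (qp 1 z) - (if n = 0 then of_real pi * \<i> else 0)"
  using assms
proof (induction n arbitrary: z)
  case 0
  let ?p = "of_real pi :: complex"
  have ni: "z \<notin> \<int>\<^sub>\<le>\<^sub>0" "1 - z \<notin> \<int>\<^sub>\<le>\<^sub>0" using 0 by (auto intro!: not_nonpos_Int)
  \<comment> \<open>Sine and cosine of \<open>pi * z\<close> are rational in \<open>E\<close>, and
    \<open>E * E\<close> is \<open>q\<close>.\<close>
  define E where "E = exp (\<i> * (?p * z))"
  have E0: "E \<noteq> 0" by (simp add: E_def)
  have E2: "E * E = qp 1 z" by (simp add: E_def qp_def exp_add[symmetric] algebra_simps)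
  have q1: "qp 1 z \<noteq> 1" using norm_qp1_less_1[OF 0] by auto
  have Em: "exp (- (\<i> * (?p * z))) = 1 / E" by (simp add: E_def exp_minus inverse_eq_divide)
  have sin: "sin (?p * z) = (E - 1 / E) / (2 * \<i>)" and cos: "cos (?p * z) = (E + 1 / E) / 2"
    by (simp_all only: sin_exp_eq cos_exp_eq Em E_def[symmetric])
  have s0: "sin (?p * z) \<noteq> 0" 
  proof
    assume "sin (?p * z) = 0"
    then have "E - 1 / E = 0" unfolding sin by simp
    then have "E * E = 1" using E0 by (simp add: field_simps)
    then show False using q1 E2 by simp
  qed
  have d1: "((\<lambda>z. Gamma z * Gamma (1 - z)) has_field_derivative
      Gamma z * Gamma (1 - z) * (Digamma z - Digamma (1 - z))) (at z)"
    using ni by (auto intro!: derivative_eq_intros simp: algebra_simps)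
  have d2: "((\<lambda>z. ?p / sin (?p * z)) has_field_derivative
      - (?p * (cos (?p * z) * ?p)) / (sin (?p * z))\<^sup>2) (at z)"
    using s0 by (auto intro!: derivative_eq_intros simp: power2_eq_square)
  have "((\<lambda>z. Gamma z * Gamma (1 - z)) has_field_derivative
      - (?p * (cos (?p * z) * ?p)) / (sin (?p * z))\<^sup>2) (at z)"
    using d2 by (simp only: Gamma_reflection_complex)
  then have "Gamma z * Gamma (1 - z) * (Digamma z - Digamma (1 - z)) = - (?p * (cos (?p * z) * ?p)) / (sin (?p * z))\<^sup>2"
    by (rule DERIV_unique[OF d1])
  then have eqD: "?p / sin (?p * z) * (Digamma z - Digamma (1 - z)) = - (?p * (cos (?p * z) * ?p)) / (sin (?p * z))\<^sup>2"
    by (simp only: Gamma_reflection_complex)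
  have aux: "X = - p * c / s" if "p / s * X = - (p * (c * p)) / s\<^sup>2" "s \<noteq> 0" "p \<noteq> 0" for X p s c :: complex
  proof -
    have "X = (s / p) * (p / s * X)" using that(2,3) by simp
    also have "\<dots> = - p * c / s" unfolding that(1) using that(2,3) by (simp add: power2_eq_square)
    finally show ?thesis .
  qed
  have "Digamma z - Digamma (1 - z) = - ?p * cos (?p * z) / sin (?p * z)"
    by (rule aux[OF eqD s0]) simp
  also have "\<dots> = - ?p * \<i> * (E * E + 1) / (E * E - 1)"
    unfolding sin cos using E0 E2 q1 by (simp add: field_simps)
  also have "\<dots> = 2 * ?p * \<i> * (1 / (1 - qp 1 z)) - ?p * \<i>"
    unfolding E2 using q1 by (simp add: divide_simps) (simp add: algebra_simps)
  also have "1 / (1 - qp 1 z) = powser 0 (qp 1 z)"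
    using powser_0 norm_qp1_less_1[OF 0] by simp
  finally show ?case by simp
next
  case (Suc n)
  have ni: "z \<notin> \<int>\<^sub>\<le>\<^sub>0" "1 - z \<notin> \<int>\<^sub>\<le>\<^sub>0" using Suc.prems by (auto intro!: not_nonpos_Int)
  have d1: "((\<lambda>z. Polygamma n z + (-1) ^ Suc n * Polygamma n (1 - z)) has_field_derivative
      Polygamma (Suc n) z + (-1) ^ Suc (Suc n) * Polygamma (Suc n) (1 - z)) (at z)"
    using ni by (auto intro!: derivative_eq_intros)
  obtain D where D: "(powser n has_field_derivative D) (at (qp 1 z))" "qp 1 z * D = powser (Suc n) (qp 1 z)"
    using powser_Suc_deriv[OF norm_qp1_less_1[OF Suc.prems]] by blast
  have d2: "((\<lambda>z. (2 * of_real pi * \<i>) ^ Suc n * powser n (qp 1 z) - (if n = 0 then of_real pi * \<i> else 0)) has_field_derivative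
      (2 * of_real pi * \<i>) ^ Suc (Suc n) * powser (Suc n) (qp 1 z)) (at z)"
    by (rule derivative_eq_intros DERIV_chain2[where f = "powser n" and g = "qp 1", OF D(1)] refl)+
       (simp add: D(2)[symmetric])
  have "eventually (\<lambda>z. z \<in> upper_half_plane) (nhds z)"
    using Suc.prems by (intro eventually_nhds_in_open) auto
  then have e: "eventually (\<lambda>z. Polygamma n z + (-1) ^ Suc n * Polygamma n (1 - z) =
     (2 * of_real pi * \<i>) ^ Suc n * powser n (qp 1 z) - (if n = 0 then of_real pi * \<i> else 0)) (nhds z)"
    by eventually_elim (use Suc.IH in auto)
  show ?case using DERIV_unique[OF d1 iffD2[OF DERIV_cong_ev[OF refl e refl] d2]] by simp
qed

text \<open>The sums over \<open>d \<ge> 0\<close> and \<open>d < 0\<close> are polygamma values at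
  \<open>z\<close> and \<open>1 - z\<close>. Odd \<open>n\<close> makes the exponent even, so both
  enter with the same sign and the reflection formula applies.\<close>

lemma Lipschitz_formula:
  assumes z: "Im z > 0" and n: "n > 0" "odd n"
    and s: "(\<lambda>d. 1 / (z + of_int d) ^ Suc n) summable_on UNIV"
  shows "(\<Sum>\<^sub>\<infinity>d. 1 / (z + of_int d) ^ Suc n) = (2 * of_real pi * \<i>) ^ Suc n / fact n * powser n (qp 1 z)"
proof -
  let ?f = "\<lambda>d::int. 1 / (z + of_int d) ^ Suc n"
  have z0: "z \<noteq> 0" "1 - z \<noteq> 0" using z by auto
  have "?f summable_on range int" "?f summable_on range (\<lambda>k. - int k - 1)"
    using s by (auto intro: summable_on_subset_banach)
  then have s1: "(\<lambda>k. ?f (int k)) summable_on UNIV" and s2: "(\<lambda>k. ?f (- int k - 1)) summable_on UNIV"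
    by (auto simp: summable_on_reindex inj_on_def o_def)
  have "(\<lambda>k. ?f (int k)) sums (Polygamma n z / fact n)"
    using Polygamma_LIMSEQ[OF z0(1) n(1)] n by (simp add: divide_inverse)
  then have 1: "(\<Sum>\<^sub>\<infinity>k. ?f (int k)) = Polygamma n z / fact n"
    using sums_unique2[OF has_sum_imp_sums[OF has_sum_infsum[OF s1]]] by simp
  have "(\<lambda>k. inverse ((1 - z + of_nat k) ^ Suc n)) sums (Polygamma n (1 - z) / fact n)"
    using Polygamma_LIMSEQ[OF z0(2) n(1)] n by simp
  moreover have "inverse ((1 - z + of_nat k) ^ Suc n) = ?f (- int k - 1)" for k
  proof -
    have "(1 - z + of_nat k) ^ Suc n = (- (1 - z + of_nat k)) ^ Suc n"
      by (rule power_minus_even[symmetric]) (use n in simp)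
    also have "- (1 - z + of_nat k) = z + of_int (- int k - 1)" by simp
    finally show ?thesis by (simp only: divide_inverse mult_1)
  qed
  ultimately have "(\<lambda>k. ?f (- int k - 1)) sums (Polygamma n (1 - z) / fact n)" by simp
  then have 2: "(\<Sum>\<^sub>\<infinity>k. ?f (- int k - 1)) = Polygamma n (1 - z) / fact n"
    using sums_unique2[OF has_sum_imp_sums[OF has_sum_infsum[OF s2]]] by simp
  have "infsum ?f UNIV = Polygamma n z / fact n + Polygamma n (1 - z) / fact n"
    unfolding summable_on_int(2)[OF s1 s2] 1 2 ..
  also have "\<dots> = (Polygamma n z + (-1) ^ Suc n * Polygamma n (1 - z)) / fact n"
    using n by (simp add: add_divide_distrib)
  finally show ?thesis using Polygamma_reflection[OF z, of n] n by simp
qed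

section \<open>The Eisenstein series of weights 4 and 6\<close>

lemma infsum_even_int:
  fixes f :: "int \<Rightarrow> complex"
  assumes "f summable_on UNIV - {0}" "\<And>d. f (- d) = f d"
  shows "infsum f (UNIV - {0}) = 2 * (\<Sum>\<^sub>\<infinity>k::nat. f (int k + 1))"
proof -
  have U: "UNIV - {0::int} = range (\<lambda>k. int k + 1) \<union> range (\<lambda>k. - (int k + 1))"
  proof -
    have "x \<in> range (\<lambda>k. int k + 1) \<union> range (\<lambda>k. - (int k + 1))" if "x \<noteq> 0" for x
    proof (cases "x > 0")
      case True
      then have "x = int (nat (x - 1)) + 1" by simp
      then show ?thesis by blast
    next
      case False
      then have "x = - (int (nat (- x - 1)) + 1)" using that by simp
      then show ?thesis by blast
    qed
    then show ?thesis by force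
  qed
  have disj: "range (\<lambda>k. int k + 1) \<inter> range (\<lambda>k. - (int k + 1)) = {}" by auto
  have s: "f summable_on range (\<lambda>k. int k + 1)" "f summable_on range (\<lambda>k. - (int k + 1))"
    using assms(1) unfolding U by (auto intro: summable_on_subset_banach)
  show ?thesis
    unfolding U infsum_Un_disjoint[OF s disj]
    by (simp add: infsum_reindex inj_on_def o_def assms(2) del: minus_add_distrib)
qed

text \<open>The generating series of the divisor sums \<open>\<sigma>_k\<close>, with the exponent
  left as a product \<open>(a + 1) * (b + 1)\<close>: the double series can be summed one index at a
  time and compared with a product of two simple series.\<close>

definition Lam :: "nat \<Rightarrow> complex \<Rightarrow> complex" where
  "Lam k q = (\<Sum>\<^sub>\<infinity>(a, b). of_nat (Suc b) ^ k * q ^ (Suc a * Suc b))"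

lemma Lam_term_bound:
  assumes "norm q \<le> r" "r < 1"
  shows "norm (of_nat (Suc b) ^ k * (q :: complex) ^ (Suc a * Suc b)) \<le> r ^ a * (of_nat (Suc b) ^ k * r ^ Suc b)"
proof -
  have r: "r \<ge> 0" using assms(1) norm_ge_zero order_trans by blast
  have "norm q ^ (Suc a * Suc b) \<le> r ^ (Suc a * Suc b)" using assms by (intro power_mono) auto
  also have "\<dots> \<le> r ^ (a + Suc b)" using assms r by (intro power_decreasing) auto
  finally have "norm q ^ (Suc a * Suc b) \<le> r ^ a * r ^ Suc b" by (simp only: power_add)
  then have "of_nat (Suc b) ^ k * norm q ^ (Suc a * Suc b) \<le> of_nat (Suc b) ^ k * (r ^ a * r ^ Suc b)"
    by (intro mult_left_mono) auto
  then show ?thesis by (simp add: norm_mult norm_power mult_ac del: of_nat_Suc power_Suc mult_Suc mult_Suc_right)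
qed

lemma Lam_majorant_summable:
  fixes r :: real
  assumes "0 \<le> r" "r < 1"
  shows "(\<lambda>(a, b). r ^ a * (of_nat (Suc b) ^ k * r ^ Suc b)) summable_on (UNIV :: (nat \<times> nat) set)"
proof -
  have "summable (\<lambda>b. real b ^ k * r ^ b)" using summable_powser[of r k] assms by simp
  then have "summable (\<lambda>b. real (Suc b) ^ k * r ^ Suc b)" by (subst summable_Suc_iff)
  then have 1: "(\<lambda>b. real (Suc b) ^ k * r ^ Suc b) summable_on UNIV"
    using assms by (subst summable_on_UNIV_nonneg_real_iff) auto
  have "summable (\<lambda>a. r ^ a)" using assms by simp
  then have "(\<lambda>a. r ^ a) summable_on UNIV"
    using assms by (subst summable_on_UNIV_nonneg_real_iff) auto
  then have "(\<lambda>(a, b). r ^ a * (of_nat (Suc b) ^ k * r ^ Suc b)) summable_on (UNIV \<times> UNIV)"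
    using 1 assms by (intro summable_on_product_real) auto
  then show ?thesis by simp
qed

lemma Lam_summable:
  fixes q :: complex
  assumes "norm q < 1"
  shows "(\<lambda>(a, b). of_nat (Suc b) ^ k * q ^ (Suc a * Suc b)) summable_on (UNIV :: (nat \<times> nat) set)"
proof (rule abs_summable_summable)
  have M: "(\<lambda>(a, b). norm q ^ a * (of_nat (Suc b) ^ k * norm q ^ Suc b)) summable_on (UNIV :: (nat \<times> nat) set)"
    by (rule Lam_majorant_summable) (use assms in auto)
  show "(\<lambda>p. norm (case p of (a, b) \<Rightarrow> of_nat (Suc b) ^ k * q ^ (Suc a * Suc b))) summable_on (UNIV :: (nat \<times> nat) set)"
  proof (rule summable_on_comparison_test[OF M])
    show "norm (case p of (a, b) \<Rightarrow> of_nat (Suc b) ^ k * q ^ (Suc a * Suc b)) \<le>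
       (case p of (a, b) \<Rightarrow> norm q ^ a * (of_nat (Suc b) ^ k * norm q ^ Suc b))" for p
      using Lam_term_bound[OF order_refl assms] by (cases p) (simp only: prod.case)
  qed auto
qed

lemma holomorphic_Lam: "Lam k holomorphic_on ball 0 1"
proof -
  have "(\<lambda>q. \<Sum>\<^sub>\<infinity>p\<in>UNIV. (case p of (a, b) \<Rightarrow> of_nat (Suc b) ^ k * q ^ (Suc a * Suc b))) holomorphic_on ball 0 1"
  proof (rule holomorphic_infsum)
    show "(\<lambda>q. case p of (a, b) \<Rightarrow> of_nat (Suc b) ^ k * q ^ (Suc a * Suc b)) holomorphic_on ball 0 1" for p :: "nat \<times> nat"
      by (cases p) (auto intro!: holomorphic_intros simp del: mult_Suc mult_Suc_right of_nat_Suc)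
    fix z :: complex assume z: "z \<in> ball 0 1"
    define r where "r = (1 - norm z) / 2"
    define R where "R = norm z + r"
    have r: "r > 0" "0 \<le> R" "R < 1" using z by (auto simp: r_def R_def field_simps)
    have "norm w \<le> R" if "w \<in> cball z r" for w
      using that norm_triangle_ineq2[of w z] by (simp add: R_def dist_norm norm_minus_commute)
    then have "\<forall>p\<in>UNIV. \<forall>w\<in>cball z r. norm (case p of (a, b) \<Rightarrow> of_nat (Suc b) ^ k * w ^ (Suc a * Suc b))
      \<le> (case p of (a, b) \<Rightarrow> R ^ a * (of_nat (Suc b) ^ k * R ^ Suc b))"
      using Lam_term_bound[OF _ r(3)] by (auto simp del: mult_Suc mult_Suc_right of_nat_Suc power_Suc)
    moreover have "cball z r \<subseteq> ball 0 1"
      using \<open>\<And>w. w \<in> cball z r \<Longrightarrow> norm w \<le> R\<close> r(3) by fastforce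
    ultimately show "\<exists>r>0. \<exists>M. M summable_on UNIV \<and> cball z r \<subseteq> ball 0 1 \<and>
        (\<forall>p\<in>UNIV. \<forall>w\<in>cball z r. norm (case p of (a, b) \<Rightarrow> of_nat (Suc b) ^ k * w ^ (Suc a * Suc b)) \<le> M p)"
      using r Lam_majorant_summable[OF r(2,3), of k] by blast
  qed auto
  then show ?thesis by (simp add: Lam_def[abs_def])
qed

section \<open>The Lambert series near 0\<close>

lemma Lam_0 [simp]: "Lam k 0 = 0"
proof -
  have "Lam k 0 = (\<Sum>\<^sub>\<infinity>p::nat \<times> nat. 0)"
    unfolding Lam_def by (rule infsum_cong) auto
  then show ?thesis by simp
qed

text \<open>The term at \<open>(0, 0)\<close> is the leading one, and
  \<open>1 / ((1 - s) * (1 - t)) - 1\<close> is the sum of all other products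
  \<open>s ^ a * t ^ b\<close>.\<close>

lemma infsum_two_geometric_tail:
  fixes f :: "nat \<times> nat \<Rightarrow> complex"
  assumes st: "0 \<le> s" "s < 1" "0 \<le> t" "t < 1"
    and f: "\<And>a b. norm (f (a, b)) \<le> C * (s ^ a * t ^ b)"
  shows "norm (infsum f UNIV - f (0, 0)) \<le> C * (1 / ((1 - s) * (1 - t)) - 1)"
proof -
  have g: "((\<lambda>n. x ^ n) has_sum (1 / (1 - x))) UNIV" if "0 \<le> x" "x < 1" for x :: real
    using that by (intro sums_nonneg_imp_has_sum geometric_sums) auto
  have "((\<lambda>(a, b). s ^ a * t ^ b) has_sum (1 / (1 - s) * (1 / (1 - t)))) (UNIV \<times> UNIV)"
    using st by (intro has_sum_product_real g) auto
  then have G: "((\<lambda>p. C * (case p of (a, b) \<Rightarrow> s ^ a * t ^ b)) has_sum C * (1 / (1 - s) * (1 / (1 - t)))) UNIV"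
    by (intro has_sum_cmult_right) simp
  have "f summable_on UNIV"
    by (rule abs_summable_summable, rule summable_on_comparison_test[OF has_sum_imp_summable[OF G]])
       (use f in auto)
  then have F: "(f has_sum infsum f UNIV) UNIV" by simp
  have F': "(f has_sum infsum f UNIV - f (0, 0)) (UNIV - {(0, 0)})"
    using has_sum_Diff[OF F has_sum_finite[of "{(0, 0)}" f]] by simp
  have "((\<lambda>p. C * (case p of (a, b) \<Rightarrow> s ^ a * t ^ b)) has_sum C * (1 / (1 - s) * (1 / (1 - t))) - C) (UNIV - {(0, 0)})"
    using has_sum_Diff[OF G has_sum_finite[of "{(0, 0)}"]] by simp
  from norm_infsum_le[OF F' this] f
  have "norm (infsum f UNIV - f (0, 0)) \<le> C * (1 / (1 - s) * (1 / (1 - t))) - C" by auto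
  then show ?thesis by (simp add: algebra_simps)
qed

lemma Suc_power_le: "real (Suc b) ^ k \<le> (2 ^ k) ^ b"
proof -
  have "Suc b \<le> 2 ^ b" by (induction b) auto
  then have "real (Suc b) \<le> 2 ^ b" by (metis of_nat_le_iff of_nat_numeral of_nat_power)
  then have "real (Suc b) ^ k \<le> (2 ^ b) ^ k" by (intro power_mono) auto
  then show ?thesis by (simp add: power_mult[symmetric] mult.commute)
qed

text \<open>One factor \<open>q\<close> is split off; the remaining exponent
  \<open>(a + 1) * (b + 1) - 1\<close> is at least \<open>a + b\<close>, and
  \<open>(b + 1) ^ k \<le> (2 ^ k) ^ b\<close> turns the bound into two geometric series.\<close>

lemma Lam_near:
  assumes q: "norm q \<le> r" and r: "2 ^ k * r < 1" "r < 1"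
  shows "norm (Lam k q - q) \<le> norm q * (1 / ((1 - r) * (1 - 2 ^ k * r)) - 1)"
proof -
  have r0: "r \<ge> 0" using q norm_ge_zero order_trans by blast
  have "norm (infsum (\<lambda>(a, b). of_nat (Suc b) ^ k * q ^ (Suc a * Suc b)) UNIV - (case (0, 0) of (a, b) \<Rightarrow> of_nat (Suc b) ^ k * q ^ (Suc a * Suc b)))
     \<le> norm q * (1 / ((1 - r) * (1 - 2 ^ k * r)) - 1)"
  proof (rule infsum_two_geometric_tail)
    fix a b
    have "norm q ^ (Suc a * Suc b) = norm q * norm q ^ (Suc a * Suc b - 1)" by simp
    also have "\<dots> \<le> norm q * r ^ (Suc a * Suc b - 1)" using q by (intro mult_left_mono power_mono) auto
    also have "\<dots> \<le> norm q * r ^ (a + b)" using r r0 by (intro mult_left_mono power_decreasing) auto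
    finally have 1: "norm q ^ (Suc a * Suc b) \<le> norm q * r ^ (a + b)" .
    have "real (Suc b) ^ k * norm q ^ (Suc a * Suc b) \<le> (2 ^ k) ^ b * (norm q * r ^ (a + b))"
      using r0 by (intro mult_mono Suc_power_le 1) auto
    also have "\<dots> = norm q * (r ^ a * (2 ^ k * r) ^ b)" by (simp add: power_add power_mult_distrib)
    finally show "norm (case (a, b) of (a, b) \<Rightarrow> of_nat (Suc b) ^ k * q ^ (Suc a * Suc b)) \<le> norm q * (r ^ a * (2 ^ k * r) ^ b)"
      by (simp add: norm_mult norm_power del: of_nat_Suc mult_Suc mult_Suc_right)
  qed (use r r0 in auto)
  then show ?thesis by (simp add: Lam_def)
qed

text \<open>Closeness to the identity in the Lipschitz sense, which gives injectivity and a nonzero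
  derivative. The factor \<open>N\<close> from a difference of \<open>N\<close>-th powers is
  absorbed by doubling both geometric ratios.\<close>

lemma Lam_lipschitz:
  assumes x: "norm x \<le> r" and y: "norm y \<le> r" and r: "r > 0" "2 ^ Suc k * r < 1" "2 * r < 1"
  shows "norm (Lam k x - Lam k y - (x - y)) \<le> norm (x - y) * (1 / ((1 - 2 * r) * (1 - 2 ^ Suc k * r)) - 1)"
proof -
  let ?t = "\<lambda>q. \<lambda>(a, b). of_nat (Suc b) ^ k * (q :: complex) ^ (Suc a * Suc b)"
  have n1: "norm x < 1" "norm y < 1" using x y r by auto
  have "norm (infsum (\<lambda>p. ?t x p - ?t y p) UNIV - (?t x (0, 0) - ?t y (0, 0)))
     \<le> norm (x - y) * (1 / ((1 - 2 * r) * (1 - 2 ^ Suc k * r)) - 1)"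
  proof (rule infsum_two_geometric_tail)
    fix a b
    define N where "N = Suc a * Suc b"
    have N: "a + b \<le> N - 1" "N > 0" by (simp_all add: N_def)
    \<comment> \<open>Scaling to the closed unit disc, where \<open>norm_power_diff\<close>
      applies.\<close>
    define u v where "u = x / of_real r" and "v = y / of_real r"
    have uv: "norm u \<le> 1" "norm v \<le> 1" "x = of_real r * u" "y = of_real r * v"
      using x y r by (auto simp: u_def v_def norm_divide)
    have "norm (x ^ N - y ^ N) = r ^ N * norm (u ^ N - v ^ N)"
      using r by (simp add: uv(3,4) power_mult_distrib right_diff_distrib[symmetric] norm_mult norm_power)
    also have "\<dots> \<le> r ^ N * (real N * norm (u - v))"
      using r uv by (intro mult_left_mono norm_power_diff) auto
    also have "\<dots> = real N * (r ^ (N - 1) * norm (x - y))"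
      using N r by (cases N) (auto simp: uv(3,4) right_diff_distrib[symmetric] norm_mult)
    also have "\<dots> \<le> real N * (r ^ (a + b) * norm (x - y))"
      using r N by (intro mult_left_mono mult_right_mono power_decreasing) auto
    finally have 1: "norm (x ^ N - y ^ N) \<le> real (Suc a) * real (Suc b) * (r ^ (a + b) * norm (x - y))"
      by (simp only: N_def of_nat_mult)
    have "real (Suc b) ^ k * norm (x ^ N - y ^ N) \<le> real (Suc b) ^ k * (real (Suc a) * real (Suc b) * (r ^ (a + b) * norm (x - y)))"
      by (intro mult_left_mono 1) auto
    also have "\<dots> = (real (Suc a) ^ 1 * real (Suc b) ^ Suc k) * (r ^ (a + b) * norm (x - y))" by simp
    also have "\<dots> \<le> ((2 ^ 1) ^ a * (2 ^ Suc k) ^ b) * (r ^ (a + b) * norm (x - y))"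
      using r by (intro mult_right_mono mult_mono Suc_power_le) auto
    also have "\<dots> = norm (x - y) * ((2 * r) ^ a * (2 ^ Suc k * r) ^ b)"
      by (simp add: power_add power_mult_distrib)
    finally show "norm (?t x (a, b) - ?t y (a, b)) \<le> norm (x - y) * ((2 * r) ^ a * (2 ^ Suc k * r) ^ b)"
      by (simp add: right_diff_distrib[symmetric] norm_mult norm_power N_def del: of_nat_Suc mult_Suc mult_Suc_right)
  qed (use r in auto)
  moreover have "infsum (\<lambda>p. ?t x p - ?t y p) UNIV = Lam k x - Lam k y"
  proof -
    have "infsum (\<lambda>p. ?t x p + - ?t y p) UNIV = infsum (?t x) UNIV + infsum (\<lambda>p. - ?t y p) UNIV"
      by (intro infsum_add Lam_summable n1 summable_on_uminus[THEN iffD2])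
    then show ?thesis by (simp add: Lam_def infsum_uminus)
  qed
  ultimately show ?thesis by simp
qed

section \<open>Fourier expansion of the Eisenstein series\<close>

lemma Lam_Lambert:
  assumes "norm q < 1" "k > 0"
  shows "(\<Sum>\<^sub>\<infinity>a. powser k (q ^ Suc a)) = Lam k q"
proof -
  have "powser k y = (\<Sum>\<^sub>\<infinity>b. of_nat (Suc b) ^ k * y ^ Suc b)" if y: "norm y < 1" for y
  proof -
    have s: "summable (\<lambda>b. norm (of_nat (Suc b) ^ k * y ^ Suc b))"
      using summable_powser[of "norm y" k] y
      by (subst summable_Suc_iff) (simp add: norm_mult norm_power)
    have "(\<lambda>b. of_nat (Suc b) ^ k * y ^ Suc b) sums powser k y"
      unfolding powser_def using suminf_split_head[OF summable_powser[OF y, of k]] \<open>k > 0\<close>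
        summable_sums[OF summable_norm_cancel[OF s]] by (simp add: power_0_left)
    from norm_summable_imp_has_sum[OF s this] show ?thesis by (rule infsumI[symmetric])
  qed
  moreover have "norm (q ^ Suc a) < 1" for a
    using assms(1) power_Suc_less_one[of "norm q"] by (cases "q = 0") (auto simp: norm_power simp del: power_Suc)
  ultimately have "(\<Sum>\<^sub>\<infinity>a. powser k (q ^ Suc a)) = (\<Sum>\<^sub>\<infinity>a. \<Sum>\<^sub>\<infinity>b. of_nat (Suc b) ^ k * (q ^ Suc a) ^ Suc b)"
    by simp
  also have "\<dots> = (\<Sum>\<^sub>\<infinity>a. \<Sum>\<^sub>\<infinity>b. (case (a, b) of (a, b) \<Rightarrow> of_nat (Suc b) ^ k * q ^ (Suc a * Suc b)))"
    by (simp only: power_mult prod.case)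
  also have "\<dots> = Lam k q"
    unfolding Lam_def using infsum_Sigma_banach[of "\<lambda>(a, b). of_nat (Suc b) ^ k * q ^ (Suc a * Suc b)" UNIV "\<lambda>_. UNIV"]
      Lam_summable[OF assms(1), of k] by simp
  finally show ?thesis .
qed

text \<open>The rows with \<open>c = 0\<close> give the constant term, twice the zeta value at
  \<open>n + 1\<close> written with a polygamma value. Rows with \<open>c > 0\<close> give Lipschitz
  sums at the points \<open>c z\<close>, and rows with \<open>c < 0\<close> repeat them because the
  exponent is even.\<close>

lemma eis_expansion:
  assumes z: "Im z > 0" and n: "n \<ge> 3" "odd n"
  shows "eis (Suc n) z = 2 * (Polygamma n 1 / fact n) + 2 * ((2 * of_real pi * \<i>) ^ Suc n / fact n) * Lam n (qp 1 z)"
proof -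
  let ?f = "\<lambda>(c, d). 1 / (of_int c * z + of_int d) ^ Suc n"
  let ?K = "(2 * of_real pi * \<i>) ^ Suc n / fact n"
  have s: "?f summable_on UNIV - {(0, 0)}"
    by (rule abs_summable_summable[OF eis_abs_summable[OF z]]) (use n in simp)
  define X0 Xp Xm :: "(int \<times> int) set" where "X0 = Pair 0 ` (UNIV - {0})"
    and "Xp = (\<lambda>(a, d). (int a + 1, d)) ` UNIV" and "Xm = (\<lambda>(a, d). (- (int a + 1), - d)) ` UNIV"
  have U: "UNIV - {(0, 0)} = (X0 \<union> Xp) \<union> Xm"
  proof -
    have "(c, d) \<in> (X0 \<union> Xp) \<union> Xm" if "(c, d) \<noteq> (0, 0)" for c d :: int
    proof -
      consider "c = 0" | "c > 0" | "c < 0" by linarith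
      then show ?thesis
      proof cases
        case 1
        then show ?thesis using that by (auto simp: X0_def)
      next
        case 2
        then have "(c, d) = (\<lambda>(a, d). (int a + 1, d)) (nat (c - 1), d)" by simp
        then show ?thesis unfolding Xp_def by blast
      next
        case 3
        then have "(c, d) = (\<lambda>(a, d). (- (int a + 1), - d)) (nat (- c - 1), - d)" by simp
        then show ?thesis unfolding Xm_def by blast
      qed
    qed
    moreover have "(0, 0) \<notin> (X0 \<union> Xp) \<union> Xm" by (auto simp: X0_def Xp_def Xm_def)
    ultimately show ?thesis by auto
  qed
  have d: "X0 \<inter> Xp = {}" "(X0 \<union> Xp) \<inter> Xm = {}" by (auto simp: X0_def Xp_def Xm_def)
  have ss: "?f summable_on X0" "?f summable_on Xp" "?f summable_on X0 \<union> Xp" "?f summable_on Xm"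
    using s unfolding U by (auto intro: summable_on_subset_banach)
  have split: "eis (Suc n) z = infsum ?f X0 + infsum ?f Xp + infsum ?f Xm"
    unfolding eis_def U infsum_Un_disjoint[OF ss(3,4) d(2)] infsum_Un_disjoint[OF ss(1,2) d(1)] ..
  have i0: "inj_on (Pair 0) (UNIV - {0::int})" by (auto simp: inj_on_def)
  have ip: "inj_on (\<lambda>(a, d). (int a + 1, d)) (UNIV :: (nat \<times> int) set)" by (auto simp: inj_on_def)
  have im: "inj_on (\<lambda>(a, d). (- (int a + 1), - d)) (UNIV :: (nat \<times> int) set)" by (auto simp: inj_on_def)
  have X0: "infsum ?f X0 = 2 * (Polygamma n 1 / fact n)"
  proof -
    have 1: "(\<lambda>d::int. 1 / (of_int d :: complex) ^ Suc n) summable_on UNIV - {0}"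
      using ss(1) unfolding X0_def summable_on_reindex[OF i0] by (simp add: o_def)
    have "infsum ?f X0 = (\<Sum>\<^sub>\<infinity>d\<in>UNIV - {0}. 1 / (of_int d :: complex) ^ Suc n)"
      unfolding X0_def infsum_reindex[OF i0] by (simp add: o_def)
    also have "\<dots> = 2 * (\<Sum>\<^sub>\<infinity>k::nat. 1 / (of_int (int k + 1) :: complex) ^ Suc n)"
    proof (rule infsum_even_int[OF 1])
      fix d :: int
      have "(of_int (- d) :: complex) ^ Suc n = of_int d ^ Suc n"
        using n power_minus_even[of "Suc n" "of_int d :: complex"] by simp
      then show "1 / (of_int (- d) :: complex) ^ Suc n = 1 / of_int d ^ Suc n" by (simp only:)
    qed
    also have "(\<Sum>\<^sub>\<infinity>k::nat. 1 / (of_int (int k + 1) :: complex) ^ Suc n) = Polygamma n 1 / fact n"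
    proof -
      have "summable (\<lambda>k. inverse (of_nat k ^ Suc n :: real))" by (rule inverse_power_summable) (use n in auto)
      then have "summable (\<lambda>k. inverse (of_nat (Suc k) ^ Suc n :: real))" by (subst summable_Suc_iff)
      then have sn: "summable (\<lambda>k. norm (1 / (of_int (int k + 1) :: complex) ^ Suc n))"
      proof -
        have "norm (1 / (of_int (int k + 1) :: complex) ^ Suc n) = inverse (of_nat (Suc k) ^ Suc n)" for k
        proof -
          have "(of_int (int k + 1) :: complex) = of_nat (Suc k)" by simp
          then show ?thesis by (simp only: norm_divide norm_power norm_of_nat norm_one norm_inverse divide_inverse mult_1)
        qed
        then show "summable (\<lambda>k. inverse (of_nat (Suc k) ^ Suc n :: real)) \<Longrightarrow> ?thesis" by (simp only:)
      qed
      have "(\<lambda>k. 1 / (of_int (int k + 1) :: complex) ^ Suc n) sums (Polygamma n 1 / fact n)"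
        using Polygamma_LIMSEQ[of "1::complex" n] n by (simp add: divide_inverse add.commute)
      from norm_summable_imp_has_sum[OF sn this] show ?thesis by (rule infsumI)
    qed
    finally show ?thesis .
  qed
  have Xp: "infsum ?f Xp = ?K * Lam n (qp 1 z)"
  proof -
    have 1: "(\<lambda>(a, d). 1 / (of_int (int a + 1) * z + of_int d) ^ Suc n) summable_on (UNIV \<times> UNIV :: (nat \<times> int) set)"
      using ss(2) unfolding Xp_def summable_on_reindex[OF ip] by (simp add: o_def case_prod_beta')
    have "infsum ?f Xp = infsum (\<lambda>(a, d). 1 / (of_int (int a + 1) * z + of_int d) ^ Suc n) (UNIV \<times> UNIV :: (nat \<times> int) set)"
      unfolding Xp_def infsum_reindex[OF ip] by (simp add: o_def case_prod_beta')
    also have "\<dots> = (\<Sum>\<^sub>\<infinity>a. \<Sum>\<^sub>\<infinity>d. 1 / (of_int (int a + 1) * z + of_int d) ^ Suc n)"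
      using infsum_Sigma_banach[OF 1] by simp
    also have "\<dots> = (\<Sum>\<^sub>\<infinity>a. ?K * powser n (qp 1 z ^ Suc a))"
    proof (rule infsum_cong)
      fix a :: nat
      define w where "w = of_int (int a + 1) * z"
      have w: "Im w > 0" using z by (simp add: w_def)
      have q: "qp 1 w = qp 1 z ^ Suc a"
        unfolding qp_def w_def exp_of_nat_mult[symmetric] by (simp add: algebra_simps)
      have sm: "(\<lambda>d. 1 / (w + of_int d) ^ Suc n) summable_on UNIV"
        using summable_on_Sigma_banach[OF 1] summable_on_SigmaD1[of _ UNIV "\<lambda>_. UNIV" a] 1 by (simp add: w_def)
      have "(\<Sum>\<^sub>\<infinity>d. 1 / (w + of_int d) ^ Suc n) = ?K * powser n (qp 1 w)"
        by (rule Lipschitz_formula[OF w _ n(2) sm]) (use n in simp)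
      then show "(\<Sum>\<^sub>\<infinity>d. 1 / (of_int (int a + 1) * z + of_int d) ^ Suc n) = ?K * powser n (qp 1 z ^ Suc a)"
        unfolding q unfolding w_def .
    qed
    also have "\<dots> = ?K * Lam n (qp 1 z)"
      using Lam_Lambert[OF norm_qp1_less_1[OF z], of n] n by (simp only: infsum_cmult_right')
    finally show ?thesis .
  qed
  have Xm: "infsum ?f Xm = infsum ?f Xp"
  proof -
    have "1 / (of_int (- (int a + 1)) * z + of_int (- d)) ^ Suc n = 1 / (of_int (int a + 1) * z + of_int d) ^ Suc n" for a d
    proof -
      have "(of_int (- (int a + 1)) * z + of_int (- d)) ^ Suc n = (- (of_int (int a + 1) * z + of_int d)) ^ Suc n"
        by (rule arg_cong[where f = "\<lambda>x. x ^ Suc n"]) (simp add: algebra_simps)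
      also have "\<dots> = (of_int (int a + 1) * z + of_int d) ^ Suc n"
        by (rule power_minus_even) (use n in simp)
      finally show ?thesis by (simp only:)
    qed
    then show ?thesis
      unfolding Xm_def Xp_def infsum_reindex[OF ip] infsum_reindex[OF im]
      by (intro infsum_cong) (simp only: o_def case_prod_beta' fst_conv snd_conv)
  qed
  show ?thesis unfolding split X0 Xm Xp by (simp add: algebra_simps)
qed

text \<open>A way to zeta values without Bernoulli numbers: for \<open>w = \<i> * y\<close>,
  reflection and recurrence express \<open>Polygamma n (1 + w) + Polygamma n (1 - w)\<close> as a
  multiple of \<open>powser n\<close> minus the pole \<open>fact n / w ^ Suc n\<close>, and then
  \<open>y\<close> tends to 0. A closed form of \<open>powser n\<close> leaves a limit of real
  functions.\<close>

lemma Polygamma_1_limit: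
  assumes n: "odd n"
    and lim: "(g \<longlongrightarrow> L) (at_right 0)"
    and g: "\<And>y. y > 0 \<Longrightarrow> complex_of_real (g y) = (2 * of_real pi * \<i>) ^ Suc n * powser n (of_real (exp (- (2 * pi * y)))) - fact n / (\<i> * of_real y) ^ Suc n"
  shows "2 * Polygamma n (1 :: complex) = of_real L"
proof -
  have ev: "\<forall>\<^sub>F y in at_right 0. complex_of_real (g y) = Polygamma n (1 + \<i> * of_real y) + Polygamma n (1 - \<i> * of_real y)"
    unfolding eventually_at_right_field
  proof (intro exI[of _ 1] conjI allI impI)
    fix y :: real assume y: "0 < y" "y < 1"
    define w where "w = \<i> * complex_of_real y"
    have w: "Im w > 0" "w \<noteq> 0" using y by (auto simp: w_def)
    have q: "qp 1 w = of_real (exp (- (2 * pi * y)))"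
      by (simp add: qp_def w_def exp_of_real[symmetric] algebra_simps)
    have "n \<noteq> 0" using n by (auto intro: ccontr)
    then have 1: "Polygamma n w + Polygamma n (1 - w) = (2 * of_real pi * \<i>) ^ Suc n * powser n (of_real (exp (- (2 * pi * y))))"
      using Polygamma_reflection[OF w(1), of n] n unfolding q by simp
    have 2: "Polygamma n (1 + w) = Polygamma n w - fact n / w ^ Suc n"
      using Polygamma_plus1[OF w(2), of n] n by (simp add: add.commute)
    show "complex_of_real (g y) = Polygamma n (1 + \<i> * of_real y) + Polygamma n (1 - \<i> * of_real y)"
      unfolding g[OF y(1)] w_def[symmetric] 1[symmetric] 2 by simp
  qed auto
  have c: "isCont (Polygamma n) (1 :: complex)" by (intro isCont_Polygamma continuous_ident) (auto elim!: nonpos_Ints_cases simp: complex_eq_iff)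
  have a: "((\<lambda>y. 1 + \<i> * complex_of_real y) \<longlongrightarrow> 1 + \<i> * of_real 0) (at_right 0)"
    and b: "((\<lambda>y. 1 - \<i> * complex_of_real y) \<longlongrightarrow> 1 - \<i> * of_real 0) (at_right 0)"
    by (intro tendsto_intros)+
  have "((\<lambda>y. Polygamma n (1 + \<i> * complex_of_real y) + Polygamma n (1 - \<i> * of_real y)) \<longlongrightarrow> Polygamma n 1 + Polygamma n 1) (at_right 0)"
    using a b by (intro tendsto_add isCont_tendsto_compose[OF c]) simp_all
  moreover have "((\<lambda>y. complex_of_real (g y)) \<longlongrightarrow> of_real L) (at_right 0)" by (intro tendsto_of_real lim)
  then have "((\<lambda>y. Polygamma n (1 + \<i> * complex_of_real y) + Polygamma n (1 - \<i> * of_real y)) \<longlongrightarrow> of_real L) (at_right 0)"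
    by (rule Lim_transform_eventually[OF _ ev])
  ultimately have "Polygamma n 1 + Polygamma n 1 = (of_real L :: complex)"
    using tendsto_unique[OF trivial_limit_at_right_real] by blast
  then show ?thesis by simp
qed

lemma filterlim_scale_at_right_0: "c > 0 \<Longrightarrow> filterlim (\<lambda>y::real. c * y) (at_right 0) (at_right 0)"
  unfolding filterlim_at
  by (auto intro!: tendsto_eq_intros simp: eventually_at_right_field intro: exI[of _ 1])

lemma i_power: "\<i> ^ 4 = 1" "\<i> ^ 6 = -1"
  by (simp_all add: eval_nat_numeral)

text \<open>The number 1/120 is the zeta value at -3, the limit of
  \<open>\<Sum> n ^ 3 * exp (- n * t) - 6 / t ^ 4\<close> for \<open>t\<close> tending to 0;
  \<open>16 * pi ^ 4\<close> is \<open>(2 * pi * \<i>) ^ 4\<close>. The result amounts to the zeta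
  value \<open>pi ^ 4 / 90\<close> at 4.\<close>

lemma Polygamma_3_1: "2 * Polygamma 3 (1 :: complex) = of_real (16 * pi ^ 4 * (1 / 120))"
proof (rule Polygamma_1_limit)
  let ?h = "\<lambda>t::real. exp (-t) * (1 + 4 * exp (-t) + exp (-t) ^ 2) / (1 - exp (-t)) ^ 4 - 6 / t ^ 4"
  have "(?h \<longlongrightarrow> 1 / 120) (at_right 0)" by real_asymp
  then have "((\<lambda>y. ?h (2 * pi * y)) \<longlongrightarrow> 1 / 120) (at_right 0)"
    by (rule filterlim_compose) (intro filterlim_scale_at_right_0, simp)
  then show "((\<lambda>y. 16 * pi ^ 4 * ?h (2 * pi * y)) \<longlongrightarrow> 16 * pi ^ 4 * (1 / 120)) (at_right 0)"
    by (rule tendsto_mult_left)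
  fix y :: real assume y: "y > 0"
  let ?x = "exp (- (2 * pi * y))"
  have x: "norm (complex_of_real ?x) < 1" using y by simp
  have r: "16 * pi ^ 4 * ?h (2 * pi * y) = 16 * pi ^ 4 * (?x * (1 + 4 * ?x + ?x ^ 2) / (1 - ?x) ^ 4) - 6 / y ^ 4"
    using y by (simp add: right_diff_distrib power_mult_distrib)
  have 1: "(2 * of_real pi * \<i>) ^ Suc 3 = complex_of_real ((16 * pi ^ 4))" "(\<i> * of_real y) ^ Suc 3 = complex_of_real ((y ^ 4))"
    by (simp_all add: power_mult_distrib i_power)
  have 2: "powser 3 (complex_of_real ?x) = complex_of_real (?x * (1 + 4 * ?x + ?x ^ 2) / (1 - ?x) ^ 4)"
    unfolding powser_3[OF x] by (simp only: of_real_add of_real_mult of_real_diff of_real_divide of_real_power of_real_1 of_real_numeral)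
  have 3: "(fact 3 :: complex) = complex_of_real 6" by (simp add: fact_numeral)
  show "complex_of_real (16 * pi ^ 4 * ?h (2 * pi * y)) =
     (2 * of_real pi * \<i>) ^ Suc 3 * powser 3 (of_real ?x) - fact 3 / (\<i> * of_real y) ^ Suc 3"
    unfolding r 1 2 3 of_real_mult[symmetric] of_real_divide[symmetric] of_real_diff[symmetric] of_real_eq_iff by simp
qed simp

text \<open>Here \<open>\<i> ^ 6 = -1\<close> reverses the sign, so the limit is minus the zeta
  value at -5, that is 1/252.\<close>

lemma Polygamma_5_1: "2 * Polygamma 5 (1 :: complex) = of_real (64 * pi ^ 6 * (1 / 252))"
proof (rule Polygamma_1_limit)
  let ?h = "\<lambda>t::real. 120 / t ^ 6 - exp (-t) * (1 + 26 * exp (-t) + 66 * exp (-t) ^ 2 + 26 * exp (-t) ^ 3 + exp (-t) ^ 4) / (1 - exp (-t)) ^ 6"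
  have "(?h \<longlongrightarrow> 1 / 252) (at_right 0)" by real_asymp
  then have "((\<lambda>y. ?h (2 * pi * y)) \<longlongrightarrow> 1 / 252) (at_right 0)"
    by (rule filterlim_compose) (intro filterlim_scale_at_right_0, simp)
  then show "((\<lambda>y. 64 * pi ^ 6 * ?h (2 * pi * y)) \<longlongrightarrow> 64 * pi ^ 6 * (1 / 252)) (at_right 0)"
    by (rule tendsto_mult_left)
  fix y :: real assume y: "y > 0"
  let ?x = "exp (- (2 * pi * y))"
  have x: "norm (complex_of_real ?x) < 1" using y by simp
  have r: "64 * pi ^ 6 * ?h (2 * pi * y) = 120 / y ^ 6 - 64 * pi ^ 6 * (?x * (1 + 26 * ?x + 66 * ?x ^ 2 + 26 * ?x ^ 3 + ?x ^ 4) / (1 - ?x) ^ 6)"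
    using y by (simp add: right_diff_distrib power_mult_distrib)
  have 1: "(2 * of_real pi * \<i>) ^ Suc 5 = complex_of_real (- (64 * pi ^ 6))" "(\<i> * of_real y) ^ Suc 5 = complex_of_real (- (y ^ 6))"
    by (simp_all add: power_mult_distrib i_power)
  have 2: "powser 5 (complex_of_real ?x) = complex_of_real (?x * (1 + 26 * ?x + 66 * ?x ^ 2 + 26 * ?x ^ 3 + ?x ^ 4) / (1 - ?x) ^ 6)"
    unfolding powser_5[OF x] by (simp only: of_real_add of_real_mult of_real_diff of_real_divide of_real_power of_real_1 of_real_numeral)
  have 3: "(fact 5 :: complex) = complex_of_real 120" by (simp add: fact_numeral)
  show "complex_of_real (64 * pi ^ 6 * ?h (2 * pi * y)) =
     (2 * of_real pi * \<i>) ^ Suc 5 * powser 5 (of_real ?x) - fact 5 / (\<i> * of_real y) ^ Suc 5"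
    unfolding r 1 2 3 of_real_mult[symmetric] of_real_divide[symmetric] of_real_diff[symmetric] of_real_eq_iff by simp
qed simp

text \<open>The coefficients 240 and -504 are \<open>- 2 * k / B_k\<close> with Bernoulli numbers
  \<open>B_4 = - 1 / 30\<close> and \<open>B_6 = 1 / 42\<close>. Defined by their expansions, the
  series inherit modularity from the lattice sums through \<open>eis_4\<close> and
  \<open>eis_6\<close>.\<close>

definition E4 :: "complex \<Rightarrow> complex" where "E4 z = 1 + 240 * Lam 3 (qp 1 z)"
definition E6 :: "complex \<Rightarrow> complex" where "E6 z = 1 - 504 * Lam 5 (qp 1 z)"

lemma eis_4: "Im z > 0 \<Longrightarrow> eis 4 z = of_real (pi ^ 4 / 45) * E4 z"
proof -
  assume z: "Im z > 0"
  have P: "Polygamma 3 (1 :: complex) = of_real (16 * pi ^ 4 * (1 / 120)) / 2"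
    unfolding Polygamma_3_1[symmetric] by simp
  have "eis (Suc 3) z = 2 * (Polygamma 3 1 / fact 3) + 2 * ((2 * of_real pi * \<i>) ^ Suc 3 / fact 3) * Lam 3 (qp 1 z)"
    by (rule eis_expansion[OF z]) auto
  then show ?thesis unfolding P
    by (simp add: E4_def power_mult_distrib i_power fact_numeral field_simps)
qed

lemma eis_6: "Im z > 0 \<Longrightarrow> eis 6 z = of_real (2 * pi ^ 6 / 945) * E6 z"
proof -
  assume z: "Im z > 0"
  have P: "Polygamma 5 (1 :: complex) = of_real (64 * pi ^ 6 * (1 / 252)) / 2"
    unfolding Polygamma_5_1[symmetric] by simp
  have "eis (Suc 5) z = 2 * (Polygamma 5 1 / fact 5) + 2 * ((2 * of_real pi * \<i>) ^ Suc 5 / fact 5) * Lam 5 (qp 1 z)"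
    by (rule eis_expansion[OF z]) auto
  then show ?thesis unfolding P
    by (simp add: E6_def power_mult_distrib i_power fact_numeral field_simps)
qed

lemma E4_modular: "A \<in> SL2Z \<Longrightarrow> Im z > 0 \<Longrightarrow> E4 (moebius A z) = den A z ^ 4 * E4 z"
  using eis_modular[of A z 4] by (simp add: eis_4 Im_moebius_pos)

lemma E6_modular: "A \<in> SL2Z \<Longrightarrow> Im z > 0 \<Longrightarrow> E6 (moebius A z) = den A z ^ 6 * E6 z"
  using eis_modular[of A z 6] by (simp add: eis_6 Im_moebius_pos)

lemma q_class_E4: "q_class 0 E4"
  by (rule q_classI[of "\<lambda>q. 1 + 240 * Lam 3 q"]) (auto simp: E4_def intro!: holomorphic_intros holomorphic_Lam)

lemma q_class_E6: "q_class 0 E6"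
  by (rule q_classI[of "\<lambda>q. 1 - 504 * Lam 5 q"]) (auto simp: E6_def intro!: holomorphic_intros holomorphic_Lam)

lemma holomorphic_E4: "E4 holomorphic_on upper_half_plane"
  and holomorphic_E6: "E6 holomorphic_on upper_half_plane"
  using q_class_holomorphic q_class_E4 q_class_E6 by blast+

section \<open>Numerical bounds at reduced points\<close>

lemma pi_gt_31: "pi > 31 / 10"
proof -
  \<comment> \<open>\<open>12 * sin (pi / 12)\<close>, about 3.106, is a lower bound for
    \<open>pi\<close>, and the half-angle formula makes it algebraic.\<close>
  have "cos (pi / 6) = 1 - 2 * (sin (pi / 12))\<^sup>2"
    using cos_double_sin[of "pi / 12"] by simp
  then have s: "(sin (pi / 12))\<^sup>2 = (2 - sqrt 3) / 4" by (simp add: cos_30)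
  have "sqrt 3 \<le> 17321 / 10000" by (rule real_le_lsqrt) (auto simp: power2_eq_square)
  then have 1: "(sin (pi / 12))\<^sup>2 > (31 / 120)\<^sup>2" unfolding s by (simp add: power2_eq_square)
  have "0 \<le> sin (pi / 12)" by (rule sin_ge_zero) auto
  with 1 have "sin (pi / 12) > 31 / 120" by (rule power2_less_imp_less)
  moreover have "sin (pi / 12) \<le> pi / 12" by (rule sin_x_le_x) simp
  ultimately show ?thesis by simp
qed

text \<open>At reduced points \<open>norm q \<le> exp (- pi * sqrt 3)\<close>, about 1/231. The
  following estimates for Lambert series are all made on the disc of radius 1/200.\<close>

lemma qp_small:
  assumes "Im z \<ge> sqrt 3 / 2"
  shows "norm (qp 1 z) < 1 / 200"
proof -
  have "sqrt 3 \<ge> 173 / 100" by (rule real_le_rsqrt) (auto simp: power2_eq_square)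
  then have "pi * sqrt 3 \<ge> 31 / 10 * (173 / 100)" using pi_gt_31 by (intro mult_mono) auto
  moreover have "pi * (2 * Im z) \<ge> pi * sqrt 3" using assms by (intro mult_left_mono) auto
  ultimately have "2 * pi * Im z \<ge> 536 / 100" by linarith
  moreover have "exp (536 / 100 :: real) > 200"
  proof -
    \<comment> \<open>The quadratic Taylor bound is sharp only for small arguments, so it is taken
      at \<open>67 / 400 = 5.36 / 32\<close> and raised to the power 32.\<close>
    have "(1 + (67/400) + (67/400) ^ 2 / 2) ^ 32 \<le> exp ((67/400) :: real) ^ 32"
      by (intro power_mono exp_lower_Taylor_quadratic) auto
    also have "\<dots> = exp (536 / 100)" by (simp add: exp_of_nat_mult[symmetric])
    finally show ?thesis by (simp add: power2_eq_square eval_nat_numeral)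
  qed
  ultimately have "exp (2 * pi * Im z) > 200" by (meson exp_le_cancel_iff less_le_trans)
  then show ?thesis by (simp add: norm_qp exp_minus field_simps)
qed

text \<open>The radius is just small enough: for \<open>k = 5\<close> the Lipschitz constant is
  \<open>1 / (0.99 * 0.68) - 1\<close>, about 0.485.\<close>

lemma Lam_almost_identity:
  assumes "k \<in> {3, 5}" "norm x \<le> 1 / 200" "norm y \<le> 1 / 200"
  shows "norm (Lam k x - Lam k y - (x - y)) \<le> norm (x - y) / 2"
proof -
  have "norm (Lam k x - Lam k y - (x - y)) \<le> norm (x - y) * (1 / ((1 - 2 * (1/200)) * (1 - 2 ^ Suc k * (1/200))) - 1)"
    by (rule Lam_lipschitz) (use assms in auto)
  also have "\<dots> \<le> norm (x - y) * (1 / 2)"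
    using assms(1) by (intro mult_left_mono) auto
  finally show ?thesis by simp
qed

lemma Lam_inj:
  assumes "k \<in> {3, 5}" "norm x \<le> 1 / 200" "norm y \<le> 1 / 200" "Lam k x = Lam k y"
  shows "x = y"
  using Lam_almost_identity[OF assms(1-3)] assms(4) by (simp add: norm_minus_commute)

lemma Lam_deriv_nonzero:
  assumes k: "k \<in> {3, 5}" and x: "norm x < 1 / 200"
  shows "deriv (Lam k) x \<noteq> 0"
proof -
  have "(Lam k has_field_derivative deriv (Lam k) x) (at x)"
    using x by (intro holomorphic_derivI[OF holomorphic_Lam]) auto
  then have "((\<lambda>y. (Lam k y - Lam k x) / (y - x)) \<longlongrightarrow> deriv (Lam k) x) (at x)"
    by (simp add: has_field_derivative_iff)
  then have lim: "((\<lambda>y. norm ((Lam k y - Lam k x) / (y - x))) \<longlongrightarrow> norm (deriv (Lam k) x)) (at x)"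
    by (rule tendsto_norm)
  have "eventually (\<lambda>y. y \<in> ball 0 (1/200) - {x}) (at x)"
    using x by (intro eventually_at_in_open) auto
  then have "eventually (\<lambda>y. 1 / 2 \<le> norm ((Lam k y - Lam k x) / (y - x))) (at x)"
  proof eventually_elim
    case (elim y)
    have "norm (Lam k y - Lam k x - (y - x)) \<le> norm (y - x) / 2"
      by (rule Lam_almost_identity[OF k]) (use elim x in auto)
    moreover have "norm (y - x) \<le> norm (Lam k y - Lam k x) + norm (Lam k y - Lam k x - (y - x))"
      using norm_triangle_ineq4[of "Lam k y - Lam k x" "Lam k y - Lam k x - (y - x)"] by simp
    ultimately show ?case using elim by (simp add: norm_divide field_simps)
  qed
  then have "1 / 2 \<le> norm (deriv (Lam k) x)"
    by (intro tendsto_lowerbound[OF lim]) auto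
  then show ?thesis by auto
qed

section \<open>Zeros of E4 and E6\<close>

lemma deriv_modular:
  assumes f: "f holomorphic_on upper_half_plane" and k: "k > 0"
    and mod: "\<And>z. Im z > 0 \<Longrightarrow> f (moebius A z) = den A z ^ k * f z"
    and A: "A \<in> SL2Z" and z: "Im z > 0"
  shows "deriv f (moebius A z) = den A z ^ (k + 2) * deriv f z + of_nat k * of_int (A$2$1) * den A z ^ (k + 1) * f z"
proof -
  have nz: "den A z \<noteq> 0" using A z by (rule den_nonzero)
  have "(f has_field_derivative deriv f (moebius A z)) (at (moebius A z))"
    using A z by (intro holomorphic_derivI[OF f]) (auto simp: Im_moebius_pos)
  then have d1: "((\<lambda>z. f (moebius A z)) has_field_derivative deriv f (moebius A z) * (1 / (den A z)\<^sup>2)) (at z)"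
    by (rule DERIV_chain2[OF _ has_field_derivative_moebius[OF A z]])
  have df: "(f has_field_derivative deriv f z) (at z)"
    using z by (intro holomorphic_derivI[OF f]) auto
  have d2: "((\<lambda>z. den A z ^ k * f z) has_field_derivative
     den A z ^ k * deriv f z + of_nat k * den A z ^ (k - 1) * of_int (A$2$1) * f z) (at z)"
    by (auto intro!: derivative_eq_intros has_field_derivative_den df)
  have "eventually (\<lambda>z. z \<in> upper_half_plane) (nhds z)"
    using z by (intro eventually_nhds_in_open) auto
  then have e: "eventually (\<lambda>z. f (moebius A z) = den A z ^ k * f z) (nhds z)"
    by eventually_elim (use mod in auto)
  have "deriv f (moebius A z) * (1 / (den A z)\<^sup>2) = den A z ^ k * deriv f z + of_nat k * den A z ^ (k - 1) * of_int (A$2$1) * f z"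
    by (rule DERIV_unique[OF d1 iffD2[OF DERIV_cong_ev[OF refl e refl] d2]])
  then have "deriv f (moebius A z) = (den A z)\<^sup>2 * (den A z ^ k * deriv f z + of_nat k * den A z ^ (k - 1) * of_int (A$2$1) * f z)"
    using nz by (simp add: field_simps)
  also have "\<dots> = den A z ^ (k + 2) * deriv f z + of_nat k * of_int (A$2$1) * den A z ^ (k + 1) * f z"
    using k by (cases k) (simp_all add: algebra_simps power2_eq_square)
  finally show ?thesis .
qed

text \<open>This stands in for the valence formula. Any zero can be moved to height at least
  \<open>sqrt 3 / 2\<close>, where \<open>f\<close> depends on \<open>q\<close> injectively and with
  nonzero derivative; so the zero is unique up to the group and simple. Simplicity is carried back
  to \<open>z\<close> by \<open>deriv_modular\<close>, whose second term vanishes at a zero.\<close>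

lemma zeros_of_Lambert_form:
  assumes f: "\<And>z. f z = 1 + c * Lam l (qp 1 z)" and l: "l \<in> {3, 5}" and c: "c \<noteq> 0" and k: "k > 0"
    and mod: "\<And>A z. A \<in> SL2Z \<Longrightarrow> Im z > 0 \<Longrightarrow> f (moebius A z) = den A z ^ k * f z"
    and p: "f p = 0" "Im p \<ge> sqrt 3 / 2"
    and z: "Im z > 0" "f z = 0"
  shows "\<exists>A\<in>SL2Z. z = moebius A p" "deriv f z \<noteq> 0"
proof -
  have hol: "f holomorphic_on upper_half_plane"
    unfolding f[abs_def] by (intro holomorphic_intros holomorphic_comp_qp holomorphic_Lam)
  obtain A where A: "A \<in> SL2Z" "Im (moebius A z) \<ge> sqrt 3 / 2"
    using SL2Z_reduction[OF z(1)] by blast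
  define w where "w = moebius A z"
  have fw: "f w = 0" using mod[OF A(1) z(1)] z by (simp add: w_def)
  have "Lam l (qp 1 w) = Lam l (qp 1 p)"
  proof -
    have "1 + c * Lam l (qp 1 w) = 1 + c * Lam l (qp 1 p)" using fw p(1) f[of w] f[of p] by metis
    then show ?thesis using c by simp
  qed
  note eqL = this
  have "qp 1 w = qp 1 p"
    by (rule Lam_inj[OF l _ _ eqL]) (use qp_small[OF p(2)] qp_small[OF A(2)] in \<open>auto simp: w_def\<close>)
  then obtain n where n: "w = p + of_int n" using qp_1_eq_iff by blast
  have p0: "Im p > 0" using p(2) by (rule less_le_trans[rotated]) simp
  have "moebius (adj22 A ** mat22 1 n 0 1) p = moebius (adj22 A) w"
    using A p0 by (simp add: moebius_mult n)
  also have "\<dots> = moebius (adj22 A ** A) z" using A z by (simp add: moebius_mult w_def)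
  also have "\<dots> = z" using A by (simp add: adj22_left)
  finally show "\<exists>A\<in>SL2Z. z = moebius A p"
    using A by (intro bexI[of _ "adj22 A ** mat22 1 n 0 1"]) (auto intro: SL2Z_mult)
  have "(Lam l has_field_derivative deriv (Lam l) (qp 1 w)) (at (qp 1 w))"
    using qp_small[OF A(2)] by (intro holomorphic_derivI[OF holomorphic_Lam]) (auto simp: w_def)
  note ch = DERIV_chain2[where g = "qp 1", OF this]
  have "(qp 1 has_field_derivative 2 * of_real pi * \<i> * qp 1 w) (at w)"
    using has_field_derivative_qp[OF DERIV_ident, of 1 w UNIV] by simp
  then have "((\<lambda>w. Lam l (qp 1 w)) has_field_derivative deriv (Lam l) (qp 1 w) * (2 * of_real pi * \<i> * qp 1 w)) (at w)"
    by (rule ch)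
  then have "(f has_field_derivative c * (deriv (Lam l) (qp 1 w) * (2 * of_real pi * \<i> * qp 1 w))) (at w)"
    unfolding f[abs_def] by (auto intro!: derivative_eq_intros)
  then have "deriv f w = c * (deriv (Lam l) (qp 1 w) * (2 * of_real pi * \<i> * qp 1 w))" by (rule DERIV_imp_deriv)
  then have "deriv f w \<noteq> 0"
    using c Lam_deriv_nonzero[OF l, of "qp 1 w"] qp_small[OF A(2)] by (simp add: w_def)
  then show "deriv f z \<noteq> 0"
    using deriv_modular[OF hol k mod[OF A(1)] A(1) z(1)] z(2) by (auto simp: w_def)
qed

lemma E6_i: "E6 \<i> = 0"
  using E6_modular[of S_mat \<i>] by (simp add: i_power)

lemma E6_zero:
  assumes "Im z > 0" "E6 z = 0"
  shows "\<exists>A\<in>SL2Z. z = moebius A \<i>" "deriv E6 z \<noteq> 0"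
proof -
  have "sqrt 3 \<le> 2" by (rule real_le_lsqrt) auto
  then have "Im \<i> \<ge> sqrt 3 / 2" by simp
  note * = zeros_of_Lambert_form[of E6 "-504" 5 6 \<i>, OF _ _ _ _ E6_modular E6_i this assms]
  show "\<exists>A\<in>SL2Z. z = moebius A \<i>" "deriv E6 z \<noteq> 0"
    by (rule *; simp add: E6_def)+
qed

text \<open>The elliptic point of order three; the name is unrelated to the representation
  \<open>\<rho>\<close>.\<close>

definition rho3 :: complex where "rho3 = Complex (-1/2) (sqrt 3 / 2)"

lemma rho3_eq: "rho3 ^ 2 + rho3 + 1 = 0"
  by (simp add: rho3_def complex_eq_iff power2_eq_square)

lemma rho3_Im: "Im rho3 > 0" "Im rho3 \<ge> sqrt 3 / 2"
  by (simp_all add: rho3_def)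

definition R_mat :: "int^2^2" where "R_mat = mat22 (-1) (-1) 1 0"

lemma R_mat_SL2Z [simp]: "R_mat \<in> SL2Z"
  by (simp add: R_mat_def SL2Z_iff)

lemma moebius_R_rho3: "moebius R_mat rho3 = rho3"
proof -
  have "rho3 \<noteq> 0" using rho3_Im by auto
  moreover have "- rho3 - 1 = rho3 * rho3" using rho3_eq by algebra
  ultimately show ?thesis by (simp add: moebius_def R_mat_def)
qed

lemma den_R [simp]: "den R_mat z = z"
  by (simp add: den_def R_mat_def)

lemma rho3_cube: "rho3 ^ 3 = 1" and rho3_neq_1: "rho3 \<noteq> 1"
proof -
  have "(rho3 - 1) * (rho3 ^ 2 + rho3 + 1) = rho3 ^ 3 - 1"
    by (simp add: algebra_simps power2_eq_square power3_eq_cube)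
  then show "rho3 ^ 3 = 1" by (simp add: rho3_eq)
  show "rho3 \<noteq> 1" using rho3_Im by auto
qed

lemma E4_rho3: "E4 rho3 = 0"
proof -
  have "rho3 ^ 4 = rho3" using rho3_cube by (simp add: eval_nat_numeral)
  then have "E4 rho3 = rho3 * E4 rho3"
    using E4_modular[of R_mat rho3] rho3_Im by (simp add: moebius_R_rho3)
  then show ?thesis using rho3_neq_1 by simp
qed

lemma E4_zero:
  assumes "Im z > 0" "E4 z = 0"
  shows "\<exists>A\<in>SL2Z. z = moebius A rho3" "deriv E4 z \<noteq> 0"
proof -
  note * = zeros_of_Lambert_form[of E4 "240" 3 4 rho3, OF _ _ _ _ E4_modular E4_rho3 rho3_Im(2) assms]
  show "\<exists>A\<in>SL2Z. z = moebius A rho3" "deriv E4 z \<noteq> 0"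
    by (rule *; simp add: E4_def)+
qed

section \<open>The discriminant\<close>

text \<open>This is 1728 times the usual discriminant; the leading coefficient is
  \<open>3 * 240 + 2 * 504\<close>.\<close>

definition disc :: "complex \<Rightarrow> complex" where "disc z = E4 z ^ 3 - E6 z ^ 2"

definition disc_q :: "complex \<Rightarrow> complex" where
  "disc_q q = (1 + 240 * Lam 3 q) ^ 3 - (1 - 504 * Lam 5 q) ^ 2"

lemma disc_eq: "disc z = disc_q (qp 1 z)"
  by (simp add: disc_def disc_q_def E4_def E6_def)

lemma holomorphic_disc_q: "disc_q holomorphic_on ball 0 1"
  unfolding disc_q_def[abs_def] by (intro holomorphic_intros holomorphic_Lam)

lemma holomorphic_disc: "disc holomorphic_on upper_half_plane"
  unfolding disc_def[abs_def] by (intro holomorphic_intros holomorphic_E4 holomorphic_E6)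

lemma disc_modular: "A \<in> SL2Z \<Longrightarrow> Im z > 0 \<Longrightarrow> disc (moebius A z) = den A z ^ 12 * disc z"
  by (simp add: disc_def E4_modular E6_modular power_mult_distrib power_mult[symmetric] right_diff_distrib)

text \<open>The linear term dominates for \<open>norm q \<le> 1 / 200\<close>; the quadratic terms must be combined first.\<close>

lemma disc_q_near:
  assumes q: "norm q \<le> 1 / 200"
  shows "norm (disc_q q - 1728 * q) \<le> 1700 * norm q"
proof -
  define t where "t = norm q"
  define \<alpha> \<beta> where "\<alpha> = Lam 3 q - q" and "\<beta> = Lam 5 q - q"
  have t: "0 \<le> t" "t \<le> 1 / 200" using q by (auto simp: t_def)
  have "norm \<alpha> \<le> t * (1 / ((1 - 1/200) * (1 - 2 ^ 3 * (1/200))) - 1)"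
    unfolding \<alpha>_def t_def by (rule Lam_near[OF q]) auto
  also have "\<dots> \<le> t * (47 / 1000)" using t by (intro mult_left_mono) auto
  finally have a: "norm \<alpha> \<le> 47 / 1000 * t" by simp
  have "norm \<beta> \<le> t * (1 / ((1 - 1/200) * (1 - 2 ^ 5 * (1/200))) - 1)"
    unfolding \<beta>_def t_def by (rule Lam_near[OF q]) auto
  also have "\<dots> \<le> t * (197 / 1000)" using t by (intro mult_left_mono) auto
  finally have b: "norm \<beta> \<le> 197 / 1000 * t" by simp
  have tt: "t * t \<le> t / 200" using t mult_left_mono[of t "1/200" t] by simp
  have ttt: "t * t * t \<le> t / 40000" using tt t mult_right_mono[OF tt, of t] by simp
  have qa: "norm (q * \<alpha>) \<le> 47 / 1000 * (t * t)" using mult_left_mono[OF a, of t] t by (simp add: norm_mult t_def[symmetric] mult_ac)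
  have qb: "norm (q * \<beta>) \<le> 197 / 1000 * (t * t)" using mult_left_mono[OF b, of t] t by (simp add: norm_mult t_def[symmetric] mult_ac)
  have aa: "norm (\<alpha> * \<alpha>) \<le> (47 / 1000 * t) * (47 / 1000 * t)" unfolding norm_mult using a t by (intro mult_mono) auto
  have bb: "norm (\<beta> * \<beta>) \<le> (197 / 1000 * t) * (197 / 1000 * t)" unfolding norm_mult using b t by (intro mult_mono) auto
  have na: "norm (q + \<alpha>) \<le> 1047 / 1000 * t" using norm_triangle_ineq[of q \<alpha>] a by (simp add: t_def)
  have aaa: "norm ((q + \<alpha>) * (q + \<alpha>) * (q + \<alpha>)) \<le> (1047 / 1000 * t) * (1047 / 1000 * t) * (1047 / 1000 * t)"
    unfolding norm_mult using na t by (intro mult_mono) auto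
  \<comment> \<open>The coefficient of \<open>q * q\<close> is
    \<open>172800 - 254016 = - 81216\<close>. Bounded separately, the two parts alone would exceed
    1728 at radius 1/200.\<close>
  have "disc_q q - 1728 * q = 720 * \<alpha> + 1008 * \<beta> - 81216 * (q * q) + 345600 * (q * \<alpha>) + 172800 * (\<alpha> * \<alpha>)
      - 508032 * (q * \<beta>) - 254016 * (\<beta> * \<beta>) + 13824000 * ((q + \<alpha>) * (q + \<alpha>) * (q + \<alpha>))"
    unfolding disc_q_def \<alpha>_def \<beta>_def by (simp add: algebra_simps power2_eq_square power3_eq_cube)
  also have "norm \<dots> \<le> 720 * norm \<alpha> + 1008 * norm \<beta> + 81216 * (t * t) + 345600 * norm (q * \<alpha>) + 172800 * norm (\<alpha> * \<alpha>)
      + 508032 * norm (q * \<beta>) + 254016 * norm (\<beta> * \<beta>) + 13824000 * norm ((q + \<alpha>) * (q + \<alpha>) * (q + \<alpha>))"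
    by (intro norm_triangle_mono order_trans[OF norm_triangle_ineq4] add_mono) (simp_all add: norm_mult t_def)
  also have "\<dots> \<le> 720 * (47 / 1000 * t) + 1008 * (197 / 1000 * t) + 81216 * (t * t) + 345600 * (47 / 1000 * (t * t)) + 172800 * ((47 / 1000 * t) * (47 / 1000 * t))
      + 508032 * (197 / 1000 * (t * t)) + 254016 * ((197 / 1000 * t) * (197 / 1000 * t)) + 13824000 * ((1047 / 1000 * t) * (1047 / 1000 * t) * (1047 / 1000 * t))"
    using a b qa qb aa bb aaa by linarith
  also have "\<dots> = (720 * 47 / 1000 + 1008 * 197 / 1000) * t
      + (81216 + 345600 * 47 / 1000 + 172800 * (47 / 1000)\<^sup>2 + 508032 * 197 / 1000 + 254016 * (197 / 1000)\<^sup>2) * (t * t)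
      + 13824000 * (1047 / 1000) ^ 3 * (t * t * t)"
    by (simp add: algebra_simps power2_eq_square power3_eq_cube)
  also have "\<dots> \<le> (720 * 47 / 1000 + 1008 * 197 / 1000) * t
      + (81216 + 345600 * 47 / 1000 + 172800 * (47 / 1000)\<^sup>2 + 508032 * 197 / 1000 + 254016 * (197 / 1000)\<^sup>2) * (t / 200)
      + 13824000 * (1047 / 1000) ^ 3 * (t / 40000)"
    by (intro add_mono mult_left_mono tt ttt order_refl) (auto simp: power2_eq_square)
  also have "\<dots> \<le> 1700 * t" using t by (simp add: power2_eq_square power3_eq_cube)
  finally show ?thesis by (simp add: t_def)
qed

lemma disc_nonzero:
  assumes "Im z > 0"
  shows "disc z \<noteq> 0"
proof
  assume z: "disc z = 0"
  obtain A where A: "A \<in> SL2Z" "Im (moebius A z) \<ge> sqrt 3 / 2"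
    using SL2Z_reduction[OF assms] by blast
  have "disc_q (qp 1 (moebius A z)) = 0" using disc_modular[OF A(1) assms] z by (simp add: disc_eq)
  then have "norm (1728 * qp 1 (moebius A z)) \<le> 1700 * norm (qp 1 (moebius A z))"
    using disc_q_near[of "qp 1 (moebius A z)"] qp_small[OF A(2)] by simp
  then show False by (simp add: norm_mult)
qed

text \<open>At 0 the factor is nonzero by \<open>disc_q_near\<close>, elsewhere because
  \<open>disc\<close> is. A zero-free \<open>u\<close> on a disc has a holomorphic logarithm, the
  source of real powers of the discriminant.\<close>

lemma disc_product:
  obtains u where "u holomorphic_on ball 0 1" "\<And>q. norm q < 1 \<Longrightarrow> u q \<noteq> 0"
    "\<And>z. Im z > 0 \<Longrightarrow> disc z = qp 1 z * u (qp 1 z)"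
proof -
  have d0: "disc_q 0 = 0" by (simp add: disc_q_def)
  define u where "u = (\<lambda>q. if q = 0 then deriv disc_q 0 else (disc_q q - disc_q 0) / (q - 0))"
  have u: "u holomorphic_on ball 0 1" unfolding u_def by (intro pole_lemma holomorphic_disc_q) auto
  have e: "disc z = qp 1 z * u (qp 1 z)" for z by (simp add: u_def disc_eq d0)
  have "u q \<noteq> 0" if q: "norm q < 1" for q
  proof (cases "q = 0")
    case True
    have "(disc_q has_field_derivative deriv disc_q 0) (at 0)"
      by (intro holomorphic_derivI[OF holomorphic_disc_q]) auto
    then have lim: "((\<lambda>q. norm (disc_q q / q)) \<longlongrightarrow> norm (deriv disc_q 0)) (at 0)"
      by (intro tendsto_norm) (simp add: has_field_derivative_iff d0)
    have "eventually (\<lambda>q. q \<in> ball 0 (1/200) - {0 :: complex}) (at 0)" by (intro eventually_at_in_open) auto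
    \<comment> \<open>\<open>28 = 1728 - 1700\<close>, the margin in
      \<open>disc_q_near\<close>.\<close>
    then have "eventually (\<lambda>q. 28 \<le> norm (disc_q q / q)) (at 0)"
    proof eventually_elim
      case (elim q)
      have "norm (1728 * q) \<le> norm (disc_q q) + norm (disc_q q - 1728 * q)"
        using norm_triangle_ineq4[of "disc_q q" "disc_q q - 1728 * q"] by simp
      then show ?case using disc_q_near[of q] elim by (simp add: norm_divide norm_mult field_simps)
    qed
    then have "28 \<le> norm (deriv disc_q 0)" by (intro tendsto_lowerbound[OF lim]) auto
    then show ?thesis using True by (auto simp: u_def)
  next
    case False
    then obtain z where "Im z > 0" "qp 1 z = q" using qp_1_surj q by blast
    then show ?thesis using e[of z] disc_nonzero[of z] by auto
  qed
  then show ?thesis using that u e by blast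
qed

section \<open>Modular functions of small weight\<close>

text \<open>The maximum of \<open>norm h\<close> over the disc of radius 1/200 is the maximum over
  the whole unit disc, since every orbit has a representative there. It is attained at an interior
  point of the unit disc.\<close>

lemma modular_function_constant:
  assumes f: "q_class 0 f" and inv: "\<And>A z. A \<in> SL2Z \<Longrightarrow> Im z > 0 \<Longrightarrow> f (moebius A z) = f z"
  shows "\<exists>c. \<forall>z. Im z > 0 \<longrightarrow> f z = c"
proof -
  obtain h where h: "h holomorphic_on ball 0 1" "\<And>z. Im z > 0 \<Longrightarrow> f z = h (qp 1 z)"
    using f by (auto simp: q_class_def)
  have c: "continuous_on (cball 0 (1/200)) (\<lambda>q. norm (h q))"
    by (intro continuous_intros holomorphic_on_imp_continuous_on holomorphic_on_subset[OF h(1)]) auto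
  then obtain \<xi> where \<xi>: "\<xi> \<in> cball 0 (1/200)" "\<And>q. q \<in> cball 0 (1/200) \<Longrightarrow> norm (h q) \<le> norm (h \<xi>)"
    using continuous_attains_sup[OF compact_cball _ c] by force
  have "h constant_on ball 0 1"
  proof (rule maximum_modulus_principle[OF h(1) open_ball connected_ball open_ball order_refl])
    show "\<xi> \<in> ball 0 1" using \<xi>(1) by auto
    fix q :: complex assume q: "q \<in> ball 0 1"
    show "norm (h q) \<le> norm (h \<xi>)"
    proof (cases "q = 0")
      case True
      then show ?thesis by (intro \<xi>(2)) auto
    next
      case False
      then obtain z where z: "Im z > 0" "qp 1 z = q" using qp_1_surj q by auto
      obtain A where A: "A \<in> SL2Z" "Im (moebius A z) \<ge> sqrt 3 / 2"
        using SL2Z_reduction[OF z(1)] by blast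
      have "h q = h (qp 1 (moebius A z))"
        using h(2)[OF z(1)] h(2)[OF Im_moebius_pos[OF A(1) z(1)]] inv[OF A(1) z(1)] z(2) by simp
      then show ?thesis using \<xi>(2) qp_small[OF A(2)] by auto
    qed
  qed
  then obtain c where "\<And>q. q \<in> ball 0 1 \<Longrightarrow> h q = c" by (auto simp: constant_on_def)
  then have "\<forall>z. Im z > 0 \<longrightarrow> f z = c" using h(2) by (simp add: norm_qp1_less_1)
  then show ?thesis ..
qed

text \<open>
  The function \<open>norm (f z) * norm (disc z) powr - \<mu> * Im z powr ((m - 12 * \<mu>) / 2)\<close> is invariant,
  and the negative exponent of \<open>Im z\<close> makes it bounded. So
  the holomorphic function of \<open>q\<close> whose absolute value is the product of the first two factors
  tends to 0 at the unit circle.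
\<close>

lemma modular_small_weight_vanishes:
  assumes f: "q_class \<mu> f"
    and inv: "\<And>A z. A \<in> SL2Z \<Longrightarrow> Im z > 0 \<Longrightarrow> norm (f (moebius A z)) = norm (den A z) powr m * norm (f z)"
    and m: "m < 12 * \<mu>" and z: "Im z > 0"
  shows "f z = 0"
proof -
  obtain h where h: "h holomorphic_on ball 0 1" "\<And>z. Im z > 0 \<Longrightarrow> f z = qp \<mu> z * h (qp 1 z)"
    using f by (auto simp: q_class_def)
  obtain u where u: "u holomorphic_on ball 0 1" "\<And>q. norm q < 1 \<Longrightarrow> u q \<noteq> 0"
    "\<And>z. Im z > 0 \<Longrightarrow> disc z = qp 1 z * u (qp 1 z)" by (rule disc_product) blast
  \<comment> \<open>\<open>exp (\<mu> * L q)\<close> is the real power \<open>u^\<mu>\<close>, so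
    \<open>k\<close> is holomorphic in \<open>q\<close> and has the absolute value of
    \<open>f / disc^\<mu>\<close>.\<close>
  obtain L where L: "L holomorphic_on ball 0 1" "\<And>q. q \<in> ball 0 1 \<Longrightarrow> u q = exp (L q)"
    by (rule contractible_imp_holomorphic_log[OF u(1)]) (use u(2) convex_imp_contractible in auto)
  define k where "k q = h q * exp (- of_real \<mu> * L q)" for q
  have khol: "k holomorphic_on ball 0 1" unfolding k_def by (intro holomorphic_intros h L)
  have kf: "norm (k (qp 1 z)) = norm (f z) * norm (disc z) powr (- \<mu>)" if z: "Im z > 0" for z
  proof -
    have q: "qp 1 z \<in> ball 0 1" using norm_qp1_less_1[OF z] by simp
    have "norm (disc z) = exp (- (2 * pi * Im z) + Re (L (qp 1 z)))"
      using u(3)[OF z] L(2)[OF q] by (simp add: norm_mult norm_qp exp_diff exp_minus field_simps)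
    then have "norm (disc z) powr (- \<mu>) = exp (2 * pi * \<mu> * Im z) * exp (- \<mu> * Re (L (qp 1 z)))"
      by (simp add: powr_def exp_add[symmetric] algebra_simps)
    moreover have "norm (f z) = exp (- (2 * pi * \<mu> * Im z)) * norm (h (qp 1 z))"
      using h(2)[OF z] by (simp add: norm_mult norm_qp)
    moreover have "norm (k (qp 1 z)) = norm (h (qp 1 z)) * exp (- \<mu> * Re (L (qp 1 z)))"
      by (simp add: k_def norm_mult)
    ultimately show ?thesis by (simp add: exp_minus)
  qed
  have ktrans: "norm (k (qp 1 (moebius A z))) = norm (den A z) powr (m - 12 * \<mu>) * norm (k (qp 1 z))"
    if A: "A \<in> SL2Z" and z: "Im z > 0" for A z
  proof -
    have n: "norm (den A z) > 0" using den_nonzero[OF A z] by simp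
    have "norm (disc (moebius A z)) powr (- \<mu>) = norm (den A z) powr (- 12 * \<mu>) * norm (disc z) powr (- \<mu>)"
    proof -
      have "norm (den A z) ^ 12 = norm (den A z) powr 12" using powr_realpow[OF n, of 12] by simp
      then have "(norm (den A z) ^ 12) powr (- \<mu>) = norm (den A z) powr (- 12 * \<mu>)"
        by (simp only: powr_powr) simp
      then show ?thesis
        unfolding disc_modular[OF A z] norm_mult norm_power by (subst powr_mult) (simp_all only: )
    qed
    then have "norm (k (qp 1 (moebius A z))) = norm (den A z) powr m * norm (den A z) powr (- 12 * \<mu>) * norm (k (qp 1 z))"
      unfolding kf[OF z] kf[OF Im_moebius_pos[OF A z]] inv[OF A z] by simp
    also have "norm (den A z) powr m * norm (den A z) powr (- 12 * \<mu>) = norm (den A z) powr (m - 12 * \<mu>)"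
      by (simp add: powr_add[symmetric])
    finally show ?thesis .
  qed
  obtain C where C: "C > 0" "\<And>q. norm q \<le> 1 / 200 \<Longrightarrow> norm (k q) \<le> C"
    using holomorphic_disc_bounded[OF khol, of "1/200"] by auto
  define s where "s = (12 * \<mu> - m) / 2"
  have s: "s > 0" using m by (simp add: s_def)
  \<comment> \<open>At the reduced point the height is at least 1/2, so
    \<open>(norm (den A z))\<^sup>2 \<le> 2 * Im z\<close>; the law \<open>ktrans\<close> carries
    the bound \<open>C\<close> back to \<open>z\<close>.\<close>
  have bound: "norm (k (qp 1 z)) \<le> C * (2 * Im z) powr s" if z: "Im z > 0" for z
  proof -
    obtain A where A: "A \<in> SL2Z" "Im (moebius A z) \<ge> sqrt 3 / 2"
      using SL2Z_reduction[OF z] by blast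
    have n: "norm (den A z) > 0" using den_nonzero[OF A(1) z] by simp
    have "1 \<le> sqrt (3 :: real)" by simp
    then have "1 / 2 \<le> Im (moebius A z)" using A(2) by linarith
    then have "(norm (den A z))\<^sup>2 \<le> 2 * Im z"
      using n unfolding Im_moebius[OF A(1)] by (simp add: field_simps)
    then have "(norm (den A z))\<^sup>2 powr s \<le> (2 * Im z) powr s" using s by (intro powr_mono2) auto
    also have "(norm (den A z))\<^sup>2 powr s = norm (den A z) powr (12 * \<mu> - m)"
    proof -
      have "(norm (den A z))\<^sup>2 = norm (den A z) powr 2" using powr_realpow[OF n, of 2] by simp
      moreover have "2 * s = 12 * \<mu> - m" by (simp add: s_def)
      ultimately show ?thesis by (simp only: powr_powr)
    qed
    finally have d: "norm (den A z) powr (12 * \<mu> - m) \<le> (2 * Im z) powr s" .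
    have "norm (k (qp 1 z)) = norm (k (qp 1 (moebius A z))) * norm (den A z) powr (12 * \<mu> - m)"
    proof -
      have "norm (den A z) powr (m - 12 * \<mu>) * norm (den A z) powr (12 * \<mu> - m) = 1"
        using n by (simp add: powr_add[symmetric])
      then show ?thesis unfolding ktrans[OF A(1) z] by (simp add: mult_ac)
    qed
    also have "\<dots> \<le> C * (2 * Im z) powr s"
      using qp_small[OF A(2)] C by (intro mult_mono d) auto
    finally show ?thesis .
  qed
  have "k q = 0" if q: "norm q < 1" for q
  proof -
    have small: "norm (k q) \<le> \<epsilon>" if \<epsilon>: "\<epsilon> > 0" for \<epsilon>
    proof -
      have "((\<lambda>y. C * (2 * y) powr s) \<longlongrightarrow> 0) (at_right 0)"
        using s by real_asymp
      then have e1: "eventually (\<lambda>y. C * (2 * y) powr s < \<epsilon>) (at_right 0)"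
        using \<epsilon> by (rule order_tendstoD)
      have "((\<lambda>y. exp (- (2 * pi * y))) \<longlongrightarrow> 1) (at_right 0)"
        by (auto intro!: tendsto_eq_intros)
      then have e2: "eventually (\<lambda>y. exp (- (2 * pi * y)) > norm q) (at_right 0)"
        using q by (rule order_tendstoD)
      have "eventually (\<lambda>y::real. y > 0) (at_right 0)" by (simp add: eventually_at_right_less)
      with e1 e2 have ev: "eventually (\<lambda>y. C * (2 * y) powr s < \<epsilon> \<and> exp (- (2 * pi * y)) > norm q \<and> y > 0) (at_right 0)"
        by eventually_elim auto
      then obtain y where y: "C * (2 * y) powr s < \<epsilon>" "exp (- (2 * pi * y)) > norm q" "y > 0"
        using eventually_happens'[OF trivial_limit_at_right_real ev] by blast
      define R where "R = exp (- (2 * pi * y))"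
      have R: "0 < R" "R < 1" using y by (auto simp: R_def)
      show ?thesis
      proof (rule maximum_modulus_frontier[of k "ball 0 R"])
        show "k holomorphic_on interior (ball 0 R)"
          using R by (auto intro!: holomorphic_on_subset[OF khol])
        show "continuous_on (closure (ball 0 R)) k"
          using R by (auto intro!: holomorphic_on_imp_continuous_on holomorphic_on_subset[OF khol])
        fix w assume "w \<in> frontier (ball (0::complex) R)"
        then have w: "norm w = R" using R by (simp add: frontier_ball)
        have "w \<noteq> 0" "norm w < 1" using w R by auto
        then obtain z where z: "Im z > 0" "qp 1 z = w" by (rule qp_1_surj)
        have "Im z = y" using w z norm_qp[of 1 z] by (simp add: R_def)
        then show "norm (k w) \<le> \<epsilon>" using bound[OF z(1)] z(2) y(1) by simp
      qed (use y R in \<open>auto simp: R_def\<close>)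
    qed
    have "norm (k q) \<le> 0" by (rule field_le_epsilon) (simp only: add_0 small)
    then show ?thesis by simp
  qed
  then have "h (qp 1 z) = 0" using norm_qp1_less_1[OF z] by (simp add: k_def)
  then show ?thesis using h(2)[OF z] by simp
qed

section \<open>The logarithmic derivative of the discriminant\<close>

text \<open>This is \<open>2 * pi * \<i>\<close> times the Eisenstein series of weight 2. As a
  logarithmic derivative it gets its quasimodular law from the law of \<open>disc\<close>, without
  conditionally convergent sums.\<close>

definition phi :: "complex \<Rightarrow> complex" where "phi z = deriv disc z / disc z"

lemma holomorphic_phi: "phi holomorphic_on upper_half_plane"
  unfolding phi_def[abs_def] by (intro holomorphic_intros holomorphic_disc) (auto simp: disc_nonzero)

lemma q_class_over_disc:
  assumes "q_class 1 f"
  shows "q_class 0 (\<lambda>z. f z / disc z)"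
proof -
  obtain h where h: "h holomorphic_on ball 0 1" "\<And>z. Im z > 0 \<Longrightarrow> f z = qp 1 z * h (qp 1 z)"
    using assms by (auto simp: q_class_def)
  obtain u where u: "u holomorphic_on ball 0 1" "\<And>q. norm q < 1 \<Longrightarrow> u q \<noteq> 0"
    "\<And>z. Im z > 0 \<Longrightarrow> disc z = qp 1 z * u (qp 1 z)" by (rule disc_product) blast
  show ?thesis
    by (rule q_classI[of "\<lambda>q. h q / u q"]) (use h u in \<open>auto intro!: holomorphic_intros\<close>)
qed

lemma q_class_disc: "q_class 1 disc"
  by (rule disc_product) (auto intro: q_classI)

lemma q_class_phi: "q_class 0 phi"
  unfolding phi_def[abs_def] by (intro q_class_over_disc q_class_deriv q_class_disc)

lemma phi_modular:
  assumes A: "A \<in> SL2Z" and z: "Im z > 0"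
  shows "phi (moebius A z) = den A z ^ 2 * phi z + 12 * of_int (A$2$1) * den A z"
proof -
  have "den A z \<noteq> 0" "disc z \<noteq> 0" using den_nonzero[OF A z] disc_nonzero[OF z] .
  then show ?thesis
    using deriv_modular[OF holomorphic_disc _ disc_modular[OF A] A z]
    by (simp add: phi_def disc_modular[OF A z] divide_simps) (simp add: algebra_simps eval_nat_numeral)
qed

text \<open>Differentiation removes the constant term. This gain of a factor \<open>q\<close> is
  what allows a division by \<open>disc\<close>.\<close>

lemma q_class_deriv_0:
  assumes "q_class 0 f"
  shows "q_class 1 (deriv f)"
proof -
  obtain h where h: "h holomorphic_on ball 0 1" "\<And>z. Im z > 0 \<Longrightarrow> f z = h (qp 1 z)"
    using assms by (auto simp: q_class_def)
  show ?thesis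
  proof (rule q_classI[of "\<lambda>q. 2 * of_real pi * \<i> * deriv h q"])
    show "(\<lambda>q. 2 * of_real pi * \<i> * deriv h q) holomorphic_on ball 0 1"
      by (intro holomorphic_intros h) auto
    fix z assume z: "Im z > 0"
    have "(h has_field_derivative deriv h (qp 1 z)) (at (qp 1 z))"
      using z by (intro holomorphic_derivI[OF h(1)]) (auto simp: norm_qp1_less_1)
    note ch = DERIV_chain2[where g = "qp 1", OF this]
    have "(qp 1 has_field_derivative 2 * of_real pi * \<i> * qp 1 z) (at z)"
      using has_field_derivative_qp[OF DERIV_ident, of 1 z UNIV] by simp
    then have d: "((\<lambda>z. h (qp 1 z)) has_field_derivative deriv h (qp 1 z) * (2 * of_real pi * \<i> * qp 1 z)) (at z)"
      by (rule ch)
    have "eventually (\<lambda>z. z \<in> upper_half_plane) (nhds z)"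
      using z by (intro eventually_nhds_in_open) auto
    then have e: "eventually (\<lambda>z. f z = h (qp 1 z)) (nhds z)"
      by eventually_elim (use h in auto)
    have "(f has_field_derivative deriv h (qp 1 z) * (2 * of_real pi * \<i> * qp 1 z)) (at z)"
      using d DERIV_cong_ev[OF refl e refl] by simp
    then show "deriv f z = qp 1 z * (2 * of_real pi * \<i> * deriv h (qp 1 z))"
      by (simp add: DERIV_imp_deriv)
  qed
qed

text \<open>The bracket \<open>B\<close> has weight 12 and vanishes at the cusp, so
  \<open>B / disc\<close> is a constant \<open>c\<close>. The rest is algebra: multiplied by
  \<open>disc\<close>, the Serre derivatives of \<open>E4\<close> and \<open>E6\<close> become
  \<open>E6 * B / 3\<close> and \<open>E4\<^sup>2 * B / 2\<close>. The value of \<open>c\<close> is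
  left open.\<close>

lemma Ramanujan:
  obtains c where "\<And>z. Im z > 0 \<Longrightarrow> deriv E4 z - phi z * E4 z / 3 = c / 3 * E6 z"
    "\<And>z. Im z > 0 \<Longrightarrow> deriv E6 z - phi z * E6 z / 2 = c / 2 * E4 z ^ 2"
proof -
  define B where "B z = 2 * E4 z * deriv E6 z - 3 * E6 z * deriv E4 z" for z
  have "q_class 1 (\<lambda>z. (2 * E4 z) * deriv E6 z - (3 * E6 z) * deriv E4 z)"
    by (intro q_class_diff q_class_mult0 q_class_const q_class_E4 q_class_E6 q_class_deriv_0)
  then have B: "q_class 0 (\<lambda>z. B z / disc z)" unfolding B_def by (rule q_class_over_disc)
  have "B (moebius A z) / disc (moebius A z) = B z / disc z" if A: "A \<in> SL2Z" and z: "Im z > 0" for A z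
  proof -
    have "B (moebius A z) = den A z ^ 12 * B z"
      using deriv_modular[OF holomorphic_E4 _ E4_modular[OF A] A z] deriv_modular[OF holomorphic_E6 _ E6_modular[OF A] A z]
      by (simp add: B_def E4_modular[OF A z] E6_modular[OF A z]) (simp add: algebra_simps eval_nat_numeral)
    then show ?thesis using den_nonzero[OF A z] by (simp add: disc_modular[OF A z])
  qed
  with B obtain c where c: "\<And>z. Im z > 0 \<Longrightarrow> B z / disc z = c"
    using modular_function_constant by blast
  have "deriv E4 z - phi z * E4 z / 3 = c / 3 * E6 z \<and> deriv E6 z - phi z * E6 z / 2 = c / 2 * E4 z ^ 2"
    if z: "Im z > 0" for z
  proof -
    have d4: "(E4 has_field_derivative deriv E4 z) (at z)" and d6: "(E6 has_field_derivative deriv E6 z) (at z)"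
      using z by (auto intro!: holomorphic_derivI[OF holomorphic_E4] holomorphic_derivI[OF holomorphic_E6])
    have "(disc has_field_derivative 3 * E4 z ^ 2 * deriv E4 z - 2 * E6 z * deriv E6 z) (at z)"
      unfolding disc_def[abs_def] by (auto intro!: derivative_eq_intros d4 d6)
    then have dd: "deriv disc z = 3 * E4 z ^ 2 * deriv E4 z - 2 * E6 z * deriv E6 z" by (rule DERIV_imp_deriv)
    have nz: "disc z \<noteq> 0" using z by (rule disc_nonzero)
    have cB: "c * disc z = B z" using c[OF z] nz by (simp add: field_simps)
    have "(deriv E4 z - phi z * E4 z / 3) * disc z = deriv E4 z * disc z - deriv disc z * E4 z / 3"
      using nz by (simp add: phi_def field_simps)
    also have "\<dots> = E6 z * B z / 3" unfolding dd disc_def B_def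
      by (simp add: field_simps power2_eq_square power3_eq_cube)
    also have "\<dots> = (c / 3 * E6 z) * disc z" unfolding cB[symmetric] by simp
    finally have 1: "deriv E4 z - phi z * E4 z / 3 = c / 3 * E6 z" using nz by simp
    have "(deriv E6 z - phi z * E6 z / 2) * disc z = deriv E6 z * disc z - deriv disc z * E6 z / 2"
      using nz by (simp add: phi_def field_simps)
    also have "\<dots> = E4 z ^ 2 * B z / 2" unfolding dd disc_def B_def
      by (simp add: field_simps power2_eq_square power3_eq_cube)
    also have "\<dots> = (c / 2 * E4 z ^ 2) * disc z" unfolding cB[symmetric] by simp
    finally show ?thesis using 1 nz by simp
  qed
  then show ?thesis using that by blast
qed

section \<open>Automorphy factors\<close>

text \<open>Neither the multiplier nor the principal branch of the power need be a cocycle alone;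
  their product is, so the two are kept together.\<close>

definition aut :: "real \<Rightarrow> (int^2^2 \<Rightarrow> complex) \<Rightarrow> int^2^2 \<Rightarrow> complex \<Rightarrow> complex" where
  "aut w \<upsilon> A z = \<upsilon> A * den A z powr of_real w"

lemma slash_eq: "slash w \<upsilon> A f z = inverse (aut w \<upsilon> A z) * f (moebius A z)"
  by (simp add: slash_def aut_def den_def powr_minus)

lemma multiplier_systemD:
  assumes "multiplier_system w \<upsilon>"
  shows "A \<in> SL2Z \<Longrightarrow> norm (\<upsilon> A) = 1"
    and "f holomorphic_on upper_half_plane \<Longrightarrow> A \<in> SL2Z \<Longrightarrow> slash w \<upsilon> A f holomorphic_on upper_half_plane"
    and "f holomorphic_on upper_half_plane \<Longrightarrow> Im z > 0 \<Longrightarrow> slash w \<upsilon> (mat 1) f z = f z"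
    and "f holomorphic_on upper_half_plane \<Longrightarrow> A \<in> SL2Z \<Longrightarrow> B \<in> SL2Z \<Longrightarrow> Im z > 0 \<Longrightarrow>
      slash w \<upsilon> B (slash w \<upsilon> A f) z = slash w \<upsilon> (A ** B) f z"
  using assms unfolding multiplier_system_def by auto

context
  fixes w :: real and \<upsilon> :: "int^2^2 \<Rightarrow> complex"
  assumes ms: "multiplier_system w \<upsilon>"
begin

lemma norm_aut: "A \<in> SL2Z \<Longrightarrow> norm (aut w \<upsilon> A z) = norm (den A z) powr w"
  using multiplier_systemD(1)[OF ms] by (simp add: aut_def norm_mult norm_powr_real_powr')

lemma aut_nonzero: "A \<in> SL2Z \<Longrightarrow> Im z > 0 \<Longrightarrow> aut w \<upsilon> A z \<noteq> 0"
  using norm_aut[of A z] den_nonzero[of A z] by auto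

text \<open>The slash action sends the constant function 1 to the inverse of the factor, so the
  action property is the cocycle property.\<close>

lemma aut_mult:
  assumes A: "A \<in> SL2Z" and B: "B \<in> SL2Z" and z: "Im z > 0"
  shows "aut w \<upsilon> (A ** B) z = aut w \<upsilon> A (moebius B z) * aut w \<upsilon> B z"
proof -
  have "inverse (aut w \<upsilon> B z) * inverse (aut w \<upsilon> A (moebius B z)) = inverse (aut w \<upsilon> (A ** B) z)"
    using multiplier_systemD(4)[OF ms _ A B z, of "\<lambda>_. 1"] by (simp add: slash_eq)
  then have "inverse (aut w \<upsilon> A (moebius B z) * aut w \<upsilon> B z) = inverse (aut w \<upsilon> (A ** B) z)"
    by (simp add: inverse_mult_distrib mult.commute)
  then show ?thesis by (metis inverse_inverse_eq)
qed

lemma aut_1: "aut w \<upsilon> (mat 1) z = 1"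
proof -
  have "inverse (aut w \<upsilon> (mat 1) \<i>) = 1"
    using multiplier_systemD(3)[OF ms, of "\<lambda>_. 1" \<i>] by (simp add: slash_eq)
  then show ?thesis by (simp add: aut_def)
qed

lemma holomorphic_aut:
  assumes "A \<in> SL2Z"
  shows "aut w \<upsilon> A holomorphic_on upper_half_plane"
proof -
  have "(\<lambda>z. inverse (slash w \<upsilon> A (\<lambda>_. 1) z)) holomorphic_on upper_half_plane"
    using aut_nonzero[OF assms]
    by (intro holomorphic_intros multiplier_systemD(2)[OF ms] assms) (auto simp: slash_eq)
  then show ?thesis by (rule holomorphic_transform) (simp add: slash_eq)
qed

lemma aut_add_int:
  assumes "A \<in> SL2Z" "Im z > 0"
  shows "aut (w + of_int n) \<upsilon> A z = aut w \<upsilon> A z * den A z powi n"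
  using den_nonzero[OF assms] by (simp add: aut_def powr_add complex_powr_of_int)

lemma multiplier_system_add_int: "multiplier_system (w + of_int n) \<upsilon>"
proof -
  have eq: "slash (w + of_int n) \<upsilon> A f z = den A z powi (- n) * slash w \<upsilon> A f z" if "A \<in> SL2Z" "Im z > 0" for A f z
    by (simp add: slash_eq aut_add_int[OF that] power_int_minus)
  have "slash (w + of_int n) \<upsilon> B (slash (w + of_int n) \<upsilon> A f) z = slash (w + of_int n) \<upsilon> (A ** B) f z"
    if f: "f holomorphic_on upper_half_plane" and A: "A \<in> SL2Z" and B: "B \<in> SL2Z" and z: "Im z > 0" for f A B z
  proof -
    have "slash (w + of_int n) \<upsilon> B (slash (w + of_int n) \<upsilon> A f) z =
      den B z powi (- n) * (inverse (aut w \<upsilon> B z) * (den A (moebius B z) powi (- n) * slash w \<upsilon> A f (moebius B z)))"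
      using eq[OF B z] eq[OF A Im_moebius_pos[OF B z]] by (simp add: slash_eq[of w \<upsilon> B])
    also have "\<dots> = (den A (moebius B z) * den B z) powi (- n) * slash w \<upsilon> B (slash w \<upsilon> A f) z"
      by (simp add: slash_eq[of w \<upsilon> B] power_int_mult_distrib mult_ac)
    also have "\<dots> = slash (w + of_int n) \<upsilon> (A ** B) f z"
      using multiplier_systemD(4)[OF ms f A B z] eq[OF SL2Z_mult[OF A B] z] by (simp add: den_mult[OF B z])
    finally show ?thesis .
  qed
  moreover have "slash (w + of_int n) \<upsilon> A f holomorphic_on upper_half_plane"
    if f: "f holomorphic_on upper_half_plane" and A: "A \<in> SL2Z" for f A
  proof -
    have "(\<lambda>z. den A z powi (- n) * slash w \<upsilon> A f z) holomorphic_on upper_half_plane"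
      using den_nonzero[OF A] by (intro holomorphic_intros multiplier_systemD(2)[OF ms f A]) auto
    then show ?thesis by (rule holomorphic_transform) (simp add: eq[OF A])
  qed
  moreover have "slash (w + of_int n) \<upsilon> (mat 1) f z = f z"
    if f: "f holomorphic_on upper_half_plane" and z: "Im z > 0" for f z
    using eq[OF SL2Z_1 z] multiplier_systemD(3)[OF ms f z] by simp
  ultimately show ?thesis
    using multiplier_systemD(1)[OF ms] unfolding multiplier_system_def by auto
qed

lemma aut_add_nat:
  assumes "A \<in> SL2Z" "Im z > 0"
  shows "aut (w + of_nat n) \<upsilon> A z = aut w \<upsilon> A z * den A z ^ n"
  using aut_add_int[OF assms, of "int n"] by simp

lemma has_field_derivative_aut:
  assumes A: "A \<in> SL2Z" and z: "Im z > 0"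
  shows "(aut w \<upsilon> A has_field_derivative of_real w * of_int (A$2$1) / den A z * aut w \<upsilon> A z) (at z)"
proof (cases "A$2$1 = 0")
  case True
  then have "aut w \<upsilon> A = (\<lambda>_. \<upsilon> A * of_int (A$2$2) powr of_real w)"
    by (simp add: aut_def den_def fun_eq_iff)
  then show ?thesis using True by simp
next
  case False
  \<comment> \<open>For \<open>c \<noteq> 0\<close> the denominator is not real and avoids the cut
    of the principal power; for \<open>c = 0\<close> the factor is constant, even when the
    denominator lies on the cut.\<close>
  have nr: "den A z \<notin> \<real>\<^sub>\<le>\<^sub>0"
    using False z by (auto simp: den_def complex_nonpos_Reals_iff)
  have nz: "den A z \<noteq> 0" using A z by (rule den_nonzero)
  have "((\<lambda>z. \<upsilon> A * den A z powr of_real w) has_field_derivative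
      \<upsilon> A * (of_real w * den A z powr (of_real w - 1) * of_int (A$2$1))) (at z)"
    by (rule DERIV_cmult DERIV_chain2[OF has_field_derivative_powr[OF nr] has_field_derivative_den])+
  moreover have "\<upsilon> A * (of_real w * den A z powr (of_real w - 1) * of_int (A$2$1)) =
     of_real w * of_int (A$2$1) / den A z * (\<upsilon> A * den A z powr of_real w)"
    using nz by (simp add: powr_diff)
  ultimately show ?thesis by (simp add: aut_def[abs_def])
qed

lemma aut_neg1_squared: "aut w \<upsilon> (mat22 (-1) 0 0 (-1)) z ^ 2 = 1"
proof -
  have "mat22 (-1) 0 0 (-1) ** mat22 (-1) 0 0 (-1) = mat 1" by (simp add: mat22_simps)
  then have "aut w \<upsilon> (mat22 (-1) 0 0 (-1)) \<i> ^ 2 = 1"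
    using aut_mult[of "mat22 (-1) 0 0 (-1)" "mat22 (-1) 0 0 (-1)" \<i>] by (simp add: aut_1 power2_eq_square)
  then show ?thesis by (simp add: aut_def)
qed

lemma norm_multiplier_T: "norm (\<upsilon> T_mat) = 1"
  by (rule multiplier_systemD(1)[OF ms SL2Z_T])

end

text \<open>The cocycle property at \<open>(-I)\<^sup>2 = I\<close> reads
  \<open>(\<upsilon> (-I))\<^sup>2 * exp (2 * pi * \<i> * w) = 1\<close>, which fixes
  \<open>w\<close> modulo 1. This discreteness is what lets a least weight exist.\<close>

lemma multiplier_weights_differ_by_int:
  assumes 1: "multiplier_system w \<upsilon>" and 2: "multiplier_system w' \<upsilon>"
  shows "\<exists>n::int. w' = w + of_int n"
proof -
  let ?I = "mat22 (-1) 0 0 (-1)"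
  have eq: "\<upsilon> ?I ^ 2 * exp (2 * of_real pi * \<i> * of_real x) = 1" if "multiplier_system x \<upsilon>" for x
  proof -
    have "((-1) powr of_real x) ^ 2 = exp (2 * of_real pi * \<i> * complex_of_real x)"
      by (simp add: powr_def exp_double[symmetric] mult_ac)
    then show ?thesis
      using aut_neg1_squared[OF that, of \<i>] by (simp add: aut_def power_mult_distrib)
  qed
  have "\<upsilon> ?I ^ 2 \<noteq> 0" using eq[OF 1] by auto
  then have "exp (2 * of_real pi * \<i> * of_real w') = exp (2 * of_real pi * \<i> * complex_of_real w)"
    using eq[OF 1] eq[OF 2] by (metis mult_cancel_left)
  then obtain n :: int where "2 * of_real pi * \<i> * of_real w' = 2 * of_real pi * \<i> * of_real w + of_int (2 * n) * of_real pi * \<i>"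
    unfolding exp_eq by auto
  then have "(2 * of_real pi * \<i>) * of_real w' = (2 * of_real pi * \<i>) * (of_real w + of_int n)"
    by (simp add: algebra_simps)
  then have "complex_of_real w' = of_real (w + of_int n)" by simp
  then show ?thesis by (metis of_real_eq_iff)
qed

lemma cis_cusp_parameter:
  assumes "norm (\<upsilon> T_mat) = 1"
  shows "cis (2 * pi * cusp_parameter \<upsilon> / 12) = \<upsilon> T_mat"
proof -
  define m where "m = 12 * Arg2pi (\<upsilon> T_mat) / (2 * pi)"
  have "\<upsilon> T_mat = cis (Arg2pi (\<upsilon> T_mat))"
    using Arg2pi_eq[of "\<upsilon> T_mat"] assms by (simp add: cis_conv_exp)
  then have m: "0 \<le> m \<and> m < 12 \<and> \<upsilon> T_mat = cis (2 * pi * m / 12)"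
    using Arg2pi_ge_0[of "\<upsilon> T_mat"] Arg2pi_lt_2pi[of "\<upsilon> T_mat"] by (simp add: m_def field_simps)
  have uniq: "m' = m" if m': "0 \<le> m' \<and> m' < 12 \<and> \<upsilon> T_mat = cis (2 * pi * m' / 12)" for m'
  proof -
    have "cis (2 * pi * m' / 12) = cis (2 * pi * m / 12)" using m m' by simp
    then obtain n :: int where "2 * pi * m' / 12 = 2 * pi * m / 12 + 2 * pi * n"
      using sin_cos_eq_iff[of "2 * pi * m' / 12" "2 * pi * m / 12"] by (auto simp: complex_eq_iff)
    then have "pi * m' = pi * (m + 12 * n)" by (simp add: field_simps)
    then have "m' = m + 12 * n" by simp
    moreover from this have "n = 0" using m m' by linarith
    ultimately show ?thesis by simp
  qed
  have "cusp_parameter \<upsilon> = m" unfolding cusp_parameter_def by (rule the_equality, rule m, rule uniq)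
  then show ?thesis using m by (simp only:)
qed

section \<open>Vector-valued modular forms of an irreducible representation\<close>

lemma vvmf_iff:
  assumes ms: "multiplier_system w \<upsilon>"
  shows "F \<in> vvmf w \<rho> \<upsilon> \<longleftrightarrow>
     (\<forall>z. Im z \<le> 0 \<longrightarrow> F z = 0) \<and>
     (\<forall>j. (\<lambda>z. F z $ j) holomorphic_on upper_half_plane) \<and>
     (\<forall>j. moderate_growth (\<lambda>z. F z $ j)) \<and>
     (\<forall>A\<in>SL2Z. \<forall>z. Im z > 0 \<longrightarrow> F (moebius A z) = aut w \<upsilon> A z *s (\<rho> A *v F z))"
proof -
  have "(\<chi> j. slash w \<upsilon> A (\<lambda>w. F w $ j) z) = \<rho> A *v F z \<longleftrightarrow> F (moebius A z) = aut w \<upsilon> A z *s (\<rho> A *v F z)"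
    if "A \<in> SL2Z" "Im z > 0" for A z
    using aut_nonzero[OF ms that] by (auto simp: slash_eq vec_eq_iff field_simps)
  then show ?thesis unfolding vvmf_def by (auto simp: not_less)
qed

text \<open>The dimension stays arbitrary here; five enters only in the last section.
  \<open>\<kappa>\<close> is some weight of \<open>\<upsilon>\<close>, and all others differ from it
  by integers.\<close>

locale irreducible_vvmf =
  fixes \<rho> :: "int^2^2 \<Rightarrow> complex^'n^'n" and \<upsilon> :: "int^2^2 \<Rightarrow> complex" and r \<Lambda> :: "'n \<Rightarrow> real" and \<kappa> :: real
  assumes irr: "irreducible_representation \<rho>"
    and rho_T: "\<rho> T_mat = (\<chi> i j. if i = j then cis (2 * pi * r i) else 0)"
    and ms: "multiplier_system \<kappa> \<upsilon>"
    and adm: "minimal_admissible r \<upsilon> \<Lambda>"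
begin

lemma rho_mult: "A \<in> SL2Z \<Longrightarrow> B \<in> SL2Z \<Longrightarrow> \<rho> (A ** B) = \<rho> A ** \<rho> B"
  and rho_invertible: "A \<in> SL2Z \<Longrightarrow> invertible (\<rho> A)"
  using irr unfolding irreducible_representation_def representation_def by auto

lemma rho_1: "\<rho> (mat 1) = mat 1"
proof -
  have "\<rho> (mat 1) = \<rho> (mat 1) ** \<rho> (mat 1)" using rho_mult[of "mat 1" "mat 1"] by simp
  moreover obtain B where "B ** \<rho> (mat 1) = mat 1" using rho_invertible[of "mat 1"] by (auto simp: invertible_def)
  ultimately show ?thesis by (metis matrix_mul_assoc matrix_mul_lid)
qed

lemma rho_adj: "A \<in> SL2Z \<Longrightarrow> \<rho> (adj22 A) ** \<rho> A = mat 1"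
  using rho_mult[of "adj22 A" A] by (simp add: adj22_left rho_1)

text \<open>The determinant is a character: at \<open>S\<close> a fourth root of unity, at
  \<open>T\<close> a product of numbers \<open>cis (2 * pi * r i)\<close> with real
  \<open>r i\<close>. This replaces unitarity of \<open>\<rho>\<close> in the estimate of the
  Wronskian.\<close>

lemma norm_det_rho: "A \<in> SL2Z \<Longrightarrow> norm (det (\<rho> A)) = 1"
proof (induction rule: SL2Z_generated)
  case S
  have "(S_mat ** S_mat) ** (S_mat ** S_mat) = mat 1" by (simp add: S_squared mat22_simps)
  then have "det (\<rho> ((S_mat ** S_mat) ** (S_mat ** S_mat))) = 1" by (simp add: rho_1)
  then have "det (\<rho> S_mat) ^ 4 = 1"
    by (simp add: rho_mult SL2Z_mult det_mul power4_eq_xxxx mult.assoc del: S_squared)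
  then have "norm (det (\<rho> S_mat)) ^ 4 = 1" by (simp add: norm_power[symmetric])
  then show ?case using power_eq_1_iff[of "norm (det (\<rho> S_mat))" 4] by simp
next
  case T
  have "det (\<rho> T_mat) = (\<Prod>i\<in>UNIV. \<rho> T_mat $ i $ i)"
    by (rule det_diagonal) (simp add: rho_T)
  then show ?case by (simp add: rho_T prod_norm[symmetric])
next
  case (inv A)
  have "det (\<rho> (adj22 A)) * det (\<rho> A) = 1" using rho_adj[OF inv(1)] by (metis det_I det_mul)
  then have "norm (det (\<rho> (adj22 A))) * norm (det (\<rho> A)) = 1" by (metis norm_mult norm_one)
  then show ?case using inv(2) by simp
next
  case (mult A B)
  then show ?case by (simp add: rho_mult det_mul norm_mult)
qed

lemma ms_int: "multiplier_system (\<kappa> + of_int n) \<upsilon>"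
  by (rule multiplier_system_add_int[OF ms])

lemma invariant_subspace_UNIV:
  assumes "vec.subspace W" "\<And>A w. A \<in> SL2Z \<Longrightarrow> w \<in> W \<Longrightarrow> \<rho> A *v w \<in> W" "w \<in> W" "w \<noteq> 0"
  shows "W = UNIV"
  using irr assms unfolding irreducible_representation_def by blast

lemma T_eigenvalue: "\<upsilon> T_mat * cis (2 * pi * r j) = cis (2 * pi * \<Lambda> j)"
proof -
  obtain n :: int where "\<Lambda> j = r j + cusp_parameter \<upsilon> / 12 + of_int n"
    using adm unfolding minimal_admissible_def by (metis Ints_cases add.commute diff_add_cancel)
  then have "2 * pi * \<Lambda> j = 2 * pi * cusp_parameter \<upsilon> / 12 + 2 * pi * r j + 2 * pi * of_int n"
    by (simp add: algebra_simps)
  then have "cis (2 * pi * \<Lambda> j) = cis (2 * pi * cusp_parameter \<upsilon> / 12) * cis (2 * pi * r j) * cis (2 * pi * of_int n)"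
    by (simp only: cis_mult)
  then show ?thesis
    unfolding cis_cusp_parameter[of \<upsilon>, OF norm_multiplier_T[OF ms]] by (simp add: cis_multiple_2pi)
qed

lemma Lambda_bounds: "0 \<le> \<Lambda> j" "\<Lambda> j < 1"
  using adm by (auto simp: minimal_admissible_def)

lemma rho_T_mult: "(\<rho> T_mat *v v) $ j = cis (2 * pi * r j) * v $ j"
proof -
  have "(\<rho> T_mat *v v) $ j = (\<Sum>i\<in>UNIV. if j = i then cis (2 * pi * r j) * v $ i else 0)"
    by (simp add: matrix_vector_mult_def rho_T if_distrib if_distribR cong: if_cong)
  then show ?thesis by simp
qed

lemma transform_T:
  assumes "\<And>A z. A \<in> SL2Z \<Longrightarrow> Im z > 0 \<Longrightarrow> F (moebius A z) = aut w \<upsilon> A z *s (\<rho> A *v F z)" and z: "Im z > 0"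
  shows "F (z + 1) $ j = cis (2 * pi * \<Lambda> j) * F z $ j"
  using assms(1)[OF SL2Z_T z] by (simp add: rho_T_mult aut_def T_eigenvalue[symmetric])

text \<open>Moderate growth is exchanged for the exponent \<open>\<Lambda> j\<close>:
  \<open>\<Lambda> j \<ge> 0\<close> yields growth from the expansion here, and
  \<open>\<Lambda> j < 1\<close> yields the expansion from growth in \<open>vvmfD\<close>.\<close>

lemma vvmfI:
  assumes w: "multiplier_system w \<upsilon>"
    and "\<And>z. Im z \<le> 0 \<Longrightarrow> F z = 0" "\<And>j. q_class (\<Lambda> j) (\<lambda>z. F z $ j)"
    and "\<And>A z. A \<in> SL2Z \<Longrightarrow> Im z > 0 \<Longrightarrow> F (moebius A z) = aut w \<upsilon> A z *s (\<rho> A *v F z)"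
  shows "F \<in> vvmf w \<rho> \<upsilon>"
  unfolding vvmf_iff[OF w]
proof (intro conjI allI ballI impI)
  show "(\<lambda>z. F z $ j) holomorphic_on upper_half_plane" for j by (rule q_class_holomorphic[OF assms(3)])
  show "moderate_growth (\<lambda>z. F z $ j)" for j by (rule q_class_moderate_growth[OF assms(3) Lambda_bounds(1)])
qed (use assms in auto)

lemma vvmfD:
  assumes w: "multiplier_system w \<upsilon>" and F: "F \<in> vvmf w \<rho> \<upsilon>"
  shows "Im z \<le> 0 \<Longrightarrow> F z = 0"
    and "(\<lambda>z. F z $ j) holomorphic_on upper_half_plane"
    and "A \<in> SL2Z \<Longrightarrow> Im z > 0 \<Longrightarrow> F (moebius A z) = aut w \<upsilon> A z *s (\<rho> A *v F z)"
    and "q_class (\<Lambda> j) (\<lambda>z. F z $ j)"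
proof -
  have *: "F (moebius A z) = aut w \<upsilon> A z *s (\<rho> A *v F z)" if "A \<in> SL2Z" "Im z > 0" for A z
    using F that by (auto simp: vvmf_iff[OF w])
  show "Im z \<le> 0 \<Longrightarrow> F z = 0" "(\<lambda>z. F z $ j) holomorphic_on upper_half_plane"
    using F by (auto simp: vvmf_iff[OF w])
  show "A \<in> SL2Z \<Longrightarrow> Im z > 0 \<Longrightarrow> F (moebius A z) = aut w \<upsilon> A z *s (\<rho> A *v F z)" by (rule *)
  show "q_class (\<Lambda> j) (\<lambda>z. F z $ j)"
  proof (rule q_class_of_moderate_growth)
    show "(\<lambda>z. F z $ j) holomorphic_on upper_half_plane" "moderate_growth (\<lambda>z. F z $ j)"
      using F by (auto simp: vvmf_iff[OF w])
    show "F (z + 1) $ j = cis (2 * pi * \<Lambda> j) * F z $ j" if "Im z > 0" for z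
      by (rule transform_T[OF * that])
  qed (rule Lambda_bounds)
qed

lemma vvmf_nonzero_somewhere:
  assumes w: "multiplier_system w \<upsilon>" and F: "F \<in> vvmf w \<rho> \<upsilon>" "F \<noteq> 0"
  shows "\<exists>z. Im z > 0 \<and> F z \<noteq> 0"
proof (rule ccontr)
  assume "\<not> ?thesis"
  then have "F z = 0" for z using vvmfD(1)[OF w F(1), of z] by (cases "Im z > 0") auto
  then show False using F(2) by (auto simp: fun_eq_iff)
qed

lemma vvmf_mult:
  assumes w: "multiplier_system w \<upsilon>" "multiplier_system (w + of_nat k) \<upsilon>" and F: "F \<in> vvmf w \<rho> \<upsilon>"
    and g: "q_class 0 g" and mod: "\<And>A z. A \<in> SL2Z \<Longrightarrow> Im z > 0 \<Longrightarrow> g (moebius A z) = den A z ^ k * g z"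
  shows "(\<lambda>z. g z *s F z) \<in> vvmf (w + of_nat k) \<rho> \<upsilon>"
proof (rule vvmfI[OF w(2)])
  show "g z *s F z = 0" if "Im z \<le> 0" for z using vvmfD(1)[OF w(1) F that] by simp
  show "q_class (\<Lambda> j) (\<lambda>z. (g z *s F z) $ j)" for j
    using q_class_mult0[OF g vvmfD(4)[OF w(1) F, of j]] by simp
  show "g (moebius A z) *s F (moebius A z) = aut (w + of_nat k) \<upsilon> A z *s (\<rho> A *v (g z *s F z))"
    if "A \<in> SL2Z" "Im z > 0" for A z
    unfolding vvmfD(3)[OF w(1) F that] mod[OF that] aut_add_nat[OF w(1) that]
    by (simp add: vec_eq_iff vector_scalar_commute mult_ac)
qed

text \<open>The transformation law of the quotient holds where \<open>g \<noteq> 0\<close> and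
  extends by analytic continuation. At the cusp \<open>unit\<close> turns the growth bound for
  \<open>F\<close> into one for \<open>G\<close>, and it also supplies a point with
  \<open>g \<noteq> 0\<close>.\<close>

lemma vvmf_divide:
  assumes w: "multiplier_system w \<upsilon>" "multiplier_system (w + of_nat k) \<upsilon>" and F: "F \<in> vvmf (w + of_nat k) \<rho> \<upsilon>"
    and g: "q_class 0 g" and mod: "\<And>A z. A \<in> SL2Z \<Longrightarrow> Im z > 0 \<Longrightarrow> g (moebius A z) = den A z ^ k * g z"
    and unit: "\<And>z. Im z \<ge> b \<Longrightarrow> norm (g z) \<ge> 1 / 2"
    and zero: "\<And>z. Im z > 0 \<Longrightarrow> g z = 0 \<Longrightarrow> F z = 0 \<and> deriv g z \<noteq> 0"
  shows "\<exists>G\<in>vvmf w \<rho> \<upsilon>. F = (\<lambda>z. g z *s G z)"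
proof -
  have ghol: "g holomorphic_on upper_half_plane" by (rule q_class_holomorphic[OF g])
  have "\<exists>h. h holomorphic_on upper_half_plane \<and> (\<forall>z. Im z > 0 \<longrightarrow> F z $ j = g z * h z)" for j
    using holomorphic_division[OF vvmfD(2)[OF w(2) F, of j] ghol open_upper_half_plane] zero
    by (metis upper_half_plane_iff zero_index)
  then obtain h where h: "\<And>j. h j holomorphic_on upper_half_plane" "\<And>j z. Im z > 0 \<Longrightarrow> F z $ j = g z * h j z" by metis
  define G where "G z = (if Im z > 0 then \<chi> j. h j z else 0)" for z
  have FG: "F z = g z *s G z" for z
    using h(2)[of z] vvmfD(1)[OF w(2) F, of z] by (cases "Im z > 0") (auto simp: G_def vec_eq_iff)
  have Ghol: "(\<lambda>z. G z $ j) holomorphic_on upper_half_plane" for j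
    by (rule holomorphic_transform[OF h(1)[of j]]) (simp add: G_def)
  define b' where "b' = max b 1"
  define X where "X = {z \<in> upper_half_plane. g z \<noteq> 0}"
  have X: "open X"
  proof -
    have "open (upper_half_plane \<inter> g -` (- {0}))"
      by (intro continuous_open_preimage holomorphic_on_imp_continuous_on ghol) auto
    then show ?thesis by (simp add: X_def Int_def vimage_def)
  qed
  have "Complex 0 b' \<in> X"
    using unit[of "Complex 0 b'"] by (auto simp: X_def b'_def)
  then have Xne: "X \<noteq> {}" by blast
  have transX: "G (moebius A z) $ j = (aut w \<upsilon> A z *s (\<rho> A *v G z)) $ j" if A: "A \<in> SL2Z" and z: "z \<in> X" for A z j
  proof -
    have z': "Im z > 0" "g z \<noteq> 0" using z by (auto simp: X_def)
    have dn: "den A z \<noteq> 0" using A z'(1) by (rule den_nonzero)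
    have "g (moebius A z) *s G (moebius A z) = aut (w + of_nat k) \<upsilon> A z *s (\<rho> A *v (g z *s G z))"
      using vvmfD(3)[OF w(2) F A z'(1)] by (simp add: FG)
    then have "(den A z ^ k * g z) *s G (moebius A z) = (den A z ^ k * g z) *s (aut w \<upsilon> A z *s (\<rho> A *v G z))"
      unfolding mod[OF A z'(1)] aut_add_nat[OF w(1) A z'(1)]
      by (simp add: vec_eq_iff vector_scalar_commute mult_ac)
    then show ?thesis using dn z' by (simp add: vec_eq_iff)
  qed
  have trans: "G (moebius A z) = aut w \<upsilon> A z *s (\<rho> A *v G z)" if A: "A \<in> SL2Z" and z: "Im z > 0" for A z
  proof -
    have "G (moebius A z) $ j = (aut w \<upsilon> A z *s (\<rho> A *v G z)) $ j" for j
    proof (rule analytic_continuation_open[where f = "\<lambda>z. G (moebius A z) $ j" and g = "\<lambda>z. (aut w \<upsilon> A z *s (\<rho> A *v G z)) $ j", OF X open_upper_half_plane Xne connected_upper_half_plane])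
      show "X \<subseteq> upper_half_plane" by (auto simp: X_def)
      have "((\<lambda>z. G z $ j) \<circ> moebius A) holomorphic_on upper_half_plane"
        by (rule holomorphic_on_compose_gen[OF holomorphic_moebius[OF A] Ghol]) (auto simp: Im_moebius_pos A)
      then show "(\<lambda>z. G (moebius A z) $ j) holomorphic_on upper_half_plane" by (simp add: o_def)
      have "(\<lambda>z. aut w \<upsilon> A z * (\<Sum>i\<in>UNIV. \<rho> A $ j $ i * G z $ i)) holomorphic_on upper_half_plane"
        by (intro holomorphic_intros holomorphic_aut[OF w(1) A] Ghol)
      then show "(\<lambda>z. (aut w \<upsilon> A z *s (\<rho> A *v G z)) $ j) holomorphic_on upper_half_plane"
        by (simp add: matrix_vector_mult_def)
    qed (use transX[OF A] z in auto)
    then show ?thesis by (simp add: vec_eq_iff)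
  qed
  have "G \<in> vvmf w \<rho> \<upsilon>"
  proof (rule vvmfI[OF w(1)])
    show "q_class (\<Lambda> j) (\<lambda>z. G z $ j)" for j
    proof (rule q_class_of_moderate_growth[OF Ghol])
      show "G (z + 1) $ j = cis (2 * pi * \<Lambda> j) * G z $ j" if "Im z > 0" for z
        by (rule transform_T[OF trans that])
      have "moderate_growth (\<lambda>z. 2 * F z $ j)"
        by (intro moderate_growth_scale q_class_moderate_growth[OF vvmfD(4)[OF w(2) F] Lambda_bounds(1)])
      then obtain N :: nat where N: "\<forall>\<^sub>F y in at_top. \<forall>x. norm (2 * F (Complex x y) $ j) < y ^ N"
        by (auto simp: moderate_growth_def)
      have "\<forall>\<^sub>F y in at_top. \<forall>x. norm (G (Complex x y) $ j) < y ^ N"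
        using N eventually_ge_at_top[of b]
      proof eventually_elim
        case (elim y)
        show ?case
        proof
          fix x
          have "1 / 2 * norm (G (Complex x y) $ j) \<le> norm (g (Complex x y)) * norm (G (Complex x y) $ j)"
            using unit[of "Complex x y"] elim(2) by (intro mult_right_mono) auto
          also have "\<dots> = norm (F (Complex x y) $ j)" by (simp add: FG norm_mult)
          finally show "norm (G (Complex x y) $ j) < y ^ N"
            using elim(1)[rule_format, of x] by (simp add: norm_mult)
        qed
      qed
      then show "moderate_growth (\<lambda>z. G z $ j)" unfolding moderate_growth_def by blast
    qed (rule Lambda_bounds)
  qed (use trans in \<open>auto simp: G_def\<close>)
  then show ?thesis using FG by (intro bexI[of _ G]) auto
qed

end

lemma q_class_unit_at_cusp:
  assumes h: "h holomorphic_on ball 0 1" "h 0 = 1" and f: "\<And>z. f z = h (qp 1 z)"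
  shows "\<exists>b. \<forall>z. Im z \<ge> b \<longrightarrow> norm (f z) \<ge> 1 / 2"
proof -
  have "isCont h 0" using h(1) by (intro continuous_on_interior[OF holomorphic_on_imp_continuous_on]) auto
  then have "(\<lambda>q. norm (h q)) \<midarrow>0\<rightarrow> 1" using h(2) by (auto simp: isCont_def intro!: tendsto_eq_intros)
  then have "eventually (\<lambda>q. norm (h q) > 1 / 2) (at 0)" by (rule order_tendstoD) simp
  then obtain d where d: "d > 0" "\<And>q. q \<noteq> 0 \<Longrightarrow> norm q < d \<Longrightarrow> norm (h q) > 1 / 2"
    by (auto simp: eventually_at)
  have "norm (f z) \<ge> 1 / 2" if z: "Im z \<ge> 1 / (2 * pi * d)" for z
  proof -
    have "1 / d \<le> 2 * pi * Im z" using z d by (simp add: field_simps)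
    also have "\<dots> < exp (2 * pi * Im z)" using exp_ge_add_one_self[of "2 * pi * Im z"] by linarith
    finally have "norm (qp 1 z) < d" using d by (simp add: norm_qp exp_minus field_simps)
    then show ?thesis using d(2)[of "qp 1 z"] by (simp add: f)
  qed
  then show ?thesis by blast
qed

context irreducible_vvmf
begin

section \<open>Multiplication and division by E4 and E6\<close>

lemma vvmf_mult_E4:
  "multiplier_system w \<upsilon> \<Longrightarrow> F \<in> vvmf w \<rho> \<upsilon> \<Longrightarrow> (\<lambda>z. E4 z *s F z) \<in> vvmf (w + 4) \<rho> \<upsilon>"
  using vvmf_mult[of w 4 F E4] multiplier_system_add_int[of w \<upsilon> 4] by (simp add: q_class_E4 E4_modular)

lemma vvmf_mult_E6:
  "multiplier_system w \<upsilon> \<Longrightarrow> F \<in> vvmf w \<rho> \<upsilon> \<Longrightarrow> (\<lambda>z. E6 z *s F z) \<in> vvmf (w + 6) \<rho> \<upsilon>"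
  using vvmf_mult[of w 6 F E6] multiplier_system_add_int[of w \<upsilon> 6] by (simp add: q_class_E6 E6_modular)

lemma vvmf_zero_orbit:
  assumes "multiplier_system w \<upsilon>" "F \<in> vvmf w \<rho> \<upsilon>" "F p = 0" "A \<in> SL2Z" "Im p > 0"
  shows "F (moebius A p) = 0"
  using vvmfD(3)[OF assms(1,2,4,5)] assms(3) by simp

lemma vvmf_divide_E4:
  assumes w: "multiplier_system w \<upsilon>" and F: "F \<in> vvmf (w + 4) \<rho> \<upsilon>" "F rho3 = 0"
  shows "\<exists>G\<in>vvmf w \<rho> \<upsilon>. F = (\<lambda>z. E4 z *s G z)"
proof -
  have w4: "multiplier_system (w + 4) \<upsilon>" using multiplier_system_add_int[OF w, of 4] by simp
  have "\<exists>b. \<forall>z. Im z \<ge> b \<longrightarrow> norm (E4 z) \<ge> 1 / 2"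
    by (rule q_class_unit_at_cusp[of "\<lambda>q. 1 + 240 * Lam 3 q"])
       (auto simp: E4_def intro!: holomorphic_intros holomorphic_Lam)
  then obtain b where b: "\<And>z. Im z \<ge> b \<Longrightarrow> norm (E4 z) \<ge> 1 / 2" by blast
  have zero: "F z = 0 \<and> deriv E4 z \<noteq> 0" if z: "Im z > 0" "E4 z = 0" for z
    using E4_zero[OF z] vvmf_zero_orbit[OF w4 F] by (metis rho3_Im(1))
  show ?thesis
    by (rule vvmf_divide[where k = 4 and b = b, OF w _ _ q_class_E4 E4_modular b zero]) (use w4 F in simp_all)
qed

lemma vvmf_divide_E6:
  assumes w: "multiplier_system w \<upsilon>" and F: "F \<in> vvmf (w + 6) \<rho> \<upsilon>" "F \<i> = 0"
  shows "\<exists>G\<in>vvmf w \<rho> \<upsilon>. F = (\<lambda>z. E6 z *s G z)"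
proof -
  have w6: "multiplier_system (w + 6) \<upsilon>" using multiplier_system_add_int[OF w, of 6] by simp
  have "\<exists>b. \<forall>z. Im z \<ge> b \<longrightarrow> norm (E6 z) \<ge> 1 / 2"
    by (rule q_class_unit_at_cusp[of "\<lambda>q. 1 - 504 * Lam 5 q"])
       (auto simp: E6_def intro!: holomorphic_intros holomorphic_Lam)
  then obtain b where b: "\<And>z. Im z \<ge> b \<Longrightarrow> norm (E6 z) \<ge> 1 / 2" by blast
  have zero: "F z = 0 \<and> deriv E6 z \<noteq> 0" if z: "Im z > 0" "E6 z = 0" for z
    using E6_zero[OF z] vvmf_zero_orbit[OF w6 F] by (metis imaginary_unit.sel(2) zero_less_one)
  show ?thesis
    by (rule vvmf_divide[where k = 6 and b = b, OF w _ _ q_class_E6 E6_modular b zero]) (use w6 F in simp_all)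
qed

section \<open>The modular derivative\<close>

text \<open>The Serre derivative without the factor \<open>1 / (2 * pi * \<i>)\<close>. The extra
  term \<open>12 * c * den\<close> in the law of \<open>phi\<close>, times \<open>w / 12\<close>,
  cancels what differentiating an automorphy factor of weight \<open>w\<close> produces.\<close>

definition Dop :: "real \<Rightarrow> (complex \<Rightarrow> complex^'n) \<Rightarrow> complex \<Rightarrow> complex^'n" where
  "Dop w F z = (if Im z > 0 then \<chi> j. deriv (\<lambda>z. F z $ j) z - of_real w / 12 * phi z * F z $ j else 0)"

lemma Dop_vvmf:
  assumes w: "multiplier_system w \<upsilon>" and F: "F \<in> vvmf w \<rho> \<upsilon>"
  shows "Dop w F \<in> vvmf (w + 2) \<rho> \<upsilon>"
proof (rule vvmfI)
  show w2: "multiplier_system (w + 2) \<upsilon>" using multiplier_system_add_int[OF w, of 2] by simp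
  show "Dop w F z = 0" if "Im z \<le> 0" for z using that by (simp add: Dop_def)
  show "q_class (\<Lambda> j) (\<lambda>z. Dop w F z $ j)" for j
  proof -
    have "q_class (\<Lambda> j) (\<lambda>z. deriv (\<lambda>z. F z $ j) z - (of_real w / 12 * phi z) * F z $ j)"
      by (intro q_class_diff q_class_deriv q_class_mult0 q_class_cmult q_class_phi vvmfD(4)[OF w F])
    then show ?thesis by (rule q_class_cong[THEN iffD1, rotated]) (simp add: Dop_def)
  qed
  fix A z assume A: "A \<in> SL2Z" and z: "Im z > 0"
  let ?J = "aut w \<upsilon> A z"
  have dn: "den A z \<noteq> 0" using A z by (rule den_nonzero)
  have dF: "((\<lambda>z. F z $ j) has_field_derivative deriv (\<lambda>z. F z $ j) z) (at z)" if "Im z > 0" for j z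
    using that by (intro holomorphic_derivI[OF vvmfD(2)[OF w F]]) auto
  have "Dop w F (moebius A z) $ i = (aut (w + 2) \<upsilon> A z *s (\<rho> A *v Dop w F z)) $ i" for i
  proof -
    let ?R = "\<lambda>z. \<Sum>j\<in>UNIV. \<rho> A $ i $ j * F z $ j"
    let ?R' = "\<Sum>j\<in>UNIV. \<rho> A $ i $ j * deriv (\<lambda>z. F z $ j) z"
    have d1: "((\<lambda>z. F (moebius A z) $ i) has_field_derivative deriv (\<lambda>z. F z $ i) (moebius A z) * (1 / (den A z)\<^sup>2)) (at z)"
      by (rule DERIV_chain2[OF dF[OF Im_moebius_pos[OF A z]] has_field_derivative_moebius[OF A z]])
    have dR: "(?R has_field_derivative ?R') (at z)"
      by (intro DERIV_sum DERIV_cmult dF z)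
    have d2: "((\<lambda>z. aut w \<upsilon> A z * ?R z) has_field_derivative
       (of_real w * of_int (A$2$1) / den A z * ?J) * ?R z + ?R' * ?J) (at z)"
      by (rule DERIV_mult[OF has_field_derivative_aut[OF w A z] dR])
    have "eventually (\<lambda>z. z \<in> upper_half_plane) (nhds z)"
      using z by (intro eventually_nhds_in_open) auto
    then have e: "eventually (\<lambda>z. F (moebius A z) $ i = aut w \<upsilon> A z * ?R z) (nhds z)"
      by eventually_elim (simp add: vvmfD(3)[OF w F A] matrix_vector_mult_def)
    have "deriv (\<lambda>z. F z $ i) (moebius A z) * (1 / (den A z)\<^sup>2) =
       (of_real w * of_int (A$2$1) / den A z * ?J) * ?R z + ?R' * ?J"
      by (rule DERIV_unique[OF d1 iffD2[OF DERIV_cong_ev[OF refl e refl] d2]])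
    then have 1: "deriv (\<lambda>z. F z $ i) (moebius A z) = (den A z)\<^sup>2 * ((of_real w * of_int (A$2$1) / den A z * ?J) * ?R z + ?R' * ?J)"
      using dn by (simp add: field_simps)
    have 2: "F (moebius A z) $ i = ?J * ?R z"
      by (simp add: vvmfD(3)[OF w F A z] matrix_vector_mult_def)
    have "Dop w F (moebius A z) $ i = (den A z)\<^sup>2 * ((of_real w * of_int (A$2$1) / den A z * ?J) * ?R z + ?R' * ?J)
       - of_real w / 12 * (den A z ^ 2 * phi z + 12 * of_int (A$2$1) * den A z) * (?J * ?R z)"
      using Im_moebius_pos[OF A z] by (simp only: Dop_def if_True vec_lambda_beta 1 2 phi_modular[OF A z])
    also have "\<dots> = den A z ^ 2 * ?J * (?R' - of_real w / 12 * phi z * ?R z)"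
      using dn by (simp add: field_simps power2_eq_square)
    also have "?R' - of_real w / 12 * phi z * ?R z = (\<Sum>j\<in>UNIV. \<rho> A $ i $ j * Dop w F z $ j)"
      using z by (simp add: Dop_def sum_subtractf right_diff_distrib sum_distrib_left mult_ac)
    finally show ?thesis
      using aut_add_nat[OF w A z, of 2] by (simp add: matrix_vector_mult_def mult_ac)
  qed
  then show "Dop w F (moebius A z) = aut (w + 2) \<upsilon> A z *s (\<rho> A *v Dop w F z)"
    by (simp add: vec_eq_iff)
qed

lemma Dop_mult:
  assumes w: "multiplier_system w \<upsilon>" and F: "F \<in> vvmf w \<rho> \<upsilon>" and g: "g holomorphic_on upper_half_plane" and z: "Im z > 0"
  shows "Dop (w + k) (\<lambda>z. g z *s F z) z = g z *s Dop w F z + (deriv g z - of_real k / 12 * phi z * g z) *s F z"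
proof -
  have "deriv (\<lambda>z. (g z *s F z) $ j) z = deriv g z * F z $ j + g z * deriv (\<lambda>z. F z $ j) z" for j
  proof -
    have "((\<lambda>z. g z * F z $ j) has_field_derivative deriv g z * F z $ j + deriv (\<lambda>z. F z $ j) z * g z) (at z)"
      using z by (intro DERIV_mult holomorphic_derivI[OF g] holomorphic_derivI[OF vvmfD(2)[OF w F]]) auto
    then show ?thesis by (simp add: DERIV_imp_deriv mult.commute)
  qed
  then show ?thesis using z
    by (simp add: Dop_def vec_eq_iff algebra_simps add_divide_distrib)
qed

lemma Dop_add:
  assumes w: "multiplier_system w \<upsilon>" and F: "F \<in> vvmf w \<rho> \<upsilon>" and G: "G \<in> vvmf w \<rho> \<upsilon>"
  shows "Dop w (F + G) = Dop w F + Dop w G"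
proof
  fix z
  show "Dop w (F + G) z = (Dop w F + Dop w G) z"
  proof (cases "Im z > 0")
    case True
    have "deriv (\<lambda>z. F z $ j + G z $ j) z = deriv (\<lambda>z. F z $ j) z + deriv (\<lambda>z. G z $ j) z" for j
      using True by (intro DERIV_imp_deriv DERIV_add holomorphic_derivI[OF vvmfD(2)[OF w F]] holomorphic_derivI[OF vvmfD(2)[OF w G]]) auto
    then show ?thesis using True by (simp add: Dop_def vec_eq_iff algebra_simps)
  qed (simp add: Dop_def)
qed

primrec Dit :: "real \<Rightarrow> (complex \<Rightarrow> complex^'n) \<Rightarrow> nat \<Rightarrow> complex \<Rightarrow> complex^'n" where
  "Dit w F 0 = F"
| "Dit w F (Suc n) = Dop (w + 2 * real n) (Dit w F n)"

lemma ms_even: "multiplier_system w \<upsilon> \<Longrightarrow> multiplier_system (w + 2 * real n) \<upsilon>"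
  using multiplier_system_add_int[of w \<upsilon> "2 * int n"] by simp

lemma Dit_vvmf:
  assumes w: "multiplier_system w \<upsilon>" and F: "F \<in> vvmf w \<rho> \<upsilon>"
  shows "Dit w F n \<in> vvmf (w + 2 * real n) \<rho> \<upsilon>"
proof (induction n)
  case (Suc n)
  from Dop_vvmf[OF ms_even[OF w] this] show ?case by (simp add: algebra_simps)
qed (use F in simp)

text \<open>The values of \<open>F\<close> span a subspace stable under all \<open>\<rho> A\<close>,
  hence the whole space, and \<open>v\<close> annihilates it.\<close>

lemma vvmf_nondegenerate:
  assumes w: "multiplier_system w \<upsilon>" and F: "F \<in> vvmf w \<rho> \<upsilon>" "F \<noteq> 0"
    and v: "\<And>z. Im z > 0 \<Longrightarrow> (\<Sum>j\<in>UNIV. v $ j * F z $ j) = 0"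
  shows "v = 0"
proof -
  define W where "W = vec.span (F ` upper_half_plane)"
  have "\<rho> A *v x \<in> W" if A: "A \<in> SL2Z" and x: "x \<in> W" for A x
    using x unfolding W_def
  proof (induction rule: vec.span_induct_alt)
    case base
    then show ?case by (simp add: vec.span_zero)
  next
    case (step c y x)
    then obtain z where z: "Im z > 0" "y = F z" by auto
    have "F (moebius A z) = aut w \<upsilon> A z *s (\<rho> A *v y)" using vvmfD(3)[OF w F(1) A z(1)] z(2) by simp
    then have "\<rho> A *v y = inverse (aut w \<upsilon> A z) *s F (moebius A z)"
      using aut_nonzero[OF w A z(1)] by (simp add: vec_eq_iff)
    moreover have "F (moebius A z) \<in> vec.span (F ` upper_half_plane)"
      using z A by (intro vec.span_base) (auto simp: Im_moebius_pos)
    ultimately have "\<rho> A *v y \<in> vec.span (F ` upper_half_plane)" by (simp add: vec.span_scale)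
    then show ?case using step
      by (simp add: matrix_vector_right_distrib vector_scalar_commute vec.span_add vec.span_scale)
  qed
  moreover obtain z where z: "Im z > 0" "F z \<noteq> 0" using vvmf_nonzero_somewhere[OF w F] by blast
  moreover have "F z \<in> W" unfolding W_def using z by (intro vec.span_base) auto
  ultimately have W: "W = UNIV" by (intro invariant_subspace_UNIV[of W "F z"]) (auto simp: W_def)
  have "(\<Sum>j\<in>UNIV. v $ j * x $ j) = 0" if "x \<in> W" for x
    using that unfolding W_def
    by (induction rule: vec.span_induct_alt)
       (auto simp: distrib_left sum.distrib mult.left_commute sum_distrib_left[symmetric] v)
  then have "(\<Sum>j\<in>UNIV. v $ j * axis i 1 $ j) = 0" for i by (simp add: W)
  moreover have "(\<Sum>j\<in>UNIV. v $ j * axis i 1 $ j) = v $ i" for i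
    by (simp add: axis_def if_distrib cong: if_cong)
  ultimately show ?thesis by (simp add: vec_eq_iff)
qed

text \<open>The iterates satisfy the recursion of \<open>generic_independence\<close> with
  \<open>a n = (w + 2 * n) / 12 * phi\<close>. The index type carries no order, so
  \<open>idx\<close> numbers the columns.\<close>

lemma Wronskian_nonzero:
  assumes w: "multiplier_system w \<upsilon>" and F: "F \<in> vvmf w \<rho> \<upsilon>" "F \<noteq> 0"
  shows "\<exists>z idx. Im z > 0 \<and> bij_betw idx (UNIV :: 'n set) {..<CARD('n)} \<and> det (\<chi> i b. Dit w F (idx b) z $ i) \<noteq> 0"
proof -
  have "\<exists>z\<in>upper_half_plane. \<exists>idx. bij_betw idx (UNIV :: 'n set) {..<CARD('n)} \<and> det (\<chi> i b. Dit w F (idx b) z $ i) \<noteq> 0"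
  proof (rule generic_independence)
    show "(\<lambda>z. Dit w F n z $ j) holomorphic_on upper_half_plane" for n j
      by (rule vvmfD(2)[OF ms_even[OF w] Dit_vvmf[OF w F(1)]])
    show "(\<lambda>z. of_real (w + 2 * real n) / 12 * phi z) holomorphic_on upper_half_plane" for n
      by (intro holomorphic_intros holomorphic_phi) auto
    show "deriv (\<lambda>z. Dit w F n z $ j) z = Dit w F (Suc n) z $ j + of_real (w + 2 * real n) / 12 * phi z * Dit w F n z $ j"
      if "z \<in> upper_half_plane" for n j z
      using that by (simp add: Dop_def)
    show "v = 0" if "\<And>z. z \<in> upper_half_plane \<Longrightarrow> (\<Sum>j\<in>UNIV. v $ j * Dit w F 0 z $ j) = 0" for v
      by (rule vvmf_nondegenerate[OF w F]) (use that in simp)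
  qed auto
  then show ?thesis by auto
qed

text \<open>Only the absolute value of the Wronskian is used: its multiplier and the factor
  \<open>det (\<rho> A)\<close> both have absolute value 1.\<close>

lemma weight_bound:
  assumes w: "multiplier_system w \<upsilon>" and F: "F \<in> vvmf w \<rho> \<upsilon>" "F \<noteq> 0"
  shows "12 * (\<Sum>j\<in>UNIV. \<Lambda> j) \<le> real CARD('n) * w + real (CARD('n) * (CARD('n) - 1))"
proof (rule ccontr)
  assume neg: "\<not> ?thesis"
  obtain z idx where z: "Im z > 0" and idx: "bij_betw idx (UNIV :: 'n set) {..<CARD('n)}"
    and nz: "det (\<chi> i b. Dit w F (idx b) z $ i) \<noteq> 0" using Wronskian_nonzero[OF w F] by blast
  define W where "W z = det (\<chi> i b. Dit w F (idx b) z $ i)" for z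
  let ?m = "\<Sum>b\<in>UNIV. w + 2 * real (idx b)"
  have m: "?m = real CARD('n) * w + real (CARD('n) * (CARD('n) - 1))"
  proof -
    have "(\<Sum>b\<in>UNIV. real (idx b)) = (\<Sum>i<CARD('n). real i)"
      by (rule sum.reindex_bij_betw[OF idx])
    moreover have "2 * (\<Sum>i<n. real i) = real (n * (n - 1))" for n
      by (induction n) (auto simp: algebra_simps of_nat_diff)
    ultimately show ?thesis by (simp add: sum.distrib sum_distrib_left[symmetric])
  qed
  have "W z = 0"
  proof (rule modular_small_weight_vanishes[OF _ _ _ z])
    \<comment> \<open>Every summand of the determinant takes one factor from each component, so all
      permutations give the same exponent.\<close>
    have "q_class (\<Sum>j\<in>UNIV. \<Lambda> j) (\<lambda>z. of_int (sign p) * (\<Prod>i\<in>UNIV. Dit w F (idx (p i)) z $ i))" for p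
      by (intro q_class_cmult q_class_prod) (auto intro: vvmfD(4)[OF ms_even[OF w] Dit_vvmf[OF w F(1)]])
    moreover have "{p. p permutes (UNIV :: 'n set)} \<noteq> {}" using permutes_id by blast
    ultimately have "q_class (\<Sum>j\<in>UNIV. \<Lambda> j) (\<lambda>z. \<Sum>p | p permutes (UNIV :: 'n set). of_int (sign p) * (\<Prod>i\<in>UNIV. Dit w F (idx (p i)) z $ i))"
      by (intro q_class_sum) auto
    then show "q_class (\<Sum>j\<in>UNIV. \<Lambda> j) W" by (simp add: W_def[abs_def] det_def)
    show "?m < 12 * (\<Sum>j\<in>UNIV. \<Lambda> j)" using neg m by simp
    fix A z assume A: "A \<in> SL2Z" and z: "Im z > 0"
    let ?M = "\<chi> i b. Dit w F (idx b) z $ i"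
    let ?c = "\<lambda>b. aut (w + 2 * real (idx b)) \<upsilon> A z"
    \<comment> \<open>The columns are scaled by factors of different weights; after transposition
      this is a scaling of rows.\<close>
    have "(\<chi> i b. Dit w F (idx b) (moebius A z) $ i) = transpose (\<chi> b. ?c b *s (transpose (\<rho> A ** ?M)) $ b)"
      by (simp add: vec_eq_iff transpose_def vvmfD(3)[OF ms_even[OF w] Dit_vvmf[OF w F(1)] A z]
          matrix_vector_mult_def matrix_matrix_mult_def)
    then have "W (moebius A z) = prod ?c UNIV * (det (\<rho> A) * W z)"
      by (simp add: W_def det_transpose det_rows_mul det_mul)
    moreover have "norm (prod ?c UNIV) = norm (den A z) powr ?m"
    proof -
      have "norm (den A z) \<noteq> 0" using den_nonzero[OF A z] by simp
      then show ?thesis by (simp add: prod_norm[symmetric] norm_aut[OF ms_even[OF w] A] powr_sum)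
    qed
    ultimately show "norm (W (moebius A z)) = norm (den A z) powr ?m * norm (W z)"
      by (simp add: norm_mult norm_det_rho[OF A])
  qed
  then show False using nz by (simp add: W_def)
qed

end

section \<open>Poincare series\<close>

lemma norm_matrix_vector_le:
  fixes M :: "complex^'n^'m"
  shows "norm (M *v v) \<le> (\<Sum>i\<in>UNIV. \<Sum>j\<in>UNIV. norm (M $ i $ j)) * norm v"
proof -
  have "norm (M *v v) \<le> (\<Sum>i\<in>UNIV. norm ((M *v v) $ i))"
    unfolding norm_vec_def by (rule L2_set_le_sum) auto
  also have "\<dots> \<le> (\<Sum>i\<in>UNIV. \<Sum>j\<in>UNIV. norm (M $ i $ j) * norm v)"
  proof (rule sum_mono)
    fix i
    have "norm ((M *v v) $ i) \<le> (\<Sum>j\<in>UNIV. norm (M $ i $ j * v $ j))"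
      unfolding matrix_vector_mult_def by (simp add: norm_sum)
    also have "\<dots> \<le> (\<Sum>j\<in>UNIV. norm (M $ i $ j) * norm v)"
      by (intro sum_mono) (auto simp: norm_mult intro!: mult_left_mono Finite_Cartesian_Product.norm_nth_le)
    finally show "norm ((M *v v) $ i) \<le> (\<Sum>j\<in>UNIV. norm (M $ i $ j) * norm v)" .
  qed
  finally show ?thesis by (simp add: sum_distrib_right)
qed

lemma has_sum_finite_sum:
  fixes f :: "'i \<Rightarrow> 'a \<Rightarrow> complex"
  assumes "finite J" "\<And>j. j \<in> J \<Longrightarrow> (f j has_sum s j) X"
  shows "((\<lambda>x. \<Sum>j\<in>J. f j x) has_sum (\<Sum>j\<in>J. s j)) X"
  using assms by (induction J rule: finite_induct) (auto intro: has_sum_add)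

lemma adj22_mult: "adj22 (A ** B) = adj22 B ** adj22 A"
  by (simp add: mat22_simps adj22_def algebra_simps)

lemma adj22_1 [simp]: "adj22 (mat 1) = mat 1"
  by (simp add: mat22_simps adj22_def)

lemma adj22_Tn [simp]: "adj22 (mat22 1 n 0 1) = mat22 1 (- n) 0 1"
  by (simp add: adj22_def)

lemma adj22_neg1 [simp]: "adj22 (mat22 (-1) 0 0 (-1)) = mat22 (-1) 0 0 (-1)"
  by (simp add: adj22_def)

context irreducible_vvmf
begin

section \<open>Growth of the representation\<close>

lemma rho_adj_right: "A \<in> SL2Z \<Longrightarrow> \<rho> A ** \<rho> (adj22 A) = mat 1"
  using rho_mult[of A "adj22 A"] by (simp add: adj22_right rho_1)

lemma rho_Tn: "(\<rho> (mat22 1 n 0 1) *v v) $ j = cis (2 * pi * r j * of_int n) * v $ j"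
proof (induction n arbitrary: v rule: int_induct[of _ 0])
  case base
  have "mat22 1 0 0 1 = mat 1" by (simp add: mat22_simps)
  then show ?case by (simp add: rho_1)
next
  case (step1 n)
  have "\<rho> (mat22 1 (n + 1) 0 1) = \<rho> (mat22 1 n 0 1) ** \<rho> T_mat"
    using rho_mult[of "mat22 1 n 0 1" T_mat] by (simp add: T_mat_eq T_power_eq)
  then have "(\<rho> (mat22 1 (n + 1) 0 1) *v v) $ j = (\<rho> (mat22 1 n 0 1) *v (\<rho> T_mat *v v)) $ j"
    by (simp add: matrix_vector_mul_assoc)
  also have "\<dots> = cis (2 * pi * r j * of_int n) * cis (2 * pi * r j) * v $ j"
    by (simp add: step1.IH rho_T_mult)
  also have "cis (2 * pi * r j * of_int n) * cis (2 * pi * r j) = cis (2 * pi * r j * of_int (n + 1))"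
    by (simp add: cis_mult distrib_left)
  finally show ?case .
next
  case (step2 n)
  define u where "u = (\<chi> j. cis (- (2 * pi * r j)) * v $ j)"
  have u: "\<rho> T_mat *v u = v"
  proof -
    have "cis (2 * pi * r j) * (cis (- (2 * pi * r j)) * v $ j) = v $ j" for j
      unfolding mult.assoc[symmetric] cis_mult by simp
    then show ?thesis by (simp add: vec_eq_iff rho_T_mult u_def)
  qed
  have "\<rho> (mat22 1 n 0 1) = \<rho> (mat22 1 (n - 1) 0 1) ** \<rho> T_mat"
    using rho_mult[of "mat22 1 (n - 1) 0 1" T_mat] by (simp add: T_mat_eq T_power_eq)
  then have "(\<rho> (mat22 1 n 0 1) *v u) $ j = (\<rho> (mat22 1 (n - 1) 0 1) *v v) $ j"
    using u by (metis matrix_vector_mul_assoc)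
  then have "(\<rho> (mat22 1 (n - 1) 0 1) *v v) $ j = cis (2 * pi * r j * of_int n) * u $ j"
    using step2.IH by simp
  also have "\<dots> = (cis (2 * pi * r j * of_int n) * cis (- (2 * pi * r j))) * v $ j"
    by (simp add: u_def)
  also have "cis (2 * pi * r j * of_int n) * cis (- (2 * pi * r j)) = cis (2 * pi * r j * of_int (n - 1))"
    by (simp add: cis_mult right_diff_distrib)
  finally show ?case .
qed

lemma norm_rho_Tn: "norm (\<rho> (mat22 1 n 0 1) *v v) = norm v"
  by (simp add: norm_vec_def rho_Tn norm_mult)

text \<open>By the Euclidean algorithm a matrix is a product of powers of \<open>T\<close>, which act as isometries,
  and of logarithmically many copies of \<open>S\<close>.\<close>

lemma rho_polynomial_growth:
  "\<exists>C>0. \<exists>p::nat. \<forall>A\<in>SL2Z. \<forall>v. norm (\<rho> (adj22 A) *v v) \<le> C * max 1 \<bar>real_of_int (A$2$1)\<bar> ^ p * norm v"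
proof -
  define M where "M = adj22 (S_mat ** mat22 (-1) 0 0 (-1))"
  have M: "M \<in> SL2Z" unfolding M_def by (intro SL2Z_adj SL2Z_mult) auto
  define K where "K = 1 + (\<Sum>i\<in>UNIV. \<Sum>j\<in>UNIV. norm (\<rho> M $ i $ j))"
  define C where "C = 1 + (\<Sum>i\<in>UNIV. \<Sum>j\<in>UNIV. norm (\<rho> (mat22 (-1) 0 0 (-1)) $ i $ j))"
  have KC: "K \<ge> 1" "C \<ge> 1" by (auto simp: K_def C_def intro!: sum_nonneg)
  have K: "norm (\<rho> M *v v) \<le> K * norm v" for v
    using norm_matrix_vector_le[of "\<rho> M" v] norm_ge_zero[of v] unfolding K_def distrib_right by linarith
  have C: "norm (\<rho> (mat22 (-1) 0 0 (-1)) *v v) \<le> C * norm v" for v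
    using norm_matrix_vector_le[of "\<rho> (mat22 (-1) 0 0 (-1))" v] norm_ge_zero[of v] unfolding C_def distrib_right by linarith
  \<comment> \<open>A Euclidean step costs at most a factor \<open>K\<close>. The first one, from
    \<open>c = 0\<close>, accounts for the extra \<open>K\<close> in the bound below; every later
    one at least doubles \<open>\<bar>c\<bar>\<close>, which an exponent with
    \<open>K < 2 ^ p\<close> absorbs.\<close>
  obtain p :: nat where p: "K < 2 ^ p" using real_arch_pow[of 2 K] by auto
  have "\<forall>v. norm (\<rho> (adj22 A) *v v) \<le> (if A$2$1 = 0 then C else K * C * \<bar>real_of_int (A$2$1)\<bar> ^ p) * norm v"
    if "A \<in> SL2Z" for A
    using that
  proof (induction rule: SL2Z_euclid)
    case (triangular A)
    then show ?case
    proof (rule SL2Z_triangular)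
      fix n assume "A = mat22 1 n 0 1"
      then show ?thesis using KC(2) mult_right_mono[OF KC(2)] by (simp add: norm_rho_Tn)
    next
      fix n assume A: "A = mat22 (-1) 0 0 (-1) ** mat22 1 n 0 1"
      have "\<rho> (adj22 A) *v v = \<rho> (mat22 1 (-n) 0 1) *v (\<rho> (mat22 (-1) 0 0 (-1)) *v v)" for v
        unfolding A by (simp add: adj22_mult rho_mult matrix_vector_mul_assoc)
      then show ?thesis using C triangular(2) by (simp add: norm_rho_Tn)
    qed
  next
    case (step A n)
    let ?B = "(A ** (S_mat ** mat22 (-1) 0 0 (-1))) ** mat22 1 n 0 1"
    have c: "?B$2$1 = - A$2$2" by (simp add: mat22_mult_nth S_mat_def)
    define c d where "c = \<bar>real_of_int (A$2$1)\<bar>" and "d = \<bar>real_of_int (A$2$2)\<bar>"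
    have "real_of_int (2 * \<bar>A$2$1\<bar>) \<le> real_of_int \<bar>A$2$2\<bar>" using step.hyps(2) by (simp only: of_int_le_iff)
    then have cd: "2 * c \<le> d" "0 \<le> c" by (auto simp: c_def d_def)
    have "\<bar>A$2$2\<bar> \<ge> 1" using step.hyps(3) by linarith
    then have "real_of_int \<bar>A$2$2\<bar> \<ge> 1" by (simp only: of_int_1_le_iff)
    then have d1: "d \<ge> 1" by (simp add: d_def)
    show ?case
    proof
      fix v
      have "\<rho> (adj22 ?B) *v v = \<rho> (mat22 1 (-n) 0 1) *v (\<rho> M *v (\<rho> (adj22 A) *v v))"
      proof -
        have "adj22 ?B = mat22 1 (-n) 0 1 ** (M ** adj22 A)"
          by (simp only: adj22_mult adj22_Tn M_def)
        then have "\<rho> (adj22 ?B) = \<rho> (mat22 1 (-n) 0 1) ** (\<rho> M ** \<rho> (adj22 A))"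
          using M step.hyps(1) by (simp add: rho_mult SL2Z_mult)
        then show ?thesis by (simp only: matrix_vector_mul_assoc)
      qed
      then have "norm (\<rho> (adj22 ?B) *v v) \<le> K * norm (\<rho> (adj22 A) *v v)"
        using K by (simp add: norm_rho_Tn)
      also have "\<dots> \<le> K * ((if A$2$1 = 0 then C else K * C * c ^ p) * norm v)"
        using step.IH KC unfolding c_def by (intro mult_left_mono) auto
      also have "(if A$2$1 = 0 then C else K * C * c ^ p) \<le> C * d ^ p"
      proof (cases "A$2$1 = 0")
        case True
        then show ?thesis using KC d1 by simp
      next
        case False
        have "K * c ^ p \<le> 2 ^ p * c ^ p" using p cd by (intro mult_right_mono) auto
        also have "\<dots> = (2 * c) ^ p" by (simp add: power_mult_distrib)
        also have "\<dots> \<le> d ^ p" using cd by (intro power_mono) auto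
        finally have "C * (K * c ^ p) \<le> C * d ^ p" using KC by (intro mult_left_mono) auto
        then show ?thesis using False by (simp add: mult_ac)
      qed
      then have "K * ((if A$2$1 = 0 then C else K * C * c ^ p) * norm v) \<le> K * (C * d ^ p * norm v)"
        using KC by (intro mult_left_mono mult_right_mono) auto
      finally show "norm (\<rho> (adj22 ?B) *v v) \<le> (if ?B$2$1 = 0 then C else K * C * \<bar>real_of_int (?B$2$1)\<bar> ^ p) * norm v"
        using step.hyps(3) unfolding c by (simp add: d_def mult_ac)
    qed
  qed
  moreover have "(if c = 0 then C else K * C * \<bar>real_of_int c\<bar> ^ p) \<le> K * C * max 1 \<bar>real_of_int c\<bar> ^ p" for c
  proof (cases "c = 0")
    case True
    then show ?thesis using KC by simp
  next
    case False
    then show ?thesis using KC by (auto intro!: mult_left_mono power_mono)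
  qed
  ultimately have "\<forall>A\<in>SL2Z. \<forall>v. norm (\<rho> (adj22 A) *v v) \<le> K * C * max 1 \<bar>real_of_int (A$2$1)\<bar> ^ p * norm v"
    by (meson mult_right_mono norm_ge_zero order_trans)
  then show ?thesis using KC by (intro exI[of _ "K * C"]) auto
qed

text \<open>Schur's lemma by hand: every \<open>v + \<rho>(-I) v\<close> lies in the eigenspace for
  1, which is invariant because \<open>-I\<close> is central. Either this space is everything or all
  these vectors vanish.\<close>

lemma rho_neg1: "\<exists>e. e\<^sup>2 = 1 \<and> (\<forall>v. \<rho> (mat22 (-1) 0 0 (-1)) *v v = e *s v)"
proof -
  let ?I = "mat22 (-1) 0 0 (-1)"
  have II: "\<rho> ?I *v (\<rho> ?I *v v) = v" for v
  proof -
    have "?I ** ?I = mat 1" by (simp add: mat22_simps)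
    then have "\<rho> ?I ** \<rho> ?I = mat 1" using rho_mult[of ?I ?I] by (simp add: rho_1)
    then show ?thesis by (simp add: matrix_vector_mul_assoc)
  qed
  have comm: "\<rho> A *v (\<rho> ?I *v v) = \<rho> ?I *v (\<rho> A *v v)" if A: "A \<in> SL2Z" for A v
  proof -
    have "A ** ?I = ?I ** A" by (simp add: mat22_simps)
    then have "\<rho> A ** \<rho> ?I = \<rho> ?I ** \<rho> A" using rho_mult[of A ?I] rho_mult[of ?I A] A by simp
    then show ?thesis by (simp add: matrix_vector_mul_assoc)
  qed
  define W where "W = {v. \<rho> ?I *v v = v}"
  have sub: "vec.subspace W"
    by (auto simp: W_def vec.subspace_def matrix_vector_right_distrib vector_scalar_commute)
  have inv: "\<rho> A *v x \<in> W" if "A \<in> SL2Z" "x \<in> W" for A x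
    using that comm[of A x] by (simp add: W_def)
  show ?thesis
  proof (cases "\<exists>v. \<rho> ?I *v v + v \<noteq> 0")
    case True
    then obtain v where v: "\<rho> ?I *v v + v \<noteq> 0" by blast
    have "\<rho> ?I *v v + v \<in> W" by (simp add: W_def matrix_vector_right_distrib II add.commute)
    then have "W = UNIV" using invariant_subspace_UNIV[OF sub inv] v by blast
    then have "\<forall>v. \<rho> ?I *v v = 1 *s v" by (auto simp: W_def)
    then show ?thesis by (intro exI[of _ 1]) auto
  next
    case False
    then have "\<forall>v. \<rho> ?I *v v = (-1) *s v" by (auto simp: vec_eq_iff add_eq_0_iff2)
    then show ?thesis by (intro exI[of _ "-1"]) auto
  qed
qed

text \<open>Up to constants the terms are bounded by the power \<open>p - w\<close> of
  \<open>norm (den A z)\<close>, and \<open>w - p \<ge> 4\<close> makes the sum converge. The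
  condition \<open>neg1\<close> keeps the terms of \<open>(c, d)\<close> and \<open>(-c, -d)\<close>
  from cancelling.\<close>

context
  fixes w :: real and l :: 'n and C :: real and p :: nat
  assumes w: "multiplier_system w \<upsilon>" and wp: "w \<ge> real p + 4" and C: "C > 0"
    and growth: "\<And>A v. A \<in> SL2Z \<Longrightarrow> norm (\<rho> (adj22 A) *v v) \<le> C * max 1 \<bar>real_of_int (A$2$1)\<bar> ^ p * norm v"
    and neg1: "\<And>v z. Im z > 0 \<Longrightarrow> aut w \<upsilon> (mat22 (-1) 0 0 (-1)) z *s (\<rho> (mat22 (-1) 0 0 (-1)) *v v) = v"
begin

text \<open>The negative exponent makes the seed grow at the cusp, while the terms with
  \<open>c \<noteq> 0\<close> stay bounded there. So it can be read off that the series is not zero;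
  the discriminant later repairs the growth.\<close>

definition seed :: "complex \<Rightarrow> complex^'n" where
  "seed z = qp (\<Lambda> l - 1) z *s axis l 1"

definition pterm :: "int^2^2 \<Rightarrow> complex \<Rightarrow> complex^'n" where
  "pterm A z = inverse (aut w \<upsilon> A z) *s (\<rho> (adj22 A) *v seed (moebius A z))"

definition cop :: "(int \<times> int) set" where "cop = {(c, d). coprime c d}"

text \<open>By \<open>pterm_bottom_row\<close> the choice of the matrix does not affect the
  terms.\<close>

definition rep :: "int \<times> int \<Rightarrow> int^2^2" where
  "rep q = (SOME A. A \<in> SL2Z \<and> A$2$1 = fst q \<and> A$2$2 = snd q)"

definition poin :: "complex \<Rightarrow> complex^'n" where
  "poin z = (\<chi> i. \<Sum>\<^sub>\<infinity>q\<in>cop. pterm (rep q) z $ i)"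

lemma rep:
  assumes "q \<in> cop"
  shows "rep q \<in> SL2Z \<and> rep q $2$1 = fst q \<and> rep q $2$2 = snd q"
proof -
  have "coprime (fst q) (snd q)" using assms by (auto simp: cop_def)
  then obtain A where "A \<in> SL2Z \<and> A$2$1 = fst q \<and> A$2$2 = snd q"
    using SL2Z_bottom_row_exists by blast
  then show ?thesis unfolding rep_def by (rule someI)
qed

lemma pterm_left:
  assumes B: "B \<in> SL2Z" and seed: "\<And>z. Im z > 0 \<Longrightarrow> seed (moebius B z) = aut w \<upsilon> B z *s (\<rho> B *v seed z)"
    and A: "A \<in> SL2Z" and z: "Im z > 0"
  shows "pterm (B ** A) z = pterm A z"
proof -
  have nz: "aut w \<upsilon> B (moebius A z) \<noteq> 0" by (rule aut_nonzero[OF w B Im_moebius_pos[OF A z]])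
  have "\<rho> (adj22 (B ** A)) *v seed (moebius (B ** A) z) =
     (\<rho> (adj22 A) ** \<rho> (adj22 B)) *v (aut w \<upsilon> B (moebius A z) *s (\<rho> B *v seed (moebius A z)))"
    using A B z by (simp add: adj22_mult rho_mult moebius_mult seed Im_moebius_pos)
  also have "\<dots> = aut w \<upsilon> B (moebius A z) *s (\<rho> (adj22 A) *v seed (moebius A z))"
    using rho_adj[OF B] by (simp add: vector_scalar_commute matrix_vector_mul_assoc matrix_mul_assoc[symmetric])
  finally show ?thesis
    using nz by (simp add: pterm_def aut_mult[OF w B A z] vec_eq_iff)
qed

lemma seed_T: "seed (moebius T_mat z) = aut w \<upsilon> T_mat z *s (\<rho> T_mat *v seed z)"
proof -
  have "cis (2 * pi * (\<Lambda> l - 1)) = cis (2 * pi * \<Lambda> l) * cis (- (2 * pi))"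
    by (simp add: cis_mult algebra_simps)
  moreover have "cis (- (2 * pi)) = 1" by (simp add: complex_eq_iff)
  ultimately have "cis (2 * pi * (\<Lambda> l - 1)) = cis (2 * pi * \<Lambda> l)" by simp
  then have "qp (\<Lambda> l - 1) (z + 1) = cis (2 * pi * \<Lambda> l) * qp (\<Lambda> l - 1) z"
    using qp_shift[of "\<Lambda> l - 1" z 1] by simp
  then show ?thesis
    by (simp add: seed_def vec_eq_iff rho_T_mult aut_def T_eigenvalue[symmetric] axis_def)
qed

lemma pterm_Tn:
  assumes A: "A \<in> SL2Z" and z: "Im z > 0"
  shows "pterm (mat22 1 n 0 1 ** A) z = pterm A z"
proof -
  have T: "pterm (T_mat ** A) z = pterm A z" if "A \<in> SL2Z" for A
    by (rule pterm_left[OF SL2Z_T seed_T that z])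
  show ?thesis
  proof (induction n rule: int_induct[of _ 0])
    case base
    have "mat22 1 0 0 1 = mat 1" by (simp add: mat22_simps)
    then show ?case by simp
  next
    case (step1 n)
    have "mat22 1 (n + 1) 0 1 ** A = T_mat ** (mat22 1 n 0 1 ** A)"
      by (simp add: matrix_mul_assoc T_mat_eq T_power_eq add.commute)
    then show ?case using step1 T[of "mat22 1 n 0 1 ** A"] A by (simp add: SL2Z_mult)
  next
    case (step2 n)
    have "mat22 1 n 0 1 ** A = T_mat ** (mat22 1 (n - 1) 0 1 ** A)"
      by (simp add: matrix_mul_assoc T_mat_eq T_power_eq)
    then show ?case using step2 T[of "mat22 1 (n - 1) 0 1 ** A"] A by (simp add: SL2Z_mult)
  qed
qed

lemma pterm_bottom_row:
  assumes "A \<in> SL2Z" "B \<in> SL2Z" "A$2$1 = B$2$1" "A$2$2 = B$2$2" "Im z > 0"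
  shows "pterm A z = pterm B z"
  using SL2Z_bottom_row_eq[OF assms(1-4)] pterm_Tn[OF assms(1,5)] by metis

lemma pterm_right:
  assumes A: "A \<in> SL2Z" and B: "B \<in> SL2Z" and z: "Im z > 0"
  shows "pterm A (moebius B z) = aut w \<upsilon> B z *s (\<rho> B *v pterm (A ** B) z)"
proof -
  have nz: "aut w \<upsilon> B z \<noteq> 0" by (rule aut_nonzero[OF w B z])
  have "\<rho> B *v (\<rho> (adj22 (A ** B)) *v x) = \<rho> (adj22 A) *v x" for x
    using A B rho_adj_right[OF B] by (simp add: adj22_mult rho_mult matrix_vector_mul_assoc matrix_mul_assoc)
  then have "\<rho> B *v pterm (A ** B) z = inverse (aut w \<upsilon> (A ** B) z) *s (\<rho> (adj22 A) *v seed (moebius (A ** B) z))"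
    unfolding pterm_def by (simp add: vector_scalar_commute)
  then show ?thesis
    using nz by (simp add: pterm_def aut_mult[OF w A B z] moebius_mult[OF A B z] vec_eq_iff)
qed

text \<open>For \<open>c = 0\<close> the height of \<open>z\<close> is preserved, otherwise the
  image has height at most \<open>1 / Im z\<close>. So \<open>Im z \<le> Y\<close> is asked for only
  when \<open>c = 0\<close>, and the same estimate serves near the cusp, where the height is
  unbounded.\<close>

lemma norm_pterm_le:
  assumes A: "A \<in> SL2Z" and z: "Im z \<ge> \<epsilon>" "\<epsilon> > 0" "\<bar>Re z\<bar> \<le> R" and Y: "A$2$1 = 0 \<Longrightarrow> Im z \<le> Y" "1 / \<epsilon> \<le> Y"
  shows "norm (pterm A z) \<le> C * (1 + 1 / \<epsilon>) ^ p * exp (2 * pi * Y) * (16 * (1 + (1 + R) / \<epsilon>) powr (w - real p) * lat (A$2$1, A$2$2))"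
proof -
  define n where "n = norm (den A z)"
  define c where "c = \<bar>real_of_int (A$2$1)\<bar>"
  have z0: "Im z > 0" using z by linarith
  have n: "n > 0" using den_nonzero[OF A z0] by (simp add: n_def)
  have cd: "(A$2$1, A$2$2) \<noteq> (0, 0)" using A by (auto simp: SL2Z_iff)
  have cn: "c * \<epsilon> \<le> n"
    using norm_den_ge_Im[of A z] mult_left_mono[OF z(1), of c] z0 by (simp add: n_def c_def)
  have max: "max 1 c \<le> n * (1 + 1 / \<epsilon>)"
  proof (cases "A$2$1 = 0")
    case True
    then have "\<bar>A$2$2\<bar> = 1" using A zmult_eq_1_iff by (auto simp: SL2Z_iff)
    then have "n = 1" using True unfolding n_def den_def by (simp flip: of_int_abs)
    then show ?thesis using True z by (simp add: c_def)
  next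
    case False
    then have "\<bar>A$2$1\<bar> \<ge> 1" by linarith
    then have "real_of_int \<bar>A$2$1\<bar> \<ge> 1" by (simp only: of_int_1_le_iff)
    then have "max 1 c = c" by (simp add: c_def)
    also have "c \<le> n / \<epsilon>" using cn z by (simp add: field_simps)
    also have "\<dots> \<le> n * (1 + 1 / \<epsilon>)" using n by (simp add: field_simps)
    finally show ?thesis .
  qed
  have Im: "Im (moebius A z) \<le> Y"
  proof (cases "A$2$1 = 0")
    case True
    then have "\<bar>A$2$2\<bar> = 1" using A zmult_eq_1_iff by (auto simp: SL2Z_iff)
    then have "n = 1" using True unfolding n_def den_def by (simp flip: of_int_abs)
    then show ?thesis using Y(1)[OF True] by (simp add: Im_moebius[OF A] n_def)
  next
    case False
    then have "\<bar>A$2$1\<bar> \<ge> 1" by linarith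
    then have "real_of_int \<bar>A$2$1\<bar> \<ge> 1" by (simp only: of_int_1_le_iff)
    then have "1 * Im z \<le> c * Im z" using z0 by (intro mult_right_mono) (auto simp: c_def)
    also have "\<dots> \<le> n" using norm_den_ge_Im[of A z] z0 by (simp add: n_def c_def)
    finally have "(Im z)\<^sup>2 \<le> n\<^sup>2" using z0 by (intro power_mono) auto
    then have "Im z / n\<^sup>2 \<le> Im z / (Im z)\<^sup>2" using z0 n by (intro divide_left_mono) auto
    also have "\<dots> = 1 / Im z" using z0 by (simp add: power2_eq_square)
    also have "\<dots> \<le> 1 / \<epsilon>" using z by (intro divide_left_mono) auto
    finally show ?thesis using Y(2) by (simp add: Im_moebius[OF A] n_def)
  qed
  have Y0: "0 \<le> Im (moebius A z)" using Im_moebius_pos[OF A z0] by simp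
  have seed: "norm (seed (moebius A z)) \<le> exp (2 * pi * Y)"
  proof -
    have "norm (seed (moebius A z)) = exp (2 * pi * ((1 - \<Lambda> l) * Im (moebius A z)))"
    proof -
      have "norm (seed (moebius A z)) = norm (qp (\<Lambda> l - 1) (moebius A z))"
      proof -
        have "(\<Sum>i\<in>UNIV. (norm (seed x $ i))\<^sup>2) = (\<Sum>i\<in>UNIV. if i = l then (norm (qp (\<Lambda> l - 1) x))\<^sup>2 else 0)" for x
          by (rule sum.cong) (auto simp: seed_def axis_def)
        then show ?thesis by (simp add: norm_vec_def L2_set_def)
      qed
      then show ?thesis by (simp add: norm_qp algebra_simps)
    qed
    moreover have "(1 - \<Lambda> l) * Im (moebius A z) \<le> 1 * Y"
      using Lambda_bounds[of l] Im Y0 by (intro mult_mono) auto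
    ultimately show ?thesis by simp
  qed
  have "norm (pterm A z) = n powr (- w) * norm (\<rho> (adj22 A) *v seed (moebius A z))"
  proof -
    have "norm (x *s v) = norm x * norm v" for x :: complex and v :: "complex^'n"
      by (simp add: norm_vec_def L2_set_def norm_mult power_mult_distrib sum_distrib_left[symmetric] real_sqrt_mult)
    then show ?thesis using norm_aut[OF w A, of z] by (simp add: pterm_def norm_inverse powr_minus n_def)
  qed
  also have "\<dots> \<le> n powr (- w) * (C * max 1 c ^ p * norm (seed (moebius A z)))"
    using growth[OF A] by (intro mult_left_mono) (auto simp: c_def)
  also have "\<dots> \<le> n powr (- w) * (C * (n * (1 + 1 / \<epsilon>)) ^ p * exp (2 * pi * Y))"
    using C max n z by (intro mult_left_mono mult_mono seed power_mono) auto
  also have "\<dots> = C * (1 + 1 / \<epsilon>) ^ p * exp (2 * pi * Y) * (n powr (- w) * n ^ p)"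
    by (simp add: power_mult_distrib mult_ac)
  also have "n powr (- w) * n ^ p = n powr (- (w - real p))"
    using n by (simp add: powr_realpow[symmetric] powr_add[symmetric])
  also have "C * (1 + 1 / \<epsilon>) ^ p * exp (2 * pi * Y) * n powr (- (w - real p)) \<le>
     C * (1 + 1 / \<epsilon>) ^ p * exp (2 * pi * Y) * (16 * (1 + (1 + R) / \<epsilon>) powr (w - real p) * lat (A$2$1, A$2$2))"
    unfolding n_def den_def using C z wp by (intro mult_left_mono lattice_bound[OF z cd]) auto
  finally show ?thesis .
qed

lemma pterm_bounded_on:
  assumes "\<epsilon> > 0"
  shows "\<exists>M. M summable_on cop \<and> (\<forall>q\<in>cop. \<forall>z. \<epsilon> \<le> Im z \<longrightarrow> Im z \<le> Y \<longrightarrow> \<bar>Re z\<bar> \<le> R \<longrightarrow> (\<forall>i. norm (pterm (rep q) z $ i) \<le> M q))"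
proof -
  define Y' where "Y' = max Y (1 / \<epsilon>)"
  define K where "K = C * (1 + 1 / \<epsilon>) ^ p * exp (2 * pi * Y') * (16 * (1 + (1 + R) / \<epsilon>) powr (w - real p))"
  have "(\<lambda>q. K * lat q) summable_on cop" by (intro summable_on_cmult_right lat_summable)
  moreover have "norm (pterm (rep q) z $ i) \<le> K * lat q" if q: "q \<in> cop" and z: "\<epsilon> \<le> Im z" "Im z \<le> Y" "\<bar>Re z\<bar> \<le> R" for q z i
  proof -
    have "norm (pterm (rep q) z $ i) \<le> norm (pterm (rep q) z)" by (rule Finite_Cartesian_Product.norm_nth_le)
    also have "\<dots> \<le> C * (1 + 1 / \<epsilon>) ^ p * exp (2 * pi * Y') * (16 * (1 + (1 + R) / \<epsilon>) powr (w - real p) * lat (rep q$2$1, rep q$2$2))"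
      using rep[OF q] z assms by (intro norm_pterm_le) (auto simp: Y'_def)
    also have "\<dots> = K * lat q" using rep[OF q] by (simp add: K_def)
    finally show ?thesis .
  qed
  ultimately show ?thesis by blast
qed

lemma holomorphic_pterm:
  assumes A: "A \<in> SL2Z"
  shows "(\<lambda>z. pterm A z $ i) holomorphic_on upper_half_plane"
proof -
  have "(\<lambda>z. qp (\<Lambda> l - 1) (moebius A z)) holomorphic_on upper_half_plane"
    by (intro holomorphic_intros holomorphic_moebius A)
  then have "(\<lambda>z. inverse (aut w \<upsilon> A z) * (\<Sum>j\<in>UNIV. \<rho> (adj22 A) $ i $ j * (qp (\<Lambda> l - 1) (moebius A z) * axis l 1 $ j))) holomorphic_on upper_half_plane"
    using aut_nonzero[OF w A] by (intro holomorphic_intros holomorphic_aut[OF w A] holomorphic_moebius[OF A]) auto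
  then show ?thesis by (simp add: pterm_def seed_def matrix_vector_mult_def)
qed

lemma holomorphic_poin: "(\<lambda>z. poin z $ i) holomorphic_on upper_half_plane"
proof -
  have "(\<lambda>z. \<Sum>\<^sub>\<infinity>q\<in>cop. pterm (rep q) z $ i) holomorphic_on upper_half_plane"
  proof (rule holomorphic_infsum)
    show "(\<lambda>z. pterm (rep q) z $ i) holomorphic_on upper_half_plane" if "q \<in> cop" for q
      using rep[OF that] by (intro holomorphic_pterm) auto
    fix z assume "z \<in> upper_half_plane"
    then have z: "Im z > 0" by simp
    obtain M where M: "M summable_on cop" "\<And>q x i. q \<in> cop \<Longrightarrow> Im z / 2 \<le> Im x \<Longrightarrow> Im x \<le> 2 * Im z \<Longrightarrow>
       \<bar>Re x\<bar> \<le> \<bar>Re z\<bar> + Im z / 2 \<Longrightarrow> norm (pterm (rep q) x $ i) \<le> M q"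
      using pterm_bounded_on[of "Im z / 2" "2 * Im z" "\<bar>Re z\<bar> + Im z / 2"] z by auto
    have near: "Im z / 2 \<le> Im x \<and> Im x \<le> 2 * Im z \<and> \<bar>Re x\<bar> \<le> \<bar>Re z\<bar> + Im z / 2" if "x \<in> cball z (Im z / 2)" for x
    proof -
      have "norm (x - z) \<le> Im z / 2" using that by (simp add: dist_norm norm_minus_commute)
      then have "\<bar>Re x - Re z\<bar> \<le> Im z / 2" "\<bar>Im x - Im z\<bar> \<le> Im z / 2"
        using abs_Re_le_cmod[of "x - z"] abs_Im_le_cmod[of "x - z"] by auto
      then show ?thesis using z by linarith
    qed
    show "\<exists>r>0. \<exists>M. M summable_on cop \<and> cball z r \<subseteq> upper_half_plane \<and> (\<forall>q\<in>cop. \<forall>x\<in>cball z r. norm (pterm (rep q) x $ i) \<le> M q)"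
    proof (intro exI[of _ "Im z / 2"] exI[of _ M] conjI ballI)
      show "cball z (Im z / 2) \<subseteq> upper_half_plane" using near z by fastforce
    qed (use z M near in auto)
  qed auto
  then show ?thesis by (simp add: poin_def)
qed

lemma poin_has_sum:
  assumes z: "Im z > 0"
  shows "((\<lambda>q. pterm (rep q) z $ i) has_sum poin z $ i) cop"
proof -
  from pterm_bounded_on[OF z, of "Im z" "\<bar>Re z\<bar>"]
  obtain M where M: "M summable_on cop" and b: "\<forall>q\<in>cop. \<forall>x. Im z \<le> Im x \<longrightarrow> Im x \<le> Im z \<longrightarrow> \<bar>Re x\<bar> \<le> \<bar>Re z\<bar> \<longrightarrow>
     (\<forall>i. norm (pterm (rep q) x $ i) \<le> M q)" by blast
  have b': "norm (pterm (rep q) z $ i) \<le> M q" if "q \<in> cop" for q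
    using b[rule_format, OF that, of z] by simp
  have "(\<lambda>q. norm (pterm (rep q) z $ i)) summable_on cop"
    by (rule summable_on_comparison_test[OF M]) (simp_all add: b')
  then have "(\<lambda>q. pterm (rep q) z $ i) summable_on cop" by (rule abs_summable_summable)
  then show ?thesis by (simp add: poin_def)
qed

lemma poin_transform:
  assumes B: "B \<in> SL2Z" and z: "Im z > 0"
  shows "poin (moebius B z) = aut w \<upsilon> B z *s (\<rho> B *v poin z)"
proof -
  define g where "g q = (fst q * B$1$1 + snd q * B$2$1, fst q * B$1$2 + snd q * B$2$2)" for q :: "int \<times> int"
  define g' where "g' q = (fst q * B$2$2 - snd q * B$2$1, snd q * B$1$1 - fst q * B$1$2)" for q :: "int \<times> int"
  have det: "B$1$1 * B$2$2 - B$1$2 * B$2$1 = 1" using B by (simp add: SL2Z_iff)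
  have gg': "g (g' q) = q" "g' (g q) = q" for q
  proof -
    have "g (g' q) = ((B$1$1 * B$2$2 - B$1$2 * B$2$1) * fst q, (B$1$1 * B$2$2 - B$1$2 * B$2$1) * snd q)"
      by (simp add: g_def g'_def algebra_simps)
    then show "g (g' q) = q" using det by simp
    have "g' (g q) = ((B$1$1 * B$2$2 - B$1$2 * B$2$1) * fst q, (B$1$1 * B$2$2 - B$1$2 * B$2$1) * snd q)"
      by (simp add: g_def g'_def algebra_simps)
    then show "g' (g q) = q" using det by simp
  qed
  have row: "(rep q ** X)$2$1 = fst q * X$1$1 + snd q * X$2$1" "(rep q ** X)$2$2 = fst q * X$1$2 + snd q * X$2$2" if "q \<in> cop" for q and X :: "int^2^2"
    using rep[OF that] by (simp_all add: mat22_mult_nth)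
  have gcop: "g q \<in> cop" if q: "q \<in> cop" for q
    using SL2Z_coprime[OF SL2Z_mult[of "rep q" B]] rep[OF q] B row[OF q] by (simp add: g_def cop_def)
  have g'cop: "g' q \<in> cop" if q: "q \<in> cop" for q
  proof -
    have "coprime ((rep q ** adj22 B)$2$1) ((rep q ** adj22 B)$2$2)"
      using rep[OF q] B by (intro SL2Z_coprime SL2Z_mult SL2Z_adj) auto
    then show ?thesis unfolding row[OF q] by (simp add: g'_def cop_def adj22_def add.commute)
  qed
  have bij: "bij_betw g cop cop"
    by (rule bij_betw_byWitness[of _ g']) (use gg' gcop g'cop in auto)
  have t: "pterm (rep q) (moebius B z) = aut w \<upsilon> B z *s (\<rho> B *v pterm (rep (g q)) z)" if q: "q \<in> cop" for q
  proof -
    have "pterm (rep q ** B) z = pterm (rep (g q)) z"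
      using rep[OF q] rep[OF gcop[OF q]] B row[OF q] z by (intro pterm_bottom_row SL2Z_mult) (auto simp: g_def)
    then show ?thesis using pterm_right[of "rep q" B z] rep[OF q] B z by simp
  qed
  have "poin (moebius B z) $ i = (aut w \<upsilon> B z *s (\<rho> B *v poin z)) $ i" for i
  proof -
    have "((\<lambda>q. pterm (rep (g q)) z $ j) has_sum poin z $ j) cop" for j
      using poin_has_sum[OF z, of j] has_sum_reindex_bij_betw[OF bij, of "\<lambda>q. pterm (rep q) z $ j"] by simp
    then have "((\<lambda>q. aut w \<upsilon> B z * (\<Sum>j\<in>UNIV. \<rho> B $ i $ j * pterm (rep (g q)) z $ j)) has_sum
       aut w \<upsilon> B z * (\<Sum>j\<in>UNIV. \<rho> B $ i $ j * poin z $ j)) cop"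
      by (intro has_sum_cmult_right has_sum_finite_sum) auto
    then have "((\<lambda>q. pterm (rep q) (moebius B z) $ i) has_sum
       aut w \<upsilon> B z * (\<Sum>j\<in>UNIV. \<rho> B $ i $ j * poin z $ j)) cop"
      by (rule has_sum_cong[THEN iffD1, rotated]) (simp add: t matrix_vector_mult_def)
    from has_sum_unique[OF poin_has_sum[OF Im_moebius_pos[OF B z]] this]
    show ?thesis by (simp add: matrix_vector_mult_def)
  qed
  then show ?thesis by (simp add: vec_eq_iff)
qed

text \<open>For \<open>c \<noteq> 0\<close> the majorant is independent of the height, so all rows
  except \<open>(0, 1)\<close> and \<open>(0, -1)\<close> together contribute a bounded
  amount.\<close>

lemma poin_asymptotics:
  "\<exists>K. \<forall>z i. Im z \<ge> 1 \<longrightarrow> \<bar>Re z\<bar> \<le> 1 \<longrightarrow> norm (poin z $ i - 2 * seed z $ i) \<le> K"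
proof -
  define K where "K = C * (1 + 1 / 1) ^ p * exp (2 * pi * 1) * (16 * (1 + (1 + 1) / 1) powr (w - real p))"
  let ?X = "{(0, 1), (0, -1)} :: (int \<times> int) set"
  have X: "?X \<subseteq> cop" by (auto simp: cop_def)
  have L: "((\<lambda>q. K * lat q) has_sum K * infsum lat (cop - ?X)) (cop - ?X)"
    by (intro has_sum_cmult_right has_sum_infsum lat_summable)
  have "norm (poin z $ i - 2 * seed z $ i) \<le> K * infsum lat (cop - ?X)" if z: "Im z \<ge> 1" "\<bar>Re z\<bar> \<le> 1" for z i
  proof -
    have z0: "Im z > 0" using z by simp
    have "pterm (rep (0, 1)) z = pterm (mat 1) z"
      using rep[of "(0, 1)"] X z0 by (intro pterm_bottom_row) (auto simp: mat_1_nth)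
    also have "\<dots> = seed z" using aut_1[OF w] by (simp add: pterm_def rho_1)
    finally have 1: "pterm (rep (0, 1)) z = seed z" .
    \<comment> \<open>The factor at \<open>-I\<close> is its own inverse, so \<open>neg1\<close>
      applies and this row repeats the contribution of \<open>(0, 1)\<close>.\<close>
    have "pterm (rep (0, -1)) z = pterm (mat22 (-1) 0 0 (-1)) z"
      using rep[of "(0, -1)"] X z0 by (intro pterm_bottom_row) auto
    also have "\<dots> = seed z"
    proof -
      have a: "aut w \<upsilon> (mat22 (-1) 0 0 (-1)) z \<noteq> 0" by (rule aut_nonzero[OF w SL2Z_neg1 z0])
      have "aut w \<upsilon> (mat22 (-1) 0 0 (-1)) z ^ 2 = 1" by (rule aut_neg1_squared[OF w])
      then have "inverse (aut w \<upsilon> (mat22 (-1) 0 0 (-1)) z) = aut w \<upsilon> (mat22 (-1) 0 0 (-1)) z"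
        using a by (simp add: power2_eq_square field_simps)
      then show ?thesis using neg1[OF z0] by (simp add: pterm_def)
    qed
    finally have 2: "pterm (rep (0, -1)) z = seed z" .
    have "((\<lambda>q. pterm (rep q) z $ i) has_sum poin z $ i - (\<Sum>q\<in>?X. pterm (rep q) z $ i)) (cop - ?X)"
      by (intro has_sum_Diff poin_has_sum z0 has_sum_finite X) auto
    also have "(\<Sum>q\<in>?X. pterm (rep q) z $ i) = 2 * seed z $ i" by (simp add: 1 2)
    finally have S: "((\<lambda>q. pterm (rep q) z $ i) has_sum poin z $ i - 2 * seed z $ i) (cop - ?X)" .
    show ?thesis
    proof (rule norm_infsum_le[OF S L])
      fix q assume q: "q \<in> cop - ?X"
      then have r: "rep q \<in> SL2Z" "rep q$2$1 = fst q" "rep q$2$2 = snd q" using rep[of q] by auto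
      have c: "rep q$2$1 \<noteq> 0"
      proof
        assume 0: "rep q$2$1 = 0"
        then have "\<bar>snd q\<bar> = 1" using r zmult_eq_1_iff by (auto simp: SL2Z_iff)
        then show False using q 0 r by (cases q) (auto simp: abs_if split: if_splits)
      qed
      have "norm (pterm (rep q) z $ i) \<le> norm (pterm (rep q) z)" by (rule Finite_Cartesian_Product.norm_nth_le)
      also have "\<dots> \<le> C * (1 + 1 / 1) ^ p * exp (2 * pi * 1) * (16 * (1 + (1 + 1) / 1) powr (w - real p) * lat (rep q$2$1, rep q$2$2))"
        by (rule norm_pterm_le[OF r(1)]) (use z c in auto)
      also have "\<dots> = K * lat q" using r by (simp add: K_def)
      finally show "norm (pterm (rep q) z $ i) \<le> K * lat q" .
    qed
  qed
  then show ?thesis by blast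
qed

lemma norm_poin_shift:
  assumes "Im z > 0"
  shows "norm (poin (z + of_int n) $ i) = norm (poin z $ i)"
  using poin_transform[OF SL2Z_Tn assms, of n] norm_aut[OF w SL2Z_Tn, of n z]
  by (simp add: rho_Tn norm_mult)

lemma seed_nth: "seed z $ i = (if i = l then qp (\<Lambda> l - 1) z else 0)"
  by (simp add: seed_def axis_def)

text \<open>The series has a pole of order less than one at the cusp, which the discriminant cancels.\<close>

lemma poin_disc_vvmf:
  "(\<lambda>z. if Im z > 0 then disc z *s poin z else 0) \<in> vvmf (w + 12) \<rho> \<upsilon> - {0}"
proof -
  define F where "F z = (if Im z > 0 then disc z *s poin z else 0)" for z
  have w12: "multiplier_system (w + 12) \<upsilon>" using multiplier_system_add_int[OF w, of 12] by simp
  obtain K where K: "\<And>z i. Im z \<ge> 1 \<Longrightarrow> \<bar>Re z\<bar> \<le> 1 \<Longrightarrow> norm (poin z $ i - 2 * seed z $ i) \<le> K"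
    using poin_asymptotics by blast
  obtain D where D: "D > 0" "\<And>z. Im z \<ge> 1 \<Longrightarrow> norm (disc z) \<le> D * exp (- (2 * pi * 1 * Im z))"
    using q_class_bound[OF q_class_disc, of 1] by auto
  have trans: "F (moebius A z) = aut (w + 12) \<upsilon> A z *s (\<rho> A *v F z)" if A: "A \<in> SL2Z" and z: "Im z > 0" for A z
    using A z Im_moebius_pos[OF A z] aut_add_nat[OF w A z, of 12]
    by (simp add: F_def disc_modular[OF A z] poin_transform[OF A z] vec_eq_iff vector_scalar_commute mult_ac)
  have hol: "(\<lambda>z. F z $ j) holomorphic_on upper_half_plane" for j
  proof -
    have "(\<lambda>z. disc z * poin z $ j) holomorphic_on upper_half_plane"
      by (intro holomorphic_intros holomorphic_disc holomorphic_poin)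
    then show ?thesis by (rule holomorphic_transform) (simp add: F_def)
  qed
  have bound: "norm (F z $ j) \<le> D * (2 + \<bar>K\<bar>)" if z: "Im z \<ge> 1" for z j
  proof -
    \<comment> \<open>The asymptotics are stated for \<open>\<bar>Re z\<bar> \<le> 1\<close>;
      integer translations preserve the norms of the components.\<close>
    define z' where "z' = z + of_int (- \<lfloor>Re z\<rfloor>)"
    have "0 \<le> Re z'" "Re z' \<le> 1" unfolding z'_def by simp_all linarith+
    then have z': "Im z' = Im z" "\<bar>Re z'\<bar> \<le> 1" by (simp_all add: z'_def)
    have "norm (poin z $ j) = norm (poin z' $ j)"
      unfolding z'_def using norm_poin_shift[of z "- \<lfloor>Re z\<rfloor>" j] z by simp
    also have "\<dots> \<le> norm (2 * seed z' $ j) + norm (poin z' $ j - 2 * seed z' $ j)"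
      using norm_triangle_ineq[of "2 * seed z' $ j" "poin z' $ j - 2 * seed z' $ j"] by simp
    also have "norm (2 * seed z' $ j) \<le> 2 * exp (2 * pi * Im z)"
    proof -
      have "(1 - \<Lambda> l) * Im z \<le> 1 * Im z" using Lambda_bounds[of l] z by (intro mult_right_mono) auto
      then have "exp (2 * pi * ((1 - \<Lambda> l) * Im z)) \<le> exp (2 * pi * Im z)" by simp
      then show ?thesis using z' by (simp add: seed_nth norm_mult norm_qp algebra_simps)
    qed
    also have "norm (poin z' $ j - 2 * seed z' $ j) \<le> \<bar>K\<bar>" using K[of z' j] z z' by linarith
    also have "2 * exp (2 * pi * Im z) + \<bar>K\<bar> \<le> (2 + \<bar>K\<bar>) * exp (2 * pi * Im z)"
    proof -
      have "\<bar>K\<bar> * 1 \<le> \<bar>K\<bar> * exp (2 * pi * Im z)" using z by (intro mult_left_mono) auto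
      then show ?thesis by (simp add: algebra_simps)
    qed
    finally have "norm (poin z $ j) \<le> (2 + \<bar>K\<bar>) * exp (2 * pi * Im z)" by simp
    then have "norm (disc z) * norm (poin z $ j) \<le> (D * exp (- (2 * pi * 1 * Im z))) * ((2 + \<bar>K\<bar>) * exp (2 * pi * Im z))"
      using D z by (intro mult_mono) auto
    also have "\<dots> = D * (2 + \<bar>K\<bar>)" by (simp add: exp_minus)
    finally show ?thesis using z by (simp add: F_def norm_mult)
  qed
  have "F \<in> vvmf (w + 12) \<rho> \<upsilon>"
  proof (rule vvmfI[OF w12])
    show "q_class (\<Lambda> j) (\<lambda>z. F z $ j)" for j
    proof (rule q_class_of_moderate_growth[OF hol])
      show "F (z + 1) $ j = cis (2 * pi * \<Lambda> j) * F z $ j" if "Im z > 0" for z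
        by (rule transform_T[OF trans that])
      have "\<forall>\<^sub>F y in at_top. \<forall>x. norm (F (Complex x y) $ j) < y ^ 1"
        using eventually_ge_at_top[of 1] eventually_gt_at_top[of "D * (2 + \<bar>K\<bar>)"]
      proof eventually_elim
        case (elim y)
        show ?case
        proof
          fix x
          show "norm (F (Complex x y) $ j) < y ^ 1" using bound[of "Complex x y" j] elim by simp
        qed
      qed
      then show "moderate_growth (\<lambda>z. F z $ j)" unfolding moderate_growth_def by blast
    qed (rule Lambda_bounds)
  qed (use trans in \<open>auto simp: F_def\<close>)
  moreover have "F \<noteq> 0"
  proof
    assume F0: "F = 0"
    \<comment> \<open>High enough for the absolute value of the seed,
      \<open>exp (2 * pi * (1 - \<Lambda> l) * y)\<close>, to be at least
      \<open>\<bar>K\<bar> + 1\<close>.\<close>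
    define y where "y = max 1 ((\<bar>K\<bar> + 1) / (2 * pi * (1 - \<Lambda> l)))"
    define z where "z = Complex 0 y"
    have z: "Im z \<ge> 1" "\<bar>Re z\<bar> \<le> 1" by (simp_all add: z_def y_def)
    have "F z $ l = 0" using F0 by simp
    then have "poin z $ l = 0" using z disc_nonzero[of z] by (simp add: F_def)
    then have "2 * norm (qp (\<Lambda> l - 1) z) \<le> K" using K[OF z, of l] by (simp add: seed_nth norm_mult)
    moreover have "norm (qp (\<Lambda> l - 1) z) = exp (2 * pi * (1 - \<Lambda> l) * y)"
      by (simp add: norm_qp z_def algebra_simps)
    moreover have "exp (2 * pi * (1 - \<Lambda> l) * y) \<ge> \<bar>K\<bar> + 1"
    proof -
      have pos: "2 * pi * (1 - \<Lambda> l) > 0" using Lambda_bounds[of l] by simp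
      have "(\<bar>K\<bar> + 1) / (2 * pi * (1 - \<Lambda> l)) \<le> y" by (simp add: y_def)
      then have "\<bar>K\<bar> + 1 \<le> 2 * pi * (1 - \<Lambda> l) * y" using pos by (simp add: pos_divide_le_eq mult.commute)
      then show ?thesis using exp_ge_add_one_self[of "2 * pi * (1 - \<Lambda> l) * y"] by linarith
    qed
    ultimately show False by linarith
  qed
  ultimately show ?thesis by (simp add: F_def[abs_def])
qed

end

text \<open>Raising the weight by one changes the sign of the factor at \<open>-I\<close>, whose
  denominator is -1. So one of two consecutive large weights matches the scalar by which
  \<open>-I\<close> acts.\<close>

lemma vvmf_exists: "\<exists>w. multiplier_system w \<upsilon> \<and> vvmf w \<rho> \<upsilon> \<noteq> {0}"
proof -
  let ?I = "mat22 (-1) 0 0 (-1)"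
  obtain C p where C: "C > 0"
    and growth: "\<And>A v. A \<in> SL2Z \<Longrightarrow> norm (\<rho> (adj22 A) *v v) \<le> C * max 1 \<bar>real_of_int (A$2$1)\<bar> ^ p * norm v"
    using rho_polynomial_growth by blast
  obtain e where e: "e\<^sup>2 = 1" "\<And>v. \<rho> ?I *v v = e *s v" using rho_neg1 by blast
  obtain n :: nat where n: "real n \<ge> real p + 4 - \<kappa>" using real_arch_simple by blast
  define a where "a = aut (\<kappa> + real n) \<upsilon> ?I \<i>"
  have m: "multiplier_system (\<kappa> + real k) \<upsilon>" for k :: nat
    using ms_int[of "int k"] by simp
  have const: "aut x \<upsilon> ?I z = aut x \<upsilon> ?I \<i>" for x z by (simp add: aut_def)
  have "a\<^sup>2 = 1" unfolding a_def by (rule aut_neg1_squared[OF m])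
  then have "(a * e)\<^sup>2 = 1" using e by (simp add: power_mult_distrib)
  then consider "a * e = 1" | "a * e = -1" using power2_eq_1_iff by blast
  then obtain w where w: "multiplier_system w \<upsilon>" "w \<ge> real p + 4" "aut w \<upsilon> ?I \<i> * e = 1"
  proof cases
    case 1
    then show ?thesis using n m[of n] that[of "\<kappa> + real n"] by (simp add: a_def)
  next
    case 2
    have "aut (\<kappa> + real (n + 1)) \<upsilon> ?I \<i> = - a"
      using aut_add_nat[OF m[of n] SL2Z_neg1, of \<i> 1] by (simp add: a_def add_ac)
    then show ?thesis using 2 n m[of "n + 1"] that[of "\<kappa> + real (n + 1)"] by simp
  qed
  have "aut w \<upsilon> ?I z *s (\<rho> ?I *v v) = v" for v z
    using w(3) by (simp add: e(2) const[of w z] vec_eq_iff mult.assoc[symmetric])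
  note poin_disc_vvmf[OF w(1,2) C growth this]
  then have "vvmf (w + 12) \<rho> \<upsilon> \<noteq> {0}" by blast
  moreover have "multiplier_system (w + 12) \<upsilon>" using multiplier_system_add_int[OF w(1), of 12] by simp
  ultimately show ?thesis by blast
qed

end

section \<open>Dimensions\<close>

interpretation fs: vector_space "fun_scale :: complex \<Rightarrow> (complex \<Rightarrow> complex^'n) \<Rightarrow> complex \<Rightarrow> complex^'n"
  by (rule vector_space_fun_scale)

interpretation fsp: vector_space_pair
  "fun_scale :: complex \<Rightarrow> (complex \<Rightarrow> complex^'n) \<Rightarrow> complex \<Rightarrow> complex^'n"
  "fun_scale :: complex \<Rightarrow> (complex \<Rightarrow> complex^'n) \<Rightarrow> complex \<Rightarrow> complex^'n" ..

lemma sum_fun_scale_apply: "(\<Sum>x\<in>A. fun_scale (f x) (g x)) p = (\<Sum>x\<in>A. f x *s g x p)"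
  by (induction A rule: infinite_finite_induct) (auto simp: fun_scale_def)

text \<open>Finite dimension of \<open>V\<close> is not known beforehand. It comes along with the
  count, from a basis of the forms vanishing at \<open>p\<close> and lifts of a basis of the
  values.\<close>

lemma evaluation_rank_nullity:
  fixes V :: "(complex \<Rightarrow> complex^'n) set"
  assumes V: "fs.subspace V" and BK: "finite BK" "fs.independent BK" "fs.span BK = {F\<in>V. F p = 0}"
  shows "\<exists>B. finite B \<and> fs.independent B \<and> fs.span B = V \<and> card B = card BK + vec.dim ((\<lambda>F. F p) ` V)"
proof -
  obtain C where C: "C \<subseteq> (\<lambda>F. F p) ` V" "vec.independent C" "(\<lambda>F. F p) ` V \<subseteq> vec.span C"
    "card C = vec.dim ((\<lambda>F. F p) ` V)" by (rule vec.basis_exists)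
  have fC: "finite C" by (rule vec.finiteI_independent[OF C(2)])
  have "\<forall>c\<in>C. \<exists>F\<in>V. F p = c" using C(1) by force
  then obtain g where g: "\<And>c. c \<in> C \<Longrightarrow> g c \<in> V" "\<And>c. c \<in> C \<Longrightarrow> g c p = c" by metis
  have inj: "inj_on g C" by (rule inj_onI) (metis g(2))
  have "0 \<notin> C" using C(2) vec.dependent_zero by blast
  have BKV: "BK \<subseteq> V" "\<And>x. x \<in> BK \<Longrightarrow> x p = 0" using BK(3) fs.span_superset[of BK] by auto
  have disj: "BK \<inter> g ` C = {}" using BKV(2) g(2) \<open>0 \<notin> C\<close> by force
  have lin: "f c = 0" if "(\<Sum>c\<in>C. f c *s c) = 0" "c \<in> C" for f c
    using C(2) that fC unfolding vec.independent_explicit_finite_subsets by blast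
  have "fs.independent (BK \<union> g ` C)"
  proof (rule fs.independent_if_scalars_zero)
    show "finite (BK \<union> g ` C)" using BK(1) fC by simp
    fix f x assume s: "(\<Sum>x\<in>BK \<union> g ` C. fun_scale (f x) x) = 0" and x: "x \<in> BK \<union> g ` C"
    have split: "(\<Sum>x\<in>BK. fun_scale (f x) x) + (\<Sum>c\<in>C. fun_scale (f (g c)) (g c)) = 0"
      using s BK(1) fC disj inj by (simp add: sum.union_disjoint sum.reindex)
    have "(\<Sum>x\<in>BK. f x *s x p) + (\<Sum>c\<in>C. f (g c) *s g c p) = 0"
      using fun_cong[OF split, of p] by (simp add: sum_fun_scale_apply)
    moreover have "(\<Sum>x\<in>BK. f x *s x p) = 0" by (rule sum.neutral) (simp add: BKV(2))
    ultimately have "(\<Sum>c\<in>C. f (g c) *s c) = 0" using g(2) by simp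
    then have 1: "f (g c) = 0" if "c \<in> C" for c using lin[of "\<lambda>c. f (g c)" c] that by simp
    then have "(\<Sum>c\<in>C. fun_scale (f (g c)) (g c)) = 0"
      by (intro sum.neutral) (simp add: fun_scale_def zero_fun_def)
    then have "(\<Sum>x\<in>BK. fun_scale (f x) x) = 0" using split by simp
    then have "f x = 0" if "x \<in> BK" for x
      using BK(1,2) that unfolding fs.independent_explicit_finite_subsets by blast
    then show "f x = 0" using 1 x by auto
  qed
  moreover have "fs.span (BK \<union> g ` C) = V"
  proof
    show "fs.span (BK \<union> g ` C) \<subseteq> V" using BKV g(1) V by (intro fs.span_minimal) auto
    show "V \<subseteq> fs.span (BK \<union> g ` C)"
    proof
      fix F assume F: "F \<in> V"
      then have "F p \<in> vec.span C" using C(3) by auto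
      then obtain u where u: "F p = (\<Sum>c\<in>C. u c *s c)" unfolding vec.span_finite[OF fC] by auto
      define G where "G = (\<Sum>c\<in>C. fun_scale (u c) (g c))"
      have GV: "G \<in> V" unfolding G_def by (intro fs.subspace_sum V fs.subspace_scale g(1))
      have "G p = F p" using u g(2) by (simp add: G_def sum_fun_scale_apply)
      then have "F - G \<in> fs.span BK" using BK(3) fs.subspace_diff[OF V F GV] by simp
      then have 1: "F - G \<in> fs.span (BK \<union> g ` C)" using fs.span_mono[of BK "BK \<union> g ` C"] by blast
      have 2: "G \<in> fs.span (BK \<union> g ` C)" unfolding G_def by (intro fs.span_sum fs.span_scale fs.span_base) auto
      show "F \<in> fs.span (BK \<union> g ` C)" using fs.span_add[OF 1 2] by simp
    qed
  qed
  moreover have "card (BK \<union> g ` C) = card BK + vec.dim ((\<lambda>F. F p) ` V)"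
    using BK(1) fC disj inj C(4) by (simp add: card_Un_disjoint card_image)
  ultimately show ?thesis using BK(1) fC by (intro exI[of _ "BK \<union> g ` C"]) simp
qed

text \<open>A basis of \<open>I\<close> is extended to the space of values, and only the new vectors
  are lifted; hence at most as many elements as the codimension of \<open>I\<close>.\<close>

lemma evaluation_generators:
  fixes V :: "(complex \<Rightarrow> complex^'n) set"
  assumes V: "fs.subspace V" and I: "vec.subspace I" "I \<subseteq> (\<lambda>F. F p) ` V"
  shows "\<exists>X. finite X \<and> X \<subseteq> V \<and> card X + vec.dim I \<le> vec.dim ((\<lambda>F. F p) ` V) \<and>
     (\<forall>F\<in>V. \<exists>G\<in>fs.span X. F p - G p \<in> I)"
proof -
  obtain B where B: "finite B" "B \<subseteq> I" "vec.independent B" "vec.span B = I" "card B = vec.dim I"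
    by (rule vec.basis_subspace_exists[OF I(1)])
  obtain C where C: "B \<subseteq> C" "C \<subseteq> (\<lambda>F. F p) ` V" "vec.independent C" "(\<lambda>F. F p) ` V \<subseteq> vec.span C"
    using vec.maximal_independent_subset_extend[OF order_trans[OF B(2) I(2)] B(3)] by blast
  have fC: "finite C" by (rule vec.finiteI_independent[OF C(3)])
  have "\<forall>c\<in>C. \<exists>F\<in>V. F p = c" using C(2) by force
  then obtain g where g: "\<And>c. c \<in> C \<Longrightarrow> g c \<in> V" "\<And>c. c \<in> C \<Longrightarrow> g c p = c" by metis
  define X where "X = g ` (C - B)"
  have "card C = vec.dim ((\<lambda>F. F p) ` V)" using vec.dim_unique[OF C(2,4,3)] by simp
  moreover have "card X \<le> card (C - B)" unfolding X_def using fC by (intro card_image_le) auto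
  moreover have "card (C - B) + card B = card C"
    using C(1) fC B(1) by (simp add: card_Diff_subset card_mono)
  ultimately have "card X + vec.dim I \<le> vec.dim ((\<lambda>F. F p) ` V)" using B(5) by linarith
  moreover have "\<exists>G\<in>fs.span X. F p - G p \<in> I" if F: "F \<in> V" for F
  proof -
    have "F p \<in> vec.span C" using F C(4) by auto
    then obtain u where u: "F p = (\<Sum>c\<in>C. u c *s c)" unfolding vec.span_finite[OF fC] by auto
    define G where "G = (\<Sum>c\<in>C - B. fun_scale (u c) (g c))"
    have "G \<in> fs.span X" unfolding G_def X_def by (intro fs.span_sum fs.span_scale fs.span_base) auto
    moreover have "F p - G p = (\<Sum>c\<in>B. u c *s c)"
      using fC C(1) g(2) sum.subset_diff[OF C(1) fC, of "\<lambda>c. u c *s c"]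
      by (simp add: u G_def sum_fun_scale_apply)
    moreover have "(\<Sum>c\<in>B. u c *s c) \<in> vec.span B" by (intro vec.span_sum vec.span_scale vec.span_base)
    ultimately show ?thesis using B(4) by auto
  qed
  moreover have "finite X" "X \<subseteq> V" using fC g(1) by (auto simp: X_def)
  ultimately show ?thesis by blast
qed

lemma det_nonzero_card_le:
  fixes f :: "'n \<Rightarrow> complex^'n"
  assumes det: "det (\<chi> i b. f b $ i) \<noteq> 0" and f: "\<And>b. f b \<in> vec.span S" and S: "finite S"
  shows "CARD('n) \<le> card S"
proof -
  have "x \<in> vec.span S" for x
  proof -
    have "(\<chi> i b. f b $ i) *v (\<chi> k. det (\<chi> i j. if j = k then x $ i else (\<chi> i b. f b $ i) $ i $ j) / det (\<chi> i b. f b $ i)) = x"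
      using cramer[OF det] by blast
    then obtain y where y: "(\<chi> i b. f b $ i) *v y = x" by blast
    have "(\<chi> i b. f b $ i) *v y = (\<Sum>b\<in>UNIV. y $ b *s f b)"
      by (simp add: vec_eq_iff matrix_vector_mult_def mult.commute)
    then show ?thesis using y f by (auto intro!: vec.span_sum vec.span_scale)
  qed
  then have "vec.dim (UNIV :: (complex^'n) set) \<le> card S" by (intro vec.dim_le_card S) auto
  then show ?thesis by (simp only: vec_dim_card)
qed

section \<open>Dimensions of eigenspaces\<close>

definition eigenspace :: "complex^'n^'n \<Rightarrow> complex \<Rightarrow> (complex^'n) set" where
  "eigenspace M e = {v. M *v v = e *s v}"

lemma subspace_eigenspace: "vec.subspace (eigenspace M e)"
  by (auto simp: eigenspace_def vec.subspace_def matrix_vector_right_distrib vector_scalar_commute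
      vec.scale_right_distrib vec.scale_left_commute)

lemma dim_disjoint_le:
  fixes A B :: "(complex^'n) set"
  assumes "vec.subspace A" "vec.subspace B" "\<And>x. x \<in> A \<Longrightarrow> x \<in> B \<Longrightarrow> x = 0"
  shows "vec.dim A + vec.dim B \<le> CARD('n)"
proof -
  have "A \<inter> B \<subseteq> {0}" using assms(3) by blast
  then have 0: "vec.dim (A \<inter> B) = 0" by simp
  have "vec.dim {x + y |x y. x \<in> A \<and> y \<in> B} \<le> vec.dim (UNIV :: (complex^'n) set)"
    by (rule vec.dim_subset) simp
  then show ?thesis
    using vec.dim_sums_Int[OF assms(1,2)] unfolding 0 vec_dim_card by simp
qed

lemma eigenspace_Int:
  assumes "e \<noteq> e'" "x \<in> eigenspace M e" "x \<in> eigenspace M e'"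
  shows "x = 0"
proof -
  have "e *s x = e' *s x" using assms by (simp add: eigenspace_def)
  then have "(e - e') *s x = 0" by (simp add: vec_eq_iff algebra_simps)
  then show ?thesis using assms(1) by (simp add: vec_eq_iff)
qed

lemma dim_eigenspaces_le:
  fixes M :: "complex^'n^'n"
  shows "e \<noteq> e' \<Longrightarrow> vec.dim (eigenspace M e) + vec.dim (eigenspace M e') \<le> CARD('n)"
  by (rule dim_disjoint_le[OF subspace_eigenspace subspace_eigenspace]) (rule eigenspace_Int)

context irreducible_vvmf
begin

abbreviation "k0 \<equiv> minimal_weight \<rho> \<upsilon>"

text \<open>A least element of a set of reals has to be produced. The weights of
  \<open>\<upsilon>\<close> form one class modulo 1, and the Wronskian bound with
  \<open>\<Lambda> j \<ge> 0\<close> keeps weights with a nonzero form at least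
  \<open>- CARD('n)\<close>; so the search runs over natural numbers upwards from a weight that is
  low enough.\<close>

lemma minimal_weight_props:
  shows ms_k0: "multiplier_system k0 \<upsilon>" and vvmf_k0: "\<exists>F\<in>vvmf k0 \<rho> \<upsilon>. F \<noteq> 0"
    and k0_least: "\<And>w. multiplier_system w \<upsilon> \<Longrightarrow> w < k0 \<Longrightarrow> vvmf w \<rho> \<upsilon> = {0}"
proof -
  have nz: "vvmf w \<rho> \<upsilon> \<noteq> {0} \<longleftrightarrow> (\<exists>F\<in>vvmf w \<rho> \<upsilon>. F \<noteq> 0)" for w
    using fs.subspace_0[OF subspace_vvmf, of w \<rho> \<upsilon>] by auto
  obtain w1 where w1: "multiplier_system w1 \<upsilon>" "vvmf w1 \<rho> \<upsilon> \<noteq> {0}" using vvmf_exists by blast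
  have low: "w \<ge> - real CARD('n)" if w: "multiplier_system w \<upsilon>" "vvmf w \<rho> \<upsilon> \<noteq> {0}" for w
  proof -
    obtain F where "F \<in> vvmf w \<rho> \<upsilon>" "F \<noteq> 0" using w nz by blast
    then have "12 * (\<Sum>j\<in>UNIV. \<Lambda> j) \<le> real CARD('n) * w + real (CARD('n) * (CARD('n) - 1))"
      by (rule weight_bound[OF w(1)])
    moreover have "(\<Sum>j\<in>UNIV. \<Lambda> j) \<ge> 0" by (intro sum_nonneg Lambda_bounds)
    moreover have "real (CARD('n) * (CARD('n) - 1)) \<le> real CARD('n) * real CARD('n)"
      unfolding of_nat_mult[symmetric] of_nat_le_iff by (intro mult_left_mono) auto
    ultimately have "0 \<le> real CARD('n) * (w + real CARD('n))" unfolding distrib_left by linarith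
    then show ?thesis by (simp add: zero_le_mult_iff)
  qed
  obtain M :: nat where M: "real M \<ge> w1 + real CARD('n)" using real_arch_simple by blast
  define P where "P k \<longleftrightarrow> vvmf (w1 - real M + real k) \<rho> \<upsilon> \<noteq> {0}" for k :: nat
  have "P M" using w1(2) by (simp add: P_def)
  define k where "k = (LEAST k. P k)"
  have k: "P k" "\<And>j. P j \<Longrightarrow> k \<le> j"
    unfolding k_def using \<open>P M\<close> by (auto intro: LeastI Least_le)
  define w0 where "w0 = w1 - real M + real k"
  have m0: "multiplier_system w0 \<upsilon>"
    using multiplier_system_add_int[OF w1(1), of "int k - int M"] by (simp add: w0_def algebra_simps)
  have least: "w0 \<le> w" if w: "multiplier_system w \<upsilon>" "vvmf w \<rho> \<upsilon> \<noteq> {0}" for w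
  proof -
    obtain n :: int where n: "w = w1 + of_int n" using multiplier_weights_differ_by_int[OF w1(1) w(1)] by blast
    have "real_of_int n + real M \<ge> 0" using low[OF w] M n by linarith
    then have "real_of_int (n + int M) \<ge> 0" by simp
    then have "n + int M \<ge> 0" by (simp only: of_int_0_le_iff)
    then have "w = w1 - real M + real (nat (n + int M))" using n by simp
    then have "P (nat (n + int M))" using w(2) by (simp add: P_def)
    then have "k \<le> nat (n + int M)" by (rule k(2))
    then show ?thesis using \<open>w = w1 - real M + real (nat (n + int M))\<close> by (simp add: w0_def)
  qed
  have "k0 = w0" unfolding minimal_weight_def
    by (rule Least_equality) (use m0 k(1) least in \<open>auto simp: P_def w0_def\<close>)
  then show "multiplier_system k0 \<upsilon>" "\<exists>F\<in>vvmf k0 \<rho> \<upsilon>. F \<noteq> 0"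
    "\<And>w. multiplier_system w \<upsilon> \<Longrightarrow> w < k0 \<Longrightarrow> vvmf w \<rho> \<upsilon> = {0}"
    using m0 k(1) least nz by (auto simp: P_def w0_def not_less[symmetric])
qed

text \<open>Integer degrees spare the recursions by 2 and 3 their boundary cases: the spaces of
  negative degree are zero.\<close>

definition V :: "int \<Rightarrow> (complex \<Rightarrow> complex^'n) set" where
  "V n = vvmf (k0 + 2 * of_int n) \<rho> \<upsilon>"

definition ev :: "complex \<Rightarrow> int \<Rightarrow> (complex^'n) set" where
  "ev p n = (\<lambda>F. F p) ` V n"

lemma ms_V: "multiplier_system (k0 + 2 * of_int n) \<upsilon>"
  using multiplier_system_add_int[OF ms_k0, of "2 * n"] by simp

lemma subspace_V: "fs.subspace (V n)"
  unfolding V_def by (rule subspace_vvmf)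

lemma V_neg: "n < 0 \<Longrightarrow> V n = {0}"
  unfolding V_def by (rule k0_least[OF ms_V]) simp

lemma subspace_ev: "vec.subspace (ev p n)"
proof (rule vec.subspaceI)
  show "0 \<in> ev p n" unfolding ev_def by (rule image_eqI[OF _ fs.subspace_0[OF subspace_V]]) simp
  show "x + y \<in> ev p n" if xy: "x \<in> ev p n" "y \<in> ev p n" for x y
  proof -
    obtain F where "F \<in> V n" "x = F p" using xy(1) by (auto simp: ev_def)
    moreover obtain G where "G \<in> V n" "y = G p" using xy(2) by (auto simp: ev_def)
    ultimately show ?thesis unfolding ev_def
      by (intro image_eqI[OF _ fs.subspace_add[OF subspace_V, of F n G]]) simp_all
  qed
  show "c *s x \<in> ev p n" if x: "x \<in> ev p n" for c x
  proof -
    obtain F where "F \<in> V n" "x = F p" using x by (auto simp: ev_def)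
    then show ?thesis unfolding ev_def
      by (intro image_eqI[OF _ fs.subspace_scale[OF subspace_V, of F n c]]) (simp_all add: fun_scale_def)
  qed
qed

abbreviation "fmul g F \<equiv> (\<lambda>z. g z *s F z)"

lemma V_E4: "F \<in> V n \<Longrightarrow> fmul E4 F \<in> V (n + 2)"
  using vvmf_mult_E4[OF ms_V, of F n] by (simp add: V_def algebra_simps)

lemma V_E6: "F \<in> V n \<Longrightarrow> fmul E6 F \<in> V (n + 3)"
  using vvmf_mult_E6[OF ms_V, of F n] by (simp add: V_def algebra_simps)

lemma V_divide_E4: "F \<in> V n \<Longrightarrow> F rho3 = 0 \<Longrightarrow> \<exists>G\<in>V (n - 2). F = fmul E4 G"
  using vvmf_divide_E4[OF ms_V, of F "n - 2"] by (simp add: V_def algebra_simps)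

lemma V_divide_E6: "F \<in> V n \<Longrightarrow> F \<i> = 0 \<Longrightarrow> \<exists>G\<in>V (n - 3). F = fmul E6 G"
  using vvmf_divide_E6[OF ms_V, of F "n - 3"] by (simp add: V_def algebra_simps)

lemma linear_fmul: "Vector_Spaces.linear fun_scale fun_scale (fmul g)"
  by (unfold_locales) (auto simp: fun_scale_def fun_eq_iff vec_eq_iff algebra_simps)

lemma fmul_inj:
  assumes g: "g holomorphic_on upper_half_plane" "Im p > 0" "g p \<noteq> 0"
  shows "inj_on (fmul g) (V n)"
proof -
  have ker: "F = 0" if F: "F \<in> V n" and 0: "fmul g F = 0" for F
  proof -
    have "F z $ j = 0" if z: "Im z > 0" for z j
    proof -
      define X where "X = {z \<in> upper_half_plane. g z \<noteq> 0}"
      have X: "open X"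
      proof -
        have "open (upper_half_plane \<inter> g -` (- {0}))"
          by (intro continuous_open_preimage holomorphic_on_imp_continuous_on g) auto
        then show ?thesis by (simp add: X_def Int_def vimage_def)
      qed
      have Xne: "X \<noteq> {}" using g by (auto simp: X_def)
      have FX: "F x $ j = 0" if "x \<in> X" for x
      proof -
        have "g x *s F x = 0" using fun_cong[OF 0, of x] by simp
        then have "g x * F x $ j = 0" by (metis vector_smult_component zero_index)
        then show ?thesis using that by (simp add: X_def)
      qed
      show ?thesis
        by (rule analytic_continuation_open[where f = "\<lambda>z. F z $ j" and g = "\<lambda>_. 0", OF X open_upper_half_plane Xne connected_upper_half_plane])
           (use FX z vvmfD(2)[OF ms_V F[unfolded V_def]] in \<open>auto simp: X_def\<close>)
    qed
    then have "F z = 0" for z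
      using vvmfD(1)[OF ms_V F[unfolded V_def], of z] by (cases "Im z > 0") (auto simp: vec_eq_iff)
    then show ?thesis by auto
  qed
  show ?thesis
  proof (rule inj_onI)
    fix F G assume FG: "F \<in> V n" "G \<in> V n" "fmul g F = fmul g G"
    have "fmul g (F - G) = 0" using FG(3) by (simp add: fun_eq_iff vec_eq_iff algebra_simps)
    from ker[OF fs.subspace_diff[OF subspace_V FG(1,2)] this] show "F = G" by (simp add: fun_eq_iff)
  qed
qed

text \<open>Here \<open>q\<close> is a point where \<open>g\<close> does not vanish, which makes
  multiplication by \<open>g\<close> injective. The forms vanishing at \<open>p\<close> are then an
  isomorphic copy of \<open>V (n - k)\<close>.\<close>

lemma dim_V_step:
  assumes g: "g holomorphic_on upper_half_plane" "Im q > 0" "g q \<noteq> 0"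
    and mult: "\<And>F. F \<in> V (n - k) \<Longrightarrow> fmul g F \<in> V n" and zero: "g p = 0"
    and divide: "\<And>F. F \<in> V n \<Longrightarrow> F p = 0 \<Longrightarrow> \<exists>G\<in>V (n - k). F = fmul g G"
    and B: "finite B" "fs.independent B" "fs.span B = V (n - k)"
  shows "\<exists>B'. finite B' \<and> fs.independent B' \<and> fs.span B' = V n"
    and "fs.dim (V n) = fs.dim (V (n - k)) + vec.dim (ev p n)"
proof -
  have inj: "inj_on (fmul g) (fs.span B)" unfolding B(3) by (rule fmul_inj[OF g])
  have "fs.span (fmul g ` B) = fmul g ` V (n - k)"
    unfolding fsp.linear_span_image[OF linear_fmul] B(3) ..
  also have "\<dots> = {F\<in>V n. F p = 0}"
  proof
    show "fmul g ` V (n - k) \<subseteq> {F\<in>V n. F p = 0}" using mult zero by auto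
    show "{F\<in>V n. F p = 0} \<subseteq> fmul g ` V (n - k)"
    proof
      fix F assume "F \<in> {F\<in>V n. F p = 0}"
      then obtain G where "G \<in> V (n - k)" "F = fmul g G" using divide[of F] by auto
      then show "F \<in> fmul g ` V (n - k)" by (intro image_eqI)
    qed
  qed
  finally have sp: "fs.span (fmul g ` B) = {F\<in>V n. F p = 0}" .
  have ind: "fs.independent (fmul g ` B)"
    by (rule fsp.linear_independent_injective_image[OF linear_fmul B(2) inj])
  obtain B' where B': "finite B'" "fs.independent B'" "fs.span B' = V n"
    "card B' = card (fmul g ` B) + vec.dim ((\<lambda>F. F p) ` V n)"
    using evaluation_rank_nullity[OF subspace_V finite_imageI[OF B(1)] ind sp] by blast
  have "card (fmul g ` B) = card B"
    using inj fs.span_superset[of B] by (intro card_image) (rule inj_on_subset)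
  moreover have "fs.dim (V (n - k)) = card B" using fs.dim_span_eq_card_independent[OF B(2)] B(3) by simp
  moreover have "fs.dim (V n) = card B'" using fs.dim_span_eq_card_independent[OF B'(2)] B'(3) by simp
  ultimately show "fs.dim (V n) = fs.dim (V (n - k)) + vec.dim (ev p n)" using B'(4) by (simp add: ev_def)
  show "\<exists>B'. finite B' \<and> fs.independent B' \<and> fs.span B' = V n" using B' by blast
qed

text \<open>A common zero of \<open>E4\<close> and \<open>E6\<close> would be a zero of
  \<open>disc\<close>.\<close>

lemma E4_i: "E4 \<i> \<noteq> 0" and E6_rho3: "E6 rho3 \<noteq> 0"
  using disc_nonzero[of \<i>] disc_nonzero[OF rho3_Im(1)] by (auto simp: disc_def E6_i E4_rho3)

lemma V_finite_basis: "\<exists>B. finite B \<and> fs.independent B \<and> fs.span B = V n"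
proof -
  have neg: "\<exists>B. finite B \<and> fs.independent B \<and> fs.span B = V n" if "n < 0" for n
    using V_neg[OF that] by (intro exI[of _ "{}"]) (auto simp: fs.independent_empty)
  have "\<exists>B. finite B \<and> fs.independent B \<and> fs.span B = V (int m)" for m
  proof (induction m rule: less_induct)
    case (less m)
    have "\<exists>B. finite B \<and> fs.independent B \<and> fs.span B = V (int m - 2)"
      using less[of "m - 2"] neg[of "int m - 2"] by (cases "m \<ge> 2") (auto simp: of_nat_diff)
    then obtain B where B: "finite B" "fs.independent B" "fs.span B = V (int m - 2)" by blast
    show ?case
      by (rule dim_V_step(1)[OF holomorphic_E4 _ E4_i _ E4_rho3 _ B])
         (use V_E4[of _ "int m - 2"] V_divide_E4[of _ "int m"] in auto)
  qed
  from this[of "nat n"] show ?thesis using neg[of n] by (cases "n \<ge> 0") simp_all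
qed

lemma dim_V_E4: "fs.dim (V n) = fs.dim (V (n - 2)) + vec.dim (ev rho3 n)"
proof -
  obtain B where B: "finite B" "fs.independent B" "fs.span B = V (n - 2)" using V_finite_basis by blast
  show ?thesis
    by (rule dim_V_step(2)[OF holomorphic_E4 _ E4_i _ E4_rho3 _ B])
       (use V_E4[of _ "n - 2"] V_divide_E4[of _ n] in auto)
qed

lemma dim_V_E6: "fs.dim (V n) = fs.dim (V (n - 3)) + vec.dim (ev \<i> n)"
proof -
  obtain B where B: "finite B" "fs.independent B" "fs.span B = V (n - 3)" using V_finite_basis by blast
  show ?thesis
    by (rule dim_V_step(2)[OF holomorphic_E6 rho3_Im(1) E6_rho3 _ E6_i _ B])
       (use V_E6[of _ "n - 3"] V_divide_E6[of _ n] in auto)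
qed

lemma dim_V_neg: "n < 0 \<Longrightarrow> fs.dim (V n) = 0" and dim_ev_neg: "n < 0 \<Longrightarrow> vec.dim (ev p n) = 0"
proof -
  assume n: "n < 0"
  show "fs.dim (V n) = 0"
    using fs.dim_span_eq_card_independent[OF fs.independent_empty] V_neg[OF n] by simp
  have "ev p n \<subseteq> {0}" using V_neg[OF n] by (auto simp: ev_def)
  then show "vec.dim (ev p n) = 0" by simp
qed

lemma dim_V_0: "fs.dim (V 0) > 0"
proof -
  obtain B where B: "finite B" "fs.independent B" "fs.span B = V 0" using V_finite_basis by blast
  have "B \<noteq> {}" using B(3) vvmf_k0 by (auto simp: V_def)
  then show ?thesis using fs.dim_span_eq_card_independent[OF B(2)] B by (simp add: card_gt_0_iff)
qed

lemma ev_i_mono: "ev \<i> (n - 2) \<subseteq> ev \<i> n"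
proof
  fix x assume "x \<in> ev \<i> (n - 2)"
  then obtain F where F: "F \<in> V (n - 2)" "x = F \<i>" by (auto simp: ev_def)
  have "E4 \<i> *s x \<in> ev \<i> n" using V_E4[OF F(1)] F(2) by (auto simp: ev_def)
  from vec.subspace_scale[OF subspace_ev this, of "inverse (E4 \<i>)"] show "x \<in> ev \<i> n" using E4_i by simp
qed

text \<open>The subtraction of natural numbers is exact by \<open>ev_i_mono\<close>, which rests on
  \<open>E4 \<i> \<noteq> 0\<close>.\<close>

definition mlt :: "int \<Rightarrow> nat" where "mlt n = vec.dim (ev \<i> n) - vec.dim (ev \<i> (n - 2))"

lemma mlt_ev_i: "vec.dim (ev \<i> n) = vec.dim (ev \<i> (n - 2)) + mlt n"
  using vec.dim_subset[OF ev_i_mono[of n]] by (simp add: mlt_def)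

text \<open>Computed from the recursion by \<open>E6\<close> or from that by \<open>E4\<close>, both
  jumps equal \<open>dim V n - dim V (n - 2) - dim V (n - 3) + dim V (n - 5)\<close>.\<close>

lemma mlt_ev_rho3: "vec.dim (ev rho3 n) = vec.dim (ev rho3 (n - 3)) + mlt n"
  using dim_V_E4[of n] dim_V_E4[of "n - 3"] dim_V_E6[of n] dim_V_E6[of "n - 2"] mlt_ev_i[of n] by simp

section \<open>Values at the elliptic points as eigenvectors\<close>

lemma ev_eigenspace:
  assumes A: "A \<in> SL2Z" and p: "Im p > 0" and fix_p: "moebius A p = p"
  shows "ev p n \<subseteq> eigenspace (\<rho> A) (inverse (aut k0 \<upsilon> A p * den A p powi (2 * n)))"
proof
  fix x assume "x \<in> ev p n"
  then obtain F where F: "F \<in> V n" "x = F p" by (auto simp: ev_def)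
  have a: "aut (k0 + 2 * of_int n) \<upsilon> A p = aut k0 \<upsilon> A p * den A p powi (2 * n)"
    using aut_add_int[OF ms_k0 A p, of "2 * n"] by simp
  have "x = aut (k0 + 2 * of_int n) \<upsilon> A p *s (\<rho> A *v x)"
    using vvmfD(3)[OF ms_V F(1)[unfolded V_def] A p] F(2) by (simp add: fix_p)
  then have "\<rho> A *v x = inverse (aut (k0 + 2 * of_int n) \<upsilon> A p) *s x"
    using aut_nonzero[OF ms_V A p, of n] by (metis vec.scale_left_imp_eq vec.scale_scale vec.scale_one right_inverse)
  then show "x \<in> eigenspace (\<rho> A) (inverse (aut k0 \<upsilon> A p * den A p powi (2 * n)))"
    unfolding a by (simp add: eigenspace_def)
qed

definition alpha :: "int \<Rightarrow> nat" where
  "alpha n = vec.dim (eigenspace (\<rho> S_mat) (inverse (aut k0 \<upsilon> S_mat \<i> * \<i> powi (2 * n))))"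

definition beta :: "int \<Rightarrow> nat" where
  "beta n = vec.dim (eigenspace (\<rho> R_mat) (inverse (aut k0 \<upsilon> R_mat rho3 * rho3 powi (2 * n))))"

lemma ev_i_le: "vec.dim (ev \<i> n) \<le> alpha n"
  using vec.dim_subset[OF ev_eigenspace[OF SL2Z_S, of \<i> n]] by (simp add: alpha_def)

lemma ev_rho3_le: "vec.dim (ev rho3 n) \<le> beta n"
  using vec.dim_subset[OF ev_eigenspace[OF R_mat_SL2Z rho3_Im(1) moebius_R_rho3, of n]] by (simp add: beta_def)

lemma alpha_period: "alpha (n + 2 * m) = alpha n"
proof -
  have "\<i> powi (2 * (n + 2 * m)) = \<i> powi (2 * n) * (\<i> powi 4) powi m"
    by (subst power_int_mult[symmetric], subst power_int_add[symmetric]) (simp_all add: distrib_left)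
  also have "\<i> powi 4 = 1" by (simp add: power_int_numeral i_power)
  finally show ?thesis by (simp only: alpha_def power_int_1_left mult_1_right)
qed

lemma beta_period: "beta (n + 3 * m) = beta n"
proof -
  have r0: "rho3 \<noteq> 0" using rho3_Im by auto
  have "rho3 powi (2 * (n + 3 * m)) = rho3 powi (2 * n) * (rho3 powi 3) powi (2 * m)"
    by (subst power_int_mult[symmetric], subst power_int_add[symmetric]) (simp_all add: r0 distrib_left)
  also have "rho3 powi 3 = 1" by (simp add: power_int_numeral rho3_cube)
  finally show ?thesis by (simp only: beta_def power_int_1_left mult_1_right)
qed

lemma alpha_sum: "alpha 0 + alpha 1 \<le> CARD('n)"
proof -
  have "aut k0 \<upsilon> S_mat \<i> \<noteq> 0" by (rule aut_nonzero[OF ms_k0]) auto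
  then show ?thesis unfolding alpha_def by (intro dim_eigenspaces_le) (simp add: power_int_numeral)
qed

text \<open>A common eigenvector of the generators would span an invariant line.\<close>

lemma alpha_beta:
  assumes N: "CARD('n) > 1"
  shows "alpha i + beta j \<le> CARD('n)"
  unfolding alpha_def beta_def
proof (rule dim_disjoint_le[OF subspace_eigenspace subspace_eigenspace], rule ccontr)
  fix v assume S: "v \<in> eigenspace (\<rho> S_mat) (inverse (aut k0 \<upsilon> S_mat \<i> * \<i> powi (2 * i)))"
    and R: "v \<in> eigenspace (\<rho> R_mat) (inverse (aut k0 \<upsilon> R_mat rho3 * rho3 powi (2 * j)))" and v: "v \<noteq> 0"
  define P where "P A \<longleftrightarrow> (\<exists>e. e \<noteq> 0 \<and> \<rho> A *v v = e *s v)" for A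
  have nz: "e \<noteq> 0" if "A \<in> SL2Z" "\<rho> A *v v = e *s v" for A e
  proof
    assume "e = 0"
    then have "\<rho> (adj22 A) *v (\<rho> A *v v) = 0" using that by simp
    then show False using rho_adj[OF that(1)] v by (simp add: matrix_vector_mul_assoc)
  qed
  have adj: "P (adj22 A)" if A: "A \<in> SL2Z" and PA: "P A" for A
  proof -
    obtain e where e: "e \<noteq> 0" "\<rho> A *v v = e *s v" using PA by (auto simp: P_def)
    have "\<rho> (adj22 A) *v (\<rho> A *v v) = v" using rho_adj[OF A] by (simp add: matrix_vector_mul_assoc)
    then have "e *s (\<rho> (adj22 A) *v v) = v" unfolding e(2) by (simp add: vector_scalar_commute)
    then have "\<rho> (adj22 A) *v v = inverse e *s v" using e(1)
      by (metis vec.scale_scale vec.scale_one left_inverse)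
    then show ?thesis using e(1) unfolding P_def by (intro exI[of _ "inverse e"]) simp
  qed
  have mult: "P (A ** B)" if A: "A \<in> SL2Z" "B \<in> SL2Z" and PA: "P A" "P B" for A B
  proof -
    obtain e f where e: "e \<noteq> 0" "\<rho> A *v v = e *s v" and f: "f \<noteq> 0" "\<rho> B *v v = f *s v" using PA by (auto simp: P_def)
    have "\<rho> (A ** B) *v v = \<rho> A *v (\<rho> B *v v)" using A by (simp add: rho_mult matrix_vector_mul_assoc)
    also have "\<dots> = (f * e) *s v" unfolding f(2) by (simp add: vector_scalar_commute e(2))
    finally show ?thesis using e f unfolding P_def by (intro exI[of _ "f * e"]) simp
  qed
  have PI: "P A" if "A \<in> SL2Z" "\<rho> A *v v = e *s v" for A e
    unfolding P_def using that nz[OF that] by (intro exI[of _ e] conjI)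
  have PS: "P S_mat" using S unfolding eigenspace_def mem_Collect_eq by (rule PI[OF SL2Z_S])
  have PR: "P R_mat" using R unfolding eigenspace_def mem_Collect_eq by (rule PI[OF R_mat_SL2Z])
  have "S_mat ** adj22 R_mat = T_mat" by (simp add: mat22_simps S_mat_def R_mat_def adj22_def T_mat_eq)
  then have PT: "P T_mat" using mult[OF SL2Z_S _ PS adj[OF _ PR]] by simp
  have PA: "P A" if "A \<in> SL2Z" for A by (rule SL2Z_generated[where P = P, OF that PS PT adj mult])
  define W where "W = range (\<lambda>c. c *s v)"
  have "vec.subspace W"
  proof -
    have "W = vec.span {v}" by (simp add: W_def vec.span_singleton)
    then show ?thesis by simp
  qed
  moreover have "\<rho> A *v x \<in> W" if A: "A \<in> SL2Z" and x: "x \<in> W" for A x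
  proof -
    obtain c where c: "x = c *s v" using x unfolding W_def by (rule rangeE)
    obtain e where e: "\<rho> A *v v = e *s v" using PA[OF A] unfolding P_def by (elim exE conjE)
    have "\<rho> A *v x = (c * e) *s v" by (simp add: c vector_scalar_commute e)
    then show ?thesis unfolding W_def by (rule range_eqI)
  qed
  moreover have "v \<in> W" unfolding W_def by (intro range_eqI[of _ _ 1]) simp
  ultimately have "W = UNIV" using v by (rule invariant_subspace_UNIV)
  then have "UNIV \<subseteq> vec.span {v}" by (auto simp: W_def vec.span_singleton)
  then have "vec.dim (UNIV :: (complex^'n) set) \<le> card {v}" by (intro vec.dim_le_card) auto
  then show False using N unfolding vec_dim_card by simp
qed

section \<open>Generators\<close>

text \<open>Lifts of vectors that complement the values at \<open>\<i>\<close> already coming from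
  degree \<open>n - 2\<close> by multiplication with \<open>E4\<close>. An upper bound on their
  number is what the rank estimate asks for.\<close>

definition gens :: "int \<Rightarrow> (complex \<Rightarrow> complex^'n) set" where
  "gens n = (SOME X. finite X \<and> X \<subseteq> V n \<and> card X \<le> mlt n \<and>
     (\<forall>F\<in>V n. \<exists>G\<in>fs.span X. F \<i> - G \<i> \<in> ev \<i> (n - 2)))"

lemma gens: "finite (gens n)" "gens n \<subseteq> V n" "card (gens n) \<le> mlt n"
  "F \<in> V n \<Longrightarrow> \<exists>G\<in>fs.span (gens n). F \<i> - G \<i> \<in> ev \<i> (n - 2)"
proof -
  obtain X where X: "finite X" "X \<subseteq> V n" "card X + vec.dim (ev \<i> (n - 2)) \<le> vec.dim (ev \<i> n)"
    "\<forall>F\<in>V n. \<exists>G\<in>fs.span X. F \<i> - G \<i> \<in> ev \<i> (n - 2)"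
    using evaluation_generators[OF subspace_V subspace_ev, of \<i> "n - 2" \<i> n] ev_i_mono[of n] unfolding ev_def by blast
  have "card X \<le> mlt n" using X(3) mlt_ev_i[of n] by simp
  then have "\<exists>X. finite X \<and> X \<subseteq> V n \<and> card X \<le> mlt n \<and> (\<forall>F\<in>V n. \<exists>G\<in>fs.span X. F \<i> - G \<i> \<in> ev \<i> (n - 2))"
    using X by blast
  from someI_ex[OF this]
  have *: "finite (gens n) \<and> gens n \<subseteq> V n \<and> card (gens n) \<le> mlt n \<and> (\<forall>F\<in>V n. \<exists>G\<in>fs.span (gens n). F \<i> - G \<i> \<in> ev \<i> (n - 2))"
    unfolding gens_def .
  show "finite (gens n)" "gens n \<subseteq> V n" "card (gens n) \<le> mlt n" using * by blast+
  show "F \<in> V n \<Longrightarrow> \<exists>G\<in>fs.span (gens n). F \<i> - G \<i> \<in> ev \<i> (n - 2)" using * by blast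
qed

text \<open>Subtracting \<open>G\<close> leaves a value at \<open>\<i>\<close> that occurs in degree
  \<open>n - 2\<close>, a multiple by \<open>E4\<close> removes it, and a form vanishing at
  \<open>\<i>\<close> is divisible by \<open>E6\<close>.\<close>

lemma V_decompose:
  assumes F: "F \<in> V n"
  shows "\<exists>G\<in>fs.span (gens n). \<exists>F1\<in>V (n - 2). \<exists>F2\<in>V (n - 3). F = G + fmul E4 F1 + fmul E6 F2"
proof -
  obtain G where G: "G \<in> fs.span (gens n)" "F \<i> - G \<i> \<in> ev \<i> (n - 2)" using gens(4)[OF F] by blast
  then obtain H where H: "H \<in> V (n - 2)" "F \<i> - G \<i> = H \<i>" by (auto simp: ev_def)
  define F1 where "F1 = fun_scale (inverse (E4 \<i>)) H"
  have F1: "F1 \<in> V (n - 2)" unfolding F1_def by (rule fs.subspace_scale[OF subspace_V H(1)])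
  have GV: "G \<in> V n" using G(1) fs.span_minimal[OF gens(2) subspace_V] by blast
  have EV: "fmul E4 F1 \<in> V n" using V_E4[OF F1] by simp
  have "(F - G - fmul E4 F1) \<i> = 0" using H(2) E4_i by (simp add: F1_def fun_scale_def)
  moreover have "F - G - fmul E4 F1 \<in> V n" by (intro fs.subspace_diff subspace_V F GV EV)
  ultimately obtain F2 where F2: "F2 \<in> V (n - 3)" "F - G - fmul E4 F1 = fmul E6 F2" using V_divide_E6 by blast
  have "F = G + fmul E4 F1 + (F - G - fmul E4 F1)" by simp
  then have "F = G + fmul E4 F1 + fmul E6 F2" unfolding F2(2) .
  then show ?thesis using G(1) F1 F2(1) by blast
qed

text \<open>The rank of the module generated below degree \<open>m\<close> is measured at a single
  point, where ring coefficients become scalars.\<close>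

definition gspan :: "nat \<Rightarrow> complex \<Rightarrow> (complex^'n) set" where
  "gspan m z = vec.span (\<Union>k<m. (\<lambda>G. G z) ` gens (int k))"

lemma V_gspan: "n < int m \<Longrightarrow> F \<in> V n \<Longrightarrow> F z \<in> gspan m z"
proof -
  have neg: "F z \<in> gspan m z" if "n < 0" "F \<in> V n" for n F
    using V_neg[OF that(1)] that(2) by (simp add: gspan_def vec.span_zero)
  have nonneg: "\<forall>F\<in>V (int k). F z \<in> gspan m z" if "k < m" for k
    using that
  proof (induction k rule: less_induct)
    case (less k)
    show ?case
    proof
      fix F assume "F \<in> V (int k)"
      then obtain G F1 F2 where G: "G \<in> fs.span (gens (int k))" and F1: "F1 \<in> V (int k - 2)" and F2: "F2 \<in> V (int k - 3)"
        and F: "F = G + fmul E4 F1 + fmul E6 F2" using V_decompose by blast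
      have "F1 z \<in> gspan m z"
        using less.IH[of "k - 2"] less.prems neg[of "int k - 2" F1] F1 by (cases "k \<ge> 2") (auto simp: of_nat_diff)
      moreover have "F2 z \<in> gspan m z"
        using less.IH[of "k - 3"] less.prems neg[of "int k - 3" F2] F2 by (cases "k \<ge> 3") (auto simp: of_nat_diff)
      moreover have "G z \<in> gspan m z"
        using G
      proof (induction rule: fs.span_induct_alt)
        case base
        then show ?case by (simp add: gspan_def vec.span_zero)
      next
        case (step c x y)
        then have "x z \<in> gspan m z" unfolding gspan_def using less.prems by (intro vec.span_base) auto
        then show ?case using step unfolding gspan_def by (simp add: fun_scale_def vec.span_add vec.span_scale)
      qed
      ultimately show "F z \<in> gspan m z"
        unfolding F gspan_def by (simp add: vec.span_add vec.span_scale)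
    qed
  qed
  assume n: "n < int m" and F: "F \<in> V n"
  show "F z \<in> gspan m z"
  proof (cases "n < 0")
    case True
    then show ?thesis by (rule neg[OF _ F])
  next
    case False
    then have "int (nat n) = n" "nat n < m" using n by linarith+
    then show ?thesis using nonneg[of "nat n"] F by simp
  qed
qed

lemma gspan_card: "card (\<Union>k<m. (\<lambda>G. G z) ` gens (int k)) \<le> (\<Sum>k<m. mlt (int k))"
proof -
  have "card (\<Union>k<m. (\<lambda>G. G z) ` gens (int k)) \<le> (\<Sum>k<m. card ((\<lambda>G. G z) ` gens (int k)))"
    by (rule card_UN_le) simp
  also have "\<dots> \<le> (\<Sum>k<m. mlt (int k))"
    by (intro sum_mono order_trans[OF card_image_le[OF gens(1)] gens(3)])
  finally show ?thesis .
qed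

text \<open>At a point where the Wronskian does not vanish the iterates form a basis, and they lie
  in the span of at most \<open>\<Sum>k<m. mlt (int k)\<close> vectors.\<close>

lemma rank_bound:
  assumes F: "F \<in> V 0" "F \<noteq> 0"
    and D: "\<And>j z. j < CARD('n) \<Longrightarrow> Im z > 0 \<Longrightarrow> Dit k0 F j z \<in> gspan m z"
  shows "CARD('n) \<le> (\<Sum>k<m. mlt (int k))"
proof -
  have F0: "F \<in> vvmf k0 \<rho> \<upsilon>" using F(1) by (simp add: V_def)
  obtain z idx where z: "Im z > 0" "bij_betw idx (UNIV :: 'n set) {..<CARD('n)}"
     "det (\<chi> i b. Dit k0 F (idx b) z $ i) \<noteq> 0" using Wronskian_nonzero[OF ms_k0 F0 F(2)] by blast
  have "CARD('n) \<le> card (\<Union>k<m. (\<lambda>G. G z) ` gens (int k))"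
  proof (rule det_nonzero_card_le[OF z(3)])
    fix b
    have "idx b < CARD('n)" using z(2) by (auto simp: bij_betw_def)
    then show "Dit k0 F (idx b) z \<in> vec.span (\<Union>k<m. (\<lambda>G. G z) ` gens (int k))"
      using D[OF _ z(1)] by (simp add: gspan_def)
  qed (auto intro: gens(1))
  then show ?thesis using gspan_card order_trans by blast
qed

lemma sum_mlt_ge: "CARD('n) \<le> (\<Sum>k<CARD('n). mlt (int k))"
proof -
  obtain F where F: "F \<in> V 0" "F \<noteq> 0" using vvmf_k0 by (auto simp: V_def)
  show ?thesis
  proof (rule rank_bound[OF F])
    fix j z assume "j < CARD('n)"
    moreover have "Dit k0 F j \<in> V (int j)" using Dit_vvmf[OF ms_k0, of F j] F(1) by (simp add: V_def)
    ultimately show "Dit k0 F j z \<in> gspan CARD('n) z" by (intro V_gspan[of "int j"]) auto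
  qed
qed

text \<open>An inductive predicate in place of a span, so that stability under \<open>Dop\<close>
  becomes a rule induction with one case per module operation.\<close>

inductive low :: "nat \<Rightarrow> int \<Rightarrow> (complex \<Rightarrow> complex^'n) \<Rightarrow> bool" for m where
  base: "n < int m \<Longrightarrow> F \<in> V n \<Longrightarrow> low m n F"
| E4: "low m n F \<Longrightarrow> low m (n + 2) (fmul E4 F)"
| E6: "low m n F \<Longrightarrow> low m (n + 3) (fmul E6 F)"
| add: "low m n F \<Longrightarrow> low m n G \<Longrightarrow> low m n (F + G)"
| scale: "low m n F \<Longrightarrow> low m n (fun_scale c F)"

lemma low_V: "low m n F \<Longrightarrow> F \<in> V n"
proof (induction rule: low.induct)
  case (add n F G)
  show ?case by (rule fs.subspace_add[OF subspace_V add.IH])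
next
  case (scale n F c)
  show ?case by (rule fs.subspace_scale[OF subspace_V scale.IH])
qed (assumption | rule V_E4 V_E6)+

lemma low_gspan: "low m n F \<Longrightarrow> F z \<in> gspan m z"
proof (induction rule: low.induct)
  case (base n F)
  then show ?case by (rule V_gspan)
qed (auto simp: gspan_def fun_scale_def intro: vec.span_add vec.span_scale)

lemma Dop_scale:
  assumes "F \<in> V n"
  shows "Dop w (fun_scale c F) = fun_scale c (Dop w F)"
proof
  fix z
  show "Dop w (fun_scale c F) z = fun_scale c (Dop w F) z"
  proof (cases "Im z > 0")
    case True
    have "deriv (\<lambda>z. c * F z $ j) z = c * deriv (\<lambda>z. F z $ j) z" for j
      using True by (intro DERIV_imp_deriv DERIV_cmult holomorphic_derivI[OF vvmfD(2)[OF ms_V assms[unfolded V_def]]]) auto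
    then show ?thesis using True by (simp add: Dop_def fun_scale_def vec_eq_iff algebra_simps)
  qed (simp add: Dop_def fun_scale_def)
qed

text \<open>For multiples by \<open>E4\<close> and \<open>E6\<close> the Leibniz rule and
  Ramanujan's identities suffice: the derivatives of the factors contribute multiples by
  \<open>E6\<close> and by \<open>E4\<close> twice.\<close>

lemma Dop_low:
  assumes m: "mlt (int m) = 0" and F: "low m n F"
  shows "low m (n + 1) (Dop (k0 + 2 * of_int n) F)"
  using F
proof (induction rule: low.induct)
  case (base n F)
  have DV: "Dop (k0 + 2 * of_int n) F \<in> V (n + 1)"
    using Dop_vvmf[OF ms_V, of F n] base(2) by (simp add: V_def algebra_simps)
  show ?case
  proof (cases "n + 1 < int m")
    case True
    then show ?thesis using DV by (rule low.base)
  next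
    case False
    \<comment> \<open>Only degree \<open>m\<close> itself can be reached anew. Without generators
      there, \<open>V m\<close> consists of \<open>E4\<close> and \<open>E6\<close> multiples of
      lower forms.\<close>
    then have n: "n + 1 = int m" using base by simp
    have "gens (int m) = {}" using gens(1,3)[of "int m"] m by simp
    then obtain F1 F2 where F12: "F1 \<in> V (int m - 2)" "F2 \<in> V (int m - 3)"
      "Dop (k0 + 2 * of_int n) F = fmul E4 F1 + fmul E6 F2"
      using V_decompose[OF DV] unfolding n by auto
    have "low m (int m - 2 + 2) (fmul E4 F1)" "low m (int m - 3 + 3) (fmul E6 F2)"
      by (intro low.E4 low.E6 low.base F12; simp)+
    then show ?thesis unfolding n F12(3) by (intro low.add) simp_all
  qed
next
  case (E4 n F)
  obtain c where c: "\<And>z. Im z > 0 \<Longrightarrow> deriv E4 z - phi z * E4 z / 3 = c / 3 * E6 z"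
    by (rule Ramanujan) blast
  note FV = low_V[OF E4.hyps, unfolded V_def]
  have D: "Dop (k0 + 2 * of_int (n + 2)) (fmul E4 F) = fmul E4 (Dop (k0 + 2 * of_int n) F) + fmul E6 (fun_scale (c / 3) F)"
  proof
    fix z
    show "Dop (k0 + 2 * of_int (n + 2)) (fmul E4 F) z = (fmul E4 (Dop (k0 + 2 * of_int n) F) + fmul E6 (fun_scale (c / 3) F)) z"
    proof (cases "Im z > 0")
      case True
      have w: "k0 + 2 * of_int (n + 2) = k0 + 2 * of_int n + 4" by simp
      have d: "deriv E4 z = c / 3 * E6 z + phi z * E4 z / 3" unfolding c[OF True, symmetric] by simp
      show ?thesis unfolding w Dop_mult[OF ms_V FV holomorphic_E4 True, of 4]
        by (simp add: d fun_scale_def vec_eq_iff algebra_simps)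
    next
      case False
      then show ?thesis using vvmfD(1)[OF ms_V FV, of z] by (simp add: Dop_def fun_scale_def)
    qed
  qed
  have 1: "low m (n + 3) (fmul E4 (Dop (k0 + 2 * of_int n) F))" using low.E4[OF E4.IH] by (simp add: add.commute)
  have 2: "low m (n + 3) (fmul E6 (fun_scale (c / 3) F))" by (intro low.E6 low.scale E4.hyps)
  have n: "n + 2 + 1 = n + 3" by simp
  show ?case unfolding D n by (rule low.add[OF 1 2])
next
  case (E6 n F)
  obtain c where c: "\<And>z. Im z > 0 \<Longrightarrow> deriv E6 z - phi z * E6 z / 2 = c / 2 * E4 z ^ 2"
    by (rule Ramanujan) blast
  note FV = low_V[OF E6.hyps, unfolded V_def]
  have D: "Dop (k0 + 2 * of_int (n + 3)) (fmul E6 F) = fmul E6 (Dop (k0 + 2 * of_int n) F) + fmul E4 (fmul E4 (fun_scale (c / 2) F))"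
  proof
    fix z
    show "Dop (k0 + 2 * of_int (n + 3)) (fmul E6 F) z = (fmul E6 (Dop (k0 + 2 * of_int n) F) + fmul E4 (fmul E4 (fun_scale (c / 2) F))) z"
    proof (cases "Im z > 0")
      case True
      have w: "k0 + 2 * of_int (n + 3) = k0 + 2 * of_int n + 6" by simp
      have d: "deriv E6 z = c / 2 * E4 z ^ 2 + phi z * E6 z / 2" unfolding c[OF True, symmetric] by simp
      show ?thesis unfolding w Dop_mult[OF ms_V FV holomorphic_E6 True, of 6]
        by (simp add: d fun_scale_def vec_eq_iff algebra_simps power2_eq_square)
    next
      case False
      then show ?thesis using vvmfD(1)[OF ms_V FV, of z] by (simp add: Dop_def fun_scale_def)
    qed
  qed
  have 1: "low m (n + 4) (fmul E6 (Dop (k0 + 2 * of_int n) F))" using low.E6[OF E6.IH] by (simp add: add.commute)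
  have 2: "low m (n + 4) (fmul E4 (fmul E4 (fun_scale (c / 2) F)))"
    using low.E4[OF low.E4[OF low.scale[OF E6.hyps]]] by (simp add: add.commute)
  have n: "n + 3 + 1 = n + 4" by simp
  show ?case unfolding D n by (rule low.add[OF 1 2])
next
  case (add n F G)
  show ?case
    unfolding Dop_add[OF ms_V low_V[OF add.hyps(1), unfolded V_def] low_V[OF add.hyps(2), unfolded V_def]]
    by (rule low.add[OF add.IH])
next
  case (scale n F c)
  show ?case unfolding Dop_scale[OF low_V[OF scale.hyps]] by (rule low.scale[OF scale.IH])
qed

lemma no_gap:
  assumes m: "m > 0" "mlt (int m) = 0"
  shows "CARD('n) \<le> (\<Sum>k<m. mlt (int k))"
proof -
  obtain F where F: "F \<in> V 0" "F \<noteq> 0" using vvmf_k0 by (auto simp: V_def)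
  \<comment> \<open>All iterates stay in the part generated below degree \<open>m\<close>;
    \<open>m > 0\<close> lets the induction start with \<open>F\<close> in degree 0.\<close>
  have "low m (int j) (Dit k0 F j)" for j
  proof (induction j)
    case 0
    then show ?case using F m by (auto intro: low.base)
  next
    case (Suc j)
    from Dop_low[OF m(2) this] show ?case by (simp add: add.commute)
  qed
  then show ?thesis by (intro rank_bound[OF F]) (rule low_gspan)
qed

section \<open>From numbers of generators to the series\<close>

lemma dim_V_vvmf: "dim_vvmf (k0 + 2 * real n) \<rho> \<upsilon> = fs.dim (V (int n))"
  by (simp add: dim_vvmf_def V_def)

text \<open>Clearing the denominator \<open>1 - X^4 - X^6 + X^10\<close> leaves
  \<open>dim V n - dim V (n - 2) - dim V (n - 3) + dim V (n - 5)\<close> at the exponent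
  \<open>2 * n\<close>, and this is \<open>mlt n\<close>.\<close>

lemma hilbert_poincare_eq:
  fixes P :: "real fps"
  assumes P: "\<And>n. fps_nth P (2 * n) = real (mlt (int n))" "\<And>n. fps_nth P (2 * n + 1) = 0"
  shows "hilbert_poincare \<rho> \<upsilon> = shift_fps k0 (P / ((1 - fps_X^4) * (1 - fps_X^6)))"
proof -
  define h where "h n = real (fs.dim (V n))" for n
  \<comment> \<open>The series without the factor \<open>t^k0\<close>, whose exponent is real and
    need not be an integer.\<close>
  define \<Psi> :: "real fps" where "\<Psi> = Abs_fps (\<lambda>k. if even k then h (int k div 2) else 0)"
  have h: "h n - h (n - 2) - h (n - 3) + h (n - 5) = real (mlt n)" for n
    using dim_V_E6[of n] dim_V_E6[of "n - 2"] mlt_ev_i[of n] by (simp add: h_def)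
  have hneg: "h n = 0" if "n < 0" for n using dim_V_neg[OF that] by (simp add: h_def)
  have prod: "\<Psi> * ((1 - fps_X^4) * (1 - fps_X^6)) = P"
  proof (rule fps_ext)
    fix k
    have e: "\<Psi> * ((1 - fps_X^4) * (1 - fps_X^6)) = \<Psi> - fps_X^4 * \<Psi> - fps_X^6 * \<Psi> + fps_X^10 * \<Psi>"
      by (simp add: algebra_simps flip: power_add)
    show "fps_nth (\<Psi> * ((1 - fps_X^4) * (1 - fps_X^6))) k = fps_nth P k"
    proof (cases "even k")
      case True
      then obtain n where n: "k = 2 * n" by (auto elim: evenE)
      have s: "fps_nth (fps_X ^ (2 * j) * \<Psi>) k = h (int n - int j)" for j
        unfolding n fps_X_power_mult_nth by (auto simp: \<Psi>_def hneg of_nat_diff)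
      have "fps_nth (\<Psi> * ((1 - fps_X^4) * (1 - fps_X^6))) k = h (int n) - h (int n - 2) - h (int n - 3) + h (int n - 5)"
        unfolding e using s[of 2] s[of 3] s[of 5] by (simp add: \<Psi>_def n)
      then show ?thesis using h[of "int n"] P(1)[of n] n by simp
    next
      case False
      then obtain n where n: "k = 2 * n + 1" by (auto elim: oddE)
      have s: "fps_nth (fps_X ^ (2 * j) * \<Psi>) k = 0" for j
        unfolding n fps_X_power_mult_nth by (auto simp: \<Psi>_def)
      show ?thesis unfolding e using s[of 2] s[of 3] s[of 5] P(2)[of n] by (simp add: \<Psi>_def n)
    qed
  qed
  have nz: "(1 - fps_X^4) * (1 - fps_X^6) \<noteq> (0 :: real fps)"
  proof
    assume "(1 - fps_X^4) * (1 - fps_X^6) = (0 :: real fps)"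
    from arg_cong[OF this, of "\<lambda>f. fps_nth f 0"] show False by simp
  qed
  have \<Psi>: "P / ((1 - fps_X^4) * (1 - fps_X^6)) = \<Psi>"
    unfolding prod[symmetric] by (rule nonzero_mult_div_cancel_right[OF nz])
  show ?thesis
  proof
    fix x
    show "hilbert_poincare \<rho> \<upsilon> x = shift_fps k0 (P / ((1 - fps_X^4) * (1 - fps_X^6))) x"
    proof (cases "x - k0 \<in> \<nat>")
      case nat: True
      then obtain j where j: "x = k0 + real j" by (auto elim!: Nats_cases simp: algebra_simps)
      show ?thesis
      proof (cases "even j")
        case True
        then obtain n where n: "j = 2 * n" by (auto elim: evenE)
        have "x - k0 = real (2 * n)" using j n by simp
        then have fl: "nat \<lfloor>x - k0\<rfloor> = 2 * n" by (simp only: floor_of_nat nat_int)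
        have x: "x = k0 + 2 * real n" using j n by simp
        have "hilbert_poincare \<rho> \<upsilon> x = h (int n)"
          unfolding x by (auto simp: hilbert_poincare_def h_def dim_V_vvmf)
        also have "h (int n) = fps_nth \<Psi> (2 * n)" by (simp add: \<Psi>_def)
        also have "\<dots> = shift_fps k0 \<Psi> x" unfolding shift_fps_def fl using nat by simp
        finally show ?thesis unfolding \<Psi> .
      next
        case False
        then have "\<not> (\<exists>n::nat. x = k0 + 2 * real n)" unfolding j
          by (metis add_left_cancel dvd_triv_left of_nat_eq_iff of_nat_mult of_nat_numeral)
        then show ?thesis using False j by (simp add: hilbert_poincare_def shift_fps_def \<Psi> \<Psi>_def)
      qed
    next
      case False
      have "x \<noteq> k0 + 2 * real n" for n :: nat
      proof
        assume "x = k0 + 2 * real n"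
        then have "x - k0 = real (2 * n)" by simp
        then show False using False by (metis of_nat_in_Nats)
      qed
      then show ?thesis using False by (simp add: hilbert_poincare_def shift_fps_def)
    qed
  qed
qed

text \<open>The values at \<open>\<i>\<close> grow in steps of 2 inside eigenspaces of period 2;
  once an eigenspace is filled, in degree 3 or 4, nothing can be added in that parity.\<close>

lemma mlt_eventually_0:
  assumes e: "vec.dim (ev \<i> 4) = alpha 0" "vec.dim (ev \<i> 3) = alpha 1"
    and n: "n \<ge> 5"
  shows "mlt n = 0"
proof -
  have ge: "vec.dim (ev \<i> (int k + 3)) = alpha (int k + 3)" for k
  proof (induction k rule: less_induct)
    case (less k)
    consider "k = 0" | "k = 1" | "k \<ge> 2" by linarith
    then show ?case
    proof cases
      case 1
      then show ?thesis using e(2) alpha_period[of 1 1] by simp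
    next
      case 2
      then show ?thesis using e(1) alpha_period[of 0 2] by simp
    next
      case 3
      have "vec.dim (ev \<i> (int (k - 2) + 3)) = alpha (int (k - 2) + 3)" using less[of "k - 2"] 3 by simp
      moreover have k: "int (k - 2) + 3 = int k + 3 - 2" using 3 by (simp add: of_nat_diff)
      moreover have "alpha (int k + 3) = alpha (int k + 3 - 2)" using alpha_period[of "int k + 3 - 2" 1] by (simp add: add.commute)
      ultimately have "alpha (int k + 3) \<le> vec.dim (ev \<i> (int k + 3 - 2))" by simp
      then show ?thesis using mlt_ev_i[of "int k + 3"] ev_i_le[of "int k + 3"] by linarith
    qed
  qed
  have "vec.dim (ev \<i> n) = alpha n" using ge[of "nat (n - 3)"] n by simp
  moreover have "vec.dim (ev \<i> (n - 2)) = alpha (n - 2)" using ge[of "nat (n - 5)"] n by simp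
  moreover have "alpha n = alpha (n - 2)" using alpha_period[of "n - 2" 1] by simp
  ultimately show ?thesis by (simp add: mlt_def)
qed

end

section \<open>Dimension five\<close>

text \<open>\<open>a\<close> to \<open>e\<close> are the numbers of generators in degrees 0 to 4,
  \<open>x\<close> and \<open>y\<close> the dimensions of the eigenspaces of
  \<open>\<rho>(S)\<close> for even and odd degree, and \<open>u\<close>, \<open>v\<close>,
  \<open>w\<close> those of \<open>\<rho>(R)\<close> for degrees 0, 1, 2 modulo 3. The equations for
  \<open>x\<close> and \<open>y\<close> belong to the conclusion because they exclude generators
  beyond degree 4.\<close>

lemma generator_patterns:
  fixes a b c d e :: nat
  assumes a: "a \<ge> 1" and ge: "a + b + c + d + e \<ge> 5"
    and even: "a + c + e \<le> x" and odd: "b + d \<le> y" and xy: "x + y \<le> 5"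
    and three: "a + d \<le> u" "b + e \<le> v" "c \<le> w"
    and mix: "x + u \<le> 5" "x + v \<le> 5" "x + w \<le> 5" "y + u \<le> 5" "y + v \<le> 5" "y + w \<le> 5"
    and gap: "b = 0 \<Longrightarrow> a \<ge> 5" "c = 0 \<Longrightarrow> a + b \<ge> 5" "d = 0 \<Longrightarrow> a + b + c \<ge> 5" "e = 0 \<Longrightarrow> a + b + c + d \<ge> 5"
  shows "x = a + c + e \<and> y = b + d \<and>
    (a, b, c, d, e) \<in> {(1, 1, 1, 1, 1), (2, 2, 1, 0, 0), (1, 1, 2, 1, 0), (1, 2, 1, 1, 0), (1, 2, 2, 0, 0)}"
proof -
  \<comment> \<open>At least five generators have to fit into two eigenspaces of total dimension at
    most 5, so equality holds everywhere.\<close>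
  have x: "x = a + c + e" and y: "y = b + d" and xy5: "x + y = 5" using ge even odd xy by linarith+
  have sum: "a + b + c + d + e = 5" using x y xy5 by linarith
  \<comment> \<open>For each eigenspace of \<open>\<rho>(R)\<close> the two mixed inequalities add
    up to \<open>5 + 2 * u \<le> 10\<close>.\<close>
  have "u \<le> 2" "v \<le> 2" "w \<le> 2" using mix xy5 by linarith+
  then have le: "a + d \<le> 2" "b + e \<le> 2" "c \<le> 2" using three by linarith+
  have m: "2 * a + c + d + e \<le> 5" using x mix(1) three(1) by linarith
  have "b \<noteq> 0" using gap(1) le by auto
  have "c \<noteq> 0" using gap(2) le by auto
  have d: "d = 0 \<longrightarrow> a + b + c = 5" and e: "e = 0 \<longrightarrow> a + b + c + d = 5" using gap(3,4) sum by auto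
  have "a = 1 \<or> a = 2" "b = 1 \<or> b = 2" "c = 1 \<or> c = 2" "d = 0 \<or> d = 1" "e = 0 \<or> e = 1"
    using a le \<open>b \<noteq> 0\<close> \<open>c \<noteq> 0\<close> by linarith+
  then have "(a, b, c, d, e) \<in> {(1, 1, 1, 1, 1), (2, 2, 1, 0, 0), (1, 1, 2, 1, 0), (1, 2, 1, 1, 0), (1, 2, 2, 0, 0)}"
    using sum le m d e by (elim disjE) simp_all
  then show ?thesis using x y by blast
qed

lemma P_poly_nth:
  fixes a b c d e :: nat
  assumes "(a, b, c, d, e) = [(1, 1, 1, 1, 1), (2, 2, 1, 0, 0), (1, 1, 2, 1, 0), (1, 2, 1, 1, 0), (1, 2, 2, 0, 0)] ! N" "N < 5"
  shows "fps_nth (P_poly N) k = real (if k = 0 then a else if k = 2 then b else if k = 4 then c else if k = 6 then d else if k = 8 then e else 0)"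
proof -
  have num: "fps_nth (numeral m) k = (if k = 0 then numeral m else (0 :: real))" for m k
    by (simp add: numeral_fps_const)
  have num2: "fps_nth (numeral m * f) k = (numeral m * fps_nth f k :: real)" for m f k
    by (simp add: numeral_fps_const)
  have "N \<in> {0, 1, 2, 3, 4}" using assms(2) by auto
  then show ?thesis using assms(1)
    by (elim insertE emptyE; simp add: P_poly_def Let_def num num2 fps_X_power_nth)
qed

theorem theorem6p1:
  fixes \<rho> :: "int^2^2 \<Rightarrow> complex^5^5"
    and \<upsilon> :: "int^2^2 \<Rightarrow> complex"
    and r \<Lambda> :: "5 \<Rightarrow> real"
    and k :: real
  assumes "irreducible_representation \<rho>"
    and "\<rho> T_mat = (\<chi> i j. if i = j then cis (2 * pi * r i) else 0)"
    and "\<And>j. 0 \<le> r j \<and> r j < 1"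
    and "multiplier_system k \<upsilon>"
    and "minimal_admissible r \<upsilon> \<Lambda>"
  shows "minimal_weight \<rho> \<upsilon> \<ge> 12 * (\<Sum>j\<in>UNIV. \<Lambda> j) / 5 - 4 \<and>
    (\<exists>N\<in>{0,1,2,3,4}. hilbert_poincare \<rho> \<upsilon> =
       shift_fps (minimal_weight \<rho> \<upsilon>) (P_poly N / ((1 - fps_X^4) * (1 - fps_X^6))))"
proof -
  interpret irreducible_vvmf \<rho> \<upsilon> r \<Lambda> k
    by unfold_locales (use assms in auto)
  obtain F where "F \<in> vvmf k0 \<rho> \<upsilon>" "F \<noteq> 0" using vvmf_k0 by blast
  from weight_bound[OF ms_k0 this] have bound: "k0 \<ge> 12 * (\<Sum>j\<in>UNIV. \<Lambda> j) / 5 - 4" by simp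
  \<comment> \<open>The jumps are summed in steps of 2, and below in steps of 3, down to negative
    degrees, where all spaces vanish.\<close>
  have i: "vec.dim (ev \<i> 4) = mlt 0 + mlt 2 + mlt 4" "vec.dim (ev \<i> 3) = mlt 1 + mlt 3"
    using mlt_ev_i[of 4] mlt_ev_i[of 3] mlt_ev_i[of 2] mlt_ev_i[of 1] mlt_ev_i[of 0] dim_ev_neg[of "-1" \<i>] dim_ev_neg[of "-2" \<i>]
    by simp_all
  have rho: "vec.dim (ev rho3 3) = mlt 0 + mlt 3" "vec.dim (ev rho3 4) = mlt 1 + mlt 4" "vec.dim (ev rho3 2) = mlt 2"
    using mlt_ev_rho3[of 4] mlt_ev_rho3[of 3] mlt_ev_rho3[of 2] mlt_ev_rho3[of 1] mlt_ev_rho3[of 0]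
      dim_ev_neg[of "-1" rho3] dim_ev_neg[of "-2" rho3] dim_ev_neg[of "-3" rho3]
    by simp_all
  have sum: "(\<Sum>k<5. mlt (int k)) = mlt 0 + mlt 1 + mlt 2 + mlt 3 + mlt 4"
    "(\<Sum>k<4. mlt (int k)) = mlt 0 + mlt 1 + mlt 2 + mlt 3" "(\<Sum>k<3. mlt (int k)) = mlt 0 + mlt 1 + mlt 2"
    "(\<Sum>k<2. mlt (int k)) = mlt 0 + mlt 1" "(\<Sum>k<1. mlt (int k)) = mlt 0"
    by (simp_all add: eval_nat_numeral)
  have *: "alpha 0 = mlt 0 + mlt 2 + mlt 4 \<and> alpha 1 = mlt 1 + mlt 3 \<and>
    (mlt 0, mlt 1, mlt 2, mlt 3, mlt 4) \<in> {(1, 1, 1, 1, 1), (2, 2, 1, 0, 0), (1, 1, 2, 1, 0), (1, 2, 1, 1, 0), (1, 2, 2, 0, 0)}"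
  proof (rule generator_patterns[where u = "beta 0" and v = "beta 1" and w = "beta 2"])
    have "fs.dim (V 0) = mlt 0"
      using dim_V_E6[of 0] dim_V_neg[of "-3"] mlt_ev_i[of 0] dim_ev_neg[of "-2" \<i>] by simp
    then show "mlt 0 \<ge> 1" using dim_V_0 by simp
    show "mlt 0 + mlt 1 + mlt 2 + mlt 3 + mlt 4 \<ge> 5" using sum_mlt_ge by (simp add: sum)
    show "mlt 0 + mlt 2 + mlt 4 \<le> alpha 0" using ev_i_le[of 4] i alpha_period[of 0 2] by simp
    show "mlt 1 + mlt 3 \<le> alpha 1" using ev_i_le[of 3] i alpha_period[of 1 1] by simp
    show "mlt 0 + mlt 3 \<le> beta 0" using ev_rho3_le[of 3] rho beta_period[of 0 1] by simp
    show "mlt 1 + mlt 4 \<le> beta 1" using ev_rho3_le[of 4] rho beta_period[of 1 1] by simp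
    show "mlt 2 \<le> beta 2" using ev_rho3_le[of 2] rho by simp
    show "alpha 0 + alpha 1 \<le> 5" using alpha_sum by simp
    show "alpha 0 + beta 0 \<le> 5" "alpha 0 + beta 1 \<le> 5" "alpha 0 + beta 2 \<le> 5"
      "alpha 1 + beta 0 \<le> 5" "alpha 1 + beta 1 \<le> 5" "alpha 1 + beta 2 \<le> 5"
      using alpha_beta by simp_all
    show "mlt 1 = 0 \<Longrightarrow> mlt 0 \<ge> 5" using no_gap[of 1] by (simp add: sum)
    show "mlt 2 = 0 \<Longrightarrow> mlt 0 + mlt 1 \<ge> 5" using no_gap[of 2] by (simp add: sum)
    show "mlt 3 = 0 \<Longrightarrow> mlt 0 + mlt 1 + mlt 2 \<ge> 5" using no_gap[of 3] by (simp add: sum)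
    show "mlt 4 = 0 \<Longrightarrow> mlt 0 + mlt 1 + mlt 2 + mlt 3 \<ge> 5" using no_gap[of 4] by (simp add: sum)
  qed
  \<comment> \<open>The equations for \<open>alpha\<close> say that the values at
    \<open>\<i>\<close> fill both eigenspaces in degrees 4 and 3.\<close>
  have zero: "mlt n = 0" if "n \<ge> 5" for n
    using mlt_eventually_0[OF _ _ that] * i by simp
  obtain N where N: "N \<in> {0,1,2,3,4}"
    "(mlt 0, mlt 1, mlt 2, mlt 3, mlt 4) = [(1, 1, 1, 1, 1), (2, 2, 1, 0, 0), (1, 1, 2, 1, 0), (1, 2, 1, 1, 0), (1, 2, 2, 0, 0)] ! N"
  proof -
    from * consider "(mlt 0, mlt 1, mlt 2, mlt 3, mlt 4) = (1, 1, 1, 1, 1)" | "(mlt 0, mlt 1, mlt 2, mlt 3, mlt 4) = (2, 2, 1, 0, 0)"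
      | "(mlt 0, mlt 1, mlt 2, mlt 3, mlt 4) = (1, 1, 2, 1, 0)" | "(mlt 0, mlt 1, mlt 2, mlt 3, mlt 4) = (1, 2, 1, 1, 0)"
      | "(mlt 0, mlt 1, mlt 2, mlt 3, mlt 4) = (1, 2, 2, 0, 0)" by blast
    then show thesis
      by cases (rule that[of 0], simp, simp, rule that[of 1], simp, simp, rule that[of 2], simp, simp,
          rule that[of 3], simp, simp, rule that[of 4], simp, simp)
  qed
  have "N < 5" using N(1) by auto
  note P = P_poly_nth[OF N(2) this]
  have "hilbert_poincare \<rho> \<upsilon> = shift_fps k0 (P_poly N / ((1 - fps_X^4) * (1 - fps_X^6)))"
  proof (rule hilbert_poincare_eq)
    fix n :: nat
    show "fps_nth (P_poly N) (2 * n) = real (mlt (int n))"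
    proof (cases "n \<ge> 5")
      case True
      then show ?thesis using zero[of "int n"] by (simp add: P)
    next
      case False
      then have "n \<in> {0, 1, 2, 3, 4}" by auto
      then show ?thesis by (elim insertE emptyE; simp add: P)
    qed
    have "2 * n + 1 \<noteq> 2 * j" for j by presburger
    from this[of 0] this[of 1] this[of 2] this[of 3] this[of 4]
    show "fps_nth (P_poly N) (2 * n + 1) = 0" by (simp add: P)
  qed
  with bound show ?thesis by (intro conjI bexI[OF _ N(1)])
qed

end
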